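(* Let $X$ be a paracompact Hausdorff space that has an exhaustion by finite dimensional compact subsets, and let $\Phi\hookrightarrow\Psi$ be an inclusion of sheaves of topological spaces on $X$ which is a local weak homotopy equivalence. Assume that $\Phi$ is either (1) complete metric and weakly flexible, or (2) ordered flexible. Then $\Phi(X)\neq\emptyset$ if and only if $\Psi(X)\neq\emptyset$. Moreover, if $\Psi$ is likewise in either of the two classes of sheaves (1), (2), then the inclusion $\Phi(X)\hookrightarrow\Psi(X)$ is a weak homotopy equivalence.
   Context: Dimension means covering dimension. An exhaustion of $X$ is a sequence $K_1\subset K_2\subset\cdots$ of subsets with $K_i\subset K_{i+1}^\circ$ and $\bigcup_i K_i=X$. Sheaves. A sheaf of topological spaces $\Phi$ on a topological space $X$ is a sheaf of sets $U\mapsto\Phi(U)$ ($U\subset X$ open) such that each $\Phi(U)$ is a topological space, restrictions are continuous, and for the closed unit ball $\mathbb{D}\subset\mathbb{R}^n$ of every dimension $n\ge 1$ the presheaf $U\mapsto\Phi^{\mathbb{D}}(U)$, the set of continuous maps $\mathbb{D}\to\Phi(U)$, is a sheaf. Restriction maps to $V$ are denoted $r_V$. $\Phi$ is metric if each $\Phi(U)$ is equipped with a metric inducing its topology, and complete metric if these metrics are complete. $\Phi\hookrightarrow\Psi$ is an inclusion of sheaves of topological spaces if $\Phi$ is a subsheaf of the sheaf of topological spaces $\Psi$ with each $\Phi(U)\subset\Psi(U)$ carrying the subspace topology. Throughout, $\mathbb{D}\subset\mathbb{R}^n$ is the closed unit ball; for $n=0$ it is a singleton with empty boundary. Subscripts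 $s,t\in[0,1]$ indicate homotopies (jointly continuous). $A^\circ$ is the interior of $A$. Local weak homotopy equivalence. The inclusion $\Phi\hookrightarrow\Psi$ is a local weak homotopy equivalence if for every $p\in X$, every open neighborhood $U$ of $p$, every $n\ge 0$ and every continuous $f:\mathbb{D}\to\Psi(U)$ with $f(\partial\mathbb{D})\subset\Phi(U)$, there are an open neighborhood $p\in V\subset U$ and a homotopy $f_t:\mathbb{D}\to\Psi(V)$ with $f_0=r_V\circ f$, $f_t|_{\partial\mathbb{D}}$ independent of $t$, and $f_1(\mathbb{D})\subset\Phi(V)$. Flexible pairs. For compact $A,B\subset X$, the ordered pair $(A,B)$ is weakly flexible for $\Phi$ if the following holds for every $n\ge 0$. Given open neighborhoods $U,V,W$ of $A,B,A\cap B$ respectively, continuous maps $a:\mathbb{D}\to\Phi(U)$, $b:\mathbb{D}\to\Phi(V)$ and a homotopy $c_s:\mathbb{D}\to\Phi(W)$ with $c_0=r_W\circ a$, $c_1=r_W\circ b$ and $c_s|_{\partial\mathbb{D}}$ independent of $s$, and given a neighborhood $\mathcal{N}$ of $r_{A^\circ}\circ a$ in the space of continuous maps $\mathbb{D}\to\Phi(A^\circ)$ with the compact open topology, there are open neighborhoods $A\subset U'\subset U$, $B\subset V'\subset V$, $A\cap B\subset W'\subset W$ and homotopies $a_t:\mathbb{D}\to\Phi(U')$, $b_t:\mathbb{D}\to\Phi(V')$, $c_{s,t}:\mathbb{D}\to\Phi(W')$ with $a_0=r_{U'}\circ a$, $b_0=r_{V'}\circ b$, $c_{s,0}=r_{W'}\circ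 c_s$ such that (i) $c_{0,t}=r_{W'}\circ a_t$ and $c_{1,t}=r_{W'}\circ b_t$; (ii) $a_t|_{\partial\mathbb{D}}$, $b_t|_{\partial\mathbb{D}}$, $c_{s,t}|_{\partial\mathbb{D}}$ are independent of $t$; (iii) $c_{s,1}$ is independent of $s$; (iv) $r_{A^\circ}\circ a_t\in\mathcal{N}$ for all $t$. The pair is ordered flexible if moreover the homotopies can be chosen with $r_{A^\circ}\circ a_t=r_{A^\circ}\circ a_0$ for all $t$. Flexible strings, covers, sheaves. A weakly flexible string for $\Phi$ of length $n\ge 2$ is recursively defined as a finite sequence $(A_1,\dots,A_n)$ of compacts of $X$ such that $(A_1\cup\cdots\cup A_{n-1},A_n)$ is a weakly flexible pair for $\Phi$ and, if $n\ge 3$, $(A_1,\dots,A_{n-1})$ and $(A_1\cap A_n,\dots,A_{n-1}\cap A_n)$ are weakly flexible strings for $\Phi$. A weakly flexible cover for $\Phi$ is a locally finite cover $(A_1,A_2,A_3,\dots)$ of $X$ such that $(A_1,\dots,A_n)$ is a weakly flexible string for $\Phi$ for every $n\geq 2$. $\Phi$ is weakly flexible if every open cover of $X$ can be refined by a weakly flexible cover for $\Phi$. Ordered flexible strings, covers and sheaves are defined by replacing "weakly" by "ordered" everywhere. *)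

theory Defs
  imports "HOL-Analysis.Analysis"
begin

section \<open>The space\<close>

definition open_cover :: "'a topology \<Rightarrow> 'a set set \<Rightarrow> bool" where
  "open_cover X \<U> \<longleftrightarrow> (\<forall>U\<in>\<U>. openin X U) \<and> \<Union>\<U> = topspace X"

definition paracompact_space :: "'a topology \<Rightarrow> bool" where
  "paracompact_space X \<longleftrightarrow>
     (\<forall>\<U>. open_cover X \<U> \<longrightarrow>
       (\<exists>\<V>. open_cover X \<V> \<and> (\<forall>V\<in>\<V>. \<exists>U\<in>\<U>. V \<subseteq> U) \<and> locally_finite_in X \<V>))"

definition covering_dim_le :: "'a topology \<Rightarrow> nat \<Rightarrow> bool" where
  "covering_dim_le X m \<longleftrightarrow>
     (\<forall>\<U>. open_cover X \<U> \<longrightarrow>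
       (\<exists>\<V>. open_cover X \<V> \<and> (\<forall>V\<in>\<V>. \<exists>U\<in>\<U>. V \<subseteq> U) \<and>
            (\<forall>x\<in>topspace X. finite {V\<in>\<V>. x \<in> V} \<and> card {V\<in>\<V>. x \<in> V} \<le> m + 1)))"

definition finite_dimensional :: "'a topology \<Rightarrow> bool" where
  "finite_dimensional X \<longleftrightarrow> (\<exists>m. covering_dim_le X m)"

definition exhaustion :: "'a topology \<Rightarrow> (nat \<Rightarrow> 'a set) \<Rightarrow> bool" where
  "exhaustion X K \<longleftrightarrow>
     (\<forall>i. K i \<subseteq> topspace X \<and> K i \<subseteq> K (Suc i) \<and> K i \<subseteq> X interior_of K (Suc i)) \<and>
     (\<Union>i. K i) = topspace X"


section \<open>Balls and mapping spaces\<close>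

text \<open>The closed unit ball of \<open>\<real>\<^sup>n\<close>. For \<open>n = 0\<close> the sums below are empty, so the ball is a
  singleton and its boundary is empty.\<close>

definition disk :: "nat \<Rightarrow> (nat \<Rightarrow> real) topology" where
  "disk n = subtopology (Euclidean_space n) {x. (\<Sum>i<n. (x i)\<^sup>2) \<le> 1}"

definition disk_boundary :: "nat \<Rightarrow> (nat \<Rightarrow> real) set" where
  "disk_boundary n = {x \<in> topspace (Euclidean_space n). (\<Sum>i<n. (x i)\<^sup>2) = 1}"

abbreviation unit_interval :: "real topology" where
  "unit_interval \<equiv> top_of_set {0..1}"

text \<open>Elements of mapping spaces are made extensional, so that two of them are equal if and only
  if they agree on the domain.\<close>

definition continuous_maps :: "'c topology \<Rightarrow> 'b topology \<Rightarrow> ('c \<Rightarrow> 'b) set" where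
  "continuous_maps Y Z = {f. continuous_map Y Z f \<and> f \<in> extensional (topspace Y)}"

definition compact_open_topology :: "'c topology \<Rightarrow> 'b topology \<Rightarrow> ('c \<Rightarrow> 'b) topology" where
  "compact_open_topology Y Z =
     topology_generated_by
       {{f \<in> continuous_maps Y Z. f ` K \<subseteq> G} | K G. compactin Y K \<and> openin Z G}"

definition neighbourhood_of :: "'c topology \<Rightarrow> 'c \<Rightarrow> 'c set \<Rightarrow> bool" where
  "neighbourhood_of T x N \<longleftrightarrow> N \<subseteq> topspace T \<and> (\<exists>G. openin T G \<and> x \<in> G \<and> G \<subseteq> N)"


section \<open>Sheaves of topological spaces\<close>

definition sheaf_of_sets ::
  "'a topology \<Rightarrow> ('a set \<Rightarrow> 's set) \<Rightarrow> ('a set \<Rightarrow> 'a set \<Rightarrow> 's \<Rightarrow> 's) \<Rightarrow> bool" where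
  "sheaf_of_sets X S r \<longleftrightarrow>
     (\<forall>U V. openin X U \<and> openin X V \<and> V \<subseteq> U \<longrightarrow> r U V ` S U \<subseteq> S V) \<and>
     (\<forall>U. openin X U \<longrightarrow> (\<forall>f\<in>S U. r U U f = f)) \<and>
     (\<forall>U V W. openin X U \<and> openin X V \<and> openin X W \<and> W \<subseteq> V \<and> V \<subseteq> U \<longrightarrow>
        (\<forall>f\<in>S U. r V W (r U V f) = r U W f)) \<and>
     (\<forall>\<U> \<sigma>. (\<forall>U\<in>\<U>. openin X U \<and> \<sigma> U \<in> S U) \<and>
            (\<forall>U\<in>\<U>. \<forall>V\<in>\<U>. r U (U \<inter> V) (\<sigma> U) = r V (U \<inter> V) (\<sigma> V)) \<longrightarrow>
        (\<exists>!f. f \<in> S (\<Union>\<U>) \<and> (\<forall>U\<in>\<U>. r (\<Union>\<U>) U f = \<sigma> U)))"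

text \<open>\<open>res F U V\<close> is the restriction from \<open>U\<close> to \<open>V \<subseteq> U\<close>; only open \<open>U\<close> and \<open>V\<close> matter.\<close>

record ('a, 'b) top_presheaf =
  sec :: "'a set \<Rightarrow> 'b topology"
  res :: "'a set \<Rightarrow> 'a set \<Rightarrow> 'b \<Rightarrow> 'b"

definition sheaf_of_spaces :: "'a topology \<Rightarrow> ('a, 'b) top_presheaf \<Rightarrow> bool" where
  "sheaf_of_spaces X F \<longleftrightarrow>
     sheaf_of_sets X (\<lambda>U. topspace (sec F U)) (res F) \<and>
     (\<forall>U V. openin X U \<and> openin X V \<and> V \<subseteq> U \<longrightarrow>
        continuous_map (sec F U) (sec F V) (res F U V)) \<and>
     (\<forall>n\<ge>1. sheaf_of_sets X
        (\<lambda>U. continuous_maps (disk n) (sec F U))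
        (\<lambda>U V f. restrict (res F U V \<circ> f) (topspace (disk n))))"

definition complete_metric_sheaf ::
  "'a topology \<Rightarrow> ('a, 'b) top_presheaf \<Rightarrow> ('a set \<Rightarrow> 'b \<Rightarrow> 'b \<Rightarrow> real) \<Rightarrow> bool" where
  "complete_metric_sheaf X F d \<longleftrightarrow>
     (\<forall>U. openin X U \<longrightarrow>
        Metric_space (topspace (sec F U)) (d U) \<and>
        Metric_space.mtopology (topspace (sec F U)) (d U) = sec F U \<and>
        Metric_space.mcomplete (topspace (sec F U)) (d U))"

definition sheaf_inclusion ::
  "'a topology \<Rightarrow> ('a, 'b) top_presheaf \<Rightarrow> ('a, 'b) top_presheaf \<Rightarrow> bool" where
  "sheaf_inclusion X F G \<longleftrightarrow>
     sheaf_of_spaces X F \<and> sheaf_of_spaces X G \<and>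
     (\<forall>U. openin X U \<longrightarrow>
        topspace (sec F U) \<subseteq> topspace (sec G U) \<and>
        sec F U = subtopology (sec G U) (topspace (sec F U))) \<and>
     (\<forall>U V. openin X U \<and> openin X V \<and> V \<subseteq> U \<longrightarrow>
        (\<forall>f\<in>topspace (sec F U). res F U V f = res G U V f))"

definition local_weak_homotopy_equivalence ::
  "'a topology \<Rightarrow> ('a, 'b) top_presheaf \<Rightarrow> ('a, 'b) top_presheaf \<Rightarrow> bool" where
  "local_weak_homotopy_equivalence X F G \<longleftrightarrow>
     (\<forall>p\<in>topspace X. \<forall>U n f.
        openin X U \<and> p \<in> U \<and> continuous_map (disk n) (sec G U) f \<and>
        f ` disk_boundary n \<subseteq> topspace (sec F U) \<longrightarrow>
        (\<exists>V h. openin X V \<and> p \<in> V \<and> V \<subseteq> U \<and>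
           continuous_map (prod_topology unit_interval (disk n)) (sec G V) (\<lambda>(t, x). h t x) \<and>
           (\<forall>x\<in>topspace (disk n). h 0 x = res G U V (f x)) \<and>
           (\<forall>t\<in>{0..1}. \<forall>x\<in>disk_boundary n. h t x = h 0 x) \<and>
           h 1 ` topspace (disk n) \<subseteq> topspace (sec F V)))"


section \<open>Flexibility\<close>

text \<open>The restrictions of \<open>a\<close> and \<open>b\<close> to \<open>W\<close> only make sense for \<open>W \<subseteq> U \<inter> V\<close>; similarly for
  \<open>W'\<close> below.\<close>

definition flexibility_data ::
  "'a topology \<Rightarrow> ('a, 'b) top_presheaf \<Rightarrow> 'a set \<Rightarrow> 'a set \<Rightarrow> nat \<Rightarrow>
   'a set \<Rightarrow> 'a set \<Rightarrow> 'a set \<Rightarrow> ((nat \<Rightarrow> real) \<Rightarrow> 'b) \<Rightarrow> ((nat \<Rightarrow> real) \<Rightarrow> 'b) \<Rightarrow>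
   (real \<Rightarrow> (nat \<Rightarrow> real) \<Rightarrow> 'b) \<Rightarrow> bool" where
  "flexibility_data X F A B n U V W a b c \<longleftrightarrow>
     openin X U \<and> A \<subseteq> U \<and> openin X V \<and> B \<subseteq> V \<and>
     openin X W \<and> A \<inter> B \<subseteq> W \<and> W \<subseteq> U \<inter> V \<and>
     continuous_map (disk n) (sec F U) a \<and>
     continuous_map (disk n) (sec F V) b \<and>
     continuous_map (prod_topology unit_interval (disk n)) (sec F W) (\<lambda>(s, x). c s x) \<and>
     (\<forall>x\<in>topspace (disk n). c 0 x = res F U W (a x) \<and> c 1 x = res F V W (b x)) \<and>
     (\<forall>s\<in>{0..1}. \<forall>x\<in>disk_boundary n. c s x = c 0 x)"

definition flexibility_solution ::
  "'a topology \<Rightarrow> ('a, 'b) top_presheaf \<Rightarrow> 'a set \<Rightarrow> 'a set \<Rightarrow> nat \<Rightarrow>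
   'a set \<Rightarrow> 'a set \<Rightarrow> 'a set \<Rightarrow> ((nat \<Rightarrow> real) \<Rightarrow> 'b) \<Rightarrow> ((nat \<Rightarrow> real) \<Rightarrow> 'b) \<Rightarrow>
   (real \<Rightarrow> (nat \<Rightarrow> real) \<Rightarrow> 'b) \<Rightarrow>
   'a set \<Rightarrow> 'a set \<Rightarrow> 'a set \<Rightarrow>
   (real \<Rightarrow> (nat \<Rightarrow> real) \<Rightarrow> 'b) \<Rightarrow> (real \<Rightarrow> (nat \<Rightarrow> real) \<Rightarrow> 'b) \<Rightarrow>
   (real \<Rightarrow> real \<Rightarrow> (nat \<Rightarrow> real) \<Rightarrow> 'b) \<Rightarrow> bool" where
  "flexibility_solution X F A B n U V W a b c U' V' W' a' b' c' \<longleftrightarrow>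
     openin X U' \<and> A \<subseteq> U' \<and> U' \<subseteq> U \<and> openin X V' \<and> B \<subseteq> V' \<and> V' \<subseteq> V \<and>
     openin X W' \<and> A \<inter> B \<subseteq> W' \<and> W' \<subseteq> W \<and> W' \<subseteq> U' \<inter> V' \<and>
     continuous_map (prod_topology unit_interval (disk n)) (sec F U') (\<lambda>(t, x). a' t x) \<and>
     continuous_map (prod_topology unit_interval (disk n)) (sec F V') (\<lambda>(t, x). b' t x) \<and>
     continuous_map (prod_topology unit_interval (prod_topology unit_interval (disk n)))
       (sec F W') (\<lambda>(s, t, x). c' s t x) \<and>
     (\<forall>x\<in>topspace (disk n). a' 0 x = res F U U' (a x) \<and> b' 0 x = res F V V' (b x)) \<and>
     (\<forall>s\<in>{0..1}. \<forall>x\<in>topspace (disk n). c' s 0 x = res F W W' (c s x)) \<and>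
     (\<forall>t\<in>{0..1}. \<forall>x\<in>topspace (disk n).
        c' 0 t x = res F U' W' (a' t x) \<and> c' 1 t x = res F V' W' (b' t x)) \<and>
     (\<forall>t\<in>{0..1}. \<forall>x\<in>disk_boundary n. a' t x = a' 0 x \<and> b' t x = b' 0 x) \<and>
     (\<forall>s\<in>{0..1}. \<forall>t\<in>{0..1}. \<forall>x\<in>disk_boundary n. c' s t x = c' s 0 x) \<and>
     (\<forall>s\<in>{0..1}. \<forall>x\<in>topspace (disk n). c' s 1 x = c' 0 1 x)"

definition weakly_flexible_pair ::
  "'a topology \<Rightarrow> ('a, 'b) top_presheaf \<Rightarrow> 'a set \<Rightarrow> 'a set \<Rightarrow> bool" where
  "weakly_flexible_pair X F A B \<longleftrightarrow>
     compactin X A \<and> compactin X B \<and>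
     (\<forall>n U V W a b c N.
        flexibility_data X F A B n U V W a b c \<and>
        neighbourhood_of (compact_open_topology (disk n) (sec F (X interior_of A)))
          (restrict (res F U (X interior_of A) \<circ> a) (topspace (disk n))) N \<longrightarrow>
        (\<exists>U' V' W' a' b' c'.
           flexibility_solution X F A B n U V W a b c U' V' W' a' b' c' \<and>
           (\<forall>t\<in>{0..1}.
              restrict (res F U' (X interior_of A) \<circ> a' t) (topspace (disk n)) \<in> N)))"

definition ordered_flexible_pair ::
  "'a topology \<Rightarrow> ('a, 'b) top_presheaf \<Rightarrow> 'a set \<Rightarrow> 'a set \<Rightarrow> bool" where
  "ordered_flexible_pair X F A B \<longleftrightarrow>
     compactin X A \<and> compactin X B \<and>
     (\<forall>n U V W a b c N.
        flexibility_data X F A B n U V W a b c \<and>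
        neighbourhood_of (compact_open_topology (disk n) (sec F (X interior_of A)))
          (restrict (res F U (X interior_of A) \<circ> a) (topspace (disk n))) N \<longrightarrow>
        (\<exists>U' V' W' a' b' c'.
           flexibility_solution X F A B n U V W a b c U' V' W' a' b' c' \<and>
           (\<forall>t\<in>{0..1}.
              restrict (res F U' (X interior_of A) \<circ> a' t) (topspace (disk n)) \<in> N) \<and>
           (\<forall>t\<in>{0..1}. \<forall>x\<in>topspace (disk n).
              res F U' (X interior_of A) (a' t x) = res F U' (X interior_of A) (a' 0 x))))"

text \<open>Strings, covers and sheaves are defined relative to a notion \<open>P\<close> of flexible pair.\<close>

inductive flexible_string ::
  "'a topology \<Rightarrow> ('a set \<Rightarrow> 'a set \<Rightarrow> bool) \<Rightarrow> 'a set list \<Rightarrow> bool"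
  for X P where
  pair: "\<lbrakk>compactin X A; compactin X B; P A B\<rbrakk> \<Longrightarrow> flexible_string X P [A, B]"
| snoc: "\<lbrakk>compactin X B; P (\<Union>(set As)) B; flexible_string X P As;
          flexible_string X P (map (\<lambda>A. A \<inter> B) As)\<rbrakk> \<Longrightarrow> flexible_string X P (As @ [B])"

text \<open>Local finiteness is that of the indexed family, not of its range.\<close>

definition flexible_cover ::
  "'a topology \<Rightarrow> ('a set \<Rightarrow> 'a set \<Rightarrow> bool) \<Rightarrow> (nat \<Rightarrow> 'a set) \<Rightarrow> bool" where
  "flexible_cover X P A \<longleftrightarrow>
     (\<Union>i. A i) = topspace X \<and>
     (\<forall>x\<in>topspace X. \<exists>V. openin X V \<and> x \<in> V \<and> finite {i. A i \<inter> V \<noteq> {}}) \<and>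
     (\<forall>n\<ge>2. flexible_string X P (map A [0..<n]))"

definition flexible_sheaf :: "'a topology \<Rightarrow> ('a set \<Rightarrow> 'a set \<Rightarrow> bool) \<Rightarrow> bool" where
  "flexible_sheaf X P \<longleftrightarrow>
     (\<forall>\<U>. open_cover X \<U> \<longrightarrow>
        (\<exists>A. flexible_cover X P A \<and> (\<forall>i. \<exists>U\<in>\<U>. A i \<subseteq> U)))"

definition weakly_flexible :: "'a topology \<Rightarrow> ('a, 'b) top_presheaf \<Rightarrow> bool" where
  "weakly_flexible X F \<longleftrightarrow> flexible_sheaf X (weakly_flexible_pair X F)"

definition ordered_flexible :: "'a topology \<Rightarrow> ('a, 'b) top_presheaf \<Rightarrow> bool" where
  "ordered_flexible X F \<longleftrightarrow> flexible_sheaf X (ordered_flexible_pair X F)"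


section \<open>Weak homotopy equivalences\<close>

text \<open>The set underlying \<open>\<pi>\<^sub>n(Y, y)\<close> consists of the homotopy classes of maps of pairs from the
  \<open>n\<close>-ball and its boundary to \<open>(Y, {y})\<close>. Since the maps induced on homotopy groups are always
  homomorphisms, they are isomorphisms if and only if they are bijective, so that the group
  structure is not needed here.\<close>

definition homotopy_class ::
  "nat \<Rightarrow> 'b topology \<Rightarrow> 'b \<Rightarrow> ((nat \<Rightarrow> real) \<Rightarrow> 'b) \<Rightarrow> ((nat \<Rightarrow> real) \<Rightarrow> 'b) set" where
  "homotopy_class n Y y p =
     {q. homotopic_with (\<lambda>h. h ` disk_boundary n \<subseteq> {y}) (disk n) Y p q}"

definition homotopy_group :: "nat \<Rightarrow> 'b topology \<Rightarrow> 'b \<Rightarrow> ((nat \<Rightarrow> real) \<Rightarrow> 'b) set set" where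
  "homotopy_group n Y y =
     homotopy_class n Y y ` {p. continuous_map (disk n) Y p \<and> p ` disk_boundary n \<subseteq> {y}}"

definition homotopy_group_map ::
  "nat \<Rightarrow> 'c topology \<Rightarrow> ('b \<Rightarrow> 'c) \<Rightarrow> 'b \<Rightarrow>
   ((nat \<Rightarrow> real) \<Rightarrow> 'b) set \<Rightarrow> ((nat \<Rightarrow> real) \<Rightarrow> 'c) set" where
  "homotopy_group_map n Z f y C = (\<Union>p\<in>C. homotopy_class n Z (f y) (f \<circ> p))"

definition path_components_map :: "'c topology \<Rightarrow> ('b \<Rightarrow> 'c) \<Rightarrow> 'b set \<Rightarrow> 'c set" where
  "path_components_map Z f C = (\<Union>y\<in>C. path_component_of_set Z (f y))"

definition weak_homotopy_equivalence ::
  "'b topology \<Rightarrow> 'c topology \<Rightarrow> ('b \<Rightarrow> 'c) \<Rightarrow> bool" where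
  "weak_homotopy_equivalence Y Z f \<longleftrightarrow>
     continuous_map Y Z f \<and>
     bij_betw (path_components_map Z f) (path_components_of Y) (path_components_of Z) \<and>
     (\<forall>n\<ge>1. \<forall>y\<in>topspace Y.
        bij_betw (homotopy_group_map n Z f y) (homotopy_group n Y y) (homotopy_group n Z (f y)))"

end

theory Submission
 imports Defs
begin

text \<open>A \<^emph>\<open>complex\<close> assigns to every point of a simplex of the nerve of a cover a section over the
 intersection of the members that span it, continuously and compatibly with restriction; it encodes a
 section up to coherent homotopies on overlaps. Restricting a section of \<open>\<Psi>\<close> to a fine cover, the local
 weak homotopy equivalence deforms it over the skeleta of the nerves of a tower of finer and finer covers
 into a complex with values in \<open>\<Phi>\<close>. As the exhausting compact sets are finite dimensional, finitely many
 stages of the tower suffice near each of them, and the stages can be combined.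

 Flexibility deforms a complex to one that comes from a global section: the sets of a flexible cover are
 added one at a time, and a cone construction reduces each step to a flexible pair and to a shorter
 string over a cube of one dimension more. The successive modifications either stabilise on compact sets
 (ordered flexibility) or are uniformly Cauchy there (weak flexibility and complete metrics). For \<open>\<Phi>\<close>
 this yields a global section. If \<open>\<Psi>\<close> is flexible too, the complex interpolating between a cube in
 \<open>\<Psi>(X)\<close> and its deformation into \<open>\<Phi>(X)\<close> is glued relative to the boundary, so that cells in \<open>\<Psi>(X)\<close> can
 be compressed into \<open>\<Phi>(X)\<close>.\<close>

section \<open>Cells\<close>

text \<open>The local equivalence gives no control over the neighbourhood on which a cell is
  compressed, so every further skeleton costs a refinement of the cover. The dimensions of the
  exhausting compacts may grow without bound; hence no stage of the tower serves all of
  \<open>X\<close>, and each member of the final cover carries a stage number of its own, which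
  bounds the number of members through its points. Every gluing shrinks the domains, and a set
  shrunk infinitely often need not stay open; a locally finite family of neighbourhoods of the
  flexible cover allows the domain of each vertex to be frozen at a finite stage, beyond which a
  section over the interior of a finite union of sets of the cover takes over. All deformations are
  relative to the boundary of a parameter cube. The induction on strings depends on this, because
  there the weight of the last vertex becomes a further coordinate of the cube, and it lets the time
  of a deformation be treated as a coordinate when cells are compressed.\<close>

abbreviation cmap :: "'c::topological_space set \<Rightarrow> 'd topology \<Rightarrow> ('c \<Rightarrow> 'd) \<Rightarrow> bool" where
 "cmap S \<equiv> continuous_map (top_of_set S)"

definition coords :: "nat \<Rightarrow> (nat \<Rightarrow> real) set" where
 "coords n = {x. \<forall>i\<ge>n. x i = 0}"

definition disk_set :: "nat \<Rightarrow> (nat \<Rightarrow> real) set" where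
 "disk_set n = {x \<in> coords n. (\<Sum>i<n. (x i)\<^sup>2) \<le> 1}"

lemma Euclidean_space_eq: "Euclidean_space n = top_of_set (coords n)"
 by (simp add: Euclidean_space_def coords_def flip: euclidean_product_topology)

lemma disk_eq: "disk n = top_of_set (disk_set n)"
 by (simp add: disk_def Euclidean_space_eq subtopology_subtopology disk_set_def Collect_conj_eq)

lemma disk_boundary_eq: "disk_boundary n = {x \<in> coords n. (\<Sum>i<n. (x i)\<^sup>2) = 1}"
 by (simp add: disk_boundary_def Euclidean_space_eq)

text \<open>One notion for balls, cubes, simplices and their products: the hypotheses speak of
  balls, the induction on strings needs cubes, and the filling of skeleta needs simplices times
  cubes. The dimension is recorded because the sheaf axiom and the local equivalence are stated
  dimension by dimension.\<close>

definition cell_pair :: "nat \<Rightarrow> 'c::topological_space set \<Rightarrow> 'c set \<Rightarrow> bool" where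
 "cell_pair n T S \<longleftrightarrow> (\<exists>f g. homeomorphism (disk_set n) T f g \<and> f ` disk_boundary n = S)"

lemma disk_boundary_subset: "disk_boundary n \<subseteq> disk_set n"
 by (auto simp: disk_boundary_eq disk_set_def)

lemma cell_pair_subset: "cell_pair n T S \<Longrightarrow> S \<subseteq> T"
 unfolding cell_pair_def homeomorphism_def using disk_boundary_subset by fastforce

lemma cell_pair_homeomorphism:
 assumes "cell_pair n T S" "homeomorphism T T' f g" "f ` S = S'"
 shows "cell_pair n T' S'"
proof -
 obtain h k where "homeomorphism (disk_set n) T h k" "h ` disk_boundary n = S"
  using assms(1) unfolding cell_pair_def by blast
 hence "homeomorphism (disk_set n) T' (f \<circ> h) (k \<circ> g)" "(f \<circ> h) ` disk_boundary n = S'"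
  using homeomorphism_compose[OF _ assms(2)] assms(3) by (auto simp: image_comp[symmetric])
 thus ?thesis unfolding cell_pair_def by blast
qed

lemma cell_pair_disk: "cell_pair n (disk_set n) (disk_boundary n)"
 unfolding cell_pair_def by (rule exI[of _ id], rule exI[of _ id]) (auto simp: homeomorphism_def)

lemma continuous_on_apply [continuous_intros]:
 fixes S :: "('i \<Rightarrow> 'b::topological_space) set"
 shows "continuous_on S (\<lambda>x. x i)"
 by (rule continuous_on_product_then_coordinatewise) simp

lemma continuous_on_fst_apply [continuous_intros]:
 fixes S :: "(('i \<Rightarrow> 'b::topological_space) \<times> 'c::topological_space) set"
 shows "continuous_on S (\<lambda>x. fst x i)"
 by (rule continuous_on_product_then_coordinatewise) (intro continuous_intros)

lemma continuous_on_snd_apply [continuous_intros]: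
 fixes S :: "('c::topological_space \<times> ('i \<Rightarrow> 'b::topological_space)) set"
 shows "continuous_on S (\<lambda>x. snd x i)"
 by (rule continuous_on_product_then_coordinatewise) (intro continuous_intros)

lemma continuous_on_pi:
 fixes f :: "'c::topological_space \<Rightarrow> 'i \<Rightarrow> 'b::topological_space"
 assumes "\<And>i. continuous_on S (\<lambda>x. f x i)"
 shows "continuous_on S f"
 by (rule continuous_on_coordinatewise_then_product) (rule assms)

subsection \<open>Radial homeomorphisms\<close>

text \<open>Minkowski functionals of bodies around the origin. Scaling by nonnegative factors only
  admits asymmetric bodies such as a simplex about its barycentre. The last clause bounds the body
  and gives continuity of radial maps at the origin.\<close>

definition gauge_fun :: "nat \<Rightarrow> ((nat \<Rightarrow> real) \<Rightarrow> real) \<Rightarrow> bool" where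
 "gauge_fun n P \<longleftrightarrow> continuous_on (coords n) P \<and>
  (\<forall>c\<ge>0. \<forall>x\<in>coords n. P (\<lambda>i. c * x i) = c * P x) \<and>
  (\<forall>x\<in>coords n. x \<noteq> (\<lambda>_. 0) \<longrightarrow> P x > 0) \<and>
  (\<exists>C. \<forall>x\<in>coords n. \<forall>i. \<bar>x i\<bar> \<le> C * P x)"

lemma gauge_scale: "\<lbrakk>gauge_fun n P; 0 \<le> c; x \<in> coords n\<rbrakk> \<Longrightarrow> P (\<lambda>i. c * x i) = c * P x"
 unfolding gauge_fun_def by blast

lemma gauge_zero:
 assumes "gauge_fun n P" shows "P (\<lambda>_. 0) = 0"
proof -
 have *: "(\<lambda>_. 0) \<in> coords n" by (simp add: coords_def)
 have "P (\<lambda>i. 0 * (\<lambda>_. 0) i) = 0 * P (\<lambda>_. 0)"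
  by (rule gauge_scale[OF assms order_refl *])
 thus ?thesis by simp
qed

lemma gauge_nonneg: "gauge_fun n P \<Longrightarrow> x \<in> coords n \<Longrightarrow> P x \<ge> 0"
 by (cases "x = (\<lambda>_. 0)") (auto simp: gauge_zero, auto simp: gauge_fun_def less_eq_real_def)

text \<open>Away from the origin this is a quotient of continuous functions with positive
  denominator. At the origin the bound of the coordinates by \<open>C * Q x\<close> cancels the
  denominator and leaves \<open>C * P x\<close>, which tends to 0.\<close>

lemma continuous_on_radial:
 assumes P: "gauge_fun n P" and Q: "gauge_fun n Q"
 shows "continuous_on (coords n) (\<lambda>x i. x i * (P x / Q x))"
proof (rule continuous_on_pi)
 fix i
 obtain C where C: "\<And>x. x \<in> coords n \<Longrightarrow> \<bar>x i\<bar> \<le> C * Q x"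
  using Q unfolding gauge_fun_def by blast
 have cP: "continuous_on (coords n) P" and cQ: "continuous_on (coords n) Q"
  using P Q unfolding gauge_fun_def by auto
 have ci: "continuous_on (coords n) (\<lambda>x. x i)"
  by (intro continuous_intros)
 show "continuous_on (coords n) (\<lambda>x. x i * (P x / Q x))"
  unfolding continuous_on_def
 proof
  fix x0 assume x0: "x0 \<in> coords n"
  show "((\<lambda>x. x i * (P x / Q x)) \<longlongrightarrow> x0 i * (P x0 / Q x0)) (at x0 within coords n)"
  proof (cases "x0 = (\<lambda>_. 0)")
   case False
   hence "Q x0 \<noteq> 0" using Q x0 unfolding gauge_fun_def by fastforce
   thus ?thesis
    using cP cQ ci x0 unfolding continuous_on_def by (intro tendsto_intros) auto
  next
   case True
   have "(P \<longlongrightarrow> 0) (at x0 within coords n)"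
    using cP x0 gauge_zero[OF P] True unfolding continuous_on_def by metis
   hence lim: "((\<lambda>x. C * P x) \<longlongrightarrow> 0) (at x0 within coords n)"
    by (rule tendsto_mult_right_zero)
   have "\<bar>x i * (P x / Q x)\<bar> \<le> C * P x" if x: "x \<in> coords n" for x
   proof (cases "Q x = 0")
    case True
    hence "x = (\<lambda>_. 0)" using Q x unfolding gauge_fun_def by fastforce
    thus ?thesis using gauge_zero[OF P] by simp
   next
    case False
    hence q: "Q x > 0" using gauge_nonneg[OF Q x] by simp
    have "\<bar>x i * (P x / Q x)\<bar> = \<bar>x i\<bar> * (P x / Q x)"
     using q gauge_nonneg[OF P x] by (simp add: abs_mult)
    also have "\<dots> \<le> (C * Q x) * (P x / Q x)"
     using C[OF x] q gauge_nonneg[OF P x] by (intro mult_right_mono) auto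
    finally show ?thesis using q by simp
   qed
   hence "\<forall>\<^sub>F x in at x0 within coords n. norm (x i * (P x / Q x)) \<le> C * P x"
    by (simp add: eventually_at_filter)
   from Lim_null_comparison[OF this lim] show ?thesis
    by (simp add: True)
  qed
 qed
qed

text \<open>By homogeneity the factor \<open>P x / Q x\<close> turns the value \<open>Q x\<close>
  into \<open>P x\<close>, so the unit level sets of \<open>P\<close> and \<open>Q\<close>
  correspond under the radial map. At the origin the factor is \<open>0 / 0 = 0\<close>, and both
  sides vanish.\<close>

lemma radial_gauge:
 assumes P: "gauge_fun n P" and Q: "gauge_fun n Q" and x: "x \<in> coords n"
 shows "(\<lambda>i. x i * (P x / Q x)) \<in> coords n" "Q (\<lambda>i. x i * (P x / Q x)) = P x"
proof -
 show "(\<lambda>i. x i * (P x / Q x)) \<in> coords n" using x by (simp add: coords_def)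
 have "Q (\<lambda>i. (P x / Q x) * x i) = (P x / Q x) * Q x"
  by (rule gauge_scale[OF Q _ x]) (simp add: gauge_nonneg[OF P x] gauge_nonneg[OF Q x])
 also have "\<dots> = P x"
 proof (cases "x = (\<lambda>_. 0)")
  case True thus ?thesis using gauge_zero[OF P] gauge_zero[OF Q] by simp
 next
  case False
  hence "Q x > 0" using Q x unfolding gauge_fun_def by blast
  thus ?thesis by simp
 qed
 finally show "Q (\<lambda>i. x i * (P x / Q x)) = P x" by (simp add: mult.commute)
qed

lemma radial_inverse:
 assumes P: "gauge_fun n P" and Q: "gauge_fun n Q" and x: "x \<in> coords n"
 shows "(\<lambda>i. (x i * (P x / Q x)) * (Q (\<lambda>i. x i * (P x / Q x)) / P (\<lambda>i. x i * (P x / Q x)))) = x"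
proof (cases "x = (\<lambda>_. 0)")
 case True thus ?thesis by auto
next
 case False
 hence pos: "P x > 0" "Q x > 0" using P Q x unfolding gauge_fun_def by blast+
 have "P (\<lambda>i. (P x / Q x) * x i) = (P x / Q x) * P x"
  by (rule gauge_scale[OF P _ x]) (use pos in simp)
 hence e: "P (\<lambda>i. x i * (P x / Q x)) = (P x / Q x) * P x" by (simp add: mult.commute)
 show ?thesis unfolding e radial_gauge(2)[OF P Q x] using pos by (auto simp: fun_eq_iff)
qed

lemma homeomorphism_radial:
 assumes P: "gauge_fun n P" and Q: "gauge_fun n Q"
 shows "homeomorphism {x \<in> coords n. P x \<le> 1} {x \<in> coords n. Q x \<le> 1}
  (\<lambda>x i. x i * (P x / Q x)) (\<lambda>x i. x i * (Q x / P x))"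
proof (rule homeomorphismI)
 show "continuous_on {x \<in> coords n. P x \<le> 1} (\<lambda>x i. x i * (P x / Q x))"
  by (rule continuous_on_subset[OF continuous_on_radial[OF P Q]]) auto
 show "continuous_on {x \<in> coords n. Q x \<le> 1} (\<lambda>x i. x i * (Q x / P x))"
  by (rule continuous_on_subset[OF continuous_on_radial[OF Q P]]) auto
qed (use radial_gauge[OF P Q] radial_gauge[OF Q P] radial_inverse[OF P Q] radial_inverse[OF Q P] in auto)

lemma gauge_norm: "gauge_fun n (\<lambda>x. sqrt (\<Sum>i<n. (x i)\<^sup>2))"
 unfolding gauge_fun_def
proof (intro conjI ballI allI impI)
 show "continuous_on (coords n) (\<lambda>x. sqrt (\<Sum>i<n. (x i)\<^sup>2))"
  by (intro continuous_intros)
 fix c :: real and x :: "nat \<Rightarrow> real" assume "0 \<le> c"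
 thus "sqrt (\<Sum>i<n. (c * x i)\<^sup>2) = c * sqrt (\<Sum>i<n. (x i)\<^sup>2)"
  by (simp add: power_mult_distrib real_sqrt_mult flip: sum_distrib_left)
next
 fix x :: "nat \<Rightarrow> real" assume x: "x \<in> coords n" "x \<noteq> (\<lambda>_. 0)"
 then obtain i where "i < n" "x i \<noteq> 0" unfolding coords_def by (metis (mono_tags) mem_Collect_eq not_le ext)
 hence "(\<Sum>i<n. (x i)\<^sup>2) > 0" by (intro sum_pos2[of _ i]) auto
 thus "sqrt (\<Sum>i<n. (x i)\<^sup>2) > 0" by simp
next
 show "\<exists>C. \<forall>x\<in>coords n. \<forall>i. \<bar>x i\<bar> \<le> C * sqrt (\<Sum>i<n. (x i)\<^sup>2)"
 proof (intro exI[of _ 1] ballI allI)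
  fix x :: "nat \<Rightarrow> real" and i assume x: "x \<in> coords n"
  show "\<bar>x i\<bar> \<le> 1 * sqrt (\<Sum>i<n. (x i)\<^sup>2)"
  proof (cases "i < n")
   case True
   hence "(x i)\<^sup>2 \<le> (\<Sum>i<n. (x i)\<^sup>2)" by (intro member_le_sum) auto
   thus ?thesis by (simp add: real_le_rsqrt)
  next
   case False
   thus ?thesis using x by (simp add: coords_def sum_nonneg)
  qed
 qed
qed

text \<open>The ball is the unit body of the Euclidean norm, and the radial map from one unit body
  to another matches the level sets of value 1.\<close>

lemma cell_pair_gauge:
 assumes P: "gauge_fun n P"
 shows "cell_pair n {x \<in> coords n. P x \<le> 1} {x \<in> coords n. P x = 1}"
proof -
 define N where "N = (\<lambda>x::nat\<Rightarrow>real. sqrt (\<Sum>i<n. (x i)\<^sup>2))"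
 have N: "gauge_fun n N" unfolding N_def by (rule gauge_norm)
 have d: "disk_set n = {x \<in> coords n. N x \<le> 1}" by (simp add: disk_set_def N_def)
 have b: "disk_boundary n = {x \<in> coords n. N x = 1}" by (simp add: disk_boundary_eq N_def)
 have "(\<lambda>x i. x i * (N x / P x)) ` disk_boundary n = {x \<in> coords n. P x = 1}"
 proof (intro equalityI subsetI)
  fix y assume y: "y \<in> {x \<in> coords n. P x = 1}"
  hence "y = (\<lambda>x i. x i * (N x / P x)) (\<lambda>i. y i * (P y / N y))"
   using radial_inverse[OF P N, of y] by auto
  moreover have "(\<lambda>i. y i * (P y / N y)) \<in> disk_boundary n"
   using radial_gauge[OF P N, of y] y by (auto simp: b)
  ultimately show "y \<in> (\<lambda>x i. x i * (N x / P x)) ` disk_boundary n" by (rule image_eqI)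
 next
  fix y assume "y \<in> (\<lambda>x i. x i * (N x / P x)) ` disk_boundary n"
  then obtain x where x: "x \<in> coords n" "N x = 1" "y = (\<lambda>i. x i * (N x / P x))" by (auto simp: b)
  show "y \<in> {x \<in> coords n. P x = 1}"
   using radial_gauge[OF N P x(1)] unfolding x(3)[symmetric] using x(2) by simp
 qed
 thus ?thesis
  unfolding cell_pair_def d using homeomorphism_radial[OF N P] by blast
qed

text \<open>The start value 0 keeps the maximum meaningful for \<open>n = 0\<close>, so that cells
  of dimension 0 fall under the same argument; the gauges built from it are nonnegative
  anyway.\<close>

primrec fmax :: "nat \<Rightarrow> (nat \<Rightarrow> real) \<Rightarrow> real" where
 "fmax 0 f = 0"
| "fmax (Suc n) f = max (fmax n f) (f n)"

lemma fmax_le: "fmax n f \<le> c \<longleftrightarrow> 0 \<le> c \<and> (\<forall>i<n. f i \<le> c)"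
 by (induction n) (auto simp: less_Suc_eq)

lemma fmax_less: "fmax n f < c \<longleftrightarrow> 0 < c \<and> (\<forall>i<n. f i < c)"
 by (induction n) (auto simp: less_Suc_eq)

lemma fmax_mult: "0 \<le> c \<Longrightarrow> fmax n (\<lambda>i. c * f i) = c * fmax n f"
 by (induction n) (auto simp: max_mult_distrib_left)

lemma continuous_on_fmax:
 "(\<And>i. i < n \<Longrightarrow> continuous_on S (\<lambda>x. F x i)) \<Longrightarrow> continuous_on S (\<lambda>x. fmax n (F x))"
 by (induction n) (auto intro!: continuous_intros)

subsection \<open>Cubes\<close>

text \<open>As the coordinates from \<open>n\<close> on vanish, \<open>cube k\<close> is literally
  the face of \<open>cube (Suc k)\<close> on which coordinate \<open>k\<close> is 0, and a further
  parameter is inserted by a function update at \<open>k\<close>.\<close>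

definition cube :: "nat \<Rightarrow> (nat \<Rightarrow> real) set" where
 "cube n = {x. (\<forall>i<n. 0 \<le> x i \<and> x i \<le> 1) \<and> (\<forall>i\<ge>n. x i = 0)}"

definition cube_bd :: "nat \<Rightarrow> (nat \<Rightarrow> real) set" where
 "cube_bd n = {x \<in> cube n. \<exists>i<n. x i = 0 \<or> x i = 1}"

abbreviation cyl :: "nat \<Rightarrow> (real \<times> (nat \<Rightarrow> real)) set" where
 "cyl k \<equiv> {0..1} \<times> cube k"

lemma cube_bd_subset: "cube_bd n \<subseteq> cube n"
 by (auto simp: cube_bd_def)

lemma cell_pair_cube: "cell_pair n (cube n) (cube_bd n)"
proof -
 \<comment> \<open>The maximum norm has \<open>[-1,1]^n\<close> as its unit body; the affine maps
   \<open>f\<close> and \<open>g\<close> below exchange it with \<open>[0,1]^n\<close>.\<close>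
 define P where "P = (\<lambda>x::nat\<Rightarrow>real. fmax n (\<lambda>i. \<bar>x i\<bar>))"
 have le: "P x \<le> 1 \<longleftrightarrow> (\<forall>i<n. \<bar>x i\<bar> \<le> 1)" for x by (simp add: P_def fmax_le)
 have less: "P x < 1 \<longleftrightarrow> (\<forall>i<n. \<bar>x i\<bar> < 1)" for x by (simp add: P_def fmax_less)
 have eq: "P x = 1 \<longleftrightarrow> (\<forall>i<n. \<bar>x i\<bar> \<le> 1) \<and> (\<exists>i<n. \<bar>x i\<bar> = 1)" for x
 proof -
  have "P x = 1 \<longleftrightarrow> P x \<le> 1 \<and> \<not> P x < 1" by linarith
  moreover have "(\<exists>i<n. 1 \<le> \<bar>x i\<bar>) \<longleftrightarrow> (\<exists>i<n. \<bar>x i\<bar> = 1)" if "\<forall>i<n. \<bar>x i\<bar> \<le> 1"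
   using that by force
  ultimately show ?thesis unfolding le less not_all not_imp not_less by (simp cong: conj_cong)
 qed
 have "gauge_fun n P"
  unfolding gauge_fun_def
 proof (intro conjI ballI allI impI)
  show "continuous_on (coords n) P"
   unfolding P_def by (intro continuous_on_fmax continuous_intros)
  show "P (\<lambda>i. c * x i) = c * P x" if "0 \<le> c" for c x
   using that fmax_mult[of c n "\<lambda>i. \<bar>x i\<bar>"] by (simp add: P_def abs_mult)
  show "0 < P x" if "x \<in> coords n" "x \<noteq> (\<lambda>_. 0)" for x
  proof (rule ccontr)
   assume "\<not> 0 < P x"
   hence "\<forall>i<n. x i = 0" unfolding not_less P_def fmax_le by simp
   thus False using that by (auto simp: coords_def fun_eq_iff) (metis not_le)
  qed
  have "\<bar>x i\<bar> \<le> 1 * P x" if "x \<in> coords n" for x i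
  proof (cases "i < n")
   case True thus ?thesis using fmax_le[of n "\<lambda>i. \<bar>x i\<bar>" "P x"] by (simp add: P_def)
  next
   case False thus ?thesis using that fmax_le[of n "\<lambda>i. \<bar>x i\<bar>" "P x"] by (simp add: P_def coords_def)
  qed
  thus "\<exists>C. \<forall>x\<in>coords n. \<forall>i. \<bar>x i\<bar> \<le> C * P x" by blast
 qed
 from cell_pair_gauge[OF this] show ?thesis
 proof (rule cell_pair_homeomorphism)
  define f where "f = (\<lambda>x i. if i < n then (x i + 1) / 2 else (0::real))"
  define g where "g = (\<lambda>x i. if i < n then 2 * x i - 1 else (0::real))"
  have "continuous_on S (\<lambda>x. f x i)" "continuous_on S (\<lambda>x. g x i)" for i and S :: "(nat \<Rightarrow> real) set"
   unfolding f_def g_def by (cases "i < n"; simp; intro continuous_intros; simp)+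
  hence cf: "continuous_on S f" "continuous_on S g" for S :: "(nat \<Rightarrow> real) set"
   by (auto intro: continuous_on_pi)
  have f1: "f x \<in> cube n" if "P x \<le> 1" for x
   using that unfolding le cube_def abs_le_iff f_def by fastforce
  have g1: "g y \<in> coords n" "P (g y) \<le> 1" if "y \<in> cube n" for y
   using that unfolding le cube_def coords_def g_def by auto
  have gf: "g (f x) = x" if "x \<in> coords n" for x
   using that by (auto simp: fun_eq_iff coords_def field_simps f_def g_def)
  have fg: "f (g x) = x" if "x \<in> cube n" for x
   using that by (auto simp: fun_eq_iff cube_def f_def g_def)
  show "homeomorphism {x \<in> coords n. P x \<le> 1} (cube n) f g"
   by (rule homeomorphismI) (use cf f1 g1 gf fg in auto)
  show "f ` {x \<in> coords n. P x = 1} = cube_bd n"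
  proof (intro equalityI subsetI)
   fix y assume "y \<in> f ` {x \<in> coords n. P x = 1}"
   then obtain x where x: "x \<in> coords n" "P x = 1" "y = f x" by auto
   then obtain i where i: "i < n" "\<bar>x i\<bar> = 1" unfolding eq by auto
   have "f x i = 0 \<or> f x i = 1" using i by (auto simp: f_def)
   moreover have "y \<in> cube n" using f1[of x] x by simp
   ultimately show "y \<in> cube_bd n" unfolding cube_bd_def x(3) using i(1) by blast
  next
   fix y assume y: "y \<in> cube_bd n"
   then obtain i where i: "i < n" "y i = 0 \<or> y i = 1" and yc: "y \<in> cube n" by (auto simp: cube_bd_def)
   have "\<bar>g y i\<bar> = 1" using i by (auto simp: g_def)
   hence "P (g y) = 1" unfolding eq using g1[OF yc] i(1) unfolding le by blast
   thus "y \<in> f ` {x \<in> coords n. P x = 1}"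
    using fg[OF yc] g1(1)[OF yc] by (intro image_eqI[of _ _ "g y"]) auto
  qed
 qed
qed

lemma homeomorphism_Times:
 assumes "homeomorphism S T f g" "homeomorphism S' T' f' g'"
 shows "homeomorphism (S \<times> S') (T \<times> T') (map_prod f f') (map_prod g g')"
 using assms unfolding homeomorphism_def
 by (auto simp: map_prod_def split_def intro!: continuous_intros continuous_on_compose2[where f=fst] continuous_on_compose2[where f=snd])
  (force simp: image_iff)+

lemma homeomorphism_cube_Times:
 "homeomorphism (cube n \<times> cube m) (cube (n + m))
  (\<lambda>z i. if i < n then fst z i else snd z (i - n)) (\<lambda>z. ((\<lambda>i. if i < n then z i else 0), (\<lambda>i. z (i + n))))"
proof (rule homeomorphismI)
 show "continuous_on (cube n \<times> cube m) (\<lambda>z i. if i < n then fst z i else snd z (i - n))"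
 proof (rule continuous_on_pi)
  show "continuous_on (cube n \<times> cube m) (\<lambda>z. if i < n then fst z i else snd z (i - n))" for i
   by (cases "i < n"; simp; intro continuous_intros)
 qed
 have "continuous_on (cube (n + m)) (\<lambda>z i. if i < n then z i else 0)"
 proof (rule continuous_on_pi)
  show "continuous_on (cube (n + m)) (\<lambda>z. if i < n then z i else 0)" for i
   by (cases "i < n"; simp; intro continuous_intros)
 qed
 moreover have "continuous_on (cube (n + m)) (\<lambda>z i. z (i + n))"
  by (rule continuous_on_pi) (intro continuous_intros)
 ultimately show "continuous_on (cube (n + m)) (\<lambda>z. ((\<lambda>i. if i < n then z i else 0), (\<lambda>i. z (i + n))))"
  by (rule continuous_on_Pair)
qed (auto simp: cube_def fun_eq_iff)

text \<open>For cubes the product is a cell by concatenation of coordinates, and a boundary point is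
  one with an extreme coordinate in either block. The general case is transported along
  homeomorphisms with cubes.\<close>

lemma cell_pair_Times:
 assumes "cell_pair n T S" "cell_pair m T' S'"
 shows "cell_pair (n + m) (T \<times> T') (S \<times> T' \<union> T \<times> S')"
proof -
 obtain f g where f: "homeomorphism (disk_set n) T f g" "f ` disk_boundary n = S"
  using assms(1) unfolding cell_pair_def by auto
 obtain f' g' where f': "homeomorphism (disk_set m) T' f' g'" "f' ` disk_boundary m = S'"
  using assms(2) unfolding cell_pair_def by auto
 obtain c d where c: "homeomorphism (disk_set n) (cube n) c d" "c ` disk_boundary n = cube_bd n"
  using cell_pair_cube unfolding cell_pair_def by blast
 obtain c' d' where c': "homeomorphism (disk_set m) (cube m) c' d'" "c' ` disk_boundary m = cube_bd m"
  using cell_pair_cube unfolding cell_pair_def by blast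
 have h: "homeomorphism (cube n) T (f \<circ> d) (c \<circ> g)" "homeomorphism (cube m) T' (f' \<circ> d') (c' \<circ> g')"
  using homeomorphism_compose homeomorphism_symD f c f' c' by blast+
 have db: "d ` cube_bd n = disk_boundary n" "d' ` cube_bd m = disk_boundary m"
 proof -
  have "d ` c ` disk_boundary n = disk_boundary n" "d' ` c' ` disk_boundary m = disk_boundary m"
   using c(1) c'(1) disk_boundary_subset unfolding homeomorphism_def image_comp
   by (auto simp: image_iff subset_iff)
  thus "d ` cube_bd n = disk_boundary n" "d' ` cube_bd m = disk_boundary m"
   using c(2) c'(2) by simp_all
 qed
 have b: "(f \<circ> d) ` cube_bd n = S" "(f' \<circ> d') ` cube_bd m = S'"
  unfolding image_comp[symmetric] db f(2) f'(2) by (rule refl)+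
 have i: "(f \<circ> d) ` cube n = T" "(f' \<circ> d') ` cube m = T'"
  using h unfolding homeomorphism_def by auto
 let ?C = "\<lambda>z i. if i < n then fst z i else snd z (i - n) :: real"
 let ?D = "\<lambda>z. ((\<lambda>i. if i < n then z i else 0 :: real), (\<lambda>i. z (i + n)))"
 have H: "homeomorphism (cube (n + m)) (T \<times> T') (map_prod (f \<circ> d) (f' \<circ> d') \<circ> ?D) (?C \<circ> map_prod (c \<circ> g) (c' \<circ> g'))"
  by (rule homeomorphism_compose[OF homeomorphism_symD[OF homeomorphism_cube_Times] homeomorphism_Times[OF h]])
 have D: "?D ` cube_bd (n + m) = cube_bd n \<times> cube m \<union> cube n \<times> cube_bd m"
 proof (intro equalityI subsetI)
  fix w assume "w \<in> ?D ` cube_bd (n + m)"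
  then obtain z i where z: "z \<in> cube (n + m)" "i < n + m" "z i = 0 \<or> z i = 1" "w = ?D z"
   by (auto simp: cube_bd_def)
  show "w \<in> cube_bd n \<times> cube m \<union> cube n \<times> cube_bd m"
  proof (cases "i < n")
   case True thus ?thesis using z by (auto simp: cube_bd_def cube_def)
  next
   case False
   hence "i - n < m" "(\<lambda>i. z (i + n)) (i - n) = 0 \<or> (\<lambda>i. z (i + n)) (i - n) = 1" using z by auto
   hence "(\<lambda>i. z (i + n)) \<in> cube_bd m"
    using z unfolding cube_bd_def cube_def by (auto intro!: exI[of _ "i - n"])
   thus ?thesis using z by (auto simp: cube_def)
  qed
 next
  fix w assume w: "w \<in> cube_bd n \<times> cube m \<union> cube n \<times> cube_bd m"
  hence wc: "w \<in> cube n \<times> cube m" using cube_bd_subset by blast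
  have "?D (?C w) = w" "?C w \<in> cube (n + m)"
   using homeomorphism_cube_Times[of n m] wc unfolding homeomorphism_def by (blast, blast)
  moreover have "\<exists>i<n + m. ?C w i = 0 \<or> ?C w i = 1"
   using w
  proof
   assume "w \<in> cube_bd n \<times> cube m"
   then obtain i where "i < n" "fst w i = 0 \<or> fst w i = 1" by (auto simp: cube_bd_def)
   thus ?thesis by (intro exI[of _ i]) auto
  next
   assume "w \<in> cube n \<times> cube_bd m"
   then obtain i where "i < m" "snd w i = 0 \<or> snd w i = 1" by (auto simp: cube_bd_def)
   thus ?thesis by (intro exI[of _ "n + i"]) auto
  qed
  ultimately show "w \<in> ?D ` cube_bd (n + m)"
   by (intro image_eqI[of _ _ "?C w"]) (simp_all only: cube_bd_def mem_Collect_eq simp_thms)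
 qed
 let ?M = "map_prod (f \<circ> d) (f' \<circ> d')"
 have "(?M \<circ> ?D) ` cube_bd (n + m) = ?M ` (?D ` cube_bd (n + m))"
  by (rule image_comp[symmetric])
 also have "\<dots> = ?M ` (cube_bd n \<times> cube m) \<union> ?M ` (cube n \<times> cube_bd m)"
  unfolding D by (rule image_Un)
 also have "\<dots> = S \<times> T' \<union> T \<times> S'"
  by (rule arg_cong2[where f="(\<union>)", OF map_prod_surj_on[OF b(1) i(2)] map_prod_surj_on[OF i(1) b(2)]])
 finally have "(?M \<circ> ?D) ` cube_bd (n + m) = S \<times> T' \<union> T \<times> S'" .
 thus ?thesis
  by (rule cell_pair_homeomorphism[OF cell_pair_cube H])
qed

lemma cell_pair_interval: "cell_pair 1 {0..1::real} {0, 1}"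
proof -
 have "homeomorphism (cube 1) {0..1::real} (\<lambda>x. x 0) (\<lambda>t i. if i = 0 then t else 0)"
 proof (rule homeomorphismI)
  show "continuous_on (cube 1) (\<lambda>x. x 0)" by (intro continuous_intros)
  show "continuous_on {0..1::real} (\<lambda>t i. if i = (0::nat) then t else 0)"
  proof (rule continuous_on_pi)
   show "continuous_on {0..1::real} (\<lambda>t. if i = (0::nat) then t else 0)" for i
    by (cases "i = 0"; simp; intro continuous_intros)
  qed
 qed (auto simp: cube_def fun_eq_iff)
 moreover have "(\<lambda>x. x 0) ` cube_bd 1 = {0, 1::real}"
 proof -
  have "(\<lambda>x. x 0) ` cube_bd 1 \<subseteq> {0, 1::real}" by (auto simp: cube_bd_def)
  moreover have "t \<in> (\<lambda>x. x 0) ` cube_bd 1" if "t \<in> {0, 1::real}" for t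
   using that by (intro image_eqI[of _ _ "\<lambda>i. if i = 0 then t else 0"]) (auto simp: cube_bd_def cube_def)
  ultimately show ?thesis by blast
 qed
 ultimately show ?thesis using cell_pair_homeomorphism[OF cell_pair_cube] by blast
qed

subsection \<open>Simplices\<close>

definition supp :: "('i \<Rightarrow> real) \<Rightarrow> 'i set" where
 "supp l = {i. l i \<noteq> 0}"

text \<open>Barycentric coordinates on the closed simplex with vertex set \<open>J\<close>, taken as
  functions on the whole index type: a face is then literally a subset, and a point belongs to every
  simplex that contains its support.\<close>

definition simp :: "'i set \<Rightarrow> ('i \<Rightarrow> real) set" where
 "simp J = {l. (\<forall>i. 0 \<le> l i) \<and> supp l \<subseteq> J \<and> sum l J = 1}"

lemma cell_pair_simp:
 assumes "finite J" "J \<noteq> {}"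
 shows "cell_pair (card J - 1) (simp J) {l \<in> simp J. supp l \<noteq> J}"
proof -
 define d where "d = card J - 1"
 have cJ: "card J = Suc d" using assms by (simp add: d_def card_gt_0_iff)
 \<comment> \<open>The number of vertices: the origin will correspond to the barycentre, all of
   whose coordinates are \<open>1 / a\<close>.\<close>
 define a where "a = real (d + 1)"
 have a: "a > 0" by (simp add: a_def)
 obtain e where "bij_betw e {0..<card J} J" using ex_bij_betw_nat_finite[OF assms(1)] by blast
 hence e: "bij_betw e {..d} J" unfolding cJ by (simp add: atLeast0LessThan lessThan_Suc_atMost)
 define q where "q = the_inv_into {..d} e"
 have qe: "q (e i) = i" if "i \<le> d" for i
  using e that unfolding q_def by (simp add: bij_betw_def the_inv_into_f_f)
 have eq': "e (q j) = j" "q j \<le> d" if "j \<in> J" for j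
 proof -
  from that e obtain i where i: "i \<le> d" "j = e i" by (auto simp: bij_betw_def)
  thus "e (q j) = j" "q j \<le> d" using qe by auto
 qed
 have eJ: "e i \<in> J" if "i \<le> d" for i using that e by (auto simp: bij_betw_def)
 \<comment> \<open>The point belonging to \<open>x\<close> has the barycentric coordinates
   \<open>(1 - w x i) / a\<close>, the last one being fixed by the condition that they sum to 1. So
   \<open>w x i \<le> 1\<close> expresses that the \<open>i\<close>-th one is nonnegative, and the
   maximum \<open>P\<close> is the gauge of the simplex about its barycentre.\<close>
 define w where "w = (\<lambda>(x::nat\<Rightarrow>real) i. if i < d then - a * x i else a * (\<Sum>i<d. x i))"
 define P where "P = (\<lambda>x. fmax (Suc d) (w x))"
 have wP: "w x i \<le> P x" if "i \<le> d" for x i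
  using fmax_le[of "Suc d" "w x" "P x"] that by (auto simp: P_def simp del: fmax.simps)
 have P0: "P x \<ge> 0" for x
  using fmax_le[of "Suc d" "w x" "P x"] by (auto simp: P_def simp del: fmax.simps)
 have PaP: "P x \<le> a * P x" for x using mult_right_mono[OF _ P0, of 1 a x] by (simp add: a_def)
 \<comment> \<open>The gauge bounds every coordinate from below and the sum of all coordinates from
   above. An upper bound for a single coordinate results by subtracting the lower bounds of the
   others from the bound of the sum.\<close>
 have bound: "\<bar>x i\<bar> \<le> (1 + real d) * P x" if x: "x \<in> coords d" for x i
 proof (cases "i < d")
  case True
  have lo: "- x k \<le> P x" if "k < d" for k
  proof -
   have "- (a * x k) \<le> P x" using wP[of k x] that by (simp add: w_def)
   moreover have "P x \<le> a * P x" by (rule PaP)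
   ultimately have "a * (- x k) \<le> a * P x" by simp
   thus ?thesis using a by (simp only: mult_le_cancel_left_pos)
  qed
  have "a * (\<Sum>i<d. x i) \<le> P x" using wP[of d x] by (simp add: w_def)
  moreover have "P x \<le> a * P x" by (rule PaP)
  ultimately have "a * (\<Sum>i<d. x i) \<le> a * P x" by simp
  hence s: "(\<Sum>i<d. x i) \<le> P x" using a by (simp only: mult_le_cancel_left_pos)
  have "(\<Sum>k<d. x k) = x i + (\<Sum>k\<in>{..<d} - {i}. x k)" using True by (simp add: sum.remove)
  moreover have "(\<Sum>k\<in>{..<d} - {i}. - P x) \<le> (\<Sum>k\<in>{..<d} - {i}. x k)"
   using lo by (intro sum_mono) force
  moreover have "(\<Sum>k\<in>{..<d} - {i}. - P x) = - (real (d - 1) * P x)" using True by simp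
  moreover have "real (d - 1) * P x \<le> real d * P x" using P0[of x] by (intro mult_right_mono) auto
  ultimately have "x i \<le> P x + real d * P x" using s by linarith
  moreover have "- x i \<le> P x + real d * P x" using lo[OF True] P0[of x] by (simp add: add_increasing2)
  ultimately show ?thesis by (simp add: algebra_simps)
 next
  case False
  thus ?thesis using x P0[of x] by (simp add: coords_def)
 qed
 have gP: "gauge_fun d P"
  unfolding gauge_fun_def
 proof (intro conjI ballI allI impI)
  show "continuous_on (coords d) P"
   unfolding P_def
  proof (rule continuous_on_fmax)
   show "continuous_on (coords d) (\<lambda>x. w x i)" for i
    unfolding w_def by (cases "i < d"; simp; intro continuous_intros)
  qed
  show "P (\<lambda>i. c * x i) = c * P x" if "0 \<le> c" for c x
  proof -
   have "w (\<lambda>i. c * x i) = (\<lambda>i. c * w x i)" by (auto simp: w_def fun_eq_iff sum_distrib_left mult.left_commute)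
   thus ?thesis using fmax_mult[OF that, of "Suc d" "w x"] unfolding P_def by simp
  qed
  show "0 < P x" if x: "x \<in> coords d" "x \<noteq> (\<lambda>_. 0)" for x
  proof (rule ccontr)
   assume "\<not> 0 < P x"
   hence "P x = 0" using P0[of x] by simp
   hence "\<bar>x i\<bar> \<le> 0" for i using bound[OF x(1), of i] by simp
   thus False using x(2) by auto
  qed
  show "\<exists>C. \<forall>x\<in>coords d. \<forall>i. \<bar>x i\<bar> \<le> C * P x" using bound by blast
 qed
 define y where "y = (\<lambda>(x::nat\<Rightarrow>real) i. (1 - w x i) / a)"
 have ylt: "y x i = x i + 1 / a" if "i < d" for x i using that a by (simp add: y_def w_def field_simps)
 have yd: "y x d = 1 / a - (\<Sum>i<d. x i)" for x using a by (simp add: y_def w_def field_simps)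
 have ysum: "(\<Sum>i\<le>d. y x i) = 1" for x
 proof -
  have "(\<Sum>i\<le>d. y x i) = (\<Sum>i<d. y x i) + y x d" by (simp flip: lessThan_Suc_atMost)
  also have "(\<Sum>i<d. y x i) = (\<Sum>i<d. x i + 1 / a)" using ylt by (intro sum.cong) auto
  finally show ?thesis using a by (simp add: yd sum.distrib) (simp add: a_def field_simps)
 qed
 have y0: "0 \<le> y x i \<longleftrightarrow> w x i \<le> 1" "y x i = 0 \<longleftrightarrow> w x i = 1" for x i
  using a by (auto simp: y_def zero_le_divide_iff)
 have Ple: "P x \<le> 1 \<longleftrightarrow> (\<forall>i\<le>d. 0 \<le> y x i)" for x
  unfolding P_def fmax_le y0 by (auto simp: less_Suc_eq_le)
 have Plt: "P x < 1 \<longleftrightarrow> (\<forall>i\<le>d. w x i < 1)" for x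
  unfolding P_def fmax_less by (auto simp: less_Suc_eq_le)
 have Peq: "P x = 1 \<longleftrightarrow> P x \<le> 1 \<and> (\<exists>i\<le>d. y x i = 0)" for x
 proof -
  have "P x = 1 \<longleftrightarrow> P x \<le> 1 \<and> \<not> P x < 1" by linarith
  moreover have "(\<exists>i\<le>d. 1 \<le> w x i) \<longleftrightarrow> (\<exists>i\<le>d. w x i = 1)" if "\<forall>i\<le>d. w x i \<le> 1"
   using that by force
  ultimately show ?thesis
   unfolding Ple Plt not_all not_imp not_less y0 by (simp cong: conj_cong)
 qed
 define f where "f = (\<lambda>x j. if j \<in> J then y x (q j) else 0)"
 define g where "g = (\<lambda>l (i::nat). if i < d then l (e i) - 1 / a else (0::real))"
 have sumf: "sum (f x) J = 1" for x
 proof -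
  have "sum (f x) J = (\<Sum>i\<le>d. f x (e i))" using sum.reindex_bij_betw[OF e] by metis
  also have "\<dots> = (\<Sum>i\<le>d. y x i)" using eJ qe by (intro sum.cong) (auto simp: f_def)
  finally show ?thesis using ysum by simp
 qed
 have fS: "f x \<in> simp J" if "P x \<le> 1" for x
  using that eq' sumf[of x] unfolding simp_def Ple by (auto simp: f_def supp_def split: if_splits)
 have gc: "g l \<in> coords d" for l by (simp add: g_def coords_def)
 have yg: "y (g l) i = l (e i)" if l: "l \<in> simp J" and i: "i \<le> d" for l i
 proof (cases "i < d")
  case True thus ?thesis by (simp add: ylt g_def)
 next
  case False
  hence id: "i = d" using i by simp
  have "1 = (\<Sum>i\<le>d. l (e i))" using l sum.reindex_bij_betw[OF e, of l] by (simp add: simp_def)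
  also have "\<dots> = (\<Sum>i<d. l (e i)) + l (e d)" by (simp flip: lessThan_Suc_atMost)
  also have "(\<Sum>i<d. l (e i)) = (\<Sum>i<d. g l i + 1 / a)" by (intro sum.cong) (auto simp: g_def)
  also have "\<dots> = (\<Sum>i<d. g l i) + real d / a" by (simp add: sum.distrib)
  finally have "(\<Sum>i<d. g l i) = 1 - real d / a - l (e d)" by simp
  moreover have "1 - real d / a = 1 / a" using a by (simp add: a_def field_simps)
  ultimately show ?thesis unfolding id yd by simp
 qed
 have fg: "f (g l) = l" if l: "l \<in> simp J" for l
  using l eq' by (auto simp: f_def fun_eq_iff yg[OF l] simp_def supp_def)
 have Pg: "P (g l) \<le> 1" if l: "l \<in> simp J" for l
  unfolding Ple using l by (auto simp: yg[OF l] simp_def)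
 have gf: "g (f x) = x" if "x \<in> coords d" for x
  using that eJ qe by (auto simp: fun_eq_iff g_def f_def ylt coords_def)
 have cy: "continuous_on S (\<lambda>x. y x i)" for S i
  unfolding y_def w_def using a by (cases "i < d"; simp; intro continuous_intros; simp)
 have "homeomorphism {x \<in> coords d. P x \<le> 1} (simp J) f g"
 proof (rule homeomorphismI)
  show "continuous_on {x \<in> coords d. P x \<le> 1} f"
   unfolding f_def
  proof (rule continuous_on_pi)
   fix j
   show "continuous_on {x \<in> coords d. P x \<le> 1} (\<lambda>x. if j \<in> J then y x (q j) else 0)"
    using cy by (cases "j \<in> J") auto
  qed
  show "continuous_on (simp J) g"
   unfolding g_def
  proof (rule continuous_on_pi)
   fix i
   show "continuous_on (simp J) (\<lambda>l. if i < d then l (e i) - 1 / a else 0)"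
    by (cases "i < d"; simp; intro continuous_intros)
  qed
 qed (use fS Pg gc gf fg in auto)
 moreover have "f ` {x \<in> coords d. P x = 1} = {l \<in> simp J. supp l \<noteq> J}"
 proof (intro equalityI subsetI)
  fix l assume "l \<in> f ` {x \<in> coords d. P x = 1}"
  then obtain x where x: "P x = 1" "l = f x" by auto
  then obtain i where i: "i \<le> d" "y x i = 0" using Peq by blast
  hence "f x (e i) = 0" using eJ qe by (simp add: f_def)
  hence "supp (f x) \<noteq> J" using eJ[OF i(1)] by (auto simp: supp_def)
  thus "l \<in> {l \<in> simp J. supp l \<noteq> J}" using x fS[of x] by simp
 next
  fix l assume l: "l \<in> {l \<in> simp J. supp l \<noteq> J}"
  then obtain j where j: "j \<in> J" "l j = 0" by (auto simp: simp_def supp_def)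
  hence "y (g l) (q j) = 0" using yg[of l "q j"] eq'[OF j(1)] l by simp
  hence "P (g l) = 1" unfolding Peq using Pg[of l] l eq'(2)[OF j(1)] by blast
  thus "l \<in> f ` {x \<in> coords d. P x = 1}"
   using fg[of l] gc[of l] l by (intro image_eqI[of _ _ "g l"]) auto
 qed
 ultimately show ?thesis
  unfolding d_def[symmetric] by (rule cell_pair_homeomorphism[OF cell_pair_gauge[OF gP]])
qed

section \<open>Sheaves of spaces\<close>

lemma cmap_into:
 "continuous_on S f \<Longrightarrow> f ` S \<subseteq> T \<Longrightarrow> cmap S (top_of_set T) f"
 by (auto simp: continuous_map_in_subtopology)

lemma cmap_compose:
 assumes "cmap T Z g" "continuous_on S f" "f ` S \<subseteq> T"
 shows "cmap S Z (\<lambda>x. g (f x))"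
 using continuous_map_compose[OF cmap_into[OF assms(2,3)] assms(1)] by (simp add: o_def)

lemma cmap_paste:
 assumes "closedin (top_of_set R) A" "closedin (top_of_set R) B" "R \<subseteq> A \<union> B"
  and "cmap A Z h" "cmap B Z h"
 shows "cmap R Z h"
 unfolding continuous_map_closedin
proof (intro conjI allI impI)
 have AB: "A \<subseteq> R" "B \<subseteq> R" using assms(1,2) closedin_imp_subset by blast+
 show "h \<in> topspace (top_of_set R) \<rightarrow> topspace Z"
  using assms(3-5) unfolding continuous_map_def by auto
 fix C assume C: "closedin Z C"
 have "closedin (top_of_set A) {x \<in> A. h x \<in> C}" "closedin (top_of_set B) {x \<in> B. h x \<in> C}"
  using assms(4,5) C unfolding continuous_map_closedin by auto
 hence "closedin (top_of_set R) ({x \<in> A. h x \<in> C} \<union> {x \<in> B. h x \<in> C})"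
  using assms(1,2) closedin_trans by blast
 moreover have "{x \<in> topspace (top_of_set R). h x \<in> C} = {x \<in> A. h x \<in> C} \<union> {x \<in> B. h x \<in> C}"
  using AB assms(3) by auto
 ultimately show "closedin (top_of_set R) {x \<in> topspace (top_of_set R). h x \<in> C}" by simp
qed

lemma cmap_paste_le:
 assumes "continuous_on R (a :: 'c::topological_space \<Rightarrow> real)" "continuous_on R b"
  and "cmap {x \<in> R. a x \<le> b x} Z h"
   "cmap {x \<in> R. b x \<le> a x} Z h"
 shows "cmap R Z h"
proof (rule cmap_paste[OF _ _ _ assms(3,4)])
 show "closedin (top_of_set R) {x \<in> R. a x \<le> b x}"
  using continuous_closedin_preimage[of R "\<lambda>x. b x - a x" "{0..}"] assms(1,2)
  by (auto simp: vimage_def Int_def continuous_on_diff)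
 show "closedin (top_of_set R) {x \<in> R. b x \<le> a x}"
  using continuous_closedin_preimage[of R "\<lambda>x. a x - b x" "{0..}"] assms(1,2)
  by (auto simp: vimage_def Int_def continuous_on_diff)
qed auto

text \<open>A closed subset of the compact \<open>K\<close> has a compact, hence closed, image. This
  gives continuity of functions on a simplex once they are continuous in cone coordinates, where the
  base point is undetermined at the apex.\<close>

lemma cmap_quotient:
 fixes q :: "'c::topological_space \<Rightarrow> 'd::t2_space"
 assumes "compact K" "continuous_on K q" "cmap K Z (\<lambda>x. g (q x))"
 shows "cmap (q ` K) Z g"
 unfolding continuous_map_closedin
proof (intro conjI allI impI)
 show "g \<in> topspace (top_of_set (q ` K)) \<rightarrow> topspace Z"
  using assms(3) unfolding continuous_map_def by auto
 fix C assume C: "closedin Z C"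
 have "closedin (top_of_set K) {x \<in> K. g (q x) \<in> C}"
  using assms(3) C unfolding continuous_map_closedin by auto
 hence "compact {x \<in> K. g (q x) \<in> C}"
  using assms(1) closedin_compact by blast
 hence "compact (q ` {x \<in> K. g (q x) \<in> C})"
  using assms(2) by (intro compact_continuous_image) (auto intro: continuous_on_subset)
 moreover have "{y \<in> topspace (top_of_set (q ` K)). g y \<in> C} = q ` {x \<in> K. g (q x) \<in> C}"
  by auto
 ultimately show "closedin (top_of_set (q ` K)) {y \<in> topspace (top_of_set (q ` K)). g y \<in> C}"
  by (auto intro!: closed_subset compact_imp_closed)
qed

lemma sheaf_of_sets_id:
 "\<lbrakk>sheaf_of_sets X S r; openin X U; f \<in> S U\<rbrakk> \<Longrightarrow> r U U f = f"
 unfolding sheaf_of_sets_def by (elim conjE) simp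

lemma sheaf_of_sets_comp:
 assumes "sheaf_of_sets X S r" "openin X U" "openin X V" "openin X W" "W \<subseteq> V" "V \<subseteq> U" "f \<in> S U"
 shows "r V W (r U V f) = r U W f"
 using assms(1)[unfolded sheaf_of_sets_def, THEN conjunct2, THEN conjunct2, THEN conjunct1,
   rule_format, of U V W f] assms(2-) by simp

locale space_sheaf =
 fixes X :: "'a topology" and F :: "('a, 'b) top_presheaf"
 assumes sheaf: "sheaf_of_spaces X F"
begin

abbreviation sections :: "'a set \<Rightarrow> 'b set" where
 "sections U \<equiv> topspace (sec F U)"

text \<open>Flexibility of a pair controls the first homotopy only over the interior of its first
  set; for the pairs that arise from a cover that set is a union of this kind.\<close>

abbreviation core :: "(nat \<Rightarrow> 'a set) \<Rightarrow> nat \<Rightarrow> 'a set" where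
 "core A M \<equiv> X interior_of (\<Union>i\<le>M. A i)"

lemma res_continuous:
 "\<lbrakk>openin X U; openin X V; V \<subseteq> U\<rbrakk> \<Longrightarrow> continuous_map (sec F U) (sec F V) (res F U V)"
 using sheaf unfolding sheaf_of_spaces_def by blast

lemma sheaf_sets: "sheaf_of_sets X sections (res F)"
 using sheaf unfolding sheaf_of_spaces_def by blast

lemma res_in: "\<lbrakk>openin X U; openin X V; V \<subseteq> U; f \<in> sections U\<rbrakk> \<Longrightarrow> res F U V f \<in> sections V"
 using res_continuous unfolding continuous_map_def by blast

lemma res_id: "openin X U \<Longrightarrow> f \<in> sections U \<Longrightarrow> res F U U f = f"
 using sheaf_sets by (rule sheaf_of_sets_id)

lemma res_res:
 "\<lbrakk>openin X U; openin X V; openin X W; W \<subseteq> V; V \<subseteq> U; f \<in> sections U\<rbrakk> \<Longrightarrow>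
  res F V W (res F U V f) = res F U W f"
 using sheaf_sets by (rule sheaf_of_sets_comp)

lemma cmap_res:
 "\<lbrakk>continuous_map Y (sec F U) f; openin X U; openin X V; V \<subseteq> U\<rbrakk> \<Longrightarrow>
  continuous_map Y (sec F V) (\<lambda>x. res F U V (f x))"
 using continuous_map_compose[OF _ res_continuous] by (fastforce simp: o_def)

text \<open>The sheaf axiom speaks of sets of open sets, whereas a family may list the same open set
  twice. The overlap of two equal sets is the set itself, on which restriction is the identity, so
  the prescribed sections coincide and \<open>c\<close> may pick any index.\<close>

lemma sheaf_glue:
 assumes "sheaf_of_sets X S r" and "\<And>i. i \<in> I \<Longrightarrow> openin X (U i)" "\<And>i. i \<in> I \<Longrightarrow> \<sigma> i \<in> S (U i)"
  and "\<And>i j. i \<in> I \<Longrightarrow> j \<in> I \<Longrightarrow> r (U i) (U i \<inter> U j) (\<sigma> i) = r (U j) (U i \<inter> U j) (\<sigma> j)"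
 shows "\<exists>!f. f \<in> S (\<Union>i\<in>I. U i) \<and> (\<forall>i\<in>I. r (\<Union>i\<in>I. U i) (U i) f = \<sigma> i)"
proof -
 define c where "c V = (SOME i. i \<in> I \<and> U i = V)" for V
 have c: "c V \<in> I \<and> U (c V) = V" if "V \<in> U ` I" for V
  unfolding c_def by (rule someI_ex) (use that in auto)
 have cU: "\<sigma> (c (U i)) = \<sigma> i" if i: "i \<in> I" for i
 proof -
  have id: "r V V f = f" if "openin X V" "f \<in> S V" for V f
   using sheaf_of_sets_id[OF assms(1)] that by blast
  have ci: "c (U i) \<in> I" "U (c (U i)) = U i" using c[of "U i"] i by auto
  have "r (U i) (U i) (\<sigma> (c (U i))) = r (U i) (U i) (\<sigma> i)"
   using assms(4)[OF ci(1) i] unfolding ci(2) by simp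
  thus ?thesis
   using id[OF assms(2)[OF i]] assms(3)[OF ci(1)] assms(3)[OF i] unfolding ci(2) by metis
 qed
 have "(\<forall>V\<in>U ` I. openin X V \<and> \<sigma> (c V) \<in> S V) \<and>
   (\<forall>V\<in>U ` I. \<forall>W\<in>U ` I. r V (V \<inter> W) (\<sigma> (c V)) = r W (V \<inter> W) (\<sigma> (c W)))"
  using assms(2-4) cU by auto
 hence "\<exists>!f. f \<in> S (\<Union>(U ` I)) \<and> (\<forall>V\<in>U ` I. r (\<Union>(U ` I)) V f = \<sigma> (c V))"
  by (rule assms(1)[unfolded sheaf_of_sets_def, THEN conjunct2, THEN conjunct2, THEN conjunct2,
    THEN spec, of "U ` I", THEN spec, of "\<lambda>V. \<sigma> (c V)", THEN mp])
 moreover have "(\<forall>V\<in>U ` I. r (\<Union>(U ` I)) V f = \<sigma> (c V)) \<longleftrightarrow> (\<forall>i\<in>I. r (\<Union>i\<in>I. U i) (U i) f = \<sigma> i)" for f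
  using cU by auto
 ultimately show ?thesis by (simp only:)
qed

lemma sections_eqI:
 assumes "\<And>i. i \<in> I \<Longrightarrow> openin X (U i)" "W = (\<Union>i\<in>I. U i)" "f \<in> sections W" "g \<in> sections W"
  and "\<And>i. i \<in> I \<Longrightarrow> res F W (U i) f = res F W (U i) g"
 shows "f = g"
proof -
 have oW: "openin X W" using assms(1,2) by auto
 have "\<exists>!h. h \<in> sections (\<Union>i\<in>I. U i) \<and> (\<forall>i\<in>I. res F (\<Union>i\<in>I. U i) (U i) h = res F W (U i) f)"
 proof (rule sheaf_glue[OF sheaf_sets assms(1)])
  fix i j assume ij: "i \<in> I" "j \<in> I"
  have oi: "openin X (U i)" "openin X (U j)" "openin X (U i \<inter> U j)" using assms(1) ij by auto
  show "res F W (U i) f \<in> sections (U i)" using assms(2,3) ij oi oW by (intro res_in) auto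
  have "res F (U i) (U i \<inter> U j) (res F W (U i) f) = res F W (U i \<inter> U j) f"
   using ij assms(2,3) oi oW by (intro res_res) auto
  moreover have "res F (U j) (U i \<inter> U j) (res F W (U j) f) = res F W (U i \<inter> U j) f"
   using ij assms(2,3) oi oW by (intro res_res) auto
  ultimately show "res F (U i) (U i \<inter> U j) (res F W (U i) f) = res F (U j) (U i \<inter> U j) (res F W (U j) f)"
   by simp
 qed
 then obtain h where u: "\<And>k. k \<in> sections W \<Longrightarrow> \<forall>i\<in>I. res F W (U i) k = res F W (U i) f \<Longrightarrow> k = h"
  unfolding assms(2)[symmetric] by (elim ex1E) blast
 have "f = h" by (rule u[OF assms(3)]) simp
 moreover have "g = h" by (rule u[OF assms(4)]) (simp add: assms(5))
 ultimately show ?thesis by simp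
qed

lemma sections_glue:
 assumes "\<And>i. i \<in> I \<Longrightarrow> openin X (U i)" "\<And>i. i \<in> I \<Longrightarrow> \<sigma> i \<in> sections (U i)"
  and "\<And>i j. i \<in> I \<Longrightarrow> j \<in> I \<Longrightarrow> res F (U i) (U i \<inter> U j) (\<sigma> i) = res F (U j) (U i \<inter> U j) (\<sigma> j)"
 obtains f where "f \<in> sections (\<Union>i\<in>I. U i)" "\<And>i. i \<in> I \<Longrightarrow> res F (\<Union>i\<in>I. U i) (U i) f = \<sigma> i"
proof -
 have "\<exists>f. f \<in> sections (\<Union>i\<in>I. U i) \<and> (\<forall>i\<in>I. res F (\<Union>i\<in>I. U i) (U i) f = \<sigma> i)"
  by (rule ex1_implies_ex[OF sheaf_glue[OF sheaf_sets assms]])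
 thus thesis by (elim exE conjE) (rule that, auto)
qed

text \<open>The empty family covers the empty set, so the sheaf axiom leaves exactly one section
  over it. This disposes of simplices whose sets have empty intersection.\<close>

lemma sections_empty_unique: "f \<in> sections {} \<Longrightarrow> g \<in> sections {} \<Longrightarrow> f = g"
 by (rule sections_eqI[where I="{}"]) auto

lemma sections_empty_ex: "\<exists>f. f \<in> sections {}"
 using sections_glue[where I="{}"] by auto

lemma cmap_sections_empty:
 assumes "\<And>x. x \<in> topspace Y \<Longrightarrow> f x \<in> sections {}"
 shows "continuous_map Y (sec F {}) f"
proof -
 obtain z where z: "z \<in> sections {}" using sections_empty_ex by blast
 hence "continuous_map Y (sec F {}) (\<lambda>_. z)" by (simp add: continuous_map_const)
 thus ?thesis
  by (rule continuous_map_eq) (use assms z sections_empty_unique in auto)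
qed

lemma disk_set_0: "disk_set 0 = {\<lambda>_. 0}"
 by (auto simp: disk_set_def coords_def)

text \<open>This is the sheaf axiom for maps from a ball, transported to \<open>T\<close>. The axiom
  starts in dimension 1; a cell of dimension 0 is a point and falls under the gluing of single
  sections.\<close>

lemma continuous_glue_cell:
 assumes "cell_pair n T S" and U: "\<And>i. i \<in> I \<Longrightarrow> openin X (U i)"
  and c: "\<And>i. i \<in> I \<Longrightarrow> cmap T (sec F (U i)) (\<sigma> i)"
  and e: "\<And>i j x. \<lbrakk>i \<in> I; j \<in> I; x \<in> T\<rbrakk> \<Longrightarrow>
   res F (U i) (U i \<inter> U j) (\<sigma> i x) = res F (U j) (U i \<inter> U j) (\<sigma> j x)"
 obtains g where "cmap T (sec F (\<Union>i\<in>I. U i)) g"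
  "\<And>i x. i \<in> I \<Longrightarrow> x \<in> T \<Longrightarrow> res F (\<Union>i\<in>I. U i) (U i) (g x) = \<sigma> i x"
proof -
 obtain h k where hk: "homeomorphism (disk_set n) T h k" using assms(1) unfolding cell_pair_def by blast
 have s: "\<sigma> i x \<in> sections (U i)" if "i \<in> I" "x \<in> T" for i x
  using c[OF that(1)] that(2) unfolding continuous_map_def by auto
 show ?thesis
 proof (cases "n = 0")
  case True
  then obtain x0 where x0: "T = {x0}" using hk unfolding homeomorphism_def by (auto simp: disk_set_0)
  hence "x0 \<in> T" by simp
  note x0s = s[OF _ this] and x0e = e[OF _ _ this]
  obtain z where "z \<in> sections (\<Union>i\<in>I. U i)" "\<And>i. i \<in> I \<Longrightarrow> res F (\<Union>i\<in>I. U i) (U i) z = \<sigma> i x0"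
   by (rule sections_glue[of I U "\<lambda>i. \<sigma> i x0"]) (use U x0s x0e in blast)+
  thus ?thesis by (intro that[of "\<lambda>_. z"]) (auto simp: x0 continuous_map_const)
 next
  case False
  hence sh: "sheaf_of_sets X (\<lambda>U. continuous_maps (disk n) (sec F U))
    (\<lambda>U V f. restrict (res F U V \<circ> f) (topspace (disk n)))"
   using sheaf unfolding sheaf_of_spaces_def by auto
  have hD: "continuous_on (disk_set n) h" "h ` disk_set n \<subseteq> T" "continuous_on T k" "k ` T \<subseteq> disk_set n"
   and hkx: "\<And>x. x \<in> T \<Longrightarrow> h (k x) = x"
   using hk unfolding homeomorphism_def by auto
  have td: "topspace (disk n) = disk_set n" by (simp add: disk_eq)
  have "\<exists>f. f \<in> continuous_maps (disk n) (sec F (\<Union>i\<in>I. U i)) \<and>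
    (\<forall>i\<in>I. restrict (res F (\<Union>i\<in>I. U i) (U i) \<circ> f) (topspace (disk n)) = restrict (\<sigma> i \<circ> h) (disk_set n))"
  proof (rule ex1_implies_ex, rule sheaf_glue[OF sh U])
   fix i j assume ij: "i \<in> I" "j \<in> I"
   have "continuous_map (disk n) (sec F (U i)) (\<lambda>x. \<sigma> i (h x))"
    unfolding disk_eq by (rule cmap_compose[OF c[OF ij(1)] hD(1,2)])
   hence "continuous_map (disk n) (sec F (U i)) (restrict (\<sigma> i \<circ> h) (disk_set n))"
    by (rule continuous_map_eq) (simp add: td)
   thus "restrict (\<sigma> i \<circ> h) (disk_set n) \<in> continuous_maps (disk n) (sec F (U i))"
    by (simp add: continuous_maps_def td)
   show "restrict (res F (U i) (U i \<inter> U j) \<circ> restrict (\<sigma> i \<circ> h) (disk_set n)) (topspace (disk n)) =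
     restrict (res F (U j) (U i \<inter> U j) \<circ> restrict (\<sigma> j \<circ> h) (disk_set n)) (topspace (disk n))"
    unfolding td by (rule restrict_ext) (use e[OF ij] hD(2) in auto)
  qed
  then obtain f where f: "f \<in> continuous_maps (disk n) (sec F (\<Union>i\<in>I. U i))"
   and fi: "\<And>i. i \<in> I \<Longrightarrow> restrict (res F (\<Union>i\<in>I. U i) (U i) \<circ> f) (disk_set n) = restrict (\<sigma> i \<circ> h) (disk_set n)"
   unfolding td by blast
  show ?thesis
  proof (rule that[of "\<lambda>x. f (k x)"])
   show "cmap T (sec F (\<Union>i\<in>I. U i)) (\<lambda>x. f (k x))"
    using f unfolding continuous_maps_def disk_eq
    by (intro cmap_compose[OF _ hD(3,4)]) auto
   fix i x assume ix: "i \<in> I" "x \<in> T"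
   have "k x \<in> disk_set n" using ix hD by auto
   thus "res F (\<Union>i\<in>I. U i) (U i) (f (k x)) = \<sigma> i x"
    using fun_cong[OF fi[OF ix(1)], of "k x"] hkx[OF ix(2)] by simp
  qed
 qed
qed

end

section \<open>Complexes\<close>

lemma supp_simp:
 assumes "l \<in> simp J"
 shows "supp l \<subseteq> J" "supp l \<noteq> {}"
proof -
 show "supp l \<subseteq> J" using assms by (simp add: simp_def)
 show "supp l \<noteq> {}"
 proof
  assume "supp l = {}"
  hence "\<And>j. l j = 0" by (auto simp: supp_def)
  hence "sum l J = 0" by simp
  thus False using assms by (simp add: simp_def)
 qed
qed

lemma simp_mono: "finite J' \<Longrightarrow> J \<subseteq> J' \<Longrightarrow> simp J \<subseteq> simp J'"
proof
 fix l assume a: "finite J'" "J \<subseteq> J'" "l \<in> simp J"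
 have "sum l J' = sum l J"
  using a by (intro sum.mono_neutral_right) (auto simp: simp_def supp_def)
 thus "l \<in> simp J'" using a by (auto simp: simp_def)
qed

lemma simp_supp: "finite J \<Longrightarrow> l \<in> simp J \<Longrightarrow> l \<in> simp (supp l)"
proof -
 assume a: "finite J" "l \<in> simp J"
 have "sum l (supp l) = sum l J"
  using a by (intro sum.mono_neutral_left) (auto simp: simp_def supp_def)
 thus "l \<in> simp (supp l)" using a by (auto simp: simp_def)
qed

text \<open>Barycentric coordinates of the vertex \<open>j\<close>.\<close>

definition dl :: "'i \<Rightarrow> 'i \<Rightarrow> real" where
 "dl j = (\<lambda>i. if i = j then 1 else 0)"

lemma supp_dl [simp]: "supp (dl j) = {j}"
 by (auto simp: supp_def dl_def)

lemma dl_in_simp: "finite J \<Longrightarrow> j \<in> J \<Longrightarrow> dl j \<in> simp J"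
 by (auto simp: simp_def supp_def dl_def)

text \<open>Every nonempty finite set of indices counts as a simplex, also when the corresponding
  sets have empty intersection; there the unique section over the empty set is the only possible
  value.\<close>

definition fins :: "'i set \<Rightarrow> 'i set set" where
 "fins I = {J. finite J \<and> J \<noteq> {} \<and> J \<subseteq> I}"

abbreviation nfins :: "nat set set" where
 "nfins \<equiv> fins UNIV"

lemma fins_supp: "J \<in> fins I \<Longrightarrow> l \<in> simp J \<Longrightarrow> supp l \<in> fins I"
 using supp_simp[of l J] finite_subset[of "supp l" J] by (auto simp: fins_def)

lemma fins_supp_simp: "J \<in> fins I \<Longrightarrow> l \<in> simp J \<Longrightarrow> l \<in> simp (supp l)"
 using simp_supp by (auto simp: fins_def)

lemma fins_singleton: "j \<in> I \<Longrightarrow> {j} \<in> fins I"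
 by (auto simp: fins_def)

lemma fins_mono: "I \<subseteq> I' \<Longrightarrow> J \<in> fins I \<Longrightarrow> J \<in> fins I'"
 by (auto simp: fins_def)

definition UU :: "('i \<Rightarrow> 'a set) \<Rightarrow> 'i set \<Rightarrow> 'a set" where
 "UU U J = (\<Inter>j\<in>J. U j)"

lemma UU_singleton [simp]: "UU U {j} = U j"
 by (simp add: UU_def)

lemma UU_antimono: "J \<subseteq> J' \<Longrightarrow> UU U J' \<subseteq> UU U J"
 by (auto simp: UU_def)

lemma UU_mono: "(\<And>j. j \<in> J \<Longrightarrow> U' j \<subseteq> U j) \<Longrightarrow> UU U' J \<subseteq> UU U J"
 by (fastforce simp: UU_def)

lemma UU_le: "j \<in> J \<Longrightarrow> UU U J \<subseteq> U j"
 by (auto simp: UU_def)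

abbreviation US :: "('i \<Rightarrow> 'a set) \<Rightarrow> ('i \<Rightarrow> real) \<Rightarrow> 'a set" where
 "US U l \<equiv> UU U (supp l)"

lemma openin_UU: "(\<And>j. j \<in> I \<Longrightarrow> openin X (U j)) \<Longrightarrow> J \<in> fins I \<Longrightarrow> openin X (UU U J)"
 unfolding UU_def fins_def by (auto intro!: openin_INT2)

lemma compact_cube: "compact (cube n)"
proof -
 have "cube n = PiE UNIV (\<lambda>i. if i < n then {0..1} else {0})"
 proof (intro set_eqI iffI)
  fix x assume "x \<in> cube n"
  thus "x \<in> PiE UNIV (\<lambda>i. if i < n then {0..1} else {0})" by (auto simp: cube_def)
 next
  fix x :: "nat \<Rightarrow> real" assume "x \<in> PiE UNIV (\<lambda>i. if i < n then {0..1} else {0})"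
  hence x: "x i \<in> (if i < n then {0..1} else {0})" for i by (rule PiE_mem) simp
  have "0 \<le> x i \<and> x i \<le> 1" if "i < n" for i using x[of i] that by simp
  moreover have "x i = 0" if "n \<le> i" for i using x[of i] that by simp
  ultimately show "x \<in> cube n" unfolding cube_def by blast
 qed
 moreover have "compactin (product_topology (\<lambda>i. euclideanreal) UNIV) (PiE UNIV (\<lambda>i. if i < n then {0..1} else {0}))"
  by (simp add: compactin_PiE)
 ultimately show ?thesis by (simp only: euclidean_product_topology compactin_euclidean_iff)
qed

lemma cell_pair_compact:
 assumes "cell_pair n T S" shows "compact T"
proof -
 obtain f g where "homeomorphism (disk_set n) T f g" using assms unfolding cell_pair_def by blast
 moreover obtain f' g' where "homeomorphism (disk_set n) (cube n) f' g'"
  using cell_pair_cube unfolding cell_pair_def by blast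
 ultimately have "homeomorphism (cube n) T (f \<circ> g') (f' \<circ> g)"
  using homeomorphism_compose homeomorphism_symD by blast
 thus ?thesis
  using compact_continuous_image[OF _ compact_cube] unfolding homeomorphism_def by metis
qed

lemma compact_simp: "finite J \<Longrightarrow> compact (simp J)"
proof (cases "J = {}")
 case True
 thus ?thesis by (simp add: simp_def)
next
 case False
 moreover assume "finite J"
 ultimately show ?thesis using cell_pair_compact[OF cell_pair_simp] by blast
qed

context space_sheaf
begin

text \<open>The value at \<open>l\<close> lives over the intersection for the support of
  \<open>l\<close>, which is larger than the one for the whole simplex. Values at different points
  of a simplex thus lie in different spaces, and continuity is required of their restrictions to
  \<open>UU U J\<close>. The parameter space \<open>T\<close> is carried along because all
  statements concern families.\<close>

definition cpx :: "'i set \<Rightarrow> ('i \<Rightarrow> 'a set) \<Rightarrow> 'p::topological_space set \<Rightarrow> (('i \<Rightarrow> real) \<Rightarrow> 'p \<Rightarrow> 'b) \<Rightarrow> bool" where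
 "cpx I U T f \<longleftrightarrow> (\<forall>i\<in>I. openin X (U i)) \<and>
  (\<forall>J\<in>fins I. \<forall>l\<in>simp J. \<forall>x\<in>T. f l x \<in> sections (US U l)) \<and>
  (\<forall>J\<in>fins I. cmap (simp J \<times> T) (sec F (UU U J))
    (\<lambda>(l, x). res F (US U l) (UU U J) (f l x)))"

text \<open>The homotopies on all overlaps are constant: the vertex sections agree where they meet,
  and the complex comes from a section over the union of the sets. Gluing a complex means deforming
  it to this form.\<close>

definition cst :: "'i set \<Rightarrow> ('i \<Rightarrow> 'a set) \<Rightarrow> (('i \<Rightarrow> real) \<Rightarrow> 'p \<Rightarrow> 'b) \<Rightarrow> 'p \<Rightarrow> bool" where
 "cst I U f x \<longleftrightarrow> (\<forall>J\<in>fins I. \<forall>l\<in>simp J. \<forall>j\<in>supp l. f l x = res F (U j) (US U l) (f (dl j) x))"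

lemma cpx_open: "cpx I U T f \<Longrightarrow> i \<in> I \<Longrightarrow> openin X (U i)"
 by (simp add: cpx_def)

lemma cpx_openUU: "cpx I U T f \<Longrightarrow> J \<in> fins I \<Longrightarrow> openin X (UU U J)"
 by (rule openin_UU) (auto simp: cpx_def)

lemma cpx_continuous:
 "cpx I U T f \<Longrightarrow> J \<in> fins I \<Longrightarrow> cmap (simp J \<times> T) (sec F (UU U J))
    (\<lambda>(l, x). res F (US U l) (UU U J) (f l x))"
 by (simp add: cpx_def)

end

context space_sheaf
begin

lemma cpx_in: "\<lbrakk>cpx I U T f; J \<in> fins I; l \<in> simp J; x \<in> T\<rbrakk> \<Longrightarrow> f l x \<in> sections (US U l)"
 unfolding cpx_def by blast

lemma cpx_comp:
 assumes f: "cpx I U T f" and J: "J \<in> fins I"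
  and s: "continuous_on R s" "s ` R \<subseteq> simp J" and g: "continuous_on R g" "g ` R \<subseteq> T"
  and V: "openin X V" "V \<subseteq> UU U J"
 shows "cmap R (sec F V) (\<lambda>r. res F (UU U (supp (s r))) V (f (s r) (g r)))"
proof -
 have "cmap R (sec F (UU U J))
   (\<lambda>r. (\<lambda>(l, x). res F (US U l) (UU U J) (f l x)) (s r, g r))"
  by (rule cmap_compose[OF cpx_continuous[OF f J]])
   (use s g in \<open>auto intro: continuous_on_Pair\<close>)
 hence "cmap R (sec F V)
   (\<lambda>r. res F (UU U J) V (res F (UU U (supp (s r))) (UU U J) (f (s r) (g r))))"
  using cmap_res[OF _ cpx_openUU[OF f J] V] by simp
 thus ?thesis
 proof (rule continuous_map_eq)
  fix r assume "r \<in> topspace (top_of_set R)"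
  hence r: "s r \<in> simp J" "g r \<in> T" using s g by auto
  show "res F (UU U J) V (res F (UU U (supp (s r))) (UU U J) (f (s r) (g r))) =
    res F (UU U (supp (s r))) V (f (s r) (g r))"
   using cpx_openUU[OF f] J fins_supp[OF J r(1)] V cpx_in[OF f J r] supp_simp(1)[OF r(1)]
   by (intro res_res UU_antimono) auto
 qed
qed

text \<open>Common source of all changes of sets, indices and parameters. That the values are
  defined over \<open>US U' l\<close> follows by applying the hypotheses on \<open>p\<close> to the
  face \<open>supp l\<close> instead of \<open>J\<close>.\<close>

lemma cpx_subst:
 assumes f: "cpx I U T f" and U': "\<And>i. i \<in> I' \<Longrightarrow> openin X (U' i)"
  and p: "\<And>J. J \<in> fins I' \<Longrightarrow> p J \<in> fins I" "\<And>J. J \<in> fins I' \<Longrightarrow> UU U' J \<subseteq> UU U (p J)"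
  and s: "\<And>J. J \<in> fins I' \<Longrightarrow> continuous_on (simp J \<times> T') (\<lambda>z. s (fst z) (snd z))"
   "\<And>J l x. \<lbrakk>J \<in> fins I'; l \<in> simp J; x \<in> T'\<rbrakk> \<Longrightarrow> s l x \<in> simp (p J)"
  and g: "\<And>J. J \<in> fins I' \<Longrightarrow> continuous_on (simp J \<times> T') (\<lambda>z. g (fst z) (snd z))"
   "\<And>J l x. \<lbrakk>J \<in> fins I'; l \<in> simp J; x \<in> T'\<rbrakk> \<Longrightarrow> g l x \<in> T"
 shows "cpx I' U' T' (\<lambda>l x. res F (UU U (supp (s l x))) (US U' l) (f (s l x) (g l x)))"
  (is "cpx I' U' T' ?h")
proof -
 have oU': "openin X (UU U' J)" if "J \<in> fins I'" for J by (rule openin_UU[OF U' that])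
 have *: "supp (s l x) \<in> fins I" "US U' l \<subseteq> UU U (supp (s l x))"
  "f (s l x) (g l x) \<in> sections (UU U (supp (s l x)))"
  if J: "J \<in> fins I'" and l: "l \<in> simp J" and x: "x \<in> T'" for J l x
 proof -
  have K: "supp l \<in> fins I'" "l \<in> simp (supp l)" using fins_supp[OF J l] fins_supp_simp[OF J l] by auto
  have sp: "s l x \<in> simp (p (supp l))" by (rule s(2)[OF K x])
  show "supp (s l x) \<in> fins I" by (rule fins_supp[OF p(1)[OF K(1)] sp])
  show "US U' l \<subseteq> UU U (supp (s l x))"
   using p(2)[OF K(1)] UU_antimono[OF supp_simp(1)[OF sp], of U] by blast
  show "f (s l x) (g l x) \<in> sections (UU U (supp (s l x)))"
   by (rule cpx_in[OF f p(1)[OF K(1)] sp g(2)[OF K x]])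
 qed
 show ?thesis
  unfolding cpx_def
 proof (intro conjI ballI)
  fix J l x assume J: "J \<in> fins I'" and l: "l \<in> simp J" and x: "x \<in> T'"
  show "?h l x \<in> sections (US U' l)"
   using *[OF J l x] cpx_openUU[OF f] oU'[OF fins_supp[OF J l]] by (intro res_in) auto
 next
  fix J assume J: "J \<in> fins I'"
  have "cmap (simp J \<times> T') (sec F (UU U' J))
    (\<lambda>z. res F (UU U (supp (s (fst z) (snd z)))) (UU U' J) (f (s (fst z) (snd z)) (g (fst z) (snd z))))"
   by (rule cpx_comp[OF f p(1)[OF J] s(1)[OF J] _ g(1)[OF J] _ oU'[OF J] p(2)[OF J]])
    (use s(2)[OF J] g(2)[OF J] in auto)
  thus "cmap (simp J \<times> T') (sec F (UU U' J))
    (\<lambda>(l, x). res F (US U' l) (UU U' J) (?h l x))"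
  proof (rule continuous_map_eq)
   fix z assume "z \<in> topspace (top_of_set (simp J \<times> T'))"
   then obtain l x where z: "z = (l, x)" "l \<in> simp J" "x \<in> T'" by auto
   show "res F (UU U (supp (s (fst z) (snd z)))) (UU U' J) (f (s (fst z) (snd z)) (g (fst z) (snd z))) =
     (\<lambda>(l, x). res F (US U' l) (UU U' J) (?h l x)) z"
    unfolding z(1) fst_conv snd_conv prod.case
    by (rule res_res[symmetric])
     (use *[OF J z(2,3)] cpx_openUU[OF f] oU' J fins_supp[OF J z(2)] UU_antimono[OF supp_simp(1)[OF z(2)], of U'] in auto)
  qed
 qed (rule U')
qed

lemma cpx_cong:
 assumes "cpx I U T f" "\<And>J l x. \<lbrakk>J \<in> fins I; l \<in> simp J; x \<in> T\<rbrakk> \<Longrightarrow> f l x = g l x"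
 shows "cpx I U T g"
 unfolding cpx_def
proof (intro conjI ballI)
 fix J assume J: "J \<in> fins I"
 show "cmap (simp J \<times> T) (sec F (UU U J))
   (\<lambda>(l, x). res F (US U l) (UU U J) (g l x))"
  by (rule continuous_map_eq[OF cpx_continuous[OF assms(1) J]]) (use assms(2)[OF J] in auto)
 fix l x assume l: "l \<in> simp J" "x \<in> T"
 thus "g l x \<in> sections (US U l)"
  using cpx_in[OF assms(1) J l] assms(2)[OF J l] by simp
qed (use assms(1) in \<open>simp add: cpx_def\<close>)

lemma cpx_restrict:
 assumes f: "cpx I U T f" and "I' \<subseteq> I" "\<And>i. i \<in> I' \<Longrightarrow> openin X (U' i)" "\<And>i. i \<in> I' \<Longrightarrow> U' i \<subseteq> U i"
 shows "cpx I' U' T (\<lambda>l x. res F (US U l) (US U' l) (f l x))"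
 by (rule cpx_subst[OF f, where p="\<lambda>J. J" and s="\<lambda>l x. l" and g="\<lambda>l x. x"])
  (use assms in \<open>auto intro!: continuous_intros UU_mono intro: fins_mono simp: fins_def\<close>)

lemma cpx_param:
 assumes f: "cpx I U T f" and "I' \<subseteq> I" "continuous_on T' g" "g ` T' \<subseteq> T"
 shows "cpx I' U T' (\<lambda>l x. f l (g x))"
proof -
 have "cpx I' U T' (\<lambda>l x. res F (US U l) (US U l) (f l (g x)))"
  by (rule cpx_subst[OF f, where p="\<lambda>J. J" and s="\<lambda>l x. l" and g="\<lambda>l x. g x"])
   (use assms in \<open>auto intro!: continuous_intros intro: fins_mono simp: cpx_def
    continuous_on_compose2[OF assms(3) continuous_on_snd]\<close>)
 thus ?thesis
 proof (rule cpx_cong)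
  fix J l x assume a: "J \<in> fins I'" "l \<in> simp J" "x \<in> T'"
  hence J: "J \<in> fins I" using assms(2) fins_mono by blast
  show "res F (US U l) (US U l) (f l (g x)) = f l (g x)"
   by (rule res_id[OF cpx_openUU[OF f fins_supp[OF J a(2)]] cpx_in[OF f J a(2)]]) (use a assms in auto)
 qed
qed

lemma cpx_paste_le:
 assumes ab: "continuous_on T (a :: _ \<Rightarrow> real)" "continuous_on T b"
  and "cpx I U {x \<in> T. a x \<le> b x} f" "cpx I U {x \<in> T. b x \<le> a x} f"
 shows "cpx I U T f"
 unfolding cpx_def
proof (intro conjI ballI)
 fix J assume J: "J \<in> fins I"
 have e: "{z \<in> simp J \<times> T. a (snd z) \<le> b (snd z)} = simp J \<times> {x \<in> T. a x \<le> b x}"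
  "{z \<in> simp J \<times> T. b (snd z) \<le> a (snd z)} = simp J \<times> {x \<in> T. b x \<le> a x}" by auto
 show "cmap (simp J \<times> T) (sec F (UU U J))
   (\<lambda>(l, x). res F (US U l) (UU U J) (f l x))"
 proof (rule cmap_paste_le[where a="\<lambda>z. a (snd z)" and b="\<lambda>z. b (snd z)"])
  show "continuous_on (simp J \<times> T) (\<lambda>z. a (snd z))" "continuous_on (simp J \<times> T) (\<lambda>z. b (snd z))"
   by (auto intro!: continuous_on_compose2[OF ab(1) continuous_on_snd] continuous_on_compose2[OF ab(2) continuous_on_snd])
 qed (unfold e, rule cpx_continuous[OF assms(3) J], rule cpx_continuous[OF assms(4) J])
 fix l x assume l: "l \<in> simp J" "x \<in> T"
 thus "f l x \<in> sections (US U l)"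
  using cpx_in[OF assms(3) J l(1), of x] cpx_in[OF assms(4) J l(1), of x] by fastforce
qed (use assms(3) in \<open>simp add: cpx_def\<close>)

lemma cpx_vertex:
 assumes f: "cpx I U T f" and i: "i \<in> I"
 shows "cmap T (sec F (U i)) (f (dl i))"
proof -
 have oi: "openin X (U i)" using cpx_open[OF f i] .
 have "cmap T (sec F (U i)) (\<lambda>x. res F (UU U (supp (dl i))) (U i) (f (dl i) x))"
  by (rule cpx_comp[OF f fins_singleton[OF i], where g="\<lambda>x. x"])
   (auto simp: oi dl_in_simp)
 thus ?thesis
 proof (rule continuous_map_eq)
  fix x assume "x \<in> topspace (top_of_set T)"
  hence "f (dl i) x \<in> sections (UU U (supp (dl i)))"
   by (intro cpx_in[OF f fins_singleton[OF i]]) (auto simp: dl_in_simp)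
  thus "res F (UU U (supp (dl i))) (U i) (f (dl i) x) = f (dl i) x"
   using res_id[OF oi] by simp
 qed
qed

lemma cpx_vertex_in: "\<lbrakk>cpx I U T f; i \<in> I; x \<in> T\<rbrakk> \<Longrightarrow> f (dl i) x \<in> sections (U i)"
 using cpx_vertex unfolding continuous_map_def by fastforce

lemma simp_singleton: "simp {j} = {dl j}"
proof (intro equalityI subsetI)
 fix l assume l: "l \<in> simp {j}"
 hence "l j = 1" "\<And>i. i \<noteq> j \<Longrightarrow> l i = 0" by (auto simp: simp_def supp_def)
 thus "l \<in> {dl j}" by (auto simp: dl_def fun_eq_iff)
qed (simp add: dl_in_simp)

lemma cst_singleton:
 assumes "cpx I U T f" "I = {j}" "x \<in> T" shows "cst I U f x"
 unfolding cst_def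
proof (intro ballI)
 fix J l i assume a: "J \<in> fins I" "l \<in> simp J" "i \<in> supp l"
 hence "J = {j}" using assms(2) by (auto simp: fins_def)
 hence "l = dl j" using a(2) by (simp add: simp_singleton)
 hence i: "i = j" "l = dl j" using a(3) by auto
 have "f (dl j) x \<in> sections (U j)" "openin X (U j)"
  using cpx_vertex_in[OF assms(1)] cpx_open[OF assms(1)] assms by auto
 thus "f l x = res F (U i) (US U l) (f (dl i) x)"
  using res_id unfolding i by simp
qed

lemma cstD:
 "\<lbrakk>cst I U f x; J \<in> fins I; l \<in> simp J; j \<in> supp l\<rbrakk> \<Longrightarrow> f l x = res F (U j) (US U l) (f (dl j) x)"
 unfolding cst_def by blast

lemma cst_mono: "cst I U f x \<Longrightarrow> I' \<subseteq> I \<Longrightarrow> cst I' U f x"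
 by (subst cst_def) (blast intro: cstD fins_mono)

lemma cst_cong:
 assumes "cst I U f x" "\<And>J l. J \<in> fins I \<Longrightarrow> l \<in> simp J \<Longrightarrow> f l x = g l y"
 shows "cst I U g y"
 unfolding cst_def
proof (intro ballI)
 fix J l j assume a: "J \<in> fins I" "l \<in> simp J" "j \<in> supp l"
 have "{j} \<in> fins I" "dl j \<in> simp {j}" using a supp_simp(1)[OF a(2)] by (auto simp: fins_def dl_in_simp)
 hence "f (dl j) x = g (dl j) y" by (rule assms(2))
 thus "g l y = res F (U j) (US U l) (g (dl j) y)"
  using assms(2)[OF a(1,2)] cstD[OF assms(1) a] by simp
qed

lemma cst_restrict:
 assumes f: "cpx I U T f" "cst I U f x" "x \<in> T" and "I' \<subseteq> I"
  and U': "\<And>i. i \<in> I' \<Longrightarrow> openin X (U' i)" "\<And>i. i \<in> I' \<Longrightarrow> U' i \<subseteq> U i"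
 shows "cst I' U' (\<lambda>l x. res F (US U l) (US U' l) (f l x)) x"
 unfolding cst_def
proof (intro ballI)
 fix J l j assume a: "J \<in> fins I'" "l \<in> simp J" "j \<in> supp l"
 have J: "J \<in> fins I" using a assms(4) fins_mono by blast
 have j: "j \<in> I'" "j \<in> I" using a supp_simp(1)[OF a(2)] assms(4) by (auto simp: fins_def)
 have o: "openin X (US U' l)" "openin X (US U l)" "openin X (U j)" "openin X (U' j)"
  using openin_UU[OF U'(1) fins_supp[OF a(1,2)]] cpx_openUU[OF f(1) fins_supp[OF J a(2)]] cpx_open[OF f(1)] U' j by auto
 have sub: "US U' l \<subseteq> US U l" "US U l \<subseteq> U j" "US U' l \<subseteq> U' j" "U' j \<subseteq> U j"
 proof -
  show "US U' l \<subseteq> US U l"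
   by (rule UU_mono, rule U'(2)) (use a supp_simp(1)[OF a(2)] in \<open>auto simp: fins_def\<close>)
 qed (rule UU_le[OF a(3)] U'(2)[OF j(1)])+
 have fj: "f (dl j) x \<in> sections (U j)" using cpx_vertex_in[OF f(1) j(2) f(3)] .
 have "res F (US U l) (US U' l) (f l x) = res F (U j) (US U' l) (f (dl j) x)"
  unfolding cstD[OF f(2) J a(2,3)] using o sub fj by (intro res_res) auto
 also have "\<dots> = res F (U' j) (US U' l) (res F (U j) (U' j) (f (dl j) x))"
  using o sub fj by (intro res_res[symmetric]) auto
 finally show "res F (US U l) (US U' l) (f l x) =
   res F (U' j) (US U' l) (res F (UU U (supp (dl j))) (UU U' (supp (dl j))) (f (dl j) x))"
  by simp
qed

text \<open>At the midpoint of the edge both \<open>i\<close> and \<open>j\<close> belong to the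
  support, and constancy expresses the value there by either vertex section.\<close>

lemma cst_agree:
 assumes c: "cst I U f x" and a: "i \<in> I" "j \<in> I"
 shows "res F (U i) (U i \<inter> U j) (f (dl i) x) = res F (U j) (U i \<inter> U j) (f (dl j) x)"
proof (cases "i = j")
 case False
 define l where "l = (\<lambda>k. if k = i \<or> k = j then 1 / 2 else (0::real))"
 have s: "supp l = {i, j}" by (auto simp: l_def supp_def)
 have l: "l \<in> simp {i, j}" using False by (simp add: simp_def s) (simp add: l_def)
 have J: "{i, j} \<in> fins I" using a by (simp add: fins_def)
 have "US U l = U i \<inter> U j" unfolding s UU_def by auto
 thus ?thesis using cstD[OF c J l, of i] cstD[OF c J l, of j] s by simp
qed simp

text \<open>The vertex sections agree on overlaps, so the sheaf axiom for families over a cell glues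
  them continuously; every other value of the complex is a restriction of a vertex value.\<close>

lemma cst_glue:
 assumes T: "cell_pair n T S" and f: "cpx I U T f" and c: "\<And>x. x \<in> T \<Longrightarrow> cst I U f x"
 obtains g where "cmap T (sec F (\<Union>i\<in>I. U i)) g"
  "\<And>J l x. \<lbrakk>J \<in> fins I; l \<in> simp J; x \<in> T\<rbrakk> \<Longrightarrow> f l x = res F (\<Union>i\<in>I. U i) (US U l) (g x)"
proof -
 obtain g where g: "cmap T (sec F (\<Union>i\<in>I. U i)) g"
  "\<And>i x. i \<in> I \<Longrightarrow> x \<in> T \<Longrightarrow> res F (\<Union>i\<in>I. U i) (U i) (g x) = f (dl i) x"
  by (rule continuous_glue_cell[OF T, of I U "\<lambda>i. f (dl i)"])
   (use f cpx_vertex cpx_open cst_agree[OF c] in auto)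
 show thesis
 proof (rule that[OF g(1)])
  fix J l x assume a: "J \<in> fins I" "l \<in> simp J" "x \<in> T"
  obtain j where j: "j \<in> supp l" using supp_simp(2)[OF a(2)] by blast
  hence jI: "j \<in> I" using supp_simp(1)[OF a(2)] a(1) by (auto simp: fins_def)
  have "f l x = res F (U j) (US U l) (res F (\<Union>i\<in>I. U i) (U j) (g x))"
   using cstD[OF c[OF a(3)] a(1,2) j] g(2)[OF jI a(3)] by simp
  also have "\<dots> = res F (\<Union>i\<in>I. U i) (US U l) (g x)"
  proof (rule res_res)
   show "openin X (\<Union>i\<in>I. U i)" using cpx_open[OF f] by blast
   show "openin X (U j)" "openin X (US U l)" using cpx_open[OF f jI] cpx_openUU[OF f fins_supp[OF a(1,2)]] by auto
   show "US U l \<subseteq> U j" using UU_le[OF j] .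
   show "U j \<subseteq> (\<Union>i\<in>I. U i)" using jI by blast
   show "g x \<in> sections (\<Union>i\<in>I. U i)" using g(1) a(3) unfolding continuous_map_def by auto
  qed
  finally show "f l x = res F (\<Union>i\<in>I. U i) (US U l) (g x)" .
 qed
qed

lemma cstI:
 assumes W: "openin X W" "s \<in> sections W" and U: "\<And>i. i \<in> I \<Longrightarrow> openin X (U i)" "\<And>i. i \<in> I \<Longrightarrow> U i \<subseteq> W"
  and f: "\<And>J l. J \<in> fins I \<Longrightarrow> l \<in> simp J \<Longrightarrow> f l x = res F W (US U l) s"
 shows "cst I U f x"
 unfolding cst_def
proof (intro ballI)
 fix J l j assume a: "J \<in> fins I" "l \<in> simp J" "j \<in> supp l"
 have j: "j \<in> I" using supp_simp(1)[OF a(2)] a(1,3) by (auto simp: fins_def)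
 have "f (dl j) x = res F W (U j) s" using f[OF fins_singleton[OF j], of "dl j"] by (simp add: dl_in_simp)
 hence "res F (U j) (US U l) (f (dl j) x) = res F W (US U l) s"
 proof -
  have "openin X (US U l)" by (rule openin_UU[OF U(1) fins_supp[OF a(1,2)]])
  thus ?thesis
   using res_res[OF W(1) U(1)[OF j] _ UU_le[OF a(3), of U] U(2)[OF j] W(2)] \<open>f (dl j) x = _\<close> by simp
 qed
 thus "f l x = res F (U j) (US U l) (f (dl j) x)" using f[OF a(1,2)] by simp
qed

subsection \<open>Homotopies of complexes\<close>

text \<open>Flexibility yields homotopies over smaller neighbourhoods only, hence the two families
  \<open>U\<close> and \<open>U'\<close>. In the applications \<open>S\<close> is the boundary of
  the cell \<open>T\<close>, where the homotopy has to rest.\<close>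

definition htpy where
 "htpy I U U' T S f h \<longleftrightarrow> (\<forall>i\<in>I. U' i \<subseteq> U i) \<and> cpx I U' ({0..1::real} \<times> T) h \<and>
  (\<forall>J\<in>fins I. \<forall>l\<in>simp J. \<forall>x\<in>T. h l (0, x) = res F (US U l) (US U' l) (f l x)) \<and>
  (\<forall>J\<in>fins I. \<forall>l\<in>simp J. \<forall>x\<in>S. \<forall>t\<in>{0..1}. h l (t, x) = h l (0, x))"

text \<open>Over the face spanned by \<open>L\<close> the homotopy \<open>H\<close> runs in the second half of the time interval.
 Away from this face the weights outside \<open>L\<close> are scaled down by the factor \<open>max 0 (1 - 2 * t * \<mu>)\<close>,
 where \<open>\<mu>\<close> is the total weight of \<open>L\<close>, and \<open>H\<close> is run for the time \<open>2 * t * \<mu> - 1\<close> once they vanish.\<close>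

lemma htpy_extend:
 assumes f: "cpx I U T f" and L: "L \<subseteq> I" "finite L"
  and H: "cpx L U' ({0..1::real} \<times> T) H"
  and U': "\<And>i. i \<in> L \<Longrightarrow> U' i \<subseteq> U i" "\<And>i. i \<in> I - L \<Longrightarrow> U' i = U i"
  and H0: "\<And>J l x. \<lbrakk>J \<in> fins L; l \<in> simp J; x \<in> T\<rbrakk> \<Longrightarrow>
   H l (0, x) = res F (US U l) (US U' l) (f l x)"
  and S: "S \<subseteq> T" "\<And>x. x \<in> S \<Longrightarrow> cst I U f x"
   "\<And>J l x t. \<lbrakk>J \<in> fins L; l \<in> simp J; x \<in> S; t \<in> {0..1}\<rbrakk> \<Longrightarrow> H l (t, x) = H l (0, x)"
 obtains h where "htpy I U U' T S f h"
  "\<And>J l x t. \<lbrakk>J \<in> fins L; l \<in> simp J; x \<in> T; t \<in> {0..1}\<rbrakk> \<Longrightarrow> h l (t, x) = H l (max 0 (2 * t - 1), x)"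
proof -
 define m where "m = (\<lambda>l::'c\<Rightarrow>real. sum l L)"
 define k where "k = (\<lambda>l t. max 0 (1 - 2 * t * m l))"
 \<comment> \<open>The denominator is the total weight after scaling, so the result lies in the same
   simplex again. It is positive: \<open>k l t = 0\<close> forces \<open>2 * t * m l \<ge> 1\<close>
   and hence \<open>m l > 0\<close>.\<close>
 define st where "st = (\<lambda>l t j. (if j \<in> L then l j else k l t * l j) / (m l + (1 - m l) * k l t))"
 define h where "h = (\<lambda>l (t, x). if 2 * t * m l \<le> 1
  then res F (UU U (supp (st l t))) (US U' l) (f (st l t) x)
  else res F (UU U' (supp (st l t))) (US U' l) (H (st l t) (2 * t * m l - 1, x)))"
 have m01: "0 \<le> m l" "m l \<le> 1" "m l = sum l (J \<inter> L)" "sum l (J - L) = 1 - m l" if "J \<in> fins I" "l \<in> simp J" for J l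
 proof -
  have J: "finite J" using that by (simp add: fins_def)
  show *: "m l = sum l (J \<inter> L)"
   unfolding m_def using that L J by (intro sum.mono_neutral_right) (auto simp: simp_def supp_def)
  have "sum l J = sum l (J \<inter> L) + sum l (J - L)" by (rule sum.Int_Diff[OF J])
  thus 2: "sum l (J - L) = 1 - m l" using that * by (simp add: simp_def)
  show "0 \<le> m l" unfolding m_def using that by (intro sum_nonneg) (simp add: simp_def)
  have "0 \<le> sum l (J - L)" using that by (intro sum_nonneg) (simp add: simp_def)
  thus "m l \<le> 1" using 2 by simp
 qed
 have pos: "0 < m l + (1 - m l) * k l t" if "J \<in> fins I" "l \<in> simp J" "t \<in> {0..1}" for J l t
 proof (cases "k l t = 0")
  case True
  hence "1 \<le> 2 * t * m l" by (simp add: k_def max_def split: if_splits)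
  hence "m l \<noteq> 0" by auto
  thus ?thesis using m01(1)[OF that(1,2)] True by simp
 next
  case False
  hence "0 < k l t" by (simp add: k_def max_def split: if_splits)
  thus ?thesis using m01(1,2)[OF that(1,2)] by (cases "m l = 0") (auto intro!: add_pos_nonneg)
 qed
 have ksum: "(\<Sum>j\<in>J. if j \<in> L then l j else k l t * l j) = m l + (1 - m l) * k l t"
  if "J \<in> fins I" "l \<in> simp J" for J l t
 proof -
  have J: "finite J" using that by (simp add: fins_def)
  have "(\<Sum>j\<in>J. if j \<in> L then l j else k l t * l j) = sum l (J \<inter> L) + (\<Sum>j\<in>J - L. k l t * l j)"
   unfolding sum.Int_Diff[OF J, of _ L] by (intro arg_cong2[where f="(+)"] sum.cong) auto
  also have "(\<Sum>j\<in>J - L. k l t * l j) = k l t * (1 - m l)"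
   using m01(4)[OF that] by (simp flip: sum_distrib_left)
  finally show ?thesis using m01(3)[OF that] by (simp add: mult.commute)
 qed
 have stS: "st l t \<in> simp J" if "J \<in> fins I" "l \<in> simp J" "t \<in> {0..1}" for J l t
 proof -
  have "sum (st l t) J = 1"
   unfolding st_def sum_divide_distrib[symmetric] ksum[OF that(1,2)] using pos[OF that] by simp
  moreover have "0 \<le> st l t j" for j
   using pos[OF that] that(2) by (auto simp: st_def simp_def k_def)
  moreover have "supp (st l t) \<subseteq> J" using that(2) by (auto simp: st_def simp_def supp_def split: if_splits)
  ultimately show ?thesis by (simp add: simp_def)
 qed
 have stL: "J \<inter> L \<in> fins L" "st l t \<in> simp (J \<inter> L)"
  if a: "J \<in> fins I" "l \<in> simp J" "t \<in> {0..1}" "1 \<le> 2 * t * m l" for J l t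
 proof -
  have k0: "k l t = 0" using a(4) by (simp add: k_def)
  have s: "supp (st l t) \<subseteq> J \<inter> L"
   using supp_simp(1)[OF stS[OF a(1-3)]] k0 by (auto simp: st_def supp_def split: if_splits)
  thus "J \<inter> L \<in> fins L" using supp_simp(2)[OF stS[OF a(1-3)]] a(1) by (auto simp: fins_def)
  have "st l t \<in> simp (supp (st l t))" by (rule fins_supp_simp[OF a(1) stS[OF a(1-3)]])
  thus "st l t \<in> simp (J \<inter> L)" using simp_mono[OF _ s] a(1) by (auto simp: fins_def)
 qed
 have st1: "st l t = l" if "J \<in> fins L" "l \<in> simp J" for J l t
 proof -
  have JI: "J \<in> fins I" using that(1) fins_mono[OF L(1)] by blast
  have "J - L = {}" using that(1) by (auto simp: fins_def)
  hence "m l = 1" using m01(4)[OF JI that(2)] by (simp only: sum.empty)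
  moreover have "l j = 0" if "j \<notin> L" for j using that \<open>l \<in> simp J\<close> \<open>J \<in> fins L\<close> by (auto simp: fins_def simp_def supp_def)
  ultimately show ?thesis by (auto simp: st_def fun_eq_iff)
 qed
 have mL: "m l = 1" if "J \<in> fins L" "l \<in> simp J" for J l
 proof -
  have JI: "J \<in> fins I" using that(1) fins_mono[OF L(1)] by blast
  have "J - L = {}" using that(1) by (auto simp: fins_def)
  thus ?thesis using m01(4)[OF JI that(2)] by (simp only: sum.empty)
 qed
 have st0: "st l 0 = l" for l by (auto simp: st_def fun_eq_iff k_def)
 have U'o: "openin X (U' i)" "U' i \<subseteq> U i" if "i \<in> I" for i
  using that U' cpx_open[OF H] cpx_open[OF f that] by (cases "i \<in> L"; auto)+
 have oU': "openin X (UU U' J)" if "J \<in> fins I" for J by (rule openin_UU[OF U'o(1) that])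
 have UU'U: "UU U' J \<subseteq> UU U J" if "J \<in> fins I" for J
  using that U'o by (intro UU_mono) (auto simp: fins_def)
 have k0: "k l t = 0" if "2 * t * m l = 1" for l t using that by (simp add: k_def)
 \<comment> \<open>Once the moving point has reached the face spanned by \<open>L\<close>, the start
   of \<open>H\<close> is \<open>f\<close> there. At \<open>2 * t * m l = 1\<close> this matches the
   two formulas for \<open>h\<close>; beyond it, it serves the constancy over
   \<open>S\<close>.\<close>
 have agree: "res F (UU U (supp (st l t))) (US U' l) (f (st l t) x) =
   res F (UU U' (supp (st l t))) (US U' l) (H (st l t) (0, x))"
  if a: "J \<in> fins I" "l \<in> simp J" "t \<in> {0..1}" "1 \<le> 2 * t * m l" "x \<in> T" for J l t x
 proof -
  note s = stL[OF a(1-4)]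
  have fs: "supp (st l t) \<in> fins I" by (rule fins_supp[OF a(1) stS[OF a(1-3)]])
  have ss: "supp (st l t) \<subseteq> supp l" by (auto simp: st_def supp_def split: if_splits)
  show ?thesis
   unfolding H0[OF s a(5)]
   by (rule res_res[symmetric])
    (use cpx_openUU[OF f fs] oU'[OF fs] oU'[OF fins_supp[OF a(1,2)]] UU'U[OF fs] UU_antimono[OF ss, of U']
     cpx_in[OF f a(1) stS[OF a(1-3)] a(5)] in auto)
 qed
 have "cpx I U' ({0..1} \<times> T) h"
  unfolding cpx_def
 proof (intro conjI ballI)
  fix J l z assume J: "J \<in> fins I" and l: "l \<in> simp J" and z: "z \<in> {0..1::real} \<times> T"
  obtain t x where tx: "z = (t, x)" "t \<in> {0..1}" "x \<in> T" using z by auto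
  have fs: "supp (st l t) \<in> fins I" by (rule fins_supp[OF J stS[OF J l tx(2)]])
  have ss: "supp (st l t) \<subseteq> supp l" by (auto simp: st_def supp_def split: if_splits)
  show "h l z \<in> sections (US U' l)"
  proof (cases "2 * t * m l \<le> 1")
   case True
   thus ?thesis
    using cpx_openUU[OF f fs] oU'[OF fins_supp[OF J l]] UU'U[OF fs] UU_antimono[OF ss, of U']
     cpx_in[OF f J stS[OF J l tx(2)] tx(3)]
    by (auto simp: h_def tx intro!: res_in)
  next
   case False
   hence ge: "1 \<le> 2 * t * m l" by simp
   have "2 * t * m l \<le> 2 * 1 * 1" using tx m01[OF J l] by (intro mult_mono) auto
   hence H': "H (st l t) (2 * t * m l - 1, x) \<in> sections (UU U' (supp (st l t)))"
    using ge tx by (intro cpx_in[OF H stL[OF J l tx(2) ge]]) auto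
   show ?thesis using False
    oU'[OF fs] oU'[OF fins_supp[OF J l]] UU_antimono[OF ss, of U'] H'
    by (auto simp: h_def tx intro!: res_in)
  qed
 next
  fix J assume J: "J \<in> fins I"
  let ?R = "simp J \<times> ({0..1::real} \<times> T)"
  have cm: "continuous_on R (\<lambda>z. m (fst z))" for R :: "(('c \<Rightarrow> real) \<times> (real \<times> 'd)) set"
   unfolding m_def by (intro continuous_intros)
  have ck: "continuous_on R (\<lambda>z. k (fst z) (fst (snd z)))" for R :: "(('c \<Rightarrow> real) \<times> (real \<times> 'd)) set"
   unfolding k_def by (intro continuous_intros cm)
  have cst: "continuous_on R (\<lambda>z. st (fst z) (fst (snd z)))" if "R \<subseteq> ?R" for R
  proof (rule continuous_on_pi)
   fix j
   have "m (fst z) + (1 - m (fst z)) * k (fst z) (fst (snd z)) \<noteq> 0" if "z \<in> R" for z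
    using pos[OF J, of "fst z" "fst (snd z)"] that \<open>R \<subseteq> ?R\<close> by fastforce
   thus "continuous_on R (\<lambda>z. st (fst z) (fst (snd z)) j)"
    unfolding st_def by (cases "j \<in> L"; simp; intro continuous_intros cm ck; simp)
  qed
  show "cmap ?R (sec F (UU U' J)) (\<lambda>(l, x). res F (US U' l) (UU U' J) (h l x))"
  proof (rule cmap_paste_le[where a="\<lambda>z. 2 * fst (snd z) * m (fst z)" and b="\<lambda>_. 1"])
   show "continuous_on ?R (\<lambda>z. 2 * fst (snd z) * m (fst z))" by (intro continuous_intros cm)
   show "continuous_on ?R (\<lambda>_. 1::real)" by (intro continuous_intros)
   let ?R1 = "{z \<in> ?R. 2 * fst (snd z) * m (fst z) \<le> 1}"
   let ?R2 = "{z \<in> ?R. 1 \<le> 2 * fst (snd z) * m (fst z)}"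
   have "cmap ?R1 (sec F (UU U' J))
     (\<lambda>z. res F (UU U (supp (st (fst z) (fst (snd z))))) (UU U' J) (f (st (fst z) (fst (snd z))) (snd (snd z))))"
    by (rule cpx_comp[OF f J cst _ _ _ oU'[OF J] UU'U[OF J]])
     (auto simp: stS[OF J] intro!: continuous_intros)
   thus "cmap ?R1 (sec F (UU U' J)) (\<lambda>(l, x). res F (US U' l) (UU U' J) (h l x))"
   proof (rule continuous_map_eq)
    fix z assume "z \<in> topspace (top_of_set ?R1)"
    then obtain l t x where z: "z = (l, t, x)" "l \<in> simp J" "t \<in> {0..1}" "x \<in> T" "2 * t * m l \<le> 1" by auto
    have fs: "supp (st l t) \<in> fins I" by (rule fins_supp[OF J stS[OF J z(2,3)]])
    have ss: "supp (st l t) \<subseteq> supp l" by (auto simp: st_def supp_def split: if_splits)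
    have sub: "US U' l \<subseteq> UU U (supp (st l t))" "UU U' J \<subseteq> US U' l"
     using UU'U[OF fs] UU_antimono[OF ss, of U'] UU_antimono[OF supp_simp(1)[OF z(2)], of U'] by auto
    show "res F (UU U (supp (st (fst z) (fst (snd z))))) (UU U' J) (f (st (fst z) (fst (snd z))) (snd (snd z)))
      = (\<lambda>(l, x). res F (US U' l) (UU U' J) (h l x)) z"
     using res_res[OF cpx_openUU[OF f fs] oU'[OF fins_supp[OF J z(2)]] oU'[OF J] sub(2,1)
       cpx_in[OF f J stS[OF J z(2,3)] z(4)]] z(5)
     by (simp add: h_def z(1))
   qed
   show "cmap ?R2 (sec F (UU U' J)) (\<lambda>(l, x). res F (US U' l) (UU U' J) (h l x))"
   proof (cases "J \<inter> L = {}")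
    case True
    hence "?R2 = {}" using m01(3)[OF J] by auto
    thus ?thesis by (simp only:) (simp add: continuous_map_on_empty)
   next
    case False
    hence JL: "J \<inter> L \<in> fins L" using J by (auto simp: fins_def)
    have "cmap ?R2 (sec F (UU U' J))
      (\<lambda>z. res F (UU U' (supp (st (fst z) (fst (snd z))))) (UU U' J)
       (H (st (fst z) (fst (snd z))) (2 * fst (snd z) * m (fst z) - 1, snd (snd z))))"
    proof (rule cpx_comp[OF H JL cst _ _ _ oU'[OF J]])
     show "(\<lambda>z. (2 * fst (snd z) * m (fst z) - 1, snd (snd z))) ` ?R2 \<subseteq> {0..1} \<times> T"
     proof (rule image_subsetI)
      fix z assume "z \<in> ?R2"
      then obtain l t x where z: "z = (l, t, x)" "l \<in> simp J" "t \<in> {0..1}" "x \<in> T" "1 \<le> 2 * t * m l" by auto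
      hence "2 * t * m l \<le> 2 * 1 * 1" using m01[OF J] by (intro mult_mono) auto
      thus "(2 * fst (snd z) * m (fst z) - 1, snd (snd z)) \<in> {0..1} \<times> T" using z by simp
     qed
    qed (auto intro!: continuous_intros cm stL(2)[OF J] UU_antimono)
    thus ?thesis
    proof (rule continuous_map_eq)
     fix z assume "z \<in> topspace (top_of_set ?R2)"
     then obtain l t x where z: "z = (l, t, x)" "l \<in> simp J" "t \<in> {0..1}" "x \<in> T" "1 \<le> 2 * t * m l" by auto
     have fs: "supp (st l t) \<in> fins I" by (rule fins_supp[OF J stS[OF J z(2,3)]])
     have ss: "supp (st l t) \<subseteq> supp l" by (auto simp: st_def supp_def split: if_splits)
     have sub: "US U' l \<subseteq> UU U' (supp (st l t))" "UU U' J \<subseteq> US U' l"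
      using UU_antimono[OF ss, of U'] UU_antimono[OF supp_simp(1)[OF z(2)], of U'] by auto
     have "2 * t * m l \<le> 2 * 1 * 1" using m01[OF J z(2)] z(3) by (intro mult_mono) auto
     hence H': "H (st l t) (2 * t * m l - 1, x) \<in> sections (UU U' (supp (st l t)))"
      using z by (intro cpx_in[OF H stL[OF J z(2,3,5)]]) auto
     have "h l (t, x) = res F (UU U' (supp (st l t))) (US U' l) (H (st l t) (2 * t * m l - 1, x))"
     proof (cases "2 * t * m l = 1")
      case True
      thus ?thesis using agree[OF J z(2,3,5,4)] by (simp add: h_def)
     next
      case False
      thus ?thesis using z(5) by (simp add: h_def)
     qed
     thus "res F (UU U' (supp (st (fst z) (fst (snd z))))) (UU U' J)
       (H (st (fst z) (fst (snd z))) (2 * fst (snd z) * m (fst z) - 1, snd (snd z)))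
       = (\<lambda>(l, x). res F (US U' l) (UU U' J) (h l x)) z"
      using res_res[OF oU'[OF fs] oU'[OF fins_supp[OF J z(2)]] oU'[OF J] sub(2,1) H'] by (simp add: z(1))
    qed
   qed
  qed
 qed (rule U'o(1))
 moreover have h0: "h l (0, x) = res F (US U l) (US U' l) (f l x)" for l x
  by (simp add: h_def st0)
 \<comment> \<open>For \<open>x\<close> in \<open>S\<close> the complex is constant, so moving the
   point within its simplex changes the section only by restriction, and all values agree over
   \<open>US U' l\<close>.\<close>
 moreover have "h l (t, x) = h l (0, x)" if a: "J \<in> fins I" "l \<in> simp J" "x \<in> S" "t \<in> {0..1}" for J l x t
 proof -
  have x: "x \<in> T" using S(1) a(3) by blast
  have fs: "supp (st l t) \<in> fins I" by (rule fins_supp[OF a(1) stS[OF a(1,2,4)]])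
  have ss: "supp (st l t) \<subseteq> supp l" by (auto simp: st_def supp_def split: if_splits)
  obtain j where j: "j \<in> supp (st l t)" using supp_simp(2)[OF stS[OF a(1,2,4)]] by blast
  hence jI: "j \<in> I" "j \<in> supp l" using fs ss by (auto simp: fins_def)
  have fl: "supp l \<in> fins I" by (rule fins_supp[OF a(1,2)])
  have "res F (UU U (supp (st l t))) (US U' l) (f (st l t) x) = res F (U j) (US U' l) (f (dl j) x)"
   unfolding cstD[OF S(2)[OF a(3)] a(1) stS[OF a(1,2,4)] j]
   by (rule res_res) (use cpx_open[OF f jI(1)] cpx_openUU[OF f fs] oU'[OF fl] UU'U[OF fs] UU_antimono[OF ss, of U']
    UU_le[OF j, of U] cpx_vertex_in[OF f jI(1) x] in auto)
  moreover have "res F (US U l) (US U' l) (f l x) = res F (U j) (US U' l) (f (dl j) x)"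
   unfolding cstD[OF S(2)[OF a(3)] a(1,2) jI(2)]
   by (rule res_res) (use cpx_open[OF f jI(1)] cpx_openUU[OF f fl] oU'[OF fl] UU'U[OF fl]
    UU_le[OF jI(2), of U] cpx_vertex_in[OF f jI(1) x] in auto)
  ultimately have e: "res F (UU U (supp (st l t))) (US U' l) (f (st l t) x) = h l (0, x)"
   using h0 by simp
  show ?thesis
  proof (cases "2 * t * m l \<le> 1")
   case True
   thus ?thesis using e by (simp add: h_def)
  next
   case False
   hence ge: "1 \<le> 2 * t * m l" by simp
   have "2 * t * m l \<le> 2 * 1 * 1" using m01[OF a(1,2)] a(4) by (intro mult_mono) auto
   hence "H (st l t) (2 * t * m l - 1, x) = H (st l t) (0, x)"
    using ge by (intro S(3)[OF stL[OF a(1,2,4) ge] a(3)]) auto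
   thus ?thesis using False e agree[OF a(1,2,4) ge x] by (simp add: h_def)
  qed
 qed
 ultimately have 1: "htpy I U U' T S f h" unfolding htpy_def using U'o(2) by blast
 show thesis
 proof (rule that[OF 1])
  fix J l x t assume a: "J \<in> fins L" "l \<in> simp J" "x \<in> T" "t \<in> {0..1::real}"
  have JI: "J \<in> fins I" using a(1) fins_mono[OF L(1)] by blast
  show "h l (t, x) = H l (max 0 (2 * t - 1), x)"
  proof (cases "2 * t \<le> 1")
   case True
   thus ?thesis using H0[OF a(1-3)] by (simp add: h_def mL[OF a(1,2)] st1[OF a(1,2)])
  next
   case False
   have "H l (2 * t - 1, x) \<in> sections (US U' l)"
    using False a by (intro cpx_in[OF H a(1,2)]) auto
   thus ?thesis using False res_id[OF oU'[OF fins_supp[OF JI a(2)]]]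
    by (simp add: h_def mL[OF a(1,2)] st1[OF a(1,2)])
  qed
 qed
qed

lemma htpy_trans:
 assumes h1: "htpy I U U' T S f h1" and h2: "htpy I U' U'' T S (\<lambda>l x. h1 l (1, x)) h2"
  and f: "cpx I U T f" and S: "S \<subseteq> T"
 defines "h \<equiv> \<lambda>l (t::real, x). if t \<le> 1 / 2 then res F (US U' l) (US U'' l) (h1 l (2 * t, x))
   else h2 l (2 * t - 1, x)"
 shows "htpy I U U'' T S f h"
proof -
 have c1: "cpx I U' ({0..1} \<times> T) h1" and c2: "cpx I U'' ({0..1} \<times> T) h2"
  and s1: "\<And>i. i \<in> I \<Longrightarrow> U' i \<subseteq> U i" and s2: "\<And>i. i \<in> I \<Longrightarrow> U'' i \<subseteq> U' i"
  and z1: "\<And>J l x. \<lbrakk>J \<in> fins I; l \<in> simp J; x \<in> T\<rbrakk> \<Longrightarrow> h1 l (0, x) = res F (US U l) (US U' l) (f l x)"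
  and z2: "\<And>J l x. \<lbrakk>J \<in> fins I; l \<in> simp J; x \<in> T\<rbrakk> \<Longrightarrow> h2 l (0, x) = res F (US U' l) (US U'' l) (h1 l (1, x))"
  and b1: "\<And>J l x t. \<lbrakk>J \<in> fins I; l \<in> simp J; x \<in> S; t \<in> {0..1}\<rbrakk> \<Longrightarrow> h1 l (t, x) = h1 l (0, x)"
  and b2: "\<And>J l x t. \<lbrakk>J \<in> fins I; l \<in> simp J; x \<in> S; t \<in> {0..1}\<rbrakk> \<Longrightarrow> h2 l (t, x) = h2 l (0, x)"
  using h1 h2 unfolding htpy_def by blast+
 have o: "openin X (UU U J)" "openin X (UU U' J)" "openin X (UU U'' J)" if "J \<in> fins I" for J
  using cpx_openUU[OF f that] cpx_openUU[OF c1 that] cpx_openUU[OF c2 that] by auto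
 have sub: "UU U' J \<subseteq> UU U J" "UU U'' J \<subseteq> UU U' J" if "J \<in> fins I" for J
  using that s1 s2 by (auto intro!: UU_mono simp: fins_def)
 have "cpx I U'' ({0..1} \<times> T) h"
 proof (rule cpx_paste_le[where a="fst" and b="\<lambda>_. 1 / 2"])
  have "cpx I U'' {x \<in> {0..1} \<times> T. fst x \<le> 1 / 2}
    (\<lambda>l z. res F (US U' l) (US U'' l) (h1 l (2 * fst z, snd z)))"
   by (rule cpx_restrict[OF cpx_param[OF c1, where g="\<lambda>z. (2 * fst z, snd z)"]])
    (use cpx_open[OF c2] s2 in \<open>auto intro!: continuous_intros\<close>)
  thus "cpx I U'' {x \<in> {0..1} \<times> T. fst x \<le> 1 / 2} h"
   by (rule cpx_cong) (auto simp: h_def)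
  have "cpx I U'' {x \<in> {0..1} \<times> T. 1 / 2 \<le> fst x} (\<lambda>l z. h2 l (2 * fst z - 1, snd z))"
   by (rule cpx_param[OF c2, where g="\<lambda>z. (2 * fst z - 1, snd z)"])
    (auto intro!: continuous_intros)
  thus "cpx I U'' {x \<in> {0..1} \<times> T. 1 / 2 \<le> fst x} h"
  proof (rule cpx_cong)
   fix J l z assume a: "J \<in> fins I" "l \<in> simp J" "z \<in> {x \<in> {0..1::real} \<times> T. 1 / 2 \<le> fst x}"
   obtain t x where z: "z = (t, x)" "x \<in> T" "1 / 2 \<le> t" using a(3) by auto
   show "h2 l (2 * fst z - 1, snd z) = h l z"
   proof (cases "t = 1 / 2")
    case True
    show ?thesis using z2[OF a(1,2) z(2)] unfolding z h_def True by simp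
   next
    case False
    thus ?thesis using z(3) by (simp add: h_def z)
   qed
  qed
 qed (intro continuous_intros)+
 moreover have "h l (0, x) = res F (US U l) (US U'' l) (f l x)" if a: "J \<in> fins I" "l \<in> simp J" "x \<in> T" for J l x
  using z1[OF a] res_res[OF o(1,2,3) sub(2,1) cpx_in[OF f a]] fins_supp[OF a(1,2)] by (simp add: h_def)
 moreover have "h l (t, x) = h l (0, x)" if a: "J \<in> fins I" "l \<in> simp J" "x \<in> S" "t \<in> {0..1}" for J l x t
 proof (cases "t \<le> 1 / 2")
  case True
  thus ?thesis using b1[OF a(1-3), of "2 * t"] a(4) by (simp add: h_def)
 next
  case False
  have "x \<in> T" using a S by blast
  thus ?thesis using b2[OF a(1-3), of "2 * t - 1"] b1[OF a(1-3), of 1] z2[OF a(1,2)] False a(4) by (simp add: h_def)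
 qed
 ultimately show ?thesis unfolding htpy_def using s1 s2 by blast
qed

end

section \<open>Gluing along flexible strings\<close>

text \<open>The part of \<open>A\<close> outside \<open>W\<close> is compact and misses
  \<open>B\<close>, so it can be separated from \<open>B\<close>. Adding \<open>W\<close> to its
  neighbourhood takes care of the rest of \<open>A\<close>.\<close>

lemma compact_separation_nhds:
 assumes "Hausdorff_space X" "compactin X A" "compactin X B" "openin X W" "A \<inter> B \<subseteq> W"
 obtains U V where "openin X U" "openin X V" "A \<subseteq> U" "B \<subseteq> V" "U \<inter> V \<subseteq> W"
proof -
 have A: "A \<subseteq> topspace X" using assms(2) by (simp add: compactin_def)
 have "closedin X (topspace X - W)" using assms(4) by blast
 hence "compactin X (A \<inter> (topspace X - W))" using compact_Int_closedin assms(2) by blast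
 moreover have "disjnt (A \<inter> (topspace X - W)) B" using assms(5) by (auto simp: disjnt_def)
 ultimately obtain U V where UV: "openin X U" "openin X V" "A \<inter> (topspace X - W) \<subseteq> U" "B \<subseteq> V" "disjnt U V"
  using Hausdorff_space_compact_separation[OF assms(1) _ assms(3)] by metis
 show ?thesis
  by (rule that[of "U \<union> W" V]) (use UV assms(4) A in \<open>auto simp: disjnt_def\<close>)
qed

lemma compact_separation_nhds_family:
 assumes X: "Hausdorff_space X" and A: "\<And>i. i < (n::nat) \<Longrightarrow> compactin X (A i)" and B: "compactin X B"
  and W: "\<And>i. i < n \<Longrightarrow> openin X (W i)" "\<And>i. i < n \<Longrightarrow> A i \<inter> B \<subseteq> W i"
 obtains U V where "\<And>i. i < n \<Longrightarrow> openin X (U i)" "openin X V" "\<And>i. i < n \<Longrightarrow> A i \<subseteq> U i" "B \<subseteq> V"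
  "\<And>i. i < n \<Longrightarrow> U i \<inter> V \<subseteq> W i"
proof -
 have "\<exists>U V. openin X U \<and> openin X V \<and> A i \<subseteq> U \<and> B \<subseteq> V \<and> U \<inter> V \<subseteq> W i" if i: "i < n" for i
  using compact_separation_nhds[OF X A[OF i] B W(1)[OF i] W(2)[OF i]] by metis
 then obtain U V where UV: "\<And>i. i < n \<Longrightarrow> openin X (U i) \<and> openin X (V i) \<and> A i \<subseteq> U i \<and> B \<subseteq> V i \<and> U i \<inter> V i \<subseteq> W i"
  by metis
 show ?thesis
 proof (rule that[of U "topspace X \<inter> (\<Inter>i<n. V i)"])
  show "openin X (topspace X \<inter> (\<Inter>i<n. V i))"
   by (cases "n = 0") (use UV in \<open>auto intro!: openin_Int openin_INT2\<close>)
  show "B \<subseteq> topspace X \<inter> (\<Inter>i<n. V i)" using UV B by (auto simp: compactin_def)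
 qed (use UV in blast)+
qed

lemma cube_upd: "\<lbrakk>x \<in> cube k; 0 \<le> s; s \<le> 1\<rbrakk> \<Longrightarrow> x(k := s) \<in> cube (Suc k)"
 by (auto simp: cube_def less_Suc_eq)

lemma cube_upd_0: "y \<in> cube (Suc k) \<Longrightarrow> y(k := 0) \<in> cube k"
 by (auto simp: cube_def)

lemma cube_last: "y \<in> cube (Suc k) \<Longrightarrow> 0 \<le> y k \<and> y k \<le> 1"
 by (auto simp: cube_def)

lemma cube_upd_id: "x \<in> cube k \<Longrightarrow> x(k := 0) = x"
 by (auto simp: cube_def fun_eq_iff)

lemma cube_at: "x \<in> cube k \<Longrightarrow> x k = 0"
 by (auto simp: cube_def)

lemma cube_bd_upd:
 "\<lbrakk>x \<in> cube k; 0 \<le> s; s \<le> 1; s = 0 \<or> s = 1 \<or> x \<in> cube_bd k\<rbrakk> \<Longrightarrow> x(k := s) \<in> cube_bd (Suc k)"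
 using cube_upd[of x k s] unfolding cube_bd_def by (auto simp: less_Suc_eq)

lemma cube_bd_Suc:
 "y \<in> cube_bd (Suc k) \<Longrightarrow> y k = 0 \<or> y k = 1 \<or> y(k := 0) \<in> cube_bd k"
 using cube_upd_0[of y k] unfolding cube_bd_def by (auto simp: less_Suc_eq)

lemma continuous_on_upd:
 assumes "continuous_on R f" "continuous_on R (s :: _ \<Rightarrow> real)"
 shows "continuous_on R (\<lambda>z. (f z :: nat \<Rightarrow> real)(k := s z))"
proof (rule continuous_on_pi)
 fix i
 show "continuous_on R (\<lambda>z. ((f z)(k := s z)) i)"
  using assms(2) continuous_on_product_then_coordinatewise[OF assms(1)] by (cases "i = k") auto
qed

text \<open>Cone coordinates with apex \<open>n\<close>: for \<open>l\<close> in the opposite face,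
  \<open>s\<close> is the weight of the apex. At \<open>s = 1\<close> the point \<open>l\<close> is
  forgotten, so continuity at the apex has to be checked after pulling back along this map.\<close>

definition join_apex :: "'i \<Rightarrow> real \<Rightarrow> ('i \<Rightarrow> real) \<Rightarrow> 'i \<Rightarrow> real" where
 "join_apex n s l = (\<lambda>j. (1 - s) * l j + s * dl n j)"

lemma cone_0 [simp]: "join_apex n 0 l = l" and cone_1 [simp]: "join_apex n 1 l = dl n"
 by (auto simp: join_apex_def)

lemma cone_in_simp:
 assumes "finite J" "l \<in> simp J" "n \<notin> J" "0 \<le> s" "s \<le> 1"
 shows "join_apex n s l \<in> simp (insert n J)"
proof -
 have "sum (join_apex n s l) (insert n J) = join_apex n s l n + (\<Sum>j\<in>J. (1 - s) * l j)"
  using assms by (simp add: join_apex_def dl_def) (intro sum.cong, auto)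
 moreover have "l n = 0" using assms by (auto simp: simp_def supp_def)
 ultimately have "sum (join_apex n s l) (insert n J) = s + (1 - s) * sum l J"
  by (simp add: join_apex_def dl_def sum_distrib_left)
 thus ?thesis
  using assms by (auto simp: simp_def supp_def join_apex_def dl_def)
qed

lemma cone_apex:
 assumes "l \<in> simp J" "n \<notin> J" shows "join_apex n s l n = s"
proof -
 have "l n = 0" using assms by (auto simp: simp_def supp_def)
 thus ?thesis by (simp add: join_apex_def dl_def)
qed

lemma supp_cone:
 assumes "l \<in> simp J" "n \<notin> J" "0 < s" "s < 1"
 shows "supp (join_apex n s l) = insert n (supp l)"
proof -
 have "l n = 0" using assms by (auto simp: simp_def supp_def)
 thus ?thesis using assms by (auto simp: supp_def join_apex_def dl_def split: if_splits)
qed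

text \<open>The base point is found by dividing the other weights by \<open>1 - l n\<close>. At the
  apex every base point will do, and a vertex of \<open>J\<close> is taken.\<close>

lemma simp_cone_cases:
 assumes J: "finite J" "J \<noteq> {}" "n \<notin> J" and l: "l \<in> simp (insert n J)"
 obtains l' where "l' \<in> simp J" "l = join_apex n (l n) l'" "0 \<le> l n" "l n \<le> 1"
  "l n < 1 \<Longrightarrow> l' = (\<lambda>j. if j = n then 0 else l j / (1 - l n))"
proof -
 have s: "sum l J = 1 - l n" using l J by (simp add: simp_def)
 have l0: "0 \<le> l j" for j using l by (simp add: simp_def)
 have "0 \<le> sum l J" using l0 by (rule sum_nonneg)
 hence n1: "l n \<le> 1" using s by simp
 show ?thesis
 proof (cases "l n = 1")
  case True
  hence "sum l J = 0" using s by simp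
  hence z: "l j = 0" if "j \<in> J" for j using that J(1) l0 by (simp add: sum_nonneg_eq_0_iff)
  obtain i where i: "i \<in> J" using J by blast
  have "l = dl n" using z l True by (auto simp: fun_eq_iff dl_def simp_def supp_def)
  thus ?thesis using that[of "dl i"] True i J by (simp add: dl_in_simp)
 next
  case False
  define l' where "l' = (\<lambda>j. if j = n then 0 else l j / (1 - l n))"
  have "sum l' J = sum l J / (1 - l n)"
   unfolding sum_divide_distrib l'_def using J by (intro sum.cong) auto
  hence "sum l' J = 1" using s False by simp
  hence "l' \<in> simp J" using l l0 n1 False by (auto simp: simp_def l'_def supp_def)
  moreover have "l = join_apex n (l n) l'" using False by (auto simp: fun_eq_iff join_apex_def dl_def l'_def)
  ultimately show ?thesis using that[of l'] l0 n1 l'_def by simp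
 qed
qed

section \<open>Relative gluing of complexes over finitely many compact sets\<close>

context space_sheaf
begin

lemma htpyD:
 assumes "htpy I U U' T S f h"
 shows "\<And>i. i \<in> I \<Longrightarrow> U' i \<subseteq> U i" "cpx I U' ({0..1} \<times> T) h"
  "\<And>J l x. \<lbrakk>J \<in> fins I; l \<in> simp J; x \<in> T\<rbrakk> \<Longrightarrow>
   h l (0, x) = res F (US U l) (US U' l) (f l x)"
  "\<And>J l x t. \<lbrakk>J \<in> fins I; l \<in> simp J; x \<in> S; t \<in> {0..1}\<rbrakk> \<Longrightarrow> h l (t, x) = h l (0, x)"
 using assms unfolding htpy_def by (elim conjE; blast)+

lemma cmap_in: "cmap R Z g \<Longrightarrow> z \<in> R \<Longrightarrow> g z \<in> topspace Z"
 unfolding continuous_map_def by auto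

lemma htpyI:
 assumes "\<And>i. i \<in> I \<Longrightarrow> U' i \<subseteq> U i" "cpx I U' ({0..1} \<times> T) h"
  "\<And>J l x. \<lbrakk>J \<in> fins I; l \<in> simp J; x \<in> T\<rbrakk> \<Longrightarrow>
   h l (0, x) = res F (US U l) (US U' l) (f l x)"
  "\<And>J l x t. \<lbrakk>J \<in> fins I; l \<in> simp J; x \<in> S; t \<in> {0..1}\<rbrakk> \<Longrightarrow> h l (t, x) = h l (0, x)"
 shows "htpy I U U' T S f h"
 unfolding htpy_def using assms by blast

text \<open>Flexibility data with the ball replaced by the cube, as \<open>pair_solution\<close> is
  for the solutions; in a cube the parameter of a cone can be appended as a further
  coordinate.\<close>

definition pair_data where
 "pair_data k A B U V W a b c \<longleftrightarrow>
  openin X U \<and> A \<subseteq> U \<and> openin X V \<and> B \<subseteq> V \<and> openin X W \<and> A \<inter> B \<subseteq> W \<and> W \<subseteq> U \<inter> V \<and>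
  cmap (cube k) (sec F U) a \<and>
  cmap (cube k) (sec F V) b \<and>
  cmap (cyl k) (sec F W) (\<lambda>(s, x). c s x) \<and>
  (\<forall>x\<in>cube k. c 0 x = res F U W (a x) \<and> c 1 x = res F V W (b x)) \<and>
  (\<forall>s\<in>{0..1}. \<forall>x\<in>cube_bd k. c s x = c 0 x)"

definition pair_solution where
 "pair_solution k A B U V W a b c U' V' W' a' b' c' \<longleftrightarrow>
  openin X U' \<and> A \<subseteq> U' \<and> U' \<subseteq> U \<and> openin X V' \<and> B \<subseteq> V' \<and> V' \<subseteq> V \<and>
  openin X W' \<and> A \<inter> B \<subseteq> W' \<and> W' \<subseteq> W \<and> W' \<subseteq> U' \<inter> V' \<and>
  cmap (cyl k) (sec F U') (\<lambda>(t, x). a' t x) \<and>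
  cmap (cyl k) (sec F V') (\<lambda>(t, x). b' t x) \<and>
  cmap ({0..1::real} \<times> cyl k) (sec F W') (\<lambda>(s, t, x). c' s t x) \<and>
  (\<forall>x\<in>cube k. a' 0 x = res F U U' (a x) \<and> b' 0 x = res F V V' (b x)) \<and>
  (\<forall>s\<in>{0..1}. \<forall>x\<in>cube k. c' s 0 x = res F W W' (c s x)) \<and>
  (\<forall>t\<in>{0..1}. \<forall>x\<in>cube k. c' 0 t x = res F U' W' (a' t x) \<and> c' 1 t x = res F V' W' (b' t x)) \<and>
  (\<forall>t\<in>{0..1}. \<forall>x\<in>cube_bd k. a' t x = a' 0 x \<and> b' t x = b' 0 x) \<and>
  (\<forall>s\<in>{0..1}. \<forall>t\<in>{0..1}. \<forall>x\<in>cube_bd k. c' s t x = c' s 0 x) \<and>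
  (\<forall>s\<in>{0..1}. \<forall>x\<in>cube k. c' s 1 x = c' 0 1 x)"

text \<open>\<open>R\<close> stands for the control over the interior of \<open>A\<close>: trivial
  for finite strings, equality for ordered flexibility, closeness at all points for weak
  flexibility. One gluing argument then serves all three.\<close>

definition flexible_with where
 "flexible_with R k A B \<longleftrightarrow> compactin X A \<and> compactin X B \<and>
  (\<forall>U V W a b c. pair_data k A B U V W a b c \<longrightarrow>
   (\<exists>U' V' W' a' b' c'. pair_solution k A B U V W a b c U' V' W' a' b' c' \<and>
    (\<forall>t\<in>{0..1}. R (\<lambda>x. res F U (X interior_of A) (a x)) (\<lambda>x. res F U' (X interior_of A) (a' t x)))))"

text \<open>All dimensions \<open>k\<close> are included since the induction on the number of sets
  uses the case of fewer sets in dimension \<open>k + 1\<close>.\<close>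

definition glueable where
 "glueable n A \<longleftrightarrow> (\<forall>k U f. (\<forall>i<n. A i \<subseteq> U i) \<and> cpx {..<n::nat} U (cube k) f \<and>
   (\<forall>x\<in>cube_bd k. cst {..<n} U f x) \<longrightarrow>
  (\<exists>U' h. (\<forall>i<n. A i \<subseteq> U' i) \<and> htpy {..<n} U U' (cube k) (cube_bd k) f h \<and>
   (\<forall>x\<in>cube k. cst {..<n} U' (\<lambda>l x. h l (1, x)) x)))"

lemma glueable_1: "glueable 1 A"
 unfolding glueable_def
proof (intro allI impI, elim conjE)
 fix k U f assume A: "\<forall>i<1. A i \<subseteq> U i" and f: "cpx {..<1::nat} U (cube k) f"
 have c: "cpx {..<1} U (cyl k) (\<lambda>l z. f l (snd z))"
  by (rule cpx_param[OF f]) (auto intro!: continuous_intros)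
 have "htpy {..<1} U U (cube k) (cube_bd k) f (\<lambda>l z. f l (snd z))"
  unfolding htpy_def using c cpx_in[OF f] res_id cpx_openUU[OF f] fins_supp by force
 moreover have "\<forall>x\<in>cube k. cst {..<1} U (\<lambda>l x. f l (snd (1::real, x))) x"
  using cst_singleton[OF f] by (auto simp: lessThan_Suc)
 ultimately show "\<exists>U' h. (\<forall>i<1. A i \<subseteq> U' i) \<and> htpy {..<1} U U' (cube k) (cube_bd k) f h \<and>
   (\<forall>x\<in>cube k. cst {..<1} U' (\<lambda>l x. h l (1, x)) x)"
  using A by blast
qed

lemma cst_res:
 assumes c: "cst I U f x" and f: "cpx I U T f" "x \<in> T" and J: "J \<in> fins I" "l \<in> simp J" "j \<in> supp l"
  and O: "openin X O'" "O' \<subseteq> US U l"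
 shows "res F (US U l) O' (f l x) = res F (U j) O' (f (dl j) x)"
proof -
 have jI: "j \<in> I" using supp_simp(1)[OF J(2)] J(1,3) by (auto simp: fins_def)
 show ?thesis
  unfolding cstD[OF c J]
  by (rule res_res[OF cpx_open[OF f(1) jI] cpx_openUU[OF f(1) fins_supp[OF J(1,2)]] O UU_le[OF J(3)] cpx_vertex_in[OF f(1) jI f(2)]])
qed

lemma cst_agree_sub:
 assumes c: "cst I U f x" and f: "cpx I U T f" "x \<in> T" and ij: "i \<in> I" "j \<in> I"
  and O: "openin X O'" "O' \<subseteq> U i \<inter> U j"
 shows "res F (U i) O' (f (dl i) x) = res F (U j) O' (f (dl j) x)"
proof -
 have o: "openin X (U i)" "openin X (U j)" "openin X (U i \<inter> U j)" using cpx_open[OF f(1)] ij by auto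
 have "res F (U i) O' (f (dl i) x) = res F (U i \<inter> U j) O' (res F (U i) (U i \<inter> U j) (f (dl i) x))"
  using o O cpx_vertex_in[OF f(1) _ f(2)] ij by (intro res_res[symmetric]) auto
 also have "\<dots> = res F (U i \<inter> U j) O' (res F (U j) (U i \<inter> U j) (f (dl j) x))"
  using cst_agree[OF c ij] by simp
 also have "\<dots> = res F (U j) O' (f (dl j) x)"
  using o O cpx_vertex_in[OF f(1) _ f(2)] ij by (intro res_res) auto
 finally show ?thesis .
qed

text \<open>The cone on the face \<open>{..<n}\<close> with apex \<open>n\<close> turns a complex on \<open>{..n}\<close> over the cube of dimension
 \<open>k\<close> into a complex on \<open>{..<n}\<close> over the cube of dimension \<open>k + 1\<close>, to which the hypothesis on the
 string of intersections with \<open>A n\<close> applies.\<close>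

lemma cone_cpx:
 fixes U :: "nat \<Rightarrow> 'a set" and k
 assumes f: "cpx {..n} U (cube k) f" and c: "\<And>x. x \<in> cube k \<Longrightarrow> cst {..<n} U f x"
  and bd: "\<And>x. x \<in> cube_bd k \<Longrightarrow> cst {..n} U f x"
 defines "V \<equiv> \<lambda>i. U i \<inter> U n"
 defines "g \<equiv> \<lambda>l y. res F (UU U (supp (join_apex n (y k) l))) (US V l) (f (join_apex n (y k) l) (y(k := 0)))"
 shows "cpx {..<n} V (cube (Suc k)) g"
  and "\<And>y. y \<in> cube_bd (Suc k) \<Longrightarrow> cst {..<n} V g y"
  and "\<And>J l x. \<lbrakk>J \<in> fins {..<n}; l \<in> simp J; x \<in> cube k\<rbrakk> \<Longrightarrow>
   g l (x(k := 0)) = res F (US U l) (US V l) (f l x)"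
  and "\<And>J l x s. \<lbrakk>J \<in> fins {..<n}; l \<in> simp J; x \<in> cube k; 0 < s; s \<le> 1;
   s = 1 \<or> x \<in> cube_bd k\<rbrakk> \<Longrightarrow> g l (x(k := s)) = res F (U n) (US V l) (f (dl n) x)"
proof -
 have oU: "openin X (U i)" if "i \<le> n" for i using cpx_open[OF f] that by simp
 have oV: "openin X (V i)" if "i < n" for i using oU that by (auto simp: V_def)
 have VU: "UU V J \<subseteq> UU U (insert n J)" if "J \<in> fins {..<n}" for J
  using that by (auto simp: UU_def V_def fins_def)
 have nJ: "n \<notin> J" "finite J" "insert n J \<in> fins {..n}" "J \<in> fins {..n}" if "J \<in> fins {..<n}" for J
  using that by (auto simp: fins_def)
 have oVV: "openin X (UU V J)" if "J \<in> fins {..<n}" for J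
  by (rule openin_UU[OF _ that]) (use oV in auto)
 show cpx: "cpx {..<n} V (cube (Suc k)) g"
  unfolding g_def
 proof (rule cpx_subst[OF f, where p="insert n"])
  fix J assume J: "J \<in> fins {..<n}"
  show "insert n J \<in> fins {..n}" "UU V J \<subseteq> UU U (insert n J)" using nJ[OF J] VU[OF J] by auto
  show "continuous_on (simp J \<times> cube (Suc k)) (\<lambda>z. join_apex n (snd z k) (fst z))"
   unfolding join_apex_def by (rule continuous_on_pi) (intro continuous_intros)
  show "continuous_on (simp J \<times> cube (Suc k)) (\<lambda>z. (snd z)(k := 0))"
   by (intro continuous_on_upd continuous_intros)
  fix l y assume l: "l \<in> simp J" and y: "y \<in> cube (Suc k)"
  show "join_apex n (y k) l \<in> simp (insert n J)"
   using cone_in_simp[OF nJ(2)[OF J] l nJ(1)[OF J]] cube_last[OF y] by simp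
  show "y(k := 0) \<in> cube k" by (rule cube_upd_0[OF y])
 qed (use oV in auto)
 show g0: "g l (x(k := 0)) = res F (US U l) (US V l) (f l x)" if "x \<in> cube k" for l x
  using that by (simp add: g_def cube_upd_id cube_at)
 show g1: "g l (x(k := s)) = res F (U n) (US V l) (f (dl n) x)"
  if a: "J \<in> fins {..<n}" "l \<in> simp J" "x \<in> cube k" "0 < s" "s \<le> 1" "s = 1 \<or> x \<in> cube_bd k" for J l x s
 proof (cases "s = 1")
  case True
  thus ?thesis using a by (simp add: g_def cube_upd_id)
 next
  case False
  hence x: "x \<in> cube_bd k" "s < 1" using a by auto
  have sp: "supp (join_apex n s l) = insert n (supp l)" by (rule supp_cone[OF a(2) nJ(1)[OF a(1)] a(4) x(2)])
  have "res F (UU U (supp (join_apex n s l))) (US V l) (f (join_apex n s l) x) = res F (U n) (US V l) (f (dl n) x)"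
  proof (rule cst_res[OF bd[OF x(1)] f a(3) nJ(3)[OF a(1)]])
   show "join_apex n s l \<in> simp (insert n J)"
    by (rule cone_in_simp[OF nJ(2)[OF a(1)] a(2) nJ(1)[OF a(1)]]) (use a in auto)
   show "US V l \<subseteq> UU U (supp (join_apex n s l))" unfolding sp by (rule VU[OF fins_supp[OF a(1,2)]])
   show "openin X (US V l)" by (rule oVV[OF fins_supp[OF a(1,2)]])
  qed (simp add: sp)
  thus ?thesis using a(3) by (simp add: g_def cube_upd_id)
 qed
 fix y assume y: "y \<in> cube_bd (Suc k)"
 have yc: "y \<in> cube (Suc k)" using y cube_bd_subset by blast
 define x where "x = y(k := 0)"
 have x: "x \<in> cube k" "y = x(k := y k)" "0 \<le> y k" "y k \<le> 1"
  using cube_upd_0[OF yc] cube_last[OF yc] by (auto simp: x_def)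
 \<comment> \<open>The bottom of the cube carries the complex on the base face, constant by
   \<open>c\<close>. On the rest of the boundary every value is a restriction of the section at the
   apex.\<close>
 show "cst {..<n} V g y"
 proof (cases "y k = 0")
  case True
  have f': "cpx {..<n} U (cube k) f" by (rule cpx_param[OF f, where g="\<lambda>x. x"]) (auto intro: continuous_intros)
  have "cst {..<n} V (\<lambda>l x. res F (US U l) (US V l) (f l x)) x"
   by (rule cst_restrict[OF f' c[OF x(1)] x(1)]) (use oV in \<open>auto simp: V_def\<close>)
  thus ?thesis
  proof (rule cst_cong)
   fix J l
   show "res F (US U l) (US V l) (f l x) = g l y"
    using g0[OF x(1), of l] x(2) True by simp
  qed
 next
  case False
  hence pos: "0 < y k" "y k = 1 \<or> x \<in> cube_bd k" using x(3) cube_bd_Suc[OF y] by (auto simp: x_def)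
  show ?thesis
  proof (rule cstI[where W="U n" and s="f (dl n) x"])
   show "f (dl n) x \<in> sections (U n)" by (rule cpx_vertex_in[OF f _ x(1)]) simp
   fix J l assume "J \<in> fins {..<n}" "l \<in> simp J"
   thus "g l y = res F (U n) (US V l) (f (dl n) x)"
    using g1[OF _ _ x(1) pos(1) x(4) pos(2), of J l] x(2) by simp
  qed (use oU oV in \<open>auto simp: V_def\<close>)
 qed
qed

text \<open>The cone turns the values of \<open>f\<close> on simplices with vertex \<open>n\<close>
  into a complex over the sets \<open>U i \<inter> U n\<close> in one dimension more. Once made
  constant relative to its boundary, it is a genuine homotopy near the overlap, from the section
  glued along the face to the section at the apex, and these are data for the flexible pair. The
  homotopy \<open>a\<close> over the old part is exposed in the conclusion because the passage to
  infinitely many sets needs its control.\<close>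

lemma glue_step:
 assumes X: "Hausdorff_space X" and n: "0 < n"
  and A: "\<And>i. i \<le> n \<Longrightarrow> compactin X (A i)"
  and P: "flexible_with R k (\<Union>i<n. A i) (A n)"
  and G: "glueable n (\<lambda>i. A i \<inter> A n)"
  and f: "cpx {..n} U (cube k) f" and AU: "\<And>i. i \<le> n \<Longrightarrow> A i \<subseteq> U i"
  and bd: "\<And>x. x \<in> cube_bd k \<Longrightarrow> cst {..n} U f x"
  and c: "\<And>x. x \<in> cube k \<Longrightarrow> cst {..<n} U f x"
 obtains U' h O' a0 a where "\<And>i. i \<le> n \<Longrightarrow> A i \<subseteq> U' i"
  "htpy {..n} U U' (cube k) (cube_bd k) f h"
  "\<And>x. x \<in> cube k \<Longrightarrow> cst {..n} U' (\<lambda>l x. h l (1, x)) x"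
  "openin X O'" "(\<Union>i<n. A i) \<subseteq> O'" "\<And>i. i < n \<Longrightarrow> U' i \<subseteq> O'"
  "cmap (cyl k) (sec F O') (\<lambda>(t, x). a t x)"
  "\<And>J l t x. \<lbrakk>J \<in> fins {..<n}; l \<in> simp J; t \<in> {0..1}; x \<in> cube k\<rbrakk> \<Longrightarrow>
   h l (t, x) = res F O' (US U' l) (a (max 0 (2 * t - 1)) x)"
  "\<And>x. x \<in> cube k \<Longrightarrow> a0 x = res F O' (X interior_of (\<Union>i<n. A i)) (a 0 x)"
  "\<And>t. t \<in> {0..1} \<Longrightarrow> R a0 (\<lambda>x. res F O' (X interior_of (\<Union>i<n. A i)) (a t x))"
proof -
 let ?A = "\<Union>i<n. A i"
 define V where "V = (\<lambda>i. U i \<inter> U n)"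
 define g where "g = (\<lambda>l y. res F (UU U (supp (join_apex n (y k) l))) (US V l) (f (join_apex n (y k) l) (y(k := 0))))"
 have cone:
  "cpx {..<n} V (cube (Suc k)) g"
  "\<And>y. y \<in> cube_bd (Suc k) \<Longrightarrow> cst {..<n} V g y"
  "\<And>J l x. \<lbrakk>J \<in> fins {..<n}; l \<in> simp J; x \<in> cube k\<rbrakk> \<Longrightarrow>
   g l (x(k := 0)) = res F (US U l) (US V l) (f l x)"
  "\<And>J l x s. \<lbrakk>J \<in> fins {..<n}; l \<in> simp J; x \<in> cube k; 0 < s; s \<le> 1;
   s = 1 \<or> x \<in> cube_bd k\<rbrakk> \<Longrightarrow> g l (x(k := s)) = res F (U n) (US V l) (f (dl n) x)"
  unfolding V_def g_def by (rule cone_cpx[OF f c bd]; assumption)+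
 have oU: "openin X (U i)" if "i \<le> n" for i using cpx_open[OF f] that by simp
 have oV: "openin X (V i)" if "i < n" for i using oU that by (auto simp: V_def)
 have fn: "f (dl i) x \<in> sections (U i)" if "i \<le> n" "x \<in> cube k" for i x
  using cpx_vertex_in[OF f] that by simp
 have "\<forall>i<n. A i \<inter> A n \<subseteq> V i"
  unfolding V_def by (intro allI impI Int_mono AU) auto
 then obtain V' H where AV': "\<forall>i<n. A i \<inter> A n \<subseteq> V' i"
  and hH: "htpy {..<n} V V' (cube (Suc k)) (cube_bd (Suc k)) g H"
  and cH: "\<And>y. y \<in> cube (Suc k) \<Longrightarrow> cst {..<n} V' (\<lambda>l y. H l (1, y)) y"
  using G[unfolded glueable_def, rule_format, of V "Suc k" g] cone(1,2) by blast
 note H = htpyD(2)[OF hH] and H0 = htpyD(3)[OF hH] and Hb = htpyD(4)[OF hH]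
 have V'V: "V' i \<subseteq> V i" if "i < n" for i using htpyD(1)[OF hH] that by simp
 have oV': "openin X (V' i)" if "i < n" for i using cpx_open[OF H] that by simp
 have fl: "supp l \<in> fins {..<n}" if "J \<in> fins {..<n}" "l \<in> simp J" for J l by (rule fins_supp[OF that])
 have oUU: "openin X (UU U J)" if "J \<in> fins {..n}" for J by (rule cpx_openUU[OF f that])
 have oVV: "openin X (UU V J)" "openin X (UU V' J)" "UU V' J \<subseteq> UU V J" "UU V J \<subseteq> UU U J" "UU V J \<subseteq> U n"
  if J: "J \<in> fins {..<n}" for J
 proof -
  show "openin X (UU V J)" "openin X (UU V' J)" using openin_UU[OF _ J] oV oV' by auto
  show "UU V' J \<subseteq> UU V J" "UU V J \<subseteq> UU U J" using J V'V by (auto intro!: UU_mono simp: fins_def V_def)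
  show "UU V J \<subseteq> U n" using J by (auto simp: fins_def UU_def V_def)
 qed
 have ys: "x(k := s) \<in> cube (Suc k)" if "x \<in> cube k" "s \<in> {0..1}" for x s using cube_upd[OF that(1)] that(2) by simp
 have mono: "J \<in> fins {..n}" if "J \<in> fins {..<n}" for J using that by (auto simp: fins_def)
 have fin: "f l x \<in> sections (US U l)" if "J \<in> fins {..n}" "l \<in> simp J" "x \<in> cube k" for J l x
  by (rule cpx_in[OF f that])
 \<comment> \<open>As \<open>H\<close> rests on the boundary of the larger cube, it keeps the value
   of \<open>f\<close> on the face at \<open>s = 0\<close>, and the section at the apex at
   \<open>s = 1\<close> and over the boundary of the smaller cube.\<close>
 have Hs0: "H l (t, x(k := 0)) = res F (US U l) (US V' l) (f l x)"
  if a: "J \<in> fins {..<n}" "l \<in> simp J" "t \<in> {0..1}" "x \<in> cube k" for J l t x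
 proof -
  have b: "x(k := 0) \<in> cube_bd (Suc k)" using a(4) by (intro cube_bd_upd) auto
  have "H l (t, x(k := 0)) = res F (US V l) (US V' l) (g l (x(k := 0)))"
   using Hb[OF a(1,2) b a(3)] H0[OF a(1,2) ys[OF a(4)], of 0] by simp
  thus ?thesis
   unfolding cone(3)[OF a(1,2,4)]
   using res_res[OF oUU[OF mono[OF fl[OF a(1,2)]]] oVV(1,2,3,4)[OF fl[OF a(1,2)]] fin[OF mono[OF a(1)] a(2,4)]] by simp
 qed
 have Hs1: "H l (t, x(k := s)) = res F (U n) (US V' l) (f (dl n) x)"
  if a: "J \<in> fins {..<n}" "l \<in> simp J" "t \<in> {0..1}" "x \<in> cube k" and s: "0 < s" "s \<le> 1" "s = 1 \<or> x \<in> cube_bd k" for J l t x s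
 proof -
  have b: "x(k := s) \<in> cube_bd (Suc k)" using a(4) s by (intro cube_bd_upd) auto
  have "H l (t, x(k := s)) = res F (US V l) (US V' l) (g l (x(k := s)))"
   using Hb[OF a(1,2) b a(3)] H0[OF a(1,2) ys[OF a(4)], of s] s by simp
  thus ?thesis
   unfolding cone(4)[OF a(1,2,4) s]
   using res_res[OF oU[OF order_refl] oVV(1,2,3,5)[OF fl[OF a(1,2)]] fn[OF order_refl a(4)]] by simp
 qed
 \<comment> \<open>The \<open>V' i\<close> are neighbourhoods of the overlaps
   \<open>A i \<inter> A n\<close> only. Separation shrinks the sets until the \<open>i\<close>-th
   one and the last one meet inside \<open>V' i\<close>.\<close>
 obtain U1' Un1 where "\<And>i. i < n \<Longrightarrow> openin X (U1' i)" "openin X Un1" "\<And>i. i < n \<Longrightarrow> A i \<subseteq> U1' i" "A n \<subseteq> Un1"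
  "\<And>i. i < n \<Longrightarrow> U1' i \<inter> Un1 \<subseteq> V' i"
  by (rule compact_separation_nhds_family[OF X, of n A "A n" V']) (use A AV' oV' in auto)
 note U1' = this
 define U1 where "U1 = (\<lambda>i. if i = n then U n \<inter> Un1 else U i \<inter> U1' i)"
 have U1: "openin X (U1 i)" "A i \<subseteq> U1 i" "U1 i \<subseteq> U i" if "i \<le> n" for i
  using that U1' oU AU by (auto simp: U1_def)
 have U1V: "U1 i \<inter> U1 n \<subseteq> V' i" if "i < n" for i using U1'(5)[OF that] that by (auto simp: U1_def)
 define W where "W = (\<Union>i<n. U1 i \<inter> U1 n)"
 let ?UA = "\<Union>i\<in>{..<n}. U i" and ?VV = "\<Union>i\<in>{..<n}. V' i"
 have oW: "openin X W" unfolding W_def using U1 by (intro openin_Union) auto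
 have oUA: "openin X ?UA" "openin X ?VV" using oU oV' by (auto intro!: openin_Union)
 have U1U: "U1 i \<subseteq> U i" if "i < n" for i using U1(3) that by simp
 have WVV: "W \<subseteq> ?VV" "W \<subseteq> ?UA" "W \<subseteq> U n"
 proof -
  show "W \<subseteq> ?VV" unfolding W_def using U1V by blast
  show "W \<subseteq> ?UA" unfolding W_def using U1U by blast
  show "W \<subseteq> U n" unfolding W_def using U1(3)[OF order_refl] by blast
 qed
 have f': "cpx {..<n} U (cube k) f" by (rule cpx_param[OF f, where g="\<lambda>x. x"]) (auto intro: continuous_intros)
 obtain ga where ga: "cmap (cube k) (sec F ?UA) ga"
  "\<And>J l x. \<lbrakk>J \<in> fins {..<n}; l \<in> simp J; x \<in> cube k\<rbrakk> \<Longrightarrow> f l x = res F ?UA (US U l) (ga x)"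
  by (rule cst_glue[OF cell_pair_cube f' c]) blast+
 have H1: "cpx {..<n} V' (cube (Suc k)) (\<lambda>l y. H l (1, y))"
  by (rule cpx_param[OF H, where g="\<lambda>y. (1, y)"]) (auto intro!: continuous_intros)
 obtain gc where gc: "cmap (cube (Suc k)) (sec F ?VV) gc"
  "\<And>J l y. \<lbrakk>J \<in> fins {..<n}; l \<in> simp J; y \<in> cube (Suc k)\<rbrakk> \<Longrightarrow> H l (1, y) = res F ?VV (US V' l) (gc y)"
  by (rule cst_glue[OF cell_pair_cube H1 cH]) blast+
 have gas: "ga x \<in> sections ?UA" if "x \<in> cube k" for x using ga(1) that unfolding continuous_map_def by auto
 have gcs: "gc y \<in> sections ?VV" if "y \<in> cube (Suc k)" for y using gc(1) that unfolding continuous_map_def by auto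
 \<comment> \<open>The last coordinate of the glued family over the larger cube becomes the
   parameter of a homotopy over \<open>W\<close>.\<close>
 define cc where "cc = (\<lambda>s x. res F ?VV W (gc (x(k := s))))"
 have ccs: "cc s x \<in> sections W" if "s \<in> {0..1}" "x \<in> cube k" for s x
  unfolding cc_def by (rule res_in[OF oUA(2) oW WVV(1) gcs[OF ys[OF that(2,1)]]])
 have gcH: "res F ?VV O1 (gc y) = res F (V' i) O1 (H (dl i) (1, y))"
  if "y \<in> cube (Suc k)" "i < n" "openin X O1" "O1 \<subseteq> V' i" for y i O1
 proof -
  have e: "H (dl i) (1, y) = res F ?VV (V' i) (gc y)"
   using gc(2)[of "{i}" "dl i" y] that by (simp add: fins_def dl_in_simp)
  show ?thesis
   unfolding e by (rule res_res[OF oUA(2) oV'[OF that(2)] that(3,4) _ gcs[OF that(1)], symmetric]) (use that(2) in blast)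
 qed
 have W_eqI: "p = q" if "p \<in> sections W" "q \<in> sections W"
  "\<And>i. i < n \<Longrightarrow> res F W (U1 i \<inter> U1 n) p = res F W (U1 i \<inter> U1 n) q" for p q
  by (rule sections_eqI[of "{..<n}" "\<lambda>i. U1 i \<inter> U1 n" W]) (use that U1 in \<open>auto simp: W_def\<close>)
 have rcc: "res F W (U1 i \<inter> U1 n) (cc s x) = res F (V' i) (U1 i \<inter> U1 n) (H (dl i) (1, x(k := s)))"
  if "i < n" "s \<in> {0..1}" "x \<in> cube k" for i s x
 proof -
  have o: "openin X (U1 i \<inter> U1 n)" "U1 i \<inter> U1 n \<subseteq> W" using U1 that(1) by (auto simp: W_def)
  have "res F W (U1 i \<inter> U1 n) (cc s x) = res F ?VV (U1 i \<inter> U1 n) (gc (x(k := s)))"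
   unfolding cc_def by (rule res_res[OF oUA(2) oW o WVV(1) gcs[OF ys[OF that(3,2)]]])
  thus ?thesis using gcH[OF ys[OF that(3,2)] that(1) o(1) U1V[OF that(1)]] by simp
 qed
 have fd: "{i} \<in> fins {..<n}" "dl i \<in> simp {i}" if "i < n" for i using that by (auto simp: fins_def dl_in_simp)
 have rcc0: "res F W (U1 i \<inter> U1 n) (cc 0 x) = res F (U i) (U1 i \<inter> U1 n) (f (dl i) x)"
  if "i < n" "x \<in> cube k" for i x
 proof -
  have H0': "H (dl i) (1, x(k := 0)) = res F (U i) (V' i) (f (dl i) x)"
   using Hs0[OF fd[OF that(1)] _ that(2), of 1] by simp
  show ?thesis
   unfolding rcc[OF that(1) _ that(2), of 0, simplified] H0'
   by (rule res_res) (use oU oV' U1 that fn U1V V'V in \<open>auto simp: V_def\<close>)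
 qed
 have rcc1: "res F W (U1 i \<inter> U1 n) (cc s x) = res F (U n) (U1 i \<inter> U1 n) (f (dl n) x)"
  if "i < n" "x \<in> cube k" "0 < s" "s \<le> 1" "s = 1 \<or> x \<in> cube_bd k" for i x s
 proof -
  have s: "s \<in> {0..1}" using that by simp
  have H0': "H (dl i) (1, x(k := s)) = res F (U n) (V' i) (f (dl n) x)"
   using Hs1[OF fd[OF that(1)] _ that(2-5), of 1] by simp
  show ?thesis
   unfolding rcc[OF that(1) s that(2)] H0'
   by (rule res_res) (use oU oV' U1 that fn U1V V'V in \<open>auto simp: V_def\<close>)
 qed
 have pd: "pair_data k ?A (A n) ?UA (U n) W ga (f (dl n)) cc"
  unfolding pair_data_def
 proof (intro conjI ballI)
  show "?A \<subseteq> ?UA" by (intro UN_mono AU) auto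
  show "A n \<subseteq> U n" by (rule AU) simp
  show "?A \<inter> A n \<subseteq> W"
  proof
   fix z assume "z \<in> ?A \<inter> A n"
   then obtain i where "i < n" "z \<in> A i" "z \<in> A n" by blast
   thus "z \<in> W" using U1(2)[of i] U1(2)[of n] unfolding W_def by fastforce
  qed
  show "W \<subseteq> ?UA \<inter> U n" using WVV by simp
  show "cmap (cube k) (sec F (U n)) (f (dl n))" by (rule cpx_vertex[OF f]) simp
  have "cmap (cyl k) (sec F ?VV) (\<lambda>z. gc ((snd z)(k := fst z)))"
  proof (rule cmap_compose[OF gc(1)])
   show "continuous_on (cyl k) (\<lambda>z. (snd z)(k := fst z))" by (intro continuous_on_upd continuous_intros)
   show "(\<lambda>z. (snd z)(k := fst z)) ` (cyl k) \<subseteq> cube (Suc k)" using ys by auto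
  qed
  from cmap_res[OF this oUA(2) oW WVV(1)]
  show "cmap (cyl k) (sec F W) (\<lambda>(s, x). cc s x)"
   by (simp add: cc_def split_def)
  fix x assume x: "x \<in> cube k"
  show "cc 0 x = res F ?UA W (ga x)"
  proof (rule W_eqI)
   show "cc 0 x \<in> sections W" using ccs x by simp
   show "res F ?UA W (ga x) \<in> sections W" by (rule res_in[OF oUA(1) oW WVV(2) gas[OF x]])
   fix i assume i: "i < n"
   have o: "openin X (U1 i \<inter> U1 n)" "U1 i \<inter> U1 n \<subseteq> W" "U1 i \<inter> U1 n \<subseteq> U i" "U i \<subseteq> ?UA"
    using U1 i by (auto simp: W_def) (meson U1(3) less_imp_le subsetD)
   have fg: "f (dl i) x = res F ?UA (U i) (ga x)" using ga(2)[OF fd[OF i] x] by simp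
   show "res F W (U1 i \<inter> U1 n) (cc 0 x) = res F W (U1 i \<inter> U1 n) (res F ?UA W (ga x))"
    unfolding rcc0[OF i x] fg res_res[OF oUA(1) oW o(1,2) WVV(2) gas[OF x]]
    by (rule res_res[OF oUA(1) oU[OF less_imp_le[OF i]] o(1,3,4) gas[OF x]])
  qed
  show "cc 1 x = res F (U n) W (f (dl n) x)"
  proof (rule W_eqI)
   show "cc 1 x \<in> sections W" using ccs x by simp
   show "res F (U n) W (f (dl n) x) \<in> sections W" by (rule res_in[OF oU[OF order_refl] oW WVV(3) fn[OF order_refl x]])
   fix i assume i: "i < n"
   have o: "openin X (U1 i \<inter> U1 n)" "U1 i \<inter> U1 n \<subseteq> W" using U1 i by (auto simp: W_def)
   show "res F W (U1 i \<inter> U1 n) (cc 1 x) = res F W (U1 i \<inter> U1 n) (res F (U n) W (f (dl n) x))"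
    using rcc1[OF i x, of 1] res_res[OF oU[OF order_refl] oW o WVV(3) fn[OF order_refl x]] by simp
  qed
 next
  fix s :: real and x assume s: "s \<in> {0..1}" and x: "x \<in> cube_bd k"
  hence xc: "x \<in> cube k" using cube_bd_subset by blast
  \<comment> \<open>For \<open>s > 0\<close> the values are restrictions of the section at the apex,
    for \<open>s = 0\<close> of the sections on the face. Over a boundary point of the cube the
    whole complex is constant, so these agree on the overlaps.\<close>
  show "cc s x = cc 0 x"
  proof (cases "s = 0")
   case False
   hence s': "0 < s" "s \<le> 1" using s by auto
   show ?thesis
   proof (rule W_eqI)
    fix i assume i: "i < n"
    show "res F W (U1 i \<inter> U1 n) (cc s x) = res F W (U1 i \<inter> U1 n) (cc 0 x)"
     unfolding rcc1[OF i xc s' disjI2[OF x]] rcc0[OF i xc]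
     by (rule cst_agree_sub[OF bd[OF x] f xc])
      (use i U1(1)[of i] U1(1)[of n] U1(3)[of i] U1(3)[of n] in auto)
   qed (use ccs s xc in auto)
  qed simp
 qed (use oU oUA oW ga in auto)
 obtain O' Vb Wc a b c' where sol: "pair_solution k ?A (A n) ?UA (U n) W ga (f (dl n)) cc O' Vb Wc a b c'"
  and Ra: "\<forall>t\<in>{0..1}. R (\<lambda>x. res F ?UA (X interior_of ?A) (ga x)) (\<lambda>x. res F O' (X interior_of ?A) (a t x))"
  using P pd unfolding flexible_with_def by meson
 have s1: "openin X O'" "?A \<subseteq> O'" "O' \<subseteq> ?UA" "openin X Vb" "A n \<subseteq> Vb" "Vb \<subseteq> U n" "openin X Wc" "?A \<inter> A n \<subseteq> Wc"
   "Wc \<subseteq> W" "Wc \<subseteq> O' \<inter> Vb"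
  and sa: "cmap (cyl k) (sec F O') (\<lambda>(t, x). a t x)"
  and sb: "cmap (cyl k) (sec F Vb) (\<lambda>(t, x). b t x)"
  and sc: "cmap ({0..1::real} \<times> cyl k) (sec F Wc) (\<lambda>(s, t, x). c' s t x)"
  and a0: "\<And>x. x \<in> cube k \<Longrightarrow> a 0 x = res F ?UA O' (ga x)"
  and b0: "\<And>x. x \<in> cube k \<Longrightarrow> b 0 x = res F (U n) Vb (f (dl n) x)"
  and c0: "\<And>s x. s \<in> {0..1} \<Longrightarrow> x \<in> cube k \<Longrightarrow> c' s 0 x = res F W Wc (cc s x)"
  and ca: "\<And>t x. t \<in> {0..1} \<Longrightarrow> x \<in> cube k \<Longrightarrow> c' 0 t x = res F O' Wc (a t x)"
  and cb: "\<And>t x. t \<in> {0..1} \<Longrightarrow> x \<in> cube k \<Longrightarrow> c' 1 t x = res F Vb Wc (b t x)"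
  and ba: "\<And>t x. t \<in> {0..1} \<Longrightarrow> x \<in> cube_bd k \<Longrightarrow> a t x = a 0 x"
  and bb: "\<And>t x. t \<in> {0..1} \<Longrightarrow> x \<in> cube_bd k \<Longrightarrow> b t x = b 0 x"
  and bc: "\<And>s t x. \<lbrakk>s \<in> {0..1}; t \<in> {0..1}; x \<in> cube_bd k\<rbrakk> \<Longrightarrow> c' s t x = c' s 0 x"
  and c1: "\<And>s x. s \<in> {0..1} \<Longrightarrow> x \<in> cube k \<Longrightarrow> c' s 1 x = c' 0 1 x"
  using sol unfolding pair_solution_def by (elim conjE; blast)+
 have as: "a t x \<in> sections O'" if "t \<in> {0..1}" "x \<in> cube k" for t x
  using cmap_in[OF sa, of "(t, x)"] that by simp
 have bs: "b t x \<in> sections Vb" if "t \<in> {0..1}" "x \<in> cube k" for t x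
  using cmap_in[OF sb, of "(t, x)"] that by simp
 have cs: "c' s t x \<in> sections Wc" if "s \<in> {0..1}" "t \<in> {0..1}" "x \<in> cube k" for s t x
  using cmap_in[OF sc, of "(s, t, x)"] that by simp
 have cA: "compactin X ?A"
  by (rule compactin_Union) (use A[OF less_imp_le] in auto)
 obtain O1 O2 where O12: "openin X O1" "openin X O2" "?A \<subseteq> O1" "A n \<subseteq> O2" "O1 \<inter> O2 \<subseteq> Wc"
  by (rule compact_separation_nhds[OF X cA A[OF order_refl] s1(7,8)])
 \<comment> \<open>Second shrinking: the sets of the face lie in \<open>O'\<close>, the last set
   lies in \<open>Vb\<close>, and they meet inside \<open>Wc\<close>, where the three homotopies of
   the solution live.\<close>
 define U2 where "U2 = (\<lambda>i. if i = n then U1 n \<inter> Vb \<inter> O2 else U1 i \<inter> O' \<inter> O1)"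
 have U2: "openin X (U2 i)" "A i \<subseteq> U2 i" "U2 i \<subseteq> U1 i" "U2 i \<subseteq> U i" if "i \<le> n" for i
 proof -
  show "openin X (U2 i)" using U1 s1 O12 that by (auto simp: U2_def)
  show "A i \<subseteq> U2 i"
  proof (cases "i = n")
   case True
   thus ?thesis using U1(2)[OF that] s1(5) O12(4) by (simp add: U2_def)
  next
   case False
   hence "A i \<subseteq> ?A" using that by (intro UN_upper) simp
   hence "A i \<subseteq> O'" "A i \<subseteq> O1"
    using order_trans[OF _ s1(2), of "A i"] order_trans[OF _ O12(3), of "A i"] by simp_all
   thus ?thesis using U1(2)[OF that] False by (simp add: U2_def)
  qed
  show "U2 i \<subseteq> U1 i" by (auto simp: U2_def)
  thus "U2 i \<subseteq> U i" using U1(3)[OF that] by blast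
 qed
 have U2O: "U2 i \<subseteq> O'" "U2 i \<inter> U2 n \<subseteq> Wc" "U2 i \<inter> U2 n \<subseteq> V' i" if "i < n" for i
  using that O12(5) U1V[OF that] by (auto simp: U2_def)
 have U2n: "U2 n \<subseteq> Vb" "U2 n \<subseteq> U n" using U2(4)[OF order_refl] by (auto simp: U2_def)
 have oU2: "openin X (UU U2 J)" if "J \<in> fins {..n}" for J by (rule openin_UU[OF _ that]) (use U2 in auto)
 have U2U: "UU U2 J \<subseteq> UU U J" if "J \<in> fins {..n}" for J
  using that U2(4) by (intro UU_mono) (auto simp: fins_def)
 have U2A: "UU U2 J \<subseteq> O'" if J: "J \<in> fins {..n}" "J \<noteq> {n}" for J
 proof -
  have "\<not> J \<subseteq> {n}" using J by (auto simp: fins_def subset_singleton_iff)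
  then obtain i where "i \<in> J" "i \<noteq> n" "i \<le> n" using J(1) unfolding fins_def by blast
  thus ?thesis using UU_le[of i J U2] U2O(1)[of i] by auto
 qed
 have U2B: "UU U2 J \<subseteq> U2 n" if "n \<in> J" for J using UU_le[OF that] .
 have U2C: "UU U2 J \<subseteq> Wc" "UU U2 J \<subseteq> UU V' (J - {n})" if J: "J \<in> fins {..n}" "J \<noteq> {n}" "n \<in> J" for J
 proof -
  have "\<not> J \<subseteq> {n}" using J by (auto simp: fins_def subset_singleton_iff)
  then obtain i where i: "i \<in> J" "i \<noteq> n" "i \<le> n" using J(1) unfolding fins_def by blast
  thus "UU U2 J \<subseteq> Wc" using UU_le[of i J U2] U2O(2)[of i] U2B[OF J(3)] by auto
  have "UU U2 J \<subseteq> V' i" if "i \<in> J - {n}" for i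
   using that \<open>J \<in> fins {..n}\<close> UU_le[of i J U2] U2O(3)[of i] U2B[OF \<open>n \<in> J\<close>] by (fastforce simp: fins_def)
  thus "UU U2 J \<subseteq> UU V' (J - {n})" unfolding UU_def[of V'] by blast
 qed
 have low: "J \<in> fins {..<n}" if "J \<in> fins {..n}" "n \<notin> J" for J
  using that unfolding fins_def by (auto simp: order_less_le)
 have ln0: "n \<notin> supp l \<longleftrightarrow> l n = 0" for l :: "nat \<Rightarrow> real" by (simp add: supp_def)
 have ln01: "0 \<le> l n" "l n \<le> 1" if "J \<in> fins {..n}" "l \<in> simp J" for J l
 proof -
  show "0 \<le> l n" using that by (simp add: simp_def)
  show "l n \<le> 1"
  proof (cases "n \<in> J")
   case True
   have "l n \<le> sum l J" using that True by (intro member_le_sum) (auto simp: fins_def simp_def)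
   thus ?thesis using that by (simp add: simp_def)
  next
   case False
   hence "l n = 0" using supp_simp(1)[OF that(2)] by (auto simp: supp_def)
   thus ?thesis by simp
  qed
 qed
 have ln1: "l = dl n" if "J \<in> fins {..n}" "l \<in> simp J" "l n = 1" for J l
 proof -
  have "n \<in> supp l" using that(3) by (simp add: supp_def)
  hence J: "finite J" "n \<in> J" using that(1) supp_simp(1)[OF that(2)] by (auto simp: fins_def)
  hence "sum l (J - {n}) = 0" using that by (simp add: simp_def sum_diff1)
  hence "\<forall>j\<in>J - {n}. l j = 0" using J that by (subst (asm) sum_nonneg_eq_0_iff) (auto simp: simp_def)
  thus ?thesis using that by (auto simp: fun_eq_iff dl_def simp_def supp_def)
 qed
 have suppn: "supp l \<noteq> {n}" if "J \<in> fins {..n}" "l \<in> simp J" "l n \<noteq> 1" for J l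
 proof
  assume "supp l = {n}"
  hence "l \<in> simp {n}" using fins_supp_simp[OF that(1,2)] by simp
  thus False using that(3) by (simp add: simp_def)
 qed
 \<comment> \<open>First half of the deformation: \<open>H\<close> is run in cone coordinates, with
   \<open>l'\<close> as base point. On the face and at the apex \<open>H\<close> would rest, so
   \<open>f\<close> itself is taken there, which also avoids the division by
   \<open>1 - l n = 0\<close>.\<close>
 define h1 where "h1 = (\<lambda>l (t::real, x). if l n = 0 \<or> l n = 1 then res F (US U l) (US U2 l) (f l x)
  else let l' = (\<lambda>j. if j = n then 0 else l j / (1 - l n)) in
   res F (UU V' (supp l')) (US U2 l) (H l' (t, x(k := l n))))"
 have h1_cone: "res F (UU U2 (supp (join_apex n s l'))) O3 (h1 (join_apex n s l') (t, x)) = res F (UU V' (supp l')) O3 (H l' (t, x(k := s)))"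
  and h1_in: "h1 (join_apex n s l') (t, x) \<in> sections (UU U2 (supp (join_apex n s l')))"
  if J: "J \<in> fins {..<n}" and l': "l' \<in> simp J" and t: "t \<in> {0..1}" and x: "x \<in> cube k" and s: "0 \<le> s" "s \<le> 1"
   and O3: "openin X O3" "O3 \<subseteq> UU U2 (insert n J)" for J l' t x s O3
 proof -
  define l where "l = join_apex n s l'"
  have nJ: "n \<notin> J" "finite J" using J by (auto simp: fins_def)
  have JJ: "insert n J \<in> fins {..n}" "insert n J \<noteq> {n}" using J by (auto simp: fins_def)
  have l: "l \<in> simp (insert n J)" unfolding l_def by (rule cone_in_simp[OF nJ(2) l' nJ(1) s])
  have lns: "l n = s" unfolding l_def by (rule cone_apex[OF l' nJ(1)])
  have fl': "supp l' \<in> fins {..<n}" by (rule fl[OF J l'])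
  have fll: "supp l \<in> fins {..n}" by (rule fins_supp[OF JJ(1) l])
  have O3': "O3 \<subseteq> US U2 l" using O3 UU_antimono[OF supp_simp(1)[OF l], of U2] by blast
  have O3V: "O3 \<subseteq> UU V' (supp l')"
   using O3 U2C(2)[OF JJ] nJ(1) UU_antimono[OF supp_simp(1)[OF l'], of V'] by auto
  have Hin: "H l' (t, x(k := s)) \<in> sections (UU V' (supp l'))"
   by (rule cpx_in[OF H J l']) (use t ys[OF x, of s] s in auto)
  have cases: "res F (US U2 l) O3 (h1 l (t, x)) = res F (UU V' (supp l')) O3 (H l' (t, x(k := s))) \<and>
   h1 l (t, x) \<in> sections (US U2 l)"
  proof -
   consider "s = 0" | "s = 1" | "0 < s" "s < 1" using s by linarith
   thus ?thesis
   proof cases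
    case 1
    hence ll': "l = l'" by (simp add: l_def)
    have h: "h1 l (t, x) = res F (US U l) (US U2 l) (f l x)" using lns 1 by (simp add: h1_def)
    have fx: "f l x \<in> sections (US U l)" by (rule fin[OF JJ(1) l x])
    have e1: "res F (US U2 l) O3 (h1 l (t, x)) = res F (US U l) O3 (f l x)"
     unfolding h by (rule res_res[OF oUU[OF fll] oU2[OF fll] O3(1) O3' U2U[OF fll] fx])
    have "H l' (t, x(k := s)) = res F (US U l) (US V' l) (f l x)"
     using Hs0[OF J l' t x] 1 ll' by simp
    hence "res F (UU V' (supp l')) O3 (H l' (t, x(k := s))) = res F (US U l) O3 (f l x)"
     using res_res[OF oUU[OF fll] oVV(2)[OF fl'] O3(1) O3V _ ] oVV(3,4)[OF fl'] fx ll' by auto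
    thus ?thesis using e1 h res_in[OF oUU[OF fll] oU2[OF fll] U2U[OF fll] fx] by simp
   next
    case 2
    hence ll': "l = dl n" by (simp add: l_def)
    have h: "h1 l (t, x) = res F (U n) (U2 n) (f (dl n) x)" using lns 2 ll' by (simp add: h1_def)
    have fx: "f (dl n) x \<in> sections (U n)" using fn x by simp
    have e1: "res F (US U2 l) O3 (h1 l (t, x)) = res F (U n) O3 (f (dl n) x)"
     unfolding h[unfolded ll'] ll' supp_dl UU_singleton
     by (rule res_res[OF oU[OF order_refl] U2(1)[OF order_refl] O3(1) _ U2n(2) fx]) (use O3' ll' in simp)
    have "H l' (t, x(k := s)) = res F (U n) (UU V' (supp l')) (f (dl n) x)"
     using Hs1[OF J l' t x] 2 by simp
    hence "res F (UU V' (supp l')) O3 (H l' (t, x(k := s))) = res F (U n) O3 (f (dl n) x)"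
     using res_res[OF oU[OF order_refl] oVV(2)[OF fl'] O3(1) O3V _ fx] oVV(3,5)[OF fl'] by auto
    moreover have "h1 l (t, x) \<in> sections (US U2 l)"
     unfolding h[unfolded ll'] ll' supp_dl UU_singleton by (rule res_in[OF oU[OF order_refl] U2(1)[OF order_refl] U2n(2) fx])
    ultimately show ?thesis using e1 by simp
   next
    case 3
    have l'n: "l' n = 0" using l' nJ(1) by (auto simp: simp_def supp_def)
    have "(\<lambda>j. if j = n then 0 else l j / (1 - l n)) = l'"
     unfolding lns using 3 l'n by (auto simp: fun_eq_iff l_def join_apex_def dl_def)
    hence h: "h1 l (t, x) = res F (UU V' (supp l')) (US U2 l) (H l' (t, x(k := s)))"
     using lns 3 by (simp add: h1_def Let_def)
    have sl: "supp l = insert n (supp l')" unfolding l_def by (rule supp_cone[OF l' nJ(1) 3])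
    have "supp l \<noteq> {n}" using fl' unfolding sl by (auto simp: fins_def)
    moreover have "supp l - {n} = supp l'" using sl fl' by (auto simp: fins_def)
    ultimately have sub: "US U2 l \<subseteq> UU V' (supp l')"
     using U2C(2)[OF fll] sl by simp
    show ?thesis
     unfolding h using res_res[OF oVV(2)[OF fl'] oU2[OF fll] O3(1) O3' sub Hin]
      res_in[OF oVV(2)[OF fl'] oU2[OF fll] sub Hin] by simp
   qed
  qed
  show "res F (UU U2 (supp (join_apex n s l'))) O3 (h1 (join_apex n s l') (t, x)) = res F (UU V' (supp l')) O3 (H l' (t, x(k := s)))"
   "h1 (join_apex n s l') (t, x) \<in> sections (UU U2 (supp (join_apex n s l')))"
   using cases unfolding l_def by auto
 qed
 have h1_triv: "h1 l (t, x) = res F (US U l) (US U2 l) (f l x)" if "l n = 0 \<or> l n = 1" for l t x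
  using that by (simp add: h1_def)
 have h1_triv_cont: "cmap (simp J \<times> (cyl k)) (sec F (UU U2 J))
   (\<lambda>(l, z). res F (US U2 l) (UU U2 J) (h1 l z))"
  if J: "J \<in> fins {..n}" and tr: "\<And>l. l \<in> simp J \<Longrightarrow> l n = 0 \<or> l n = 1" for J
 proof -
  have "cpx {..n} U2 (cyl k) (\<lambda>l z. res F (US U l) (US U2 l) (f l (snd z)))"
  proof (rule cpx_restrict)
   show "cpx {..n} U (cyl k) (\<lambda>l z. f l (snd z))"
    by (rule cpx_param[OF f]) (auto intro!: continuous_intros)
  qed (simp_all add: U2(1,4))
  from cpx_continuous[OF this J] show ?thesis
   by (rule continuous_map_eq) (use tr in \<open>auto simp: h1_triv\<close>)
 qed
 have c1h: "cpx {..n} U2 (cyl k) h1"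
  unfolding cpx_def
 proof (intro conjI ballI)
  fix J l z assume J: "J \<in> fins {..n}" and l: "l \<in> simp J" and z: "z \<in> cyl k"
  obtain t x where tx: "z = (t, x)" "t \<in> {0..1}" "x \<in> cube k" using z by auto
  show "h1 l z \<in> sections (US U2 l)"
  proof (cases "l n = 0 \<or> l n = 1")
   case True
   have fll: "supp l \<in> fins {..n}" by (rule fins_supp[OF J l])
   show ?thesis
    unfolding tx(1) h1_triv[of l, OF True] by (rule res_in[OF oUU[OF fll] oU2[OF fll] U2U[OF fll] fin[OF J l tx(3)]])
  next
   case False
   define K where "K = supp l - {n}"
   have K: "finite K" "n \<notin> K" "K \<noteq> {}" "K \<in> fins {..<n}" "insert n K = supp l"
    using fins_supp[OF J l] suppn[OF J l] False ln0[of l] by (auto simp: K_def fins_def order_less_le)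
   have "l \<in> simp (insert n K)" unfolding K(5) by (rule fins_supp_simp[OF J l])
   then obtain l' where l': "l' \<in> simp K" "l = join_apex n (l n) l'" "0 \<le> l n" "l n \<le> 1"
    by (rule simp_cone_cases[OF K(1,3,2)])
   have "UU U2 (insert n K) \<subseteq> UU U2 (insert n K)" "openin X (UU U2 (insert n K))"
    using oU2[OF fins_supp[OF J l]] unfolding K(5) by auto
   from h1_in[OF K(4) l'(1) tx(2,3) l'(3,4) this(2,1)] show ?thesis
    unfolding l'(2)[symmetric] tx(1) .
  qed
 next
  fix J assume J: "J \<in> fins {..n}"
  show "cmap (simp J \<times> (cyl k)) (sec F (UU U2 J))
    (\<lambda>(l, x). res F (US U2 l) (UU U2 J) (h1 l x))"
  proof (cases "n \<in> J \<and> J \<noteq> {n}")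
   case False
   show ?thesis
   proof (rule h1_triv_cont[OF J])
    fix l assume "l \<in> simp J"
    thus "l n = 0 \<or> l n = 1"
     using False by (cases "J = {n}") (auto simp: simp_singleton dl_def simp_def supp_def)
   qed
  next
   case True
   define K where "K = J - {n}"
   have K: "finite K" "n \<notin> K" "K \<noteq> {}" "K \<in> fins {..<n}" "insert n K = J"
    using J True by (auto simp: K_def fins_def order_less_le)
   let ?Q = "simp K \<times> ({0..1::real} \<times> (cyl k))"
   let ?q = "\<lambda>w. (join_apex n (fst (snd w)) (fst w), snd (snd w))"
   have im: "?q ` ?Q = simp J \<times> (cyl k)"
   proof (intro equalityI subsetI)
    fix w assume "w \<in> ?q ` ?Q"
    thus "w \<in> simp J \<times> (cyl k)"
     using cone_in_simp[OF K(1) _ K(2)] unfolding K(5) by auto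
   next
    fix w assume w: "w \<in> simp J \<times> (cyl k)"
    hence "fst w \<in> simp (insert n K)" unfolding K(5) by auto
    then obtain l' where l': "l' \<in> simp K" "fst w = join_apex n (fst w n) l'" "0 \<le> fst w n" "fst w n \<le> 1"
     by (rule simp_cone_cases[OF K(1,3,2)])
    show "w \<in> ?q ` ?Q"
     by (rule image_eqI[of _ _ "(l', fst w n, snd w)"]) (use w l' in auto)
   qed
   \<comment> \<open>The base point does not depend continuously on \<open>l\<close> at the apex. In
     cone coordinates \<open>h1\<close> is given by \<open>H\<close> without case distinction, and
     the cone map is a surjection from a compact space.\<close>
   have "cmap (?q ` ?Q) (sec F (UU U2 J))
     (\<lambda>(l, x). res F (US U2 l) (UU U2 J) (h1 l x))"
   proof (rule cmap_quotient)
    show "compact ?Q" by (intro compact_Times compact_simp K(1) compact_cube compact_Icc)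
    show "continuous_on ?Q ?q"
     unfolding join_apex_def by (intro continuous_on_Pair continuous_on_pi continuous_intros)
    have "cmap ?Q (sec F (UU U2 J))
      (\<lambda>w. res F (UU V' (supp (fst w))) (UU U2 J) (H (fst w) (fst (snd (snd w)), (snd (snd (snd w)))(k := fst (snd w)))))"
    proof (rule cpx_comp[OF H K(4) _ _ _ _ oU2[OF J]])
     show "UU U2 J \<subseteq> UU V' K" using U2C(2)[OF J] True by (simp add: K_def)
     show "continuous_on ?Q (\<lambda>w. (fst (snd (snd w)), (snd (snd (snd w)))(k := fst (snd w))))"
      by (intro continuous_on_Pair continuous_on_upd continuous_intros)
    qed (use ys in \<open>auto intro!: continuous_intros\<close>)
    thus "cmap ?Q (sec F (UU U2 J))
      (\<lambda>w. (\<lambda>(l, x). res F (US U2 l) (UU U2 J) (h1 l x)) (?q w))"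
    proof (rule continuous_map_eq)
     fix w assume "w \<in> topspace (top_of_set ?Q)"
     then obtain l' s t x where w: "w = (l', s, t, x)" "l' \<in> simp K" "s \<in> {0..1}" "t \<in> {0..1}" "x \<in> cube k" by auto
     show "res F (UU V' (supp (fst w))) (UU U2 J) (H (fst w) (fst (snd (snd w)), (snd (snd (snd w)))(k := fst (snd w)))) =
       (\<lambda>(l, x). res F (US U2 l) (UU U2 J) (h1 l x)) (?q w)"
      using h1_cone[OF K(4) w(2,4,5) _ _ oU2[OF J]] w(3) K(5) by (simp add: w(1))
    qed
   qed
   thus ?thesis unfolding im .
  qed
 qed (use U2 in auto)
 have h10: "h1 l (0, x) = res F (US U l) (US U2 l) (f l x)"
  and h1b: "t \<in> {0..1} \<Longrightarrow> x \<in> cube_bd k \<Longrightarrow> h1 l (t, x) = h1 l (0, x)"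
  and h11: "\<not> (l n = 0 \<or> l n = 1) \<Longrightarrow> h1 l (1, x) = res F ?VV (US U2 l) (gc (x(k := l n)))"
  if J: "J \<in> fins {..n}" and l: "l \<in> simp J" and x: "x \<in> cube k" for J l x t
 proof -
  have *: "h1 l (0, x) = res F (US U l) (US U2 l) (f l x) \<and>
   (t \<in> {0..1} \<longrightarrow> x \<in> cube_bd k \<longrightarrow> h1 l (t, x) = h1 l (0, x)) \<and>
   h1 l (1, x) = res F ?VV (US U2 l) (gc (x(k := l n)))" if "\<not> (l n = 0 \<or> l n = 1)"
  proof -
   define K where "K = supp l - {n}"
   have K: "finite K" "n \<notin> K" "K \<noteq> {}" "K \<in> fins {..<n}" "insert n K = supp l"
    using fins_supp[OF J l] suppn[OF J l] that ln0[of l] by (auto simp: K_def fins_def order_less_le)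
   have "l \<in> simp (insert n K)" unfolding K(5) by (rule fins_supp_simp[OF J l])
   hence "\<exists>l'. l' \<in> simp K \<and> l = join_apex n (l n) l' \<and> 0 \<le> l n \<and> l n \<le> 1 \<and>
     (l n < 1 \<longrightarrow> l' = (\<lambda>j. if j = n then 0 else l j / (1 - l n)))"
    by (rule simp_cone_cases[OF K(1,3,2)]) blast
   then obtain l' where l': "l' \<in> simp K" "l = join_apex n (l n) l'" "0 \<le> l n" "l n \<le> 1"
    "l n < 1 \<longrightarrow> l' = (\<lambda>j. if j = n then 0 else l j / (1 - l n))" by blast
   have l'e: "(\<lambda>j. if j = n then 0 else l j / (1 - l n)) = l'" using l'(4,5) that by auto
   have h: "h1 l (t, x) = res F (UU V' (supp l')) (US U2 l) (H l' (t, x(k := l n)))" for t x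
    using that by (simp add: h1_def l'e Let_def)
   have fl': "supp l' \<in> fins {..<n}" by (rule fl[OF K(4) l'(1)])
   have fll: "supp l \<in> fins {..n}" by (rule fins_supp[OF J l])
   have ln: "l n \<in> {0..1}" using l' by simp
   have s'K: "UU V' K \<subseteq> UU V' (supp l')" by (rule UU_antimono[OF supp_simp(1)[OF l'(1)]])
   have sub: "US U2 l \<subseteq> UU V' (supp l')"
    using U2C(2)[OF fll suppn[OF J l]] that ln0[of l] s'K unfolding K_def by auto
   have gl: "g l' (x(k := l n)) = res F (US U l) (UU V (supp l')) (f l x)"
    using l'(2) x by (simp add: g_def cube_upd_id)
   have Vl: "UU V (supp l') \<subseteq> US U l"
    using supp_cone[OF l'(1) K(2), of "l n"] l'(2-4) that oVV(4,5)[OF fl'] by (auto simp: UU_def)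
   have fx: "f l x \<in> sections (US U l)" by (rule fin[OF J l x])
   have "h1 l (0, x) = res F (UU V' (supp l')) (US U2 l) (res F (UU V (supp l')) (UU V' (supp l')) (res F (US U l) (UU V (supp l')) (f l x)))"
    unfolding h H0[OF K(4) l'(1) ys[OF x ln]] gl ..
   also have "\<dots> = res F (UU V' (supp l')) (US U2 l) (res F (US U l) (UU V' (supp l')) (f l x))"
    unfolding res_res[OF oUU[OF fll] oVV(1,2,3)[OF fl'] Vl fx] ..
   also have "\<dots> = res F (US U l) (US U2 l) (f l x)"
    by (rule res_res[OF oUU[OF fll] oVV(2)[OF fl'] oU2[OF fll] sub _ fx]) (use Vl oVV(3)[OF fl'] in blast)
   finally have 1: "h1 l (0, x) = res F (US U l) (US U2 l) (f l x)" .
   have 2: "h1 l (t, x) = h1 l (0, x)" if "t \<in> {0..1}" "x \<in> cube_bd k"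
   proof -
    have "x(k := l n) \<in> cube_bd (Suc k)" using x that l' by (intro cube_bd_upd) auto
    thus ?thesis unfolding h using Hb[OF K(4) l'(1) _ that(1)] by simp
   qed
   have "H l' (1, x(k := l n)) = res F ?VV (UU V' (supp l')) (gc (x(k := l n)))"
    by (rule gc(2)[OF K(4) l'(1) ys[OF x ln]])
   hence 3: "h1 l (1, x) = res F ?VV (US U2 l) (gc (x(k := l n)))"
    unfolding h
   proof (simp, intro res_res oUA(2) oVV(2)[OF fl'] oU2[OF fll] sub gcs ys[OF x ln])
    obtain i where "i \<in> supp l'" using supp_simp(2)[OF l'(1)] by blast
    thus "UU V' (supp l') \<subseteq> ?VV" using fl' by (auto simp: UU_def fins_def)
   qed
   show ?thesis using 1 2 3 by blast
  qed
  show "h1 l (0, x) = res F (US U l) (US U2 l) (f l x)" using * h1_triv by blast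
  show "t \<in> {0..1} \<Longrightarrow> x \<in> cube_bd k \<Longrightarrow> h1 l (t, x) = h1 l (0, x)"
   by (cases "l n = 0 \<or> l n = 1") (simp add: h1_triv, use * in blast)
  show "\<not> (l n = 0 \<or> l n = 1) \<Longrightarrow> h1 l (1, x) = res F ?VV (US U2 l) (gc (x(k := l n)))" using * by blast
 qed
 have hp1: "htpy {..n} U U2 (cube k) (cube_bd k) f h1"
 proof (rule htpyI)
  fix J l x and t :: real assume a: "J \<in> fins {..n}" "l \<in> simp J" "x \<in> cube_bd k" "t \<in> {0..1}"
  thus "h1 l (t, x) = h1 l (0, x)" using h1b[OF a(1,2) _ a(4,3)] cube_bd_subset by blast
 qed (use c1h h10 U2(4) in auto)
 \<comment> \<open>Second half: the weight \<open>l n\<close> of the apex is the parameter of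
   \<open>c'\<close>, whose two ends are \<open>a\<close> over the face and \<open>b\<close> at the
   apex. At time 1 \<open>c'\<close> no longer depends on this parameter, which makes the final
   complex constant.\<close>
 define h2 where "h2 = (\<lambda>l (t, x). if l n = 0 then res F O' (US U2 l) (a t x)
  else if l n = 1 then res F Vb (US U2 l) (b t x) else res F Wc (US U2 l) (c' (l n) t x))"
 have h2_mid: "h2 l (t, x) = res F Wc (US U2 l) (c' (l n) t x)" "US U2 l \<subseteq> Wc"
  if "J \<in> fins {..n}" "l \<in> simp J" "l n \<noteq> 0" "l n \<noteq> 1" for J l t x
  using U2C(1)[OF fins_supp[OF that(1,2)] suppn[OF that(1,2,4)]] ln0[of l] that by (auto simp: h2_def)
 have h2_res: "res F (US U2 l) O3 (h2 l (t, x)) = (if l n = 0 then res F O' O3 (a t x)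
   else if l n = 1 then res F Vb O3 (b t x) else res F Wc O3 (c' (l n) t x))"
  and h2_in: "h2 l (t, x) \<in> sections (US U2 l)"
  if J: "J \<in> fins {..n}" and l: "l \<in> simp J" and t: "t \<in> {0..1}" and x: "x \<in> cube k"
   and O3: "openin X O3" "O3 \<subseteq> US U2 l" for J l t x O3
 proof -
  have fll: "supp l \<in> fins {..n}" by (rule fins_supp[OF J l])
  have b1: "US U2 l \<subseteq> O'" if "l n = 0" using U2A[OF fll] that ln0[of l] by auto
  have b2: "US U2 l \<subseteq> Vb" if "l n = 1" using U2B[of "supp l"] U2n(1) that ln0[of l] by auto
  have ln: "l n \<in> {0..1}" using ln01[OF J l] by simp
  show "res F (US U2 l) O3 (h2 l (t, x)) = (if l n = 0 then res F O' O3 (a t x)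
   else if l n = 1 then res F Vb O3 (b t x) else res F Wc O3 (c' (l n) t x))"
   using res_res[OF s1(1) oU2[OF fll] O3 b1 as[OF t x]] res_res[OF s1(4) oU2[OF fll] O3 b2 bs[OF t x]]
    res_res[OF s1(7) oU2[OF fll] O3 h2_mid(2)[OF J l] cs[OF ln t x]] by (auto simp: h2_def)
  show "h2 l (t, x) \<in> sections (US U2 l)"
   using res_in[OF s1(1) oU2[OF fll] b1 as[OF t x]] res_in[OF s1(4) oU2[OF fll] b2 bs[OF t x]]
    res_in[OF s1(7) oU2[OF fll] h2_mid(2)[OF J l] cs[OF ln t x]] by (auto simp: h2_def)
 qed
 have c2h: "cpx {..n} U2 (cyl k) h2"
  unfolding cpx_def
 proof (intro conjI ballI)
  fix J l z assume J: "J \<in> fins {..n}" and l: "l \<in> simp J" and z: "z \<in> cyl k"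
  thus "h2 l z \<in> sections (US U2 l)"
   using h2_in[OF J l _ _ oU2[OF fins_supp[OF J l]]] by auto
 next
  fix J assume J: "J \<in> fins {..n}"
  let ?R = "simp J \<times> (cyl k)"
  have sub: "UU U2 J \<subseteq> US U2 l" if "l \<in> simp J" for l by (rule UU_antimono[OF supp_simp(1)[OF that]])
  show "cmap ?R (sec F (UU U2 J)) (\<lambda>(l, x). res F (US U2 l) (UU U2 J) (h2 l x))"
  proof -
   consider "n \<notin> J" | "J = {n}" | "n \<in> J" "J \<noteq> {n}" by blast
   thus ?thesis
   proof cases
    case 1
    have "cmap ?R (sec F (UU U2 J)) (\<lambda>w. res F O' (UU U2 J) ((\<lambda>(t, x). a t x) (snd w)))"
     by (rule cmap_res[OF cmap_compose[OF sa] s1(1) oU2[OF J]])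
      (use U2A[OF J] 1 in \<open>auto intro!: continuous_intros\<close>)
    thus ?thesis
    proof (rule continuous_map_eq)
     fix w assume "w \<in> topspace (top_of_set ?R)"
     then obtain l t x where w: "w = (l, t, x)" "l \<in> simp J" "t \<in> {0..1}" "x \<in> cube k" by auto
     have "l n = 0" using supp_simp(1)[OF w(2)] 1 ln0[of l] by auto
     thus "res F O' (UU U2 J) ((\<lambda>(t, x). a t x) (snd w)) = (\<lambda>(l, x). res F (US U2 l) (UU U2 J) (h2 l x)) w"
      using h2_res[OF J w(2-4) oU2[OF J] sub[OF w(2)]] by (simp add: w(1))
    qed
   next
    case 2
    have "cmap ?R (sec F (UU U2 J)) (\<lambda>w. res F Vb (UU U2 J) ((\<lambda>(t, x). b t x) (snd w)))"
     by (rule cmap_res[OF cmap_compose[OF sb] s1(4) oU2[OF J]])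
      (use U2n 2 in \<open>auto intro!: continuous_intros\<close>)
    thus ?thesis
    proof (rule continuous_map_eq)
     fix w assume "w \<in> topspace (top_of_set ?R)"
     then obtain l t x where w: "w = (l, t, x)" "l \<in> simp J" "t \<in> {0..1}" "x \<in> cube k" by auto
     have "l n = 1" using w(2) unfolding 2 simp_singleton by (simp add: dl_def)
     thus "res F Vb (UU U2 J) ((\<lambda>(t, x). b t x) (snd w)) = (\<lambda>(l, x). res F (US U2 l) (UU U2 J) (h2 l x)) w"
      using h2_res[OF J w(2-4) oU2[OF J] sub[OF w(2)]] by (simp add: w(1))
    qed
   next
    case 3
    have "cmap ?R (sec F (UU U2 J)) (\<lambda>w. res F Wc (UU U2 J) ((\<lambda>(s, t, x). c' s t x) (fst w n, snd w)))"
    proof (rule cmap_res[OF cmap_compose[OF sc] s1(7) oU2[OF J]])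
     show "continuous_on ?R (\<lambda>w. (fst w n, snd w))" by (intro continuous_intros)
     show "(\<lambda>w. (fst w n, snd w)) ` ?R \<subseteq> {0..1} \<times> cyl k" using ln01[OF J] by auto
     show "UU U2 J \<subseteq> Wc" by (rule U2C(1)[OF J 3(2,1)])
    qed
    thus ?thesis
    proof (rule continuous_map_eq)
     fix w assume "w \<in> topspace (top_of_set ?R)"
     then obtain l t x where w: "w = (l, t, x)" "l \<in> simp J" "t \<in> {0..1}" "x \<in> cube k" by auto
     have "res F O' (UU U2 J) (a t x) = res F Wc (UU U2 J) (c' 0 t x)"
      "res F Vb (UU U2 J) (b t x) = res F Wc (UU U2 J) (c' 1 t x)"
      unfolding ca[OF w(3,4)] cb[OF w(3,4)]
      using res_res[OF s1(1,7) oU2[OF J] U2C(1)[OF J 3(2,1)] _ as[OF w(3,4)]]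
       res_res[OF s1(4,7) oU2[OF J] U2C(1)[OF J 3(2,1)] _ bs[OF w(3,4)]] s1(10) by auto
     thus "res F Wc (UU U2 J) ((\<lambda>(s, t, x). c' s t x) (fst w n, snd w)) =
       (\<lambda>(l, x). res F (US U2 l) (UU U2 J) (h2 l x)) w"
      using h2_res[OF J w(2-4) oU2[OF J] sub[OF w(2)]] by (simp add: w(1))
    qed
   qed
  qed
 qed (use U2 in auto)
 have h20: "h2 l (0, x) = res F (US U2 l) (US U2 l) (h1 l (1, x))"
  if J: "J \<in> fins {..n}" and l: "l \<in> simp J" and x: "x \<in> cube k" for J l x
 proof -
  have fll: "supp l \<in> fins {..n}" by (rule fins_supp[OF J l])
  have "h2 l (0, x) = h1 l (1, x)"
  proof -
   consider "l n = 0" | "l n = 1" | "l n \<noteq> 0" "l n \<noteq> 1" by blast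
   thus ?thesis
   proof cases
    case 1
    hence lowl: "supp l \<in> fins {..<n}" using low[OF fll] ln0[of l] by simp
    have sub: "US U2 l \<subseteq> O'" using U2A[OF fll] 1 ln0[of l] by auto
    obtain i where "i \<in> supp l" using supp_simp(2)[OF l] by blast
    hence sU: "US U l \<subseteq> ?UA" using lowl by (auto simp: UU_def fins_def)
    have fg: "f l x = res F ?UA (US U l) (ga x)"
     by (rule ga(2)[OF lowl fins_supp_simp[OF J l] x])
    have "h1 l (1, x) = res F ?UA (US U2 l) (ga x)"
     unfolding h1_triv[of l, OF disjI1[OF 1]] fg by (rule res_res[OF oUA(1) oUU[OF fll] oU2[OF fll] U2U[OF fll] sU gas[OF x]])
    moreover have "h2 l (0, x) = res F ?UA (US U2 l) (ga x)"
     using res_res[OF oUA(1) s1(1) oU2[OF fll] sub s1(3) gas[OF x]] 1 by (simp add: h2_def a0[OF x])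
    ultimately show ?thesis by simp
   next
    case 2
    have ll: "l = dl n" by (rule ln1[OF J l 2])
    have "h1 l (1, x) = res F (U n) (U2 n) (f (dl n) x)"
     using h1_triv[of l 1 x, OF disjI2[OF 2]] by (simp add: ll)
    moreover have "h2 l (0, x) = res F (U n) (U2 n) (f (dl n) x)"
     using res_res[OF oU[OF order_refl] s1(4) U2(1)[OF order_refl] U2n(1) s1(6) fn[OF order_refl x]] 2
     by (simp add: h2_def ll b0[OF x])
    ultimately show ?thesis by simp
   next
    case 3
    have ln: "l n \<in> {0..1}" using ln01[OF J l] by simp
    have sub: "US U2 l \<subseteq> Wc" by (rule h2_mid(2)[OF J l 3])
    have "h2 l (0, x) = res F Wc (US U2 l) (res F W Wc (cc (l n) x))"
     unfolding h2_mid(1)[OF J l 3] c0[OF ln x] ..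
    also have "\<dots> = res F W (US U2 l) (cc (l n) x)"
     by (rule res_res[OF oW s1(7) oU2[OF fll] sub s1(9) ccs[OF ln x]])
    also have "\<dots> = res F ?VV (US U2 l) (gc (x(k := l n)))"
     unfolding cc_def by (rule res_res[OF oUA(2) oW oU2[OF fll] _ WVV(1) gcs[OF ys[OF x ln]]]) (use sub s1(9) in blast)
    finally show ?thesis using h11[OF J l x] 3 by simp
   qed
  qed
  moreover have "h1 l (1, x) \<in> sections (US U2 l)" by (rule cpx_in[OF c1h J l]) (use x in simp)
  ultimately show ?thesis using res_id[OF oU2[OF fll]] by simp
 qed
 have hp2: "htpy {..n} U2 U2 (cube k) (cube_bd k) (\<lambda>l x. h1 l (1, x)) h2"
  unfolding htpy_def
 proof (intro conjI ballI)
  fix J l x and t :: real assume J: "J \<in> fins {..n}" and l: "l \<in> simp J" and x: "x \<in> cube_bd k" and t: "t \<in> {0..1}"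
  have ln: "l n \<in> {0..1}" using ln01[OF J l] by simp
  show "h2 l (t, x) = h2 l (0, x)" using ba[OF t x] bb[OF t x] bc[OF ln t x] by (simp add: h2_def)
 qed (use c2h h20 in auto)
 define h where "h = (\<lambda>l (t::real, x). if t \<le> 1 / 2 then res F (US U2 l) (US U2 l) (h1 l (2 * t, x))
   else h2 l (2 * t - 1, x))"
 have hp: "htpy {..n} U U2 (cube k) (cube_bd k) f h"
  unfolding h_def by (rule htpy_trans[OF hp1 hp2 f cube_bd_subset])
 show thesis
 proof (rule that[of U2 h O' a "\<lambda>x. res F ?UA (X interior_of ?A) (ga x)"])
  show "htpy {..n} U U2 (cube k) (cube_bd k) f h" by (rule hp)
  fix x assume x: "x \<in> cube k"
  have iA: "openin X (X interior_of ?A)" "X interior_of ?A \<subseteq> O'"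
   using s1(2) interior_of_subset[of X ?A] by (auto simp del: UN_simps)
  show "res F ?UA (X interior_of ?A) (ga x) = res F O' (X interior_of ?A) (a 0 x)"
   unfolding a0[OF x] by (rule res_res[OF oUA(1) s1(1) iA s1(3) gas[OF x], symmetric])
  show "cst {..n} U2 (\<lambda>l x. h l (1, x)) x"
   unfolding cst_def
  proof (intro ballI)
   fix J l j assume J: "J \<in> fins {..n}" and l: "l \<in> simp J" and j: "j \<in> supp l"
   have fll: "supp l \<in> fins {..n}" by (rule fins_supp[OF J l])
   have jn: "j \<le> n" using fll j by (auto simp: fins_def)
   have one: "(1::real) \<in> {0..1}" by simp
   have dj: "{j} \<in> fins {..n}" "dl j \<in> simp {j}" using jn by (auto simp: fins_def dl_in_simp)
   have le: "US U2 l \<subseteq> UU U2 (supp (dl j))" using UU_le[OF j, of U2] by simp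
   have ln: "l n \<in> {0..1}" using ln01[OF J l] by simp
   have "res F (UU U2 (supp (dl j))) (US U2 l) (h2 (dl j) (1, x)) = h2 l (1, x)"
   proof (cases "l n = 0 \<or> l n = 1")
    case True
    have "dl j n = l n"
    proof (cases "l n = 0")
     case True
     thus ?thesis using j ln0[of l] by (auto simp: dl_def)
    next
     case False
     hence "l = dl n" using ln1[OF J l] \<open>l n = 0 \<or> l n = 1\<close> by simp
     hence "supp l = {n}" by simp
     hence "j = n" using j by simp
     thus ?thesis using \<open>l = dl n\<close> by simp
    qed
    thus ?thesis
     using h2_res[OF dj one x oU2[OF fll] le] True by (auto simp: h2_def)
   next
    case False
    have sub: "US U2 l \<subseteq> Wc" using h2_mid(2)[OF J l] False by simp
    have "res F O' (US U2 l) (a 1 x) = res F Wc (US U2 l) (c' (l n) 1 x)"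
     using res_res[OF s1(1,7) oU2[OF fll] sub _ as[OF one x]] s1(10) c1[OF ln x] ca[OF one x] by auto
    moreover have "res F Vb (US U2 l) (b 1 x) = res F Wc (US U2 l) (c' (l n) 1 x)"
     using res_res[OF s1(4,7) oU2[OF fll] sub _ bs[OF one x]] s1(10) c1[OF ln x] c1[OF one x] cb[OF one x] by auto
    ultimately show ?thesis
     using h2_res[OF dj one x oU2[OF fll] le] h2_mid(1)[OF J l] False by (simp add: dl_def)
   qed
   thus "h l (1, x) = res F (U2 j) (US U2 l) (h (dl j) (1, x))"
    by (simp add: h_def)
  qed
 next
  fix J l t x assume J: "J \<in> fins {..<n}" and l: "l \<in> simp J" and t: "t \<in> {0..1::real}" and x: "x \<in> cube k"
  have ln: "l n = 0" using J l by (auto simp: fins_def simp_def supp_def)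
  show "h l (t, x) = res F O' (US U2 l) (a (max 0 (2 * t - 1)) x)"
  proof (cases "t \<le> 1 / 2")
   case True
   have "h l (t, x) = h1 l (1, x)"
    using True res_id[OF oU2[OF fins_supp[OF mono[OF J] l]] cpx_in[OF c1h mono[OF J] l, of "(2 * t, x)"]] t x ln
    by (simp add: h_def h1_triv)
   also have "\<dots> = h2 l (0, x)"
    using h20[OF mono[OF J] l x] res_id[OF oU2[OF fins_supp[OF mono[OF J] l]] cpx_in[OF c1h mono[OF J] l, of "(1, x)"]] x by simp
   finally show ?thesis using True ln by (simp add: h2_def)
  next
   case False
   thus ?thesis using ln by (simp add: h_def h2_def)
  qed
 next
  fix t :: real assume "t \<in> {0..1}"
  thus "R (\<lambda>x. res F ?UA (X interior_of ?A) (ga x)) (\<lambda>x. res F O' (X interior_of ?A) (a t x))" using Ra by blast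
 qed (use U2 U2O s1 sa in auto)
qed

end

lemma UU_cong: "(\<And>i. i \<in> J \<Longrightarrow> U i = U' i) \<Longrightarrow> UU U J = UU U' J"
 by (simp add: UU_def)

lemma UU_cong_fins: "(\<And>i. i \<in> I \<Longrightarrow> U i = U' i) \<Longrightarrow> J \<in> fins I \<Longrightarrow> UU U J = UU U' J"
 by (rule UU_cong) (auto simp: fins_def)

lemma topspace_compact_open: "topspace (compact_open_topology Y Z) = continuous_maps Y Z"
proof -
 have "continuous_maps Y Z \<in> {{f \<in> continuous_maps Y Z. f ` K \<subseteq> G} | K G. compactin Y K \<and> openin Z G}"
  by (intro CollectI exI[of _ "{}"]) auto
 thus ?thesis unfolding compact_open_topology_def topology_generated_by_topspace by blast
qed

lemma openin_compact_open:
 "compactin Y K \<Longrightarrow> openin Z G \<Longrightarrow> openin (compact_open_topology Y Z) {f \<in> continuous_maps Y Z. f ` K \<subseteq> G}"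
 unfolding compact_open_topology_def by (rule topology_generated_by_Basis) blast

lemma continuous_maps_restrict:
 "continuous_map Y Z f \<Longrightarrow> restrict f (topspace Y) \<in> continuous_maps Y Z"
 unfolding continuous_maps_def by (auto intro: continuous_map_eq)

context space_sheaf
begin

lemma cpx_cong_sets:
 assumes e: "\<And>i. i \<in> I \<Longrightarrow> U i = U' i" and c: "cpx I U T f"
 shows "cpx I U' T f"
 unfolding cpx_def
proof (intro conjI ballI)
 have eq: "UU U J = UU U' J" if "J \<in> fins I" for J by (rule UU_cong_fins[OF e that])
 fix J assume J: "J \<in> fins I"
 show "cmap (simp J \<times> T) (sec F (UU U' J)) (\<lambda>(l, x). res F (US U' l) (UU U' J) (f l x))"
  by (rule continuous_map_eq[OF cpx_continuous[OF c J, unfolded eq[OF J]]]) (use eq[OF fins_supp[OF J]] in auto)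
 fix l x assume "l \<in> simp J" "x \<in> T"
 thus "f l x \<in> sections (US U' l)" using cpx_in[OF c J] eq[OF fins_supp[OF J]] by simp
qed (use e c in \<open>auto simp: cpx_def\<close>)

lemma htpy_cong_sets:
 assumes e: "\<And>i. i \<in> I \<Longrightarrow> U' i = V' i" and c: "htpy I U U' T S f h"
 shows "htpy I U V' T S f h"
proof (rule htpyI)
 show "V' i \<subseteq> U i" if "i \<in> I" for i using htpyD(1)[OF c that] e[OF that] by simp
 show "cpx I V' ({0..1} \<times> T) h" by (rule cpx_cong_sets[OF e htpyD(2)[OF c]])
 fix J l x assume a: "J \<in> fins I" "l \<in> simp J" "x \<in> T"
 have "US U' l = US V' l" by (rule UU_cong_fins[OF e fins_supp[OF a(1,2)]])
 thus "h l (0, x) = res F (US U l) (US V' l) (f l x)"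
  using htpyD(3)[OF c a] by simp
qed (rule htpyD(4)[OF c])

lemma cst_cong_sets:
 assumes e: "\<And>i. i \<in> I \<Longrightarrow> U i = U' i" and c: "cst I U f x"
 shows "cst I U' f x"
 unfolding cst_def
proof (intro ballI)
 fix J l j assume a: "J \<in> fins I" "l \<in> simp J" "j \<in> supp l"
 have "US U l = US U' l" by (rule UU_cong_fins[OF e fins_supp[OF a(1,2)]])
 moreover have "U j = U' j" using a supp_simp(1)[OF a(2)] by (intro e) (auto simp: fins_def)
 ultimately show "f l x = res F (U' j) (US U' l) (f (dl j) x)"
  using cstD[OF c a] by simp
qed

lemma glueable_cong: "(\<And>i. i < n \<Longrightarrow> A i = B i) \<Longrightarrow> glueable n A \<Longrightarrow> glueable n B"
 unfolding glueable_def by simp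

lemma htpy_end:
 assumes h: "htpy I U U' T S f h" and f: "cpx I U T f" and S: "S \<subseteq> T"
 shows "cpx I U' T (\<lambda>l x. h l (1, x))"
  and "\<And>x. x \<in> S \<Longrightarrow> cst I U f x \<Longrightarrow> cst I U' (\<lambda>l x. h l (1, x)) x"
proof -
 show "cpx I U' T (\<lambda>l x. h l (1, x))"
  by (rule cpx_param[OF htpyD(2)[OF h], where g="\<lambda>x. (1, x)"]) (auto intro!: continuous_intros)
 fix x assume x: "x \<in> S" "cst I U f x"
 have xT: "x \<in> T" using x S by blast
 have "cst I U' (\<lambda>l x. res F (US U l) (US U' l) (f l x)) x"
  by (rule cst_restrict[OF f x(2) xT]) (use cpx_open[OF htpyD(2)[OF h]] htpyD(1)[OF h] in auto)
 thus "cst I U' (\<lambda>l x. h l (1, x)) x"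
 proof (rule cst_cong)
  fix J l assume a: "J \<in> fins I" "l \<in> simp J"
  show "res F (US U l) (US U' l) (f l x) = h l (1, x)"
   using htpyD(3)[OF h a xT] htpyD(4)[OF h a x(1), of 1] by simp
 qed
qed

text \<open>The hypothesis on the first \<open>n\<close> sets makes the face \<open>{..<n}\<close>
  constant. Extended to all simplices by \<open>htpy_extend\<close>, this deformation prepares the
  complex for \<open>glue_step\<close>, which deals with the simplices that contain
  \<open>n\<close>.\<close>

lemma glueable_Suc:
 assumes X: "Hausdorff_space X" and n: "0 < n"
  and A: "\<And>i. i \<le> n \<Longrightarrow> compactin X (A i)"
  and P: "\<And>k. flexible_with (\<lambda>_ _. True) k (\<Union>i<n. A i) (A n)"
  and G: "glueable n A" and G': "glueable n (\<lambda>i. A i \<inter> A n)"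
 shows "glueable (Suc n) A"
 unfolding glueable_def lessThan_Suc_atMost less_Suc_eq_le
proof (intro allI impI, elim conjE)
 fix k U f assume AU: "\<forall>i\<le>n. A i \<subseteq> U i" and f: "cpx {..n} U (cube k) f"
  and bd: "\<forall>x\<in>cube_bd k. cst {..n} U f x"
 have f': "cpx {..<n} U (cube k) f" by (rule cpx_param[OF f, where g="\<lambda>x. x"]) (auto intro: continuous_intros)
 have "\<forall>i<n. A i \<subseteq> U i" using AU by simp
 moreover have "\<forall>x\<in>cube_bd k. cst {..<n} U f x"
 proof
  fix x assume "x \<in> cube_bd k"
  hence "cst {..n} U f x" using bd by blast
  thus "cst {..<n} U f x" by (rule cst_mono) auto
 qed
 ultimately obtain U0 H where U0: "\<forall>i<n. A i \<subseteq> U0 i"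
  and H: "htpy {..<n} U U0 (cube k) (cube_bd k) f H"
  and cH: "\<forall>x\<in>cube k. cst {..<n} U0 (\<lambda>l x. H l (1, x)) x"
  using G[unfolded glueable_def, rule_format, of U k f] f' by blast
 define U1 where "U1 = (\<lambda>i. if i < n then U0 i else U i)"
 have H1: "htpy {..<n} U U1 (cube k) (cube_bd k) f H"
  by (rule htpy_cong_sets[OF _ H]) (simp add: U1_def)
 obtain h1 where h1: "htpy {..n} U U1 (cube k) (cube_bd k) f h1"
  and h1H: "\<And>J l x t. \<lbrakk>J \<in> fins {..<n}; l \<in> simp J; x \<in> cube k; t \<in> {0..1}\<rbrakk> \<Longrightarrow> h1 l (t, x) = H l (max 0 (2 * t - 1), x)"
 proof (rule htpy_extend[OF f _ _ htpyD(2)[OF H1], where S="cube_bd k"])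
  show "U1 i = U i" if "i \<in> {..n} - {..<n}" for i using that by (simp add: U1_def)
  show "cst {..n} U f x" if "x \<in> cube_bd k" for x using that bd by blast
  show "U1 i \<subseteq> U i" if "i \<in> {..<n}" for i by (rule htpyD(1)[OF H1 that])
  show "H l (0, x) = res F (US U l) (US U1 l) (f l x)"
   if "J \<in> fins {..<n}" "l \<in> simp J" "x \<in> cube k" for J l x by (rule htpyD(3)[OF H1 that])
  show "H l (t, x) = H l (0, x)"
   if "J \<in> fins {..<n}" "l \<in> simp J" "x \<in> cube_bd k" "t \<in> {0..1}" for J l x t by (rule htpyD(4)[OF H1 that])
  show "cube_bd k \<subseteq> cube k" by (rule cube_bd_subset)
 qed auto
 note f1 = htpy_end[OF h1 f cube_bd_subset]
 have c1: "cst {..<n} U1 (\<lambda>l x. h1 l (1, x)) x" if x: "x \<in> cube k" for x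
 proof -
  have "cst {..<n} U1 (\<lambda>l x. H l (1, x)) x"
   by (rule cst_cong_sets[OF _ bspec[OF cH x]]) (simp add: U1_def)
  thus ?thesis by (rule cst_cong) (use h1H[OF _ _ x, of _ _ 1] in simp)
 qed
 have AU1: "A i \<subseteq> U1 i" if "i \<le> n" for i using that U0 AU by (simp add: U1_def)
 obtain U2 h2 where U2: "\<And>i. i \<le> n \<Longrightarrow> A i \<subseteq> U2 i"
  and h2: "htpy {..n} U1 U2 (cube k) (cube_bd k) (\<lambda>l x. h1 l (1, x)) h2"
  and c2: "\<And>x. x \<in> cube k \<Longrightarrow> cst {..n} U2 (\<lambda>l x. h2 l (1, x)) x"
  by (rule glue_step[OF X n A P G' f1(1) AU1 f1(2) c1]) (use bd in blast)+
 show "\<exists>U' h. (\<forall>i\<le>n. A i \<subseteq> U' i) \<and> htpy {..n} U U' (cube k) (cube_bd k) f h \<and>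
   (\<forall>x\<in>cube k. cst {..n} U' (\<lambda>l x. h l (1, x)) x)"
 proof (intro exI conjI ballI allI impI)
  show "htpy {..n} U U2 (cube k) (cube_bd k) f (\<lambda>l (t::real, x). if t \<le> 1 / 2
    then res F (US U1 l) (US U2 l) (h1 l (2 * t, x)) else h2 l (2 * t - 1, x))"
   by (rule htpy_trans[OF h1 h2 f cube_bd_subset])
  show "cst {..n} U2 (\<lambda>l x. (\<lambda>(t::real, x). if t \<le> 1 / 2
    then res F (US U1 l) (US U2 l) (h1 l (2 * t, x)) else h2 l (2 * t - 1, x)) (1, x)) x" if "x \<in> cube k" for x
   by (rule cst_cong[OF c2[OF that]]) simp
 qed (use U2 in blast)
qed

subsection \<open>Flexible pairs on cubes\<close>

text \<open>A homeomorphism between ball and cube that matches the boundaries carries data one way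
  and solutions back. The relation \<open>e\<close> is pointwise, so it is preserved at
  corresponding points.\<close>

lemma flexible_transfer:
 assumes hg: "homeomorphism (disk_set k) (cube k) h g" "h ` disk_boundary k = cube_bd k"
  and AB: "compactin X A" "compactin X B"
  and P: "\<And>U V W a b c. flexibility_data X F A B k U V W a b c \<Longrightarrow>
   \<exists>U' V' W' a' b' c'. flexibility_solution X F A B k U V W a b c U' V' W' a' b' c' \<and>
    (\<forall>t\<in>{0..1}. \<forall>y\<in>disk_set k. e (res F U (X interior_of A) (a y)) (res F U' (X interior_of A) (a' t y)))"
 shows "flexible_with (\<lambda>a0 a. \<forall>x\<in>cube k. e (a0 x) (a x)) k A B"
 unfolding flexible_with_def
proof (intro conjI AB allI impI)
 fix U V W a b c assume d: "pair_data k A B U V W a b c"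
 have hg': "continuous_on (disk_set k) h" "h ` disk_set k \<subseteq> cube k" "continuous_on (cube k) g" "g ` cube k \<subseteq> disk_set k"
  and h_g: "\<And>x. x \<in> cube k \<Longrightarrow> h (g x) = x" and g_h: "\<And>y. y \<in> disk_set k \<Longrightarrow> g (h y) = y"
  using hg(1) unfolding homeomorphism_def by auto
 have td: "topspace (disk k) = disk_set k" by (simp add: disk_eq)
 have hb: "h y \<in> cube_bd k" if "y \<in> disk_boundary k" for y using that hg(2) by blast
 have gb: "g x \<in> disk_boundary k" if x: "x \<in> cube_bd k" for x
 proof -
  obtain y where "y \<in> disk_boundary k" "x = h y" using x hg(2) by blast
  thus ?thesis using g_h disk_boundary_subset by fastforce
 qed
 have hi: "h y \<in> cube k" if "y \<in> disk_set k" for y using that hg'(2) by blast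
 have gi: "g x \<in> disk_set k" if "x \<in> cube k" for x using that hg'(4) by blast
 have d': "openin X U" "A \<subseteq> U" "openin X V" "B \<subseteq> V" "openin X W" "A \<inter> B \<subseteq> W" "W \<subseteq> U \<inter> V"
  "cmap (cube k) (sec F U) a"
  "cmap (cube k) (sec F V) b"
  "cmap (cyl k) (sec F W) (\<lambda>(s, x). c s x)"
  "\<forall>x\<in>cube k. c 0 x = res F U W (a x) \<and> c 1 x = res F V W (b x)"
  "\<forall>s\<in>{0..1}. \<forall>x\<in>cube_bd k. c s x = c 0 x"
  using d unfolding pair_data_def by (elim conjE; blast)+
 have fd: "flexibility_data X F A B k U V W (\<lambda>y. a (h y)) (\<lambda>y. b (h y)) (\<lambda>s y. c s (h y))"
  unfolding flexibility_data_def td unfolding disk_eq prod_topology_subtopology_eu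
 proof (intro conjI d'(1-7))
  show "cmap (disk_set k) (sec F U) (\<lambda>y. a (h y))"
   by (rule cmap_compose[OF d'(8) hg'(1,2)])
  show "cmap (disk_set k) (sec F V) (\<lambda>y. b (h y))"
   by (rule cmap_compose[OF d'(9) hg'(1,2)])
  have "cmap ({0..1} \<times> disk_set k) (sec F W) (\<lambda>z. (\<lambda>(s, x). c s x) (fst z, h (snd z)))"
   by (rule cmap_compose[OF d'(10)])
    (use hi in \<open>auto intro!: continuous_on_Pair continuous_on_fst continuous_on_id
     continuous_on_compose2[OF hg'(1) continuous_on_snd[OF continuous_on_id]]\<close>)
  thus "cmap ({0..1} \<times> disk_set k) (sec F W) (\<lambda>(s, x). c s (h x))"
   by (simp add: split_def)
  show "\<forall>y\<in>disk_set k. c 0 (h y) = res F U W (a (h y)) \<and> c 1 (h y) = res F V W (b (h y))"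
   using d'(11) hi by blast
  show "\<forall>s\<in>{0..1}. \<forall>y\<in>disk_boundary k. c s (h y) = c 0 (h y)"
   using d'(12) hb by blast
 qed
 obtain U' V' W' a' b' c' where s: "flexibility_solution X F A B k U V W (\<lambda>y. a (h y)) (\<lambda>y. b (h y)) (\<lambda>s y. c s (h y)) U' V' W' a' b' c'"
  and e: "\<forall>t\<in>{0..1}. \<forall>y\<in>disk_set k. e (res F U (X interior_of A) (a (h y))) (res F U' (X interior_of A) (a' t y))"
  using P[OF fd] by (elim exE conjE)
 have s': "openin X U'" "A \<subseteq> U'" "U' \<subseteq> U" "openin X V'" "B \<subseteq> V'" "V' \<subseteq> V"
  "openin X W'" "A \<inter> B \<subseteq> W'" "W' \<subseteq> W" "W' \<subseteq> U' \<inter> V'"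
  "cmap ({0..1::real} \<times> disk_set k) (sec F U') (\<lambda>(t, x). a' t x)"
  "cmap ({0..1::real} \<times> disk_set k) (sec F V') (\<lambda>(t, x). b' t x)"
  "cmap ({0..1::real} \<times> {0..1::real} \<times> disk_set k) (sec F W') (\<lambda>(s, t, x). c' s t x)"
  "\<forall>x\<in>disk_set k. a' 0 x = res F U U' (a (h x)) \<and> b' 0 x = res F V V' (b (h x))"
  "\<forall>s\<in>{0..1}. \<forall>x\<in>disk_set k. c' s 0 x = res F W W' (c s (h x))"
  "\<forall>t\<in>{0..1}. \<forall>x\<in>disk_set k. c' 0 t x = res F U' W' (a' t x) \<and> c' 1 t x = res F V' W' (b' t x)"
  "\<forall>t\<in>{0..1}. \<forall>x\<in>disk_boundary k. a' t x = a' 0 x \<and> b' t x = b' 0 x"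
  "\<forall>s\<in>{0..1}. \<forall>t\<in>{0..1}. \<forall>x\<in>disk_boundary k. c' s t x = c' s 0 x"
  "\<forall>s\<in>{0..1}. \<forall>x\<in>disk_set k. c' s 1 x = c' 0 1 x"
  using s unfolding flexibility_solution_def td unfolding disk_eq prod_topology_subtopology_eu
  by (elim conjE; blast)+
 have ps: "pair_solution k A B U V W a b c U' V' W' (\<lambda>t x. a' t (g x)) (\<lambda>t x. b' t (g x)) (\<lambda>s t x. c' s t (g x))"
  unfolding pair_solution_def
 proof (intro conjI s'(1-10))
  have "cmap (cyl k) (sec F U') (\<lambda>z. (\<lambda>(s, x). a' s x) (fst z, g (snd z)))"
   by (rule cmap_compose[OF s'(11)])
    (use gi in \<open>auto intro!: continuous_on_Pair continuous_on_fst continuous_on_id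
     continuous_on_compose2[OF hg'(3) continuous_on_snd[OF continuous_on_id]]\<close>)
  thus "cmap (cyl k) (sec F U') (\<lambda>(t, x). a' t (g x))"
   by (simp add: split_def)
  have "cmap (cyl k) (sec F V') (\<lambda>z. (\<lambda>(s, x). b' s x) (fst z, g (snd z)))"
   by (rule cmap_compose[OF s'(12)])
    (use gi in \<open>auto intro!: continuous_on_Pair continuous_on_fst continuous_on_id
     continuous_on_compose2[OF hg'(3) continuous_on_snd[OF continuous_on_id]]\<close>)
  thus "cmap (cyl k) (sec F V') (\<lambda>(t, x). b' t (g x))"
   by (simp add: split_def)
  have "cmap ({0..1} \<times> cyl k) (sec F W') (\<lambda>z. (\<lambda>(s, t, x). c' s t x) (fst z, fst (snd z), g (snd (snd z))))"
   by (rule cmap_compose[OF s'(13)])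
    (use gi in \<open>auto intro!: continuous_on_Pair continuous_on_fst continuous_on_snd continuous_on_id
     continuous_on_compose2[OF hg'(3) continuous_on_snd[OF continuous_on_snd[OF continuous_on_id]]]\<close>)
  thus "cmap ({0..1} \<times> cyl k) (sec F W') (\<lambda>(s, t, x). c' s t (g x))"
   by (simp add: split_def)
  show "\<forall>x\<in>cube k. a' 0 (g x) = res F U U' (a x) \<and> b' 0 (g x) = res F V V' (b x)"
   using s'(14) gi h_g by simp
  show "\<forall>s\<in>{0..1}. \<forall>x\<in>cube k. c' s 0 (g x) = res F W W' (c s x)"
   using s'(15) gi h_g by simp
  show "\<forall>t\<in>{0..1}. \<forall>x\<in>cube k. c' 0 t (g x) = res F U' W' (a' t (g x)) \<and> c' 1 t (g x) = res F V' W' (b' t (g x))"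
   using s'(16) gi by blast
  show "\<forall>t\<in>{0..1}. \<forall>x\<in>cube_bd k. a' t (g x) = a' 0 (g x) \<and> b' t (g x) = b' 0 (g x)"
   using s'(17) gb by blast
  show "\<forall>s\<in>{0..1}. \<forall>t\<in>{0..1}. \<forall>x\<in>cube_bd k. c' s t (g x) = c' s 0 (g x)"
   using s'(18) gb by blast
  show "\<forall>s\<in>{0..1}. \<forall>x\<in>cube k. c' s 1 (g x) = c' 0 1 (g x)"
   using s'(19) gi by blast
 qed
 show "\<exists>U' V' W' a' b' c'. pair_solution k A B U V W a b c U' V' W' a' b' c' \<and>
   (\<forall>t\<in>{0..1}. \<forall>x\<in>cube k. e (res F U (X interior_of A) (a x)) (res F U' (X interior_of A) (a' t x)))"
 proof (intro exI conjI, rule ps, intro ballI)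
  fix t x assume "t \<in> {0..1::real}" "x \<in> cube k"
  thus "e (res F U (X interior_of A) (a x)) (res F U' (X interior_of A) (a' t (g x)))"
   using e gi h_g by fastforce
 qed
qed

lemma flexibility_data_restricted:
 assumes "flexibility_data X F A B k U V W a b c"
 shows "continuous_map (disk k) (sec F (X interior_of A)) (\<lambda>y. res F U (X interior_of A) (a y))"
proof (rule cmap_res)
 have "A \<subseteq> U" using assms by (simp add: flexibility_data_def)
 thus "X interior_of A \<subseteq> U" by (rule order_trans[OF interior_of_subset])
qed (use assms in \<open>auto simp: flexibility_data_def\<close>)

lemma weakly_flexible_with:
 assumes P: "weakly_flexible_pair X F A B"
  and N: "\<And>a0. continuous_map (disk k) (sec F (X interior_of A)) a0 \<Longrightarrow>
   \<exists>N. neighbourhood_of (compact_open_topology (disk k) (sec F (X interior_of A))) (restrict a0 (disk_set k)) N \<and>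
    (\<forall>p\<in>N. \<forall>y\<in>disk_set k. e (a0 y) (p y))"
 shows "flexible_with (\<lambda>a0 a. \<forall>x\<in>cube k. e (a0 x) (a x)) k A B"
proof -
 obtain h g where hg: "homeomorphism (disk_set k) (cube k) h g" "h ` disk_boundary k = cube_bd k"
  using cell_pair_cube unfolding cell_pair_def by blast
 have td: "topspace (disk k) = disk_set k" by (simp add: disk_eq)
 show ?thesis
 proof (rule flexible_transfer[OF hg])
  show "compactin X A" "compactin X B" using P by (simp_all add: weakly_flexible_pair_def)
  fix U V W a b c assume d: "flexibility_data X F A B k U V W a b c"
  define a0 where "a0 = (\<lambda>y. res F U (X interior_of A) (a y))"
  obtain N where N': "neighbourhood_of (compact_open_topology (disk k) (sec F (X interior_of A))) (restrict a0 (disk_set k)) N"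
   "\<forall>p\<in>N. \<forall>y\<in>disk_set k. e (a0 y) (p y)"
   using N[OF flexibility_data_restricted[OF d]] unfolding a0_def by blast
  have "restrict a0 (disk_set k) = restrict (res F U (X interior_of A) \<circ> a) (topspace (disk k))"
   unfolding td a0_def by auto
  then obtain U' V' W' a' b' c' where s: "flexibility_solution X F A B k U V W a b c U' V' W' a' b' c'"
   "\<forall>t\<in>{0..1}. restrict (res F U' (X interior_of A) \<circ> a' t) (topspace (disk k)) \<in> N"
   using P d N'(1) unfolding weakly_flexible_pair_def by metis
  have "e (a0 y) (res F U' (X interior_of A) (a' t y))" if "t \<in> {0..1}" "y \<in> disk_set k" for t y
   using bspec[OF bspec[OF N'(2) bspec[OF s(2) that(1)]] that(2)] that(2) by (simp add: td)
  thus "\<exists>U' V' W' a' b' c'. flexibility_solution X F A B k U V W a b c U' V' W' a' b' c' \<and>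
    (\<forall>t\<in>{0..1}. \<forall>y\<in>disk_set k. e (res F U (X interior_of A) (a y)) (res F U' (X interior_of A) (a' t y)))"
   using s(1) unfolding a0_def by blast
 qed
qed

lemma weakly_flexible_with_True:
 assumes "weakly_flexible_pair X F A B" shows "flexible_with (\<lambda>_ _. True) k A B"
proof -
 have "flexible_with (\<lambda>a0 a. \<forall>x\<in>cube k. (\<lambda>_ _. True) (a0 x) (a x)) k A B"
 proof (rule weakly_flexible_with[OF assms])
  fix a0 assume a: "continuous_map (disk k) (sec F (X interior_of A)) a0"
  have "restrict a0 (disk_set k) \<in> continuous_maps (disk k) (sec F (X interior_of A))"
   using continuous_maps_restrict[OF a] by (simp add: disk_eq)
  thus "\<exists>N. neighbourhood_of (compact_open_topology (disk k) (sec F (X interior_of A))) (restrict a0 (disk_set k)) N \<and>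
    (\<forall>p\<in>N. \<forall>y\<in>disk_set k. (\<lambda>_ _. True) (a0 y) (p y))"
   unfolding neighbourhood_of_def
   by (intro exI[of _ "continuous_maps (disk k) (sec F (X interior_of A))"])
    (metis openin_topspace order_refl topspace_compact_open)
 qed
 thus ?thesis by simp
qed

lemma ordered_flexible_pair_imp_weakly: "ordered_flexible_pair X F A B \<Longrightarrow> weakly_flexible_pair X F A B"
 unfolding ordered_flexible_pair_def weakly_flexible_pair_def by meson

lemma ordered_flexible_with:
 assumes P: "ordered_flexible_pair X F A B"
 shows "flexible_with (\<lambda>a0 a. \<forall>x\<in>cube k. a x = a0 x) k A B"
proof -
 obtain h g where hg: "homeomorphism (disk_set k) (cube k) h g" "h ` disk_boundary k = cube_bd k"
  using cell_pair_cube unfolding cell_pair_def by blast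
 have td: "topspace (disk k) = disk_set k" by (simp add: disk_eq)
 show ?thesis
 proof (rule flexible_transfer[OF hg, where e="\<lambda>z w. w = z"])
  show "compactin X A" "compactin X B" using P by (simp_all add: ordered_flexible_pair_def)
  fix U V W a b c assume d: "flexibility_data X F A B k U V W a b c"
  let ?Y = "compact_open_topology (disk k) (sec F (X interior_of A))"
  let ?r = "restrict (res F U (X interior_of A) \<circ> a) (topspace (disk k))"
  have "?r \<in> continuous_maps (disk k) (sec F (X interior_of A))"
   using continuous_maps_restrict[OF flexibility_data_restricted[OF d]] by (simp add: o_def)
  \<comment> \<open>The whole mapping space serves as neighbourhood, as the ordered condition fixes
    the restriction to the interior exactly.\<close>
  hence "neighbourhood_of ?Y ?r (topspace ?Y)"
   unfolding neighbourhood_of_def topspace_compact_open by (metis openin_topspace order_refl topspace_compact_open)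
  then obtain U' V' W' a' b' c' where s: "flexibility_solution X F A B k U V W a b c U' V' W' a' b' c'"
   "\<forall>t\<in>{0..1}. \<forall>x\<in>topspace (disk k). res F U' (X interior_of A) (a' t x) = res F U' (X interior_of A) (a' 0 x)"
   using P d unfolding ordered_flexible_pair_def by metis
  have "res F U' (X interior_of A) (a' t y) = res F U (X interior_of A) (a y)" if t: "t \<in> {0..1}" "y \<in> disk_set k" for t y
  proof -
   have U: "openin X U'" "openin X U" "A \<subseteq> U'" "U' \<subseteq> U" "a' 0 y = res F U U' (a y)" "a y \<in> sections U"
    using s(1) d t(2) unfolding flexibility_solution_def flexibility_data_def continuous_map_def td by auto
   have i: "X interior_of A \<subseteq> U'" by (rule order_trans[OF interior_of_subset U(3)])
   have "res F U' (X interior_of A) (a' t y) = res F U' (X interior_of A) (res F U U' (a y))"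
    using s(2) t U(5) unfolding td by simp
   thus ?thesis using res_res[OF U(2,1) openin_interior_of i U(4,6)] by simp
  qed
  thus "\<exists>U' V' W' a' b' c'. flexibility_solution X F A B k U V W a b c U' V' W' a' b' c' \<and>
    (\<forall>t\<in>{0..1}. \<forall>y\<in>disk_set k. res F U' (X interior_of A) (a' t y) = res F U (X interior_of A) (a y))"
   using s(1) by blast
 qed
qed

text \<open>The two shorter strings of the recursive definition supply the two hypotheses of
  \<open>glueable_Suc\<close> on \<open>n\<close> sets: the first sets themselves and their
  intersections with the last one.\<close>

lemma flexible_string_glueable:
 assumes X: "Hausdorff_space X" and PW: "\<And>A B. P A B \<Longrightarrow> weakly_flexible_pair X F A B"
  and "flexible_string X P As"
 shows "glueable (length As) ((!) As) \<and> (\<forall>A\<in>set As. compactin X A)"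
 using assms(3)
proof induction
 case (pair A B)
 have "glueable (Suc 1) ((!) [A, B])"
 proof (rule glueable_Suc[OF X])
  fix i :: nat assume "i \<le> 1"
  thus "compactin X ([A, B] ! i)" using pair by (cases i) auto
 next
  fix k show "flexible_with (\<lambda>_ _. True) k (\<Union>i<1. [A, B] ! i) ([A, B] ! 1)"
   using weakly_flexible_with_True[OF PW[OF pair(3)]] by (simp add: lessThan_Suc)
 qed (simp_all only: glueable_1 zero_less_one)
 thus ?case using pair by simp
next
 case (snoc B As)
 let ?n = "length As"
 have nth: "(As @ [B]) ! i = As ! i" if "i < ?n" for i using that by (simp add: nth_append)
 have pos: "0 < ?n" using snoc(3) by (cases rule: flexible_string.cases) auto
 have "glueable (Suc ?n) ((!) (As @ [B]))"
 proof (rule glueable_Suc[OF X pos])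
  fix i assume "i \<le> ?n"
  thus "compactin X ((As @ [B]) ! i)"
   using snoc by (cases "i = ?n") (auto simp: nth)
 next
  fix k
  have "(\<Union>i<?n. (As @ [B]) ! i) = \<Union>(set As)"
   using nth by (auto simp: set_conv_nth)
  thus "flexible_with (\<lambda>_ _. True) k (\<Union>i<?n. (As @ [B]) ! i) ((As @ [B]) ! ?n)"
   using weakly_flexible_with_True[OF PW[OF snoc(2)]] by simp
 next
  show "glueable ?n ((!) (As @ [B]))"
   by (rule glueable_cong[OF _ conjunct1[OF snoc.IH(1)]]) (simp add: nth)
  show "glueable ?n (\<lambda>i. (As @ [B]) ! i \<inter> (As @ [B]) ! ?n)"
   by (rule glueable_cong[of _ "(!) (map (\<lambda>A. A \<inter> B) As)"]) (use snoc.IH(2) nth in auto)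
 qed
 thus ?case using snoc by simp
qed

text \<open>A string of two sets stems from the base case, which says nothing about intersections;
  hence the condition on the length.\<close>

lemma flexible_string_snocD:
 assumes "flexible_string X P (As @ [B])"
 shows "P (\<Union>(set As)) B" "length As \<noteq> 1 \<Longrightarrow> flexible_string X P (map (\<lambda>A. A \<inter> B) As)"
proof -
 have "P (\<Union>(set As)) B \<and> (length As \<noteq> 1 \<longrightarrow> flexible_string X P (map (\<lambda>A. A \<inter> B) As))"
  using assms
 proof (cases rule: flexible_string.cases)
  case (pair A B')
  hence "As = [A]" "B' = B" by (cases As; simp)+
  thus ?thesis using pair by simp
 next
  case (snoc B' As')
  thus ?thesis by simp
 qed
 thus "P (\<Union>(set As)) B" "length As \<noteq> 1 \<Longrightarrow> flexible_string X P (map (\<lambda>A. A \<inter> B) As)" by auto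
qed

end

section \<open>Gluing over infinitely many compact sets: stages and passage to the limit\<close>

definition tau :: "nat \<Rightarrow> real" where
 "tau n = 1 - 1 / 2 ^ n"

lemma tau_0 [simp]: "tau 0 = 0" and tau_nonneg: "0 \<le> tau n" and tau_less: "tau n < 1"
 and tau_Suc: "tau (Suc n) - tau n = 1 / 2 ^ Suc n"
 by (auto simp: tau_def divide_simps)

lemma tau_mono: "m \<le> n \<Longrightarrow> tau m \<le> tau n"
 by (simp add: tau_def frac_le power_increasing)

context space_sheaf
begin

lemma htpy_res:
 assumes h: "htpy I U V T S f h" and J: "J \<in> fins I" "l \<in> simp J" and x: "x \<in> T" and f: "cpx I U T f"
  and W: "openin X W" "W \<subseteq> US V l"
 shows "res F (US V l) W (h l (0, x)) = res F (US U l) W (f l x)"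
proof -
 have fl: "supp l \<in> fins I" by (rule fins_supp[OF J])
 have sub: "US V l \<subseteq> US U l"
  by (rule UU_mono, rule htpyD(1)[OF h]) (use fl in \<open>auto simp: fins_def\<close>)
 show ?thesis
  unfolding htpyD(3)[OF h J x]
  by (rule res_res[OF cpx_openUU[OF f fl] cpx_openUU[OF htpyD(2)[OF h] fl] W sub cpx_in[OF f J x]])
qed

text \<open>State after \<open>n\<close> steps: the homotopy has done its work by the time
  \<open>tau n\<close> and rests afterwards, and for \<open>M \<le> n\<close> the sets up to
  \<open>M\<close> are glued from the time \<open>tau M\<close> on. They stay glued during all later
  modifications. Since \<open>tau n < 1\<close>, time 1 is left to the limit.\<close>

definition stage where
 "stage (A :: nat \<Rightarrow> 'a set) U k f n V h \<longleftrightarrow> (\<forall>i. A i \<subseteq> V i) \<and>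
  htpy UNIV U V (cube k) (cube_bd k) f h \<and>
  (\<forall>M\<le>n. \<forall>s\<in>{tau M..1}. \<forall>x\<in>cube k. cst {..M} V h (s, x)) \<and>
  (\<forall>s\<in>{tau n..1}. \<forall>x\<in>cube k. \<forall>J\<in>fins UNIV. \<forall>l\<in>simp J. h l (s, x) = h l (1, x))"

text \<open>Up to the time \<open>tau n\<close> the next stage merely restricts the previous one.
  After it, \<open>E n M\<close> compares the sections that the two stages define over the core up
  to \<open>M\<close>. These sections are not part of a stage, so \<open>z\<close> and
  \<open>z'\<close> stand for whatever restricts to the vertex sections.\<close>

definition stage_step where
 "stage_step (A :: nat \<Rightarrow> 'a set) E k n V h V' h' \<longleftrightarrow> (\<forall>i. V' i \<subseteq> V i) \<and>
  (\<forall>s\<in>{0..tau n}. \<forall>x\<in>cube k. \<forall>J\<in>fins UNIV. \<forall>l\<in>simp J.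
    h' l (s, x) = res F (US V l) (US V' l) (h l (s, x))) \<and>
  (\<forall>M\<le>n. \<forall>s\<in>{tau n..1}. \<forall>x\<in>cube k. \<forall>z z'.
    (let I = core A M in z \<in> sections I \<and> z' \<in> sections I \<and>
    (\<forall>j\<le>M. res F I (I \<inter> V' j) z = res F (V j) (I \<inter> V' j) (h (dl j) (s, x)) \<and>
       res F I (I \<inter> V' j) z' = res F (V' j) (I \<inter> V' j) (h' (dl j) (s, x))) \<longrightarrow> E n M z z'))"

lemma stage_0:
 assumes "cpx UNIV U (cube k) f" "\<And>i. A i \<subseteq> U i"
 shows "stage A U k f 0 U (\<lambda>l z. f l (snd z))"
 unfolding stage_def
proof (intro conjI allI impI ballI)
 have c: "cpx UNIV U (cyl k) (\<lambda>l z. f l (snd z))"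
  by (rule cpx_param[OF assms(1)]) (auto intro!: continuous_intros)
 show "htpy UNIV U U (cube k) (cube_bd k) f (\<lambda>l z. f l (snd z))"
 proof (rule htpyI)
  fix J l x assume a: "J \<in> nfins" "l \<in> simp J" "x \<in> cube k"
  show "f l (snd (0::real, x)) = res F (US U l) (US U l) (f l x)"
   using res_id[OF cpx_openUU[OF assms(1) fins_supp[OF a(1,2)]] cpx_in[OF assms(1) a]] by simp
 qed (simp_all add: c)
 fix M s x assume a: "M \<le> (0::nat)" "s \<in> {tau M..1}" "x \<in> cube k"
 have "cpx {..M} U (cyl k) (\<lambda>l z. f l (snd z))"
  by (rule cpx_param[OF c, where g="\<lambda>x. x"]) (auto intro: continuous_intros)
 thus "cst {..M} U (\<lambda>l z. f l (snd z)) (s, x)"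
  by (rule cst_singleton[of _ _ _ _ 0]) (use a in auto)
qed (use assms(2) in auto)

text \<open>\<open>glue_step\<close> is applied to the end of stage \<open>n\<close>, and its
  deformation is run between \<open>tau n\<close> and \<open>tau (Suc n)\<close>. On the sets
  already glued it is the restriction of one homotopy \<open>a\<close> over a neighbourhood
  \<open>O'\<close> of their union; therefore they stay glued meanwhile, and the control of
  \<open>a\<close> passes to every smaller core.\<close>

lemma stage_Suc:
 assumes X: "Hausdorff_space X" and A: "\<And>i. compactin X (A i)"
  and P: "flexible_with R k (\<Union>i<Suc n. A i) (A (Suc n))"
  and G: "glueable (Suc n) (\<lambda>i. A i \<inter> A (Suc n))"
  and R: "\<And>a0 a M x. \<lbrakk>R a0 a; M \<le> n; x \<in> cube k\<rbrakk> \<Longrightarrow>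
   E n M (res F (core A n) (core A M) (a0 x))
    (res F (core A n) (core A M) (a x))"
  and f: "cpx UNIV U (cube k) f" and bd: "\<And>x. x \<in> cube_bd k \<Longrightarrow> cst UNIV U f x"
  and st: "stage A U k f n V h"
 shows "\<exists>V' h'. stage A U k f (Suc n) V' h' \<and> stage_step A E k n V h V' h'"
proof -
 define B where "B = (\<lambda>M. core A M)"
 have AV: "A i \<subseteq> V i" for i using st unfolding stage_def by blast
 have hV: "htpy UNIV U V (cube k) (cube_bd k) f h" using st unfolding stage_def by blast
 have hc: "cst {..M} V h (s, x)" if "M \<le> n" "s \<in> {tau M..1}" "x \<in> cube k" for M s x
  using st that unfolding stage_def by blast
 have he: "h l (s, x) = h l (1, x)" if "s \<in> {tau n..1}" "x \<in> cube k" "J \<in> fins UNIV" "l \<in> simp J" for s x J l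
  using st that unfolding stage_def by blast
 note h = htpyD(2)[OF hV]
 define f1 where "f1 = (\<lambda>l x. h l (1::real, x))"
 have f1: "cpx UNIV V (cube k) f1" unfolding f1_def by (rule htpy_end(1)[OF hV f cube_bd_subset])
 have f1b: "cst UNIV V f1 x" if "x \<in> cube_bd k" for x
  unfolding f1_def by (rule htpy_end(2)[OF hV f cube_bd_subset that bd[OF that]])
 have f1n: "cpx {..Suc n} V (cube k) f1" by (rule cpx_param[OF f1, where g="\<lambda>x. x"]) (auto intro: continuous_intros)
 have f1bn: "cst {..Suc n} V f1 x" if "x \<in> cube_bd k" for x by (rule cst_mono[OF f1b[OF that]]) simp
 have f1c: "cst {..<Suc n} V f1 x" if "x \<in> cube k" for x
  unfolding lessThan_Suc_atMost
  by (rule cst_cong[OF hc[OF order_refl _ that, of 1]]) (use tau_less[of n] in \<open>auto simp: f1_def\<close>)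
 obtain V1 H O' a0 a where V1: "\<And>i. i \<le> Suc n \<Longrightarrow> A i \<subseteq> V1 i"
  and H: "htpy {..Suc n} V V1 (cube k) (cube_bd k) f1 H"
  and Hc: "\<And>x. x \<in> cube k \<Longrightarrow> cst {..Suc n} V1 (\<lambda>l x. H l (1, x)) x"
  and O': "openin X O'" "(\<Union>i<Suc n. A i) \<subseteq> O'" "\<And>i. i < Suc n \<Longrightarrow> V1 i \<subseteq> O'"
  and a: "cmap (cyl k) (sec F O') (\<lambda>(t, x). a t x)"
  and Ha: "\<And>J l t x. \<lbrakk>J \<in> fins {..<Suc n}; l \<in> simp J; t \<in> {0..1}; x \<in> cube k\<rbrakk> \<Longrightarrow>
   H l (t, x) = res F O' (US V1 l) (a (max 0 (2 * t - 1)) x)"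
  and a0: "\<And>x. x \<in> cube k \<Longrightarrow> a0 x = res F O' (X interior_of (\<Union>i<Suc n. A i)) (a 0 x)"
  and Ra: "\<And>t. t \<in> {0..1} \<Longrightarrow> R a0 (\<lambda>x. res F O' (X interior_of (\<Union>i<Suc n. A i)) (a t x))"
  by (rule glue_step[OF X zero_less_Suc A P G f1n AV f1bn f1c]) blast+
 define V' where "V' = (\<lambda>i. if i \<le> Suc n then V1 i else V i)"
 have V'1: "V1 i = V' i" if "i \<in> {..Suc n}" for i using that by (simp add: V'_def)
 have H': "htpy {..Suc n} V V' (cube k) (cube_bd k) f1 H" by (rule htpy_cong_sets[OF V'1 H])
 obtain H1 where H1: "htpy UNIV V V' (cube k) (cube_bd k) f1 H1"
  and H1H: "\<And>J l x t. \<lbrakk>J \<in> fins {..Suc n}; l \<in> simp J; x \<in> cube k; t \<in> {0..1}\<rbrakk> \<Longrightarrow> H1 l (t, x) = H l (max 0 (2 * t - 1), x)"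
 proof (rule htpy_extend[OF f1 _ _ htpyD(2)[OF H'], where S="cube_bd k"])
  show "V' i = V i" if "i \<in> UNIV - {..Suc n}" for i using that by (simp add: V'_def)
  show "V' i \<subseteq> V i" if "i \<in> {..Suc n}" for i by (rule htpyD(1)[OF H' that])
  show "H l (0, x) = res F (US V l) (US V' l) (f1 l x)"
   if "J \<in> fins {..Suc n}" "l \<in> simp J" "x \<in> cube k" for J l x by (rule htpyD(3)[OF H' that])
  show "H l (t, x) = H l (0, x)"
   if "J \<in> fins {..Suc n}" "l \<in> simp J" "x \<in> cube_bd k" "t \<in> {0..1}" for J l x t by (rule htpyD(4)[OF H' that])
  show "cst UNIV V f1 x" if "x \<in> cube_bd k" for x by (rule f1b[OF that])
  show "cube_bd k \<subseteq> cube k" by (rule cube_bd_subset)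
 qed auto
 have V'V: "V' i \<subseteq> V i" for i by (rule htpyD(1)[OF H1 UNIV_I])
 have oV: "openin X (V i)" "openin X (V' i)" for i using cpx_open[OF h UNIV_I] cpx_open[OF htpyD(2)[OF H1] UNIV_I] by auto
 \<comment> \<open>Rescales the interval from \<open>tau n\<close> to \<open>tau (Suc n)\<close>, of
   length \<open>1 / 2 ^ Suc n\<close>, to the unit interval and is constant outside it.\<close>
 define tt where "tt = (\<lambda>s. max 0 (min 1 ((s - tau n) * 2 ^ Suc n)))"
 have tt: "tt s \<in> {0..1}" for s by (simp add: tt_def)
 have tt0: "tt (tau n) = 0" by (simp add: tt_def)
 have tt1: "tt s = 1" if "tau (Suc n) \<le> s" for s
 proof -
  have "1 / 2 ^ Suc n \<le> s - tau n" using that tau_Suc[of n] by simp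
  hence "1 \<le> (s - tau n) * 2 ^ Suc n" by (simp add: divide_simps)
  thus ?thesis by (simp add: tt_def)
 qed
 have ctt: "continuous_on S tt" for S unfolding tt_def by (intro continuous_intros)
 define h' where "h' = (\<lambda>l (s, x). if s \<le> tau n then res F (US V l) (US V' l) (h l (s, x)) else H1 l (tt s, x))"
 have h'lo: "h' l (s, x) = res F (US V l) (US V' l) (h l (s, x))" if "s \<le> tau n" for l s x
  using that by (simp add: h'_def)
 have h'hi: "h' l (s, x) = H1 l (tt s, x)" if "tau n \<le> s" "x \<in> cube k" "J \<in> fins UNIV" "l \<in> simp J" for l s x J
 proof (cases "s = tau n")
  case True
  have "h l (tau n, x) = f1 l x" unfolding f1_def by (rule he[OF _ that(2-4)]) (use tau_less[of n] in simp)
  thus ?thesis using htpyD(3)[OF H1 that(3,4,2)] by (simp add: True h'_def tt0)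
 next
  case False
  thus ?thesis using that(1) by (simp add: h'_def)
 qed
 have ch': "cpx UNIV V' (cyl k) h'"
 proof (rule cpx_paste_le[where a=fst and b="\<lambda>_. tau n"])
  have "cpx UNIV V' {z \<in> cyl k. fst z \<le> tau n} (\<lambda>l z. res F (US V l) (US V' l) (h l z))"
   by (rule cpx_restrict[OF cpx_param[OF h, where g="\<lambda>z. z"]]) (use oV V'V in \<open>auto intro: continuous_intros\<close>)
  thus "cpx UNIV V' {z \<in> cyl k. fst z \<le> tau n} h'"
   by (rule cpx_cong) (auto simp: h'lo)
  have "cpx UNIV V' {z \<in> cyl k. tau n \<le> fst z} (\<lambda>l z. H1 l (tt (fst z), snd z))"
  proof (rule cpx_param[OF htpyD(2)[OF H1]])
   show "continuous_on {z \<in> cyl k. tau n \<le> fst z} (\<lambda>z. (tt (fst z), snd z))"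
    by (intro continuous_on_Pair continuous_on_compose2[OF ctt[of UNIV] continuous_on_fst[OF continuous_on_id]] continuous_intros) auto
  qed (use tt in auto)
  thus "cpx UNIV V' {z \<in> cyl k. tau n \<le> fst z} h'"
   by (rule cpx_cong) (use h'hi in auto)
 qed (intro continuous_intros)+
 have fn: "J \<in> fins UNIV" if "J \<in> fins I" for J and I :: "nat set" using that by (simp add: fins_def)
 have hp: "htpy UNIV U V' (cube k) (cube_bd k) f h'"
 proof (rule htpyI)
  show "V' i \<subseteq> U i" for i using V'V[of i] htpyD(1)[OF hV, of i] by auto
  fix J l x assume J: "J \<in> nfins" and l: "l \<in> simp J"
  have fl: "supp l \<in> fins UNIV" by (rule fins_supp[OF J l])
  show "h' l (0, x) = res F (US U l) (US V' l) (f l x)" if x: "x \<in> cube k"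
   unfolding h'lo[OF tau_nonneg]
   by (rule htpy_res[OF hV J l x f cpx_openUU[OF ch' fl]]) (rule UU_mono[OF V'V])
  fix t :: real assume x: "x \<in> cube_bd k" and t: "t \<in> {0..1}"
  have xc: "x \<in> cube k" using x cube_bd_subset by blast
  show "h' l (t, x) = h' l (0, x)"
  proof (cases "t \<le> tau n")
   case True
   show ?thesis unfolding h'lo[OF True] h'lo[OF tau_nonneg] htpyD(4)[OF hV J l x t] ..
  next
   case False
   hence "h' l (t, x) = H1 l (tt t, x)" using h'hi[OF _ xc J l, of t] by simp
   also have "\<dots> = res F (US V l) (US V' l) (f1 l x)"
    using htpyD(4)[OF H1 J l x tt] htpyD(3)[OF H1 J l xc] by simp
   also have "f1 l x = h l (0, x)" unfolding f1_def by (rule htpyD(4)[OF hV J l x]) simp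
   finally show ?thesis unfolding h'lo[OF tau_nonneg] .
  qed
 qed (rule ch')
 have c': "cst {..M} V' h' (s, x)" if M: "M \<le> Suc n" and s: "s \<in> {tau M..1}" and x: "x \<in> cube k" for M s x
 proof (cases "M = Suc n")
  case True
  have "cst {..Suc n} V' (\<lambda>l x. H l (1, x)) x" by (rule cst_cong_sets[OF V'1 Hc[OF x]])
  hence "cst {..Suc n} V' h' (s, x)"
  proof (rule cst_cong)
   fix J l assume J: "J \<in> fins {..Suc n}" and l: "l \<in> simp J"
   have "tau n \<le> s" using s True tau_mono[of n "Suc n"] by simp
   hence "h' l (s, x) = H1 l (1, x)" using h'hi[OF _ x fn[OF J] l] tt1[of s] s True by simp
   thus "H l (1, x) = h' l (s, x)" using H1H[OF J l x, of 1] by simp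
  qed
  thus ?thesis by (simp add: True)
 next
  case False
  hence Mn: "M \<le> n" using M by simp
  show ?thesis
  proof (cases "s \<le> tau n")
   case True
   have hM: "cpx {..M} V (cyl k) h" by (rule cpx_param[OF h, where g="\<lambda>x. x"]) (auto intro: continuous_intros)
   have "s \<in> {0..1}" using s tau_nonneg[of M] by simp
   hence "cst {..M} V' (\<lambda>l z. res F (US V l) (US V' l) (h l z)) (s, x)"
    by (intro cst_restrict[OF hM hc[OF Mn s x]] oV V'V) (use x in auto)
   thus ?thesis by (rule cst_cong) (simp add: h'lo[OF True])
  next
   case False
   show ?thesis
   \<comment> \<open>On these simplices the deformations of \<open>glue_step\<close> and of
     \<open>htpy_extend\<close> both rest in the first half of their time, hence the twofold
     substitution \<open>max 0 (2 * _ - 1)\<close>.\<close>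
   proof (rule cstI[where W=O' and s="a (max 0 (2 * max 0 (2 * tt s - 1) - 1)) x"])
    show "a (max 0 (2 * max 0 (2 * tt s - 1) - 1)) x \<in> sections O'"
     using cmap_in[OF a, of "(max 0 (2 * max 0 (2 * tt s - 1) - 1), x)"] x tt[of s] by simp
    show "V' i \<subseteq> O'" if "i \<in> {..M}" for i using that Mn O'(3)[of i] by (simp add: V'_def)
    fix J l assume J: "J \<in> fins {..M}" and l: "l \<in> simp J"
    have J1: "J \<in> fins {..<Suc n}" "J \<in> fins {..Suc n}" using J Mn by (auto simp: fins_def)
    have fl: "supp l \<in> fins {..Suc n}" by (rule fins_supp[OF J1(2) l])
    have "h' l (s, x) = H1 l (tt s, x)" using h'hi[OF _ x fn[OF J] l] False by simp
    also have "\<dots> = H l (max 0 (2 * tt s - 1), x)" by (rule H1H[OF J1(2) l x tt])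
    also have "\<dots> = res F O' (US V1 l) (a (max 0 (2 * max 0 (2 * tt s - 1) - 1)) x)"
     by (rule Ha[OF J1(1) l _ x]) (use tt[of s] in auto)
    also have "US V1 l = US V' l" by (rule UU_cong_fins[OF V'1 fl])
    finally show "h' l (s, x) = res F O' (US V' l) (a (max 0 (2 * max 0 (2 * tt s - 1) - 1)) x)" .
   qed (use O'(1) oV in auto)
  qed
 qed
 have "stage A U k f (Suc n) V' h'"
  unfolding stage_def
 proof (intro conjI allI impI ballI)
  show "A i \<subseteq> V' i" for i using AV[of i] V1[of i] by (simp add: V'_def)
  fix s x J and l :: "nat \<Rightarrow> real" assume s: "s \<in> {tau (Suc n)..1}" and x: "x \<in> cube k" and J: "J \<in> fins UNIV" and l: "l \<in> simp J"
  have "tau n \<le> s" "tau (Suc n) \<le> s" "tau (Suc n) \<le> 1" "tau n \<le> 1" using s tau_mono[of n "Suc n"] tau_less[of n] tau_less[of "Suc n"] by auto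
  thus "h' l (s, x) = h' l (1, x)" using h'hi[OF _ x J l] tt1 by simp
 qed (use hp c' in auto)
 moreover have "stage_step A E k n V h V' h'"
  unfolding stage_step_def Let_def
 proof (intro conjI allI impI ballI)
  show "V' i \<subseteq> V i" for i by (rule V'V)
  fix s x J and l :: "nat \<Rightarrow> real" assume "s \<in> {0..tau n}"
  thus "h' l (s, x) = res F (US V l) (US V' l) (h l (s, x))" by (simp add: h'lo)
 next
  fix M s x z z'
  assume M: "M \<le> n" and s: "s \<in> {tau n..1}" and x: "x \<in> cube k"
  let ?B = "core A M"
  assume z: "z \<in> sections ?B \<and> z' \<in> sections ?B \<and>
    (\<forall>j\<le>M. res F ?B (?B \<inter> V' j) z = res F (V j) (?B \<inter> V' j) (h (dl j) (s, x)) \<and>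
       res F ?B (?B \<inter> V' j) z' = res F (V' j) (?B \<inter> V' j) (h' (dl j) (s, x)))"
  define t where "t = max 0 (2 * max 0 (2 * tt s - 1) - 1)"
  have t: "t \<in> {0..1}" using tt[of s] by (auto simp: t_def)
  let ?Bn = "X interior_of (\<Union>i<Suc n. A i)"
  have oB: "openin X ?B" "openin X ?Bn" by auto
  have BnO: "?Bn \<subseteq> O'" by (rule order_trans[OF interior_of_subset O'(2)])
  have "(\<Union>i\<le>M. A i) \<subseteq> (\<Union>i<Suc n. A i)" using M by (intro UN_mono) auto
  hence BB: "?B \<subseteq> ?Bn" by (rule interior_of_mono)
  have BO: "?B \<subseteq> O'" using BB BnO by blast
  have as: "a t x \<in> sections O'" if "t \<in> {0..1}" for t using cmap_in[OF a, of "(t, x)"] that x by simp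
  have cov: "?B = (\<Union>j\<in>{..M}. ?B \<inter> V' j)"
  proof -
   have "(\<Union>i\<le>M. A i) \<subseteq> (\<Union>j\<in>{..M}. V' j)"
    by (rule UN_mono) (use M V1 in \<open>auto simp: V'_def\<close>)
   hence "?B \<subseteq> (\<Union>j\<in>{..M}. V' j)" by (rule order_trans[OF interior_of_subset])
   thus ?thesis by blast
  qed
  have dj: "{j} \<in> fins {..<Suc n}" "{j} \<in> fins {..Suc n}" "{j} \<in> fins UNIV" "dl j \<in> simp {j}" if "j \<le> M" for j
   using that M by (auto simp: fins_def dl_in_simp)
  have Hj: "H (dl j) (r, x) = res F O' (V' j) (a (max 0 (2 * r - 1)) x)" if "j \<le> M" "r \<in> {0..1}" for j r
   using Ha[OF dj(1)[OF that(1)] dj(4)[OF that(1)] that(2) x] V'1[of j] that M by simp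
  have V'O: "V' j \<subseteq> O'" if "j \<le> M" for j using that M O'(3)[of j] by (simp add: V'_def)
  \<comment> \<open>Both sections compared by \<open>E\<close> are restrictions of \<open>a\<close>
    over \<open>O'\<close>: \<open>z'\<close> of its value at the rescaled time \<open>t\<close>,
    and \<open>z\<close> below of its value at time 0. So \<open>E\<close> reduces to the control
    \<open>R\<close> of \<open>a\<close>.\<close>
  have z': "z' = res F O' ?B (a t x)"
  proof (rule sections_eqI[of "{..M}" "\<lambda>j. ?B \<inter> V' j" ?B])
   show "z' \<in> sections ?B" using z by blast
   show "res F O' ?B (a t x) \<in> sections ?B" by (rule res_in[OF O'(1) oB(1) BO as[OF t]])
   fix j assume "j \<in> {..M}"
   hence j: "j \<le> M" by simp
   have "h' (dl j) (s, x) = H (dl j) (max 0 (2 * tt s - 1), x)"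
    using h'hi[OF _ x dj(3,4)[OF j], of s] H1H[OF dj(2,4)[OF j] x tt] s by simp
   also have "\<dots> = res F O' (V' j) (a t x)"
    unfolding t_def by (rule Hj[OF j]) (use tt[of s] in auto)
   finally have "res F ?B (?B \<inter> V' j) z' = res F (V' j) (?B \<inter> V' j) (res F O' (V' j) (a t x))" using z j by simp
   also have "\<dots> = res F O' (?B \<inter> V' j) (a t x)"
    by (rule res_res[OF O'(1) oV(2) _ _ V'O[OF j] as[OF t]]) (use oB oV in auto)
   also have "\<dots> = res F ?B (?B \<inter> V' j) (res F O' ?B (a t x))"
    by (rule res_res[OF O'(1) oB(1) _ _ BO as[OF t], symmetric]) (use oB oV in auto)
   finally show "res F ?B (?B \<inter> V' j) z' = res F ?B (?B \<inter> V' j) (res F O' ?B (a t x))" .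
  qed (use cov oB oV in auto)
  have z0: "z = res F O' ?B (a 0 x)"
  proof (rule sections_eqI[of "{..M}" "\<lambda>j. ?B \<inter> V' j" ?B])
   show "z \<in> sections ?B" using z by blast
   show "res F O' ?B (a 0 x) \<in> sections ?B" by (rule res_in[OF O'(1) oB(1) BO as]) simp
   fix j assume "j \<in> {..M}"
   hence j: "j \<le> M" by simp
   have o: "openin X (?B \<inter> V' j)" "?B \<inter> V' j \<subseteq> V' j" "?B \<inter> V' j \<subseteq> ?B" using oB oV by auto
   have f1j: "f1 (dl j) x \<in> sections (V j)" by (rule cpx_vertex_in[OF f1 UNIV_I x])
   have "h (dl j) (s, x) = f1 (dl j) x" unfolding f1_def by (rule he[OF s x dj(3,4)[OF j]])
   hence "res F ?B (?B \<inter> V' j) z = res F (V j) (?B \<inter> V' j) (f1 (dl j) x)" using z j by simp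
   also have "\<dots> = res F (V' j) (?B \<inter> V' j) (res F (V j) (V' j) (f1 (dl j) x))"
    by (rule res_res[OF oV o(1,2) V'V f1j, symmetric])
   also have "res F (V j) (V' j) (f1 (dl j) x) = H (dl j) (0, x)"
    using htpyD(3)[OF H' dj(2,4)[OF j] x] by simp
   also have "H (dl j) (0, x) = res F O' (V' j) (a 0 x)" using Hj[OF j, of 0] by simp
   also have "res F (V' j) (?B \<inter> V' j) (res F O' (V' j) (a 0 x)) = res F O' (?B \<inter> V' j) (a 0 x)"
    by (rule res_res[OF O'(1) oV(2) o(1,2) V'O[OF j] as]) simp
   also have "\<dots> = res F ?B (?B \<inter> V' j) (res F O' ?B (a 0 x))"
    by (rule res_res[OF O'(1) oB(1) o(1,3) BO as, symmetric]) simp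
   finally show "res F ?B (?B \<inter> V' j) z = res F ?B (?B \<inter> V' j) (res F O' ?B (a 0 x))" .
  qed (use cov oB oV in auto)
  have "res F ?Bn ?B (a0 x) = z"
   unfolding a0[OF x] z0 by (rule res_res[OF O'(1) oB(2,1) BB BnO as]) simp
  moreover have "res F ?Bn ?B (res F O' ?Bn (a t x)) = z'"
   unfolding z' by (rule res_res[OF O'(1) oB(2,1) BB BnO as[OF t]])
  ultimately show "E n M z z'"
   using R[OF Ra[OF t] M x] by (simp add: lessThan_Suc_atMost)
 qed
 ultimately show ?thesis by blast
qed

end

context space_sheaf
begin

lemma stage_stepD:
 assumes "stage_step A E k n V h V' h'" "M \<le> n" "r \<in> {tau n..1}" "x \<in> cube k"
  and "z \<in> sections (core A M)" "z' \<in> sections (core A M)"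
  and "\<And>j. j \<le> M \<Longrightarrow> res F (core A M) (core A M \<inter> V' j) z =
    res F (V j) (core A M \<inter> V' j) (h (dl j) (r, x))"
  and "\<And>j. j \<le> M \<Longrightarrow> res F (core A M) (core A M \<inter> V' j) z' =
    res F (V' j) (core A M \<inter> V' j) (h' (dl j) (r, x))"
 shows "E n M z z'"
proof -
 have "\<forall>M\<le>n. \<forall>s\<in>{tau n..1}. \<forall>x\<in>cube k. \<forall>z z'.
    (let I = core A M in z \<in> sections I \<and> z' \<in> sections I \<and>
    (\<forall>j\<le>M. res F I (I \<inter> V' j) z = res F (V j) (I \<inter> V' j) (h (dl j) (s, x)) \<and>
       res F I (I \<inter> V' j) z' = res F (V' j) (I \<inter> V' j) (h' (dl j) (s, x))) \<longrightarrow> E n M z z')"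
  using assms(1) unfolding stage_step_def by (elim conjE)
 from this[rule_format, OF assms(2-4), of z z'] show ?thesis
  unfolding Let_def using assms(5-8) by blast
qed

text \<open>Flexibility enters through the relation \<open>E\<close> between consecutive
  approximations and completeness through \<open>lim\<close>, so one construction serves both
  classes. Over the core up to \<open>M\<close> the stages from \<open>M\<close> on define sections
  with a limit. A simplex follows a finite stage until the sets that meet one of its vertex sets are
  glued, and the limit section afterwards. The two coincide at the moment of change because later
  stages do not alter what happens up to an earlier \<open>tau\<close>.\<close>

lemma infinite_glue:
 fixes A :: "nat \<Rightarrow> 'a set" and lim :: "'a set \<Rightarrow> (nat \<Rightarrow> 'b) \<Rightarrow> 'b \<Rightarrow> bool"
 assumes X: "Hausdorff_space X" and A: "\<And>i. compactin X (A i)" and cov: "(\<Union>i. A i) = topspace X"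
  and P: "\<And>n. flexible_with (R n) k (\<Union>i<Suc n. A i) (A (Suc n))"
  and G: "\<And>n. glueable (Suc n) (\<lambda>i. A i \<inter> A (Suc n))"
  and R: "\<And>n a0 a M x. \<lbrakk>R n a0 a; M \<le> n; x \<in> cube k\<rbrakk> \<Longrightarrow>
   E n M (res F (core A n) (core A M) (a0 x))
    (res F (core A n) (core A M) (a x))"
  and E_refl: "\<And>n M z. z \<in> sections (core A M) \<Longrightarrow> E n M z z"
  and lim_unique: "\<And>V s z z'. \<lbrakk>openin X V; lim V s z; lim V s z'\<rbrakk> \<Longrightarrow> z = z'"
  and lim_res: "\<And>V W s z. \<lbrakk>openin X V; openin X W; W \<subseteq> V; lim V s z\<rbrakk> \<Longrightarrow>
   lim W (\<lambda>n. res F V W (s n)) (res F V W z)"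
  and lim_const: "\<And>V z. openin X V \<Longrightarrow> z \<in> sections V \<Longrightarrow> lim V (\<lambda>_. z) z"
  and lim_tail: "\<And>V s s' z N. \<lbrakk>openin X V; lim V s z; (\<And>n. N \<le> n \<Longrightarrow> s n = s' n)\<rbrakk> \<Longrightarrow> lim V s' z"
  and lim_ex: "\<And>M p. (\<And>n. cmap (cyl k) (sec F (core A M)) (p n)) \<Longrightarrow>
   (\<And>n y. M \<le> n \<Longrightarrow> y \<in> cyl k \<Longrightarrow> E n M (p n y) (p (Suc n) y)) \<Longrightarrow>
   \<exists>q. cmap (cyl k) (sec F (core A M)) q \<and>
    (\<forall>y\<in>cyl k. lim (core A M) (\<lambda>n. p n y) (q y))"
  and f: "cpx UNIV U (cube k) f" and bd: "\<And>x. x \<in> cube_bd k \<Longrightarrow> cst UNIV U f x"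
  and AU: "\<And>i. A i \<subseteq> U i" and fin: "\<And>i. finite {j. U i \<inter> U j \<noteq> {}}"
 obtains O' h g where "\<And>i. A i \<subseteq> O' i" "htpy UNIV U O' (cube k) (cube_bd k) f h"
  "cmap (cube k) (sec F (topspace X)) g"
  "\<And>J l x. \<lbrakk>J \<in> fins UNIV; l \<in> simp J; x \<in> cube k\<rbrakk> \<Longrightarrow>
   h l (1, x) = res F (topspace X) (US O' l) (g x)"
proof -
 have "\<exists>s. \<forall>n. stage A U k f n (fst (s n)) (snd (s n)) \<and>
   stage_step A E k n (fst (s n)) (snd (s n)) (fst (s (Suc n))) (snd (s (Suc n)))"
 proof (rule dependent_nat_choice)
  show "\<exists>s. stage A U k f 0 (fst s) (snd s)"
   using stage_0[of U k f A, OF f AU] by (intro exI[of _ "(U, \<lambda>l z. f l (snd z))"]) simp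
  fix s n assume st: "stage A U k f n (fst s) (snd s)"
  have "\<exists>V' h'. stage A U k f (Suc n) V' h' \<and> stage_step A E k n (fst s) (snd s) V' h'"
  proof (rule stage_Suc[where A=A and n=n and R="R n" and U=U and f=f and E=E and k=k])
   show "E n M (res F (core A n) (core A M) (a0 x))
     (res F (core A n) (core A M) (a x))"
    if "R n a0 a" "M \<le> n" "x \<in> cube k" for a0 a M x by (rule R[OF that])
   show "cst UNIV U f x" if "x \<in> cube_bd k" for x by (rule bd[OF that])
  qed (rule X A P G f st)+
  then obtain V' h' where "stage A U k f (Suc n) V' h'" "stage_step A E k n (fst s) (snd s) V' h'" by blast
  thus "\<exists>s'. stage A U k f (Suc n) (fst s') (snd s') \<and> stage_step A E k n (fst s) (snd s) (fst s') (snd s')"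
   by (intro exI[of _ "(V', h')"]) simp
 qed
 then obtain s where s: "\<And>n. stage A U k f n (fst (s n)) (snd (s n))"
  "\<And>n. stage_step A E k n (fst (s n)) (snd (s n)) (fst (s (Suc n))) (snd (s (Suc n)))" by blast
 define V where "V = (\<lambda>n. fst (s n))"
 define h where "h = (\<lambda>n. snd (s n))"
 have st: "stage A U k f n (V n) (h n)" for n using s(1) by (simp add: V_def h_def)
 have ss: "stage_step A E k n (V n) (h n) (V (Suc n)) (h (Suc n))" for n using s(2) by (simp add: V_def h_def)
 have AV: "A i \<subseteq> V n i" for n i using st[of n] by (simp add: stage_def)
 have hV: "htpy UNIV U (V n) (cube k) (cube_bd k) f (h n)" for n using st[of n] by (simp add: stage_def)
 note hn = htpyD(2)[OF hV]
 have hc: "cst {..M} (V n) (h n) (r, x)" if "M \<le> n" "r \<in> {tau M..1}" "x \<in> cube k" for M n r x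
  using st[of n] that unfolding stage_def by blast
 have V_Suc: "V (Suc n) i \<subseteq> V n i" for n i using ss[of n] by (simp add: stage_step_def)
 have Vmono: "V n i \<subseteq> V m i" if "m \<le> n" for m n i
  using lift_Suc_antimono_le[of "\<lambda>n. V n i", OF V_Suc that] .
 have oV: "openin X (V n i)" for n i using cpx_open[OF hn UNIV_I] .
 have VU: "V n i \<subseteq> U i" for n i using htpyD(1)[OF hV UNIV_I] .
 have oU: "openin X (U i)" for i using cpx_open[OF f UNIV_I] .
 have oVV: "openin X (UU (V n) J)" if "J \<in> fins UNIV" for n J by (rule cpx_openUU[OF hn that])
 have h_Suc: "h (Suc n) l (r, x) = res F (UU (V n) (supp l)) (UU (V (Suc n)) (supp l)) (h n l (r, x))"
  if "r \<in> {0..tau n}" "x \<in> cube k" "J \<in> fins UNIV" "l \<in> simp J" for n l r x J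
  using ss[of n] that unfolding stage_step_def by blast
 have h_mono: "h N l (r, x) = res F (UU (V M) (supp l)) (UU (V N) (supp l)) (h M l (r, x))"
  if MN: "M \<le> N" and r: "r \<in> {0..tau M}" and x: "x \<in> cube k" and J: "J \<in> fins UNIV" "l \<in> simp J" for M N l r x J
  using MN
 proof (induction N rule: dec_induct)
  case base
  have "h M l (r, x) \<in> sections (UU (V M) (supp l))" by (rule cpx_in[OF hn J]) (use r x tau_less[of M] in auto)
  thus ?case using res_id[OF oVV[OF fins_supp[OF J]]] by simp
 next
  case (step n)
  have hM: "h M l (r, x) \<in> sections (UU (V M) (supp l))" by (rule cpx_in[OF hn J]) (use r x tau_less[of M] in auto)
  have r': "r \<in> {0..tau n}" using r tau_mono[OF step(1)] by simp
  show ?case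
   unfolding h_Suc[OF r' x J] step.IH
   by (rule res_res[OF oVV[OF fins_supp[OF J]] oVV[OF fins_supp[OF J]] oVV[OF fins_supp[OF J]]
     UU_mono[OF V_Suc] UU_mono[OF Vmono[OF step(1)]] hM])
 qed
 have lim_tail': "lim V s' z" if "openin X V" "lim V s z" "\<exists>N. \<forall>n\<ge>N. s n = s' n" for V s s' z
 proof -
  obtain N where "\<And>n. N \<le> n \<Longrightarrow> s n = s' n" using \<open>\<exists>N. \<forall>n\<ge>N. s n = s' n\<close> by blast
  thus ?thesis by (rule lim_tail[OF that(1,2)])
 qed
 define B where "B = (\<lambda>M. core A M)"
 have oB: "openin X (B M)" for M by (simp add: B_def)
 have Bmono: "B M \<subseteq> B N" if "M \<le> N" for M N
  unfolding B_def by (intro interior_of_mono UN_mono) (use that in auto)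
 have BV: "B M = (\<Union>i\<in>{..M}. B M \<inter> V n i)" for M n
 proof -
  have "(\<Union>i\<le>M. A i) \<subseteq> (\<Union>i\<in>{..M}. V n i)" by (intro UN_mono AV) auto
  hence "B M \<subseteq> (\<Union>i\<in>{..M}. V n i)" unfolding B_def by (rule order_trans[OF interior_of_subset])
  thus ?thesis by blast
 qed
 have B_eqI: "z = z'" if z: "z \<in> sections (B M)" "z' \<in> sections (B M)"
  and e: "\<And>j. j \<le> M \<Longrightarrow> res F (B M) (B M \<inter> V n j) z = res F (B M) (B M \<inter> V n j) z'" for M n z z'
 proof (rule sections_eqI[of "{..M}" "\<lambda>j. B M \<inter> V n j" "B M"])
  show "B M = (\<Union>i\<in>{..M}. B M \<inter> V n i)" by (rule BV)
  show "openin X (B M \<inter> V n i)" for i using oB oV by blast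
  show "res F (B M) (B M \<inter> V n i) z = res F (B M) (B M \<inter> V n i) z'" if "i \<in> {..M}" for i
   using that e by simp
 qed (use z in auto)
 \<comment> \<open>Characterises the section over the core up to \<open>M\<close> that stage
   \<open>n\<close> defines once these sets are glued. Replacing the time \<open>r\<close> by
   \<open>max (tau M) r\<close> extends it to the whole cylinder.\<close>
 define Q where "Q = (\<lambda>M n g. cmap (cyl k) (sec F (B M)) g \<and>
  (\<forall>J\<in>fins {..M}. \<forall>l\<in>simp J. \<forall>r\<in>{0..1}. \<forall>x\<in>cube k. \<forall>W. openin X W \<and> W \<subseteq> B M \<and> W \<subseteq> UU (V n) (supp l) \<longrightarrow>
   res F (B M) W (g (r, x)) = res F (UU (V n) (supp l)) W (h n l (max (tau M) r, x))))"
 have "\<exists>g. Q M n g" if Mn: "M \<le> n" for M n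
 proof -
  have mx: "max (tau M) r \<in> {tau M..1}" "max (tau M) r \<in> {0..1}" if "r \<in> {0..1}" for r
   using that tau_less[of M] by auto
  have cM: "cpx {..M} (V n) (cyl k) (\<lambda>l z. h n l (max (tau M) (fst z), snd z))"
   by (rule cpx_param[OF hn, where g="\<lambda>z. (max (tau M) (fst z), snd z)"])
    (use tau_less[of M] in \<open>auto intro!: continuous_intros\<close>)
  have cc: "cst {..M} (V n) (\<lambda>l z. h n l (max (tau M) (fst z), snd z)) z" if "z \<in> cyl k" for z
   by (rule cst_cong[OF hc[OF Mn mx(1), of "fst z" "snd z"]]) (use that in auto)
  let ?W = "\<Union>i\<in>{..M}. V n i"
  obtain g where g: "cmap (cyl k) (sec F ?W) g"
   "\<And>J l z. \<lbrakk>J \<in> fins {..M}; l \<in> simp J; z \<in> cyl k\<rbrakk> \<Longrightarrow>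
    h n l (max (tau M) (fst z), snd z) = res F ?W (UU (V n) (supp l)) (g z)"
   by (rule cst_glue[OF cell_pair_Times[OF cell_pair_interval cell_pair_cube] cM cc]) blast+
  have oW: "openin X ?W" using oV by (intro openin_Union) auto
  have BW: "B M \<subseteq> ?W" by (subst BV[of M n]) blast
  have "Q M n (\<lambda>z. res F ?W (B M) (g z))"
   unfolding Q_def
  proof (intro conjI ballI allI impI)
   show "cmap (cyl k) (sec F (B M)) (\<lambda>z. res F ?W (B M) (g z))"
    by (rule cmap_res[OF g(1) oW oB BW])
   fix J l r x W assume J: "J \<in> fins {..M}" and l: "l \<in> simp J" and r: "r \<in> {0..1::real}" and x: "x \<in> cube k"
    and W: "openin X W \<and> W \<subseteq> B M \<and> W \<subseteq> UU (V n) (supp l)"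
   have gs: "g (r, x) \<in> sections ?W" by (rule cmap_in[OF g(1)]) (use r x in auto)
   have fl: "supp l \<in> fins {..M}" by (rule fins_supp[OF J l])
   hence flU: "supp l \<in> fins UNIV" by (simp add: fins_def)
   obtain j where "j \<in> supp l" using supp_simp(2)[OF l] by blast
   hence sub: "UU (V n) (supp l) \<subseteq> ?W" using fl by (auto simp: UU_def fins_def)
   have hh: "h n l (max (tau M) r, x) = res F ?W (UU (V n) (supp l)) (g (r, x))" using g(2)[OF J l, of "(r, x)"] r x by simp
   show "res F (B M) W (res F ?W (B M) (g (r, x))) = res F (UU (V n) (supp l)) W (h n l (max (tau M) r, x))"
    unfolding hh using res_res[OF oW oB _ _ BW gs, of W] res_res[OF oW oVV[OF flU] _ _ sub gs, of W] W by simp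
  qed
  thus ?thesis by blast
 qed
 then obtain p where p: "\<And>M n. M \<le> n \<Longrightarrow> Q M n (p M n)" by metis
 have pc: "cmap (cyl k) (sec F (B M)) (p M n)" if "M \<le> n" for M n
  using p[OF that] unfolding Q_def by blast
 have ps: "p M n (r, x) \<in> sections (B M)" if "M \<le> n" "r \<in> {0..1}" "x \<in> cube k" for M n r x
  by (rule cmap_in[OF pc[OF that(1)]]) (use that in auto)
 have pW: "res F (B M) W (p M n (r, x)) = res F (UU (V n) (supp l)) W (h n l (max (tau M) r, x))"
  if "M \<le> n" "J \<in> fins {..M}" "l \<in> simp J" "r \<in> {0..1}" "x \<in> cube k" "openin X W" "W \<subseteq> B M" "W \<subseteq> UU (V n) (supp l)" for M n J l r x W
  using p[OF that(1)] that(2-) unfolding Q_def by blast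
 have dj: "{j} \<in> fins {..M}" "dl j \<in> simp {j}" "{j} \<in> fins UNIV" if "j \<le> M" for j M :: nat using that by (auto simp: fins_def dl_in_simp)
 have pj: "res F (B M) W (p M n (r, x)) = res F (V n j) W (h n (dl j) (max (tau M) r, x))"
  if "M \<le> n" "j \<le> M" "r \<in> {0..1}" "x \<in> cube k" "openin X W" "W \<subseteq> B M" "W \<subseteq> V n j" for M n j r x W
  using pW[OF that(1) dj(1,2)[OF that(2)] that(3-6)] that(7) by simp
 have hns: "h n (dl j) (r, x) \<in> sections (V n j)" if "r \<in> {0..1}" "x \<in> cube k" for n j r x
  using cpx_vertex_in[OF hn UNIV_I, of "(r, x)" n j] that by simp
 \<comment> \<open>Stages after \<open>n\<close> only restrict what happens up to
   \<open>tau n\<close>, so at these times the section over the core is final.\<close>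
 have p_eq: "p M N (r, x) = p M n (r, x)"
  if MnN: "M \<le> n" "n \<le> N" and r: "r \<in> {0..1}" "max (tau M) r \<le> tau n" and x: "x \<in> cube k" for M n N r x
 proof (rule B_eqI[of _ _ _ N])
  fix j assume j: "j \<le> M"
  have W: "openin X (B M \<inter> V N j)" "B M \<inter> V N j \<subseteq> B M" "B M \<inter> V N j \<subseteq> V N j" "B M \<inter> V N j \<subseteq> V n j"
   using oB oV Vmono[OF MnN(2), of j] by auto
  have r': "max (tau M) r \<in> {0..tau n}" "max (tau M) r \<in> {0..1}" using r tau_less[of n] by auto
  have "res F (B M) (B M \<inter> V N j) (p M N (r, x)) = res F (V N j) (B M \<inter> V N j) (h N (dl j) (max (tau M) r, x))"
   by (rule pj[OF order_trans[OF MnN] j r(1) x W(1-3)])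
  also have "h N (dl j) (max (tau M) r, x) = res F (V n j) (V N j) (h n (dl j) (max (tau M) r, x))"
   using h_mono[OF MnN(2) r'(1) x dj(3,2)[OF j]] by simp
  also have "res F (V N j) (B M \<inter> V N j) \<dots> = res F (V n j) (B M \<inter> V N j) (h n (dl j) (max (tau M) r, x))"
   by (rule res_res[OF oV oV W(1,3) Vmono[OF MnN(2)] hns[OF r'(2) x]])
  also have "\<dots> = res F (B M) (B M \<inter> V N j) (p M n (r, x))"
   by (rule pj[OF MnN(1) j r(1) x W(1,2,4), symmetric])
  finally show "res F (B M) (B M \<inter> V N j) (p M N (r, x)) = res F (B M) (B M \<inter> V N j) (p M n (r, x))" .
 qed (use ps MnN r x in auto)
 have pE: "E n M (p M n (r, x)) (p M (Suc n) (r, x))" if Mn: "M \<le> n" and r: "r \<in> {0..1}" and x: "x \<in> cube k" for M n r x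
 proof (cases "max (tau M) r \<le> tau n")
  case True
  thus ?thesis using p_eq[OF Mn le_SucI[OF order_refl] r True x] E_refl[OF ps[OF Mn r x, unfolded B_def]] by simp
 next
  case False
  hence r': "max (tau M) r \<in> {tau n..1}" using r tau_less[of M] by auto
  have BM: "core A M = B M" by (simp add: B_def)
  show ?thesis
  proof (rule stage_stepD[OF ss Mn r' x, unfolded BM])
   show "p M n (r, x) \<in> sections (B M)" by (rule ps[OF Mn r x])
   show "p M (Suc n) (r, x) \<in> sections (B M)" by (rule ps[OF le_SucI[OF Mn] r x])
   fix j assume j: "j \<le> M"
   have W: "openin X (B M \<inter> V (Suc n) j)" "B M \<inter> V (Suc n) j \<subseteq> B M" "B M \<inter> V (Suc n) j \<subseteq> V (Suc n) j" "B M \<inter> V (Suc n) j \<subseteq> V n j"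
    using oB oV V_Suc[of n j] by auto
   show "res F (B M) (B M \<inter> V (Suc n) j) (p M n (r, x)) = res F (V n j) (B M \<inter> V (Suc n) j) (h n (dl j) (max (tau M) r, x))"
    by (rule pj[OF Mn j r x W(1,2,4)])
   show "res F (B M) (B M \<inter> V (Suc n) j) (p M (Suc n) (r, x)) = res F (V (Suc n) j) (B M \<inter> V (Suc n) j) (h (Suc n) (dl j) (max (tau M) r, x))"
    by (rule pj[OF le_SucI[OF Mn] j r x W(1-3)])
  qed
 qed
 have "\<exists>q. cmap (cyl k) (sec F (B M)) q \<and>
   (\<forall>y\<in>cyl k. lim (B M) (\<lambda>n. p M (max M n) y) (q y))" for M
  unfolding B_def
 proof (rule lim_ex)
  show "cmap (cyl k) (sec F (core A M)) (p M (max M n))" for n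
   using pc[of M "max M n"] unfolding B_def by simp
  show "E n M (p M (max M n) y) (p M (max M (Suc n)) y)" if "M \<le> n" "y \<in> cyl k" for n y
   using pE[OF that(1), of "fst y" "snd y"] that by (auto simp: max_def)
 qed
 then obtain q where qc: "\<And>M. cmap (cyl k) (sec F (B M)) (q M)"
  and ql: "\<And>M y. y \<in> cyl k \<Longrightarrow> lim (B M) (\<lambda>n. p M (max M n) y) (q M y)" by metis
 have qs: "q M (r, x) \<in> sections (B M)" if "r \<in> {0..1}" "x \<in> cube k" for M r x
  by (rule cmap_in[OF qc]) (use that in auto)
 have q1: "q M (r, x) = p M N (r, x)" if MN: "M \<le> N" and r: "r \<in> {0..1}" "max (tau M) r \<le> tau N" and x: "x \<in> cube k" for M N r x
 proof -
  have "lim (B M) (\<lambda>_. p M N (r, x)) (p M N (r, x))" by (rule lim_const[OF oB ps[OF MN r(1) x]])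
  hence "lim (B M) (\<lambda>n. p M (max M n) (r, x)) (p M N (r, x))"
  proof (rule lim_tail'[OF oB], intro exI[of _ N] allI impI)
   fix n assume "N \<le> n"
   thus "p M N (r, x) = p M (max M n) (r, x)"
    using p_eq[OF MN, of n r x] r x MN by (simp add: max_def)
  qed
  thus ?thesis using lim_unique[OF oB ql] r x by auto
 qed
 have q2: "res F (B M') (B M) (q M' (r, x)) = q M (r, x)" if MM: "M \<le> M'" and r: "r \<in> {tau M'..1}" and x: "x \<in> cube k" for M M' r x
 proof -
  have r1: "r \<in> {0..1}" "max (tau M') r = r" "max (tau M) r = r" using r tau_nonneg[of M'] tau_mono[OF MM] by auto
  have e: "res F (B M') (B M) (p M' n (r, x)) = p M n (r, x)" if n: "M' \<le> n" for n
  proof (rule B_eqI[of _ _ _ n])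
   have Mn: "M \<le> n" using MM n by simp
   have pin: "p M' n (r, x) \<in> sections (B M')" by (rule ps[OF n r1(1) x])
   show "res F (B M') (B M) (p M' n (r, x)) \<in> sections (B M)" by (rule res_in[OF oB oB Bmono[OF MM] pin])
   show "p M n (r, x) \<in> sections (B M)" by (rule ps[OF Mn r1(1) x])
   fix j assume j: "j \<le> M"
   have W: "openin X (B M \<inter> V n j)" "B M \<inter> V n j \<subseteq> B M" "B M \<inter> V n j \<subseteq> V n j" "B M \<inter> V n j \<subseteq> B M'"
    using oB oV Bmono[OF MM] by auto
   show "res F (B M) (B M \<inter> V n j) (res F (B M') (B M) (p M' n (r, x))) = res F (B M) (B M \<inter> V n j) (p M n (r, x))"
    unfolding res_res[OF oB oB W(1,2) Bmono[OF MM] pin] pj[OF Mn j r1(1) x W(1-3)]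
     pj[OF n order_trans[OF j MM] r1(1) x W(1,4,3)] r1 ..
  qed
  have "lim (B M) (\<lambda>n. res F (B M') (B M) (p M' (max M' n) (r, x))) (res F (B M') (B M) (q M' (r, x)))"
   by (rule lim_res[OF oB oB Bmono[OF MM] ql]) (use r1 x in auto)
  hence "lim (B M) (\<lambda>n. p M (max M n) (r, x)) (res F (B M') (B M) (q M' (r, x)))"
   by (rule lim_tail'[OF oB], intro exI[of _ M']) (use e MM in \<open>auto simp: max_def\<close>)
  thus ?thesis using lim_unique[OF oB _ ql] r1 x by auto
 qed
 have qb: "q M (r, x) = q M (0, x)" if r: "r \<in> {0..1}" and x: "x \<in> cube_bd k" for M r x
 proof -
  have xc: "x \<in> cube k" using x cube_bd_subset by blast
  have e: "p M n (r, x) = p M n (0, x)" if n: "M \<le> n" for n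
  proof (rule B_eqI[of _ _ _ n])
   show "p M n (r, x) \<in> sections (B M)" by (rule ps[OF n r xc])
   show "p M n (0, x) \<in> sections (B M)" by (rule ps[OF n _ xc]) simp
   fix j assume j: "j \<le> M"
   have W: "openin X (B M \<inter> V n j)" "B M \<inter> V n j \<subseteq> B M" "B M \<inter> V n j \<subseteq> V n j" using oB oV by auto
   have m1: "max (tau M) r \<in> {0..1}" "max (tau M) 0 \<in> {0..1}" using r tau_less[of M] tau_nonneg[of M] by auto
   have "h n (dl j) (max (tau M) r, x) = h n (dl j) (max (tau M) 0, x)"
    using htpyD(4)[OF hV dj(3,2)[OF j] x m1(1), of n] htpyD(4)[OF hV dj(3,2)[OF j] x m1(2), of n] by simp
   thus "res F (B M) (B M \<inter> V n j) (p M n (r, x)) = res F (B M) (B M \<inter> V n j) (p M n (0, x))"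
    using pj[OF n j r xc W] pj[OF n j _ xc W, of 0] by simp
  qed
  have "lim (B M) (\<lambda>n. p M (max M n) (0, x)) (q M (r, x))"
   by (rule lim_tail'[OF oB ql[of "(r, x)"]], use r xc in simp, intro exI[of _ M]) (use e in \<open>auto simp: max_def\<close>)
  thus ?thesis using lim_unique[OF oB _ ql] xc by auto
 qed
 \<comment> \<open>An index beyond all sets that meet \<open>U i\<close>, available by local
   finiteness; as the \<open>A j\<close> cover \<open>X\<close>, the set \<open>U i\<close> then
   lies in the core up to \<open>m i\<close>. Inserting \<open>i\<close> keeps the argument of
   \<open>Max\<close> nonempty.\<close>
 define m where "m = (\<lambda>i. Suc (Max (insert i {j. U i \<inter> U j \<noteq> {}})))"
 have m: "j < m i" if "U i \<inter> U j \<noteq> {}" for i j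
 proof -
  have "j \<le> Max (insert i {j. U i \<inter> U j \<noteq> {}})" using that fin[of i] by (intro Max_ge) auto
  thus ?thesis by (simp add: m_def)
 qed
 have UB: "U i \<subseteq> B (m i)" for i
 proof -
  have "U i \<subseteq> (\<Union>j\<le>m i. A j)"
  proof
   fix z assume z: "z \<in> U i"
   hence "z \<in> topspace X" using openin_subset[OF oU] by blast
   then obtain j where j: "z \<in> A j" using cov by blast
   hence "U i \<inter> U j \<noteq> {}" using AU[of j] z by blast
   hence "j \<le> m i" using m by (simp add: less_imp_le)
   thus "z \<in> (\<Union>j\<le>m i. A j)" using j by blast
  qed
  thus ?thesis unfolding B_def by (rule interior_of_maximal[OF _ oU])
 qed
 have Btop: "(\<Union>M\<in>UNIV. B M) = topspace X"
 proof
  show "(\<Union>M\<in>UNIV. B M) \<subseteq> topspace X" using openin_subset[OF oB] by blast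
  show "topspace X \<subseteq> (\<Union>M\<in>UNIV. B M)"
  proof
   fix z assume "z \<in> topspace X"
   then obtain i where "z \<in> A i" unfolding cov[symmetric] by blast
   hence "z \<in> B (m i)" using AU[of i] UB[of i] by blast
   thus "z \<in> (\<Union>M\<in>UNIV. B M)" by blast
  qed
 qed
 obtain g where g: "cmap (cube k) (sec F (\<Union>M\<in>UNIV. B M)) g"
  "\<And>M x. M \<in> UNIV \<Longrightarrow> x \<in> cube k \<Longrightarrow> res F (\<Union>M\<in>UNIV. B M) (B M) (g x) = q M (1, x)"
 proof (rule continuous_glue_cell[OF cell_pair_cube, where I=UNIV and U=B and \<sigma>="\<lambda>M x. q M (1, x)"])
  show "cmap (cube k) (sec F (B M)) (\<lambda>x. q M (1, x))" for M
   by (rule cmap_compose[OF qc]) (auto intro!: continuous_intros)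
  have *: "res F (B M) (B M \<inter> B M') (q M (1, x)) = res F (B M') (B M \<inter> B M') (q M' (1, x))"
   if "M \<le> M'" "x \<in> cube k" for M M' x
  proof -
   have e: "B M \<inter> B M' = B M" using Bmono[OF that(1)] by blast
   show ?thesis unfolding e
    using q2[OF that(1) _ that(2), of 1] res_id[OF oB qs[OF _ that(2), of 1]] tau_less[of M'] by simp
  qed
  show "res F (B M) (B M \<inter> B M') (q M (1, x)) = res F (B M') (B M \<inter> B M') (q M' (1, x))"
   if "x \<in> cube k" for M M' x
   using *[of M M' x] *[of M' M x] that by (cases "M \<le> M'") (auto simp: Int_commute)
 qed (use oB in auto)
 note g = g[unfolded Btop]
 \<comment> \<open>The domain of vertex \<open>i\<close> is frozen at stage \<open>m i\<close>: from
   then on the section over the core, which contains \<open>U i\<close>, takes over. An intersection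
   of all \<open>V n i\<close> might fail to be open.\<close>
 define O' where "O' = (\<lambda>i. V (m i) i)"
 have oO: "openin X (O' i)" for i by (simp add: O'_def oV)
 have oOO: "openin X (UU O' J)" if "J \<in> fins UNIV" for J by (rule openin_UU[OF oO that])
 \<comment> \<open>A simplex uses the earliest of the stages of its vertices. The core up to
   \<open>mm J\<close> already contains the intersection for \<open>J\<close>, and the indices in
   \<open>J\<close> are at most \<open>mm J\<close> unless this intersection is empty.\<close>
 define mm where "mm = (\<lambda>J. Min (m ` J))"
 have mmle: "mm J \<le> m j" if "J \<in> fins UNIV" "j \<in> J" for J j
  using that by (auto simp: mm_def fins_def)
 have mmanti: "mm J \<le> mm J'" if "J \<in> fins UNIV" "J' \<subseteq> J" "J' \<noteq> {}" for J J'
  unfolding mm_def by (rule Min_antimono) (use that in \<open>auto simp: fins_def\<close>)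
 have FV: "UU O' J \<subseteq> UU (V (mm J)) J" if "J \<in> fins UNIV" for J
  by (rule UU_mono) (auto simp: O'_def intro!: subsetD[OF Vmono[OF mmle[OF that]]])
 have F0: "\<exists>j\<in>J. mm J = m j" if "J \<in> fins UNIV" for J
 proof -
  have "Min (m ` J) \<in> m ` J" using that by (intro Min_in) (auto simp: fins_def)
  thus ?thesis unfolding mm_def by (auto elim!: imageE)
 qed
 have FJ: "J \<in> fins {..mm J}" if J: "J \<in> fins UNIV" "UU O' J \<noteq> {}" for J
 proof -
  obtain j0 where j0: "j0 \<in> J" "mm J = m j0" using F0[OF J(1)] by blast
  have "j \<le> mm J" if "j \<in> J" for j
  proof -
   obtain z where "z \<in> UU O' J" using J(2) by blast
   hence "z \<in> O' j0" "z \<in> O' j" using j0(1) that by (auto simp: UU_def)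
   hence "z \<in> U j0" "z \<in> U j" using VU unfolding O'_def by blast+
   hence "U j0 \<inter> U j \<noteq> {}" by blast
   hence "j < m j0" by (rule m)
   thus ?thesis using j0(2) by simp
  qed
  thus ?thesis using J(1) by (auto simp: fins_def)
 qed
 have FB: "UU O' J \<subseteq> B (mm J)" if J: "J \<in> fins UNIV" for J
 proof -
  obtain j0 where j0: "j0 \<in> J" "mm J = m j0" using F0[OF J(1)] by blast
  have "UU O' J \<subseteq> V (m j0) j0" using UU_le[OF j0(1), of O'] by (simp add: O'_def)
  also have "\<dots> \<subseteq> U j0" by (rule VU)
  also have "\<dots> \<subseteq> B (mm J)" unfolding j0(2) by (rule UB)
  finally show ?thesis .
 qed
 \<comment> \<open>A face has fewer vertices and may change over later than \<open>J\<close>. The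
   fact \<open>K\<close> below shows that over the smaller set \<open>UU O' J\<close> the formulas
   with the time of the face and with the time of \<open>J\<close> agree, which gives continuity on
   closed simplices.\<close>
 define hh where "hh = (\<lambda>l z. let J = supp l in if UU O' J = {} then (SOME z. z \<in> sections {})
  else if fst z \<le> tau (mm J) then res F (UU (V (mm J)) J) (UU O' J) (h (mm J) l z)
  else res F (B (mm J)) (UU O' J) (q (mm J) z))"
 have hh_in: "hh l (r, x) \<in> sections (US O' l)"
  if J: "J \<in> fins UNIV" "l \<in> simp J" and r: "r \<in> {0..1}" and x: "x \<in> cube k" for J l r x
 proof (cases "US O' l = {}")
  case True
  thus ?thesis using someI_ex[OF sections_empty_ex] by (simp add: hh_def)
 next
  case False
  have fl: "supp l \<in> fins UNIV" by (rule fins_supp[OF J])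
  have "h (mm (supp l)) l (r, x) \<in> sections (UU (V (mm (supp l))) (supp l))" by (rule cpx_in[OF hn J]) (use r x in auto)
  thus ?thesis using False res_in[OF oVV[OF fl] oOO[OF fl] FV[OF fl]] res_in[OF oB oOO[OF fl] FB[OF fl] qs[OF r x]]
   by (simp add: hh_def Let_def)
 qed
 have K: "(r \<le> tau (mm J) \<longrightarrow> res F (US O' l) (UU O' J) (hh l (r, x)) = res F (UU (V (mm J)) (supp l)) (UU O' J) (h (mm J) l (r, x))) \<and>
   (tau (mm J) \<le> r \<longrightarrow> res F (US O' l) (UU O' J) (hh l (r, x)) = res F (B (mm J)) (UU O' J) (q (mm J) (r, x)))"
  if J: "J \<in> fins UNIV" "l \<in> simp J" and ne: "UU O' J \<noteq> {}" and r: "r \<in> {0..1}" and x: "x \<in> cube k" for J l r x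
 proof -
  have fl: "supp l \<in> fins UNIV" by (rule fins_supp[OF J])
  have sJ: "supp l \<subseteq> J" by (rule supp_simp(1)[OF J(2)])
  have OO: "UU O' J \<subseteq> US O' l" by (rule UU_antimono[OF sJ])
  hence ne': "US O' l \<noteq> {}" using ne by blast
  define M where "M = mm J"
  define M' where "M' = mm (supp l)"
  have MM: "M \<le> M'" unfolding M_def M'_def using fl by (intro mmanti[OF J(1) sJ]) (auto simp: fins_def)
  have hM': "h n l (r, x) \<in> sections (UU (V n) (supp l))" for n by (rule cpx_in[OF hn J]) (use r x in auto)
  have WV: "UU O' J \<subseteq> UU (V M') (supp l)" "UU O' J \<subseteq> UU (V M) (supp l)"
   using OO FV[OF fl] FV[OF J(1)] UU_antimono[OF sJ, of "V M"] unfolding M_def M'_def by auto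
  have WB: "UU O' J \<subseteq> B M" "UU O' J \<subseteq> B M'" using FB[OF J(1)] FB[OF fl] OO unfolding M_def M'_def by auto
  note oW = oOO[OF J(1)]
  show ?thesis
  proof (cases "r \<le> tau M'")
   case True
   have hh: "hh l (r, x) = res F (UU (V M') (supp l)) (US O' l) (h M' l (r, x))"
    using True ne' by (simp add: hh_def Let_def M'_def)
   have e: "res F (US O' l) (UU O' J) (hh l (r, x)) = res F (UU (V M') (supp l)) (UU O' J) (h M' l (r, x))"
    unfolding hh by (rule res_res[OF oVV[OF fl] oOO[OF fl] oW OO _ hM']) (use FV[OF fl] in \<open>simp add: M'_def\<close>)
   have 1: "res F (US O' l) (UU O' J) (hh l (r, x)) = res F (UU (V M) (supp l)) (UU O' J) (h M l (r, x))" if "r \<le> tau M"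
   proof -
    have e2: "h M' l (r, x) = res F (UU (V M) (supp l)) (UU (V M') (supp l)) (h M l (r, x))"
     by (rule h_mono[OF MM _ x J]) (use that r in auto)
    show ?thesis unfolding e unfolding e2
     by (rule res_res[OF oVV[OF fl] oVV[OF fl] oW WV(1) UU_mono[OF Vmono[OF MM]] hM'])
   qed
   \<comment> \<open>Between the two times of change the limit over the core up to \<open>M\<close>
     is already attained at stage \<open>M'\<close>, and there it restricts to the complex.\<close>
   have 2: "res F (US O' l) (UU O' J) (hh l (r, x)) = res F (B M) (UU O' J) (q M (r, x))" if "tau M \<le> r"
   proof -
    have mx: "max (tau M) r = r" using that by simp
    have qp: "q M (r, x) = p M M' (r, x)" by (rule q1[OF MM r _ x]) (use mx True in simp)
    show ?thesis unfolding e qp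
     using pW[OF MM FJ[OF J(1) ne, folded M_def] J(2) r x oW WB(1) WV(1)] mx by simp
   qed
   show ?thesis using 1 2 unfolding M_def by blast
  next
   case False
   have hh: "hh l (r, x) = res F (B M') (US O' l) (q M' (r, x))"
    using False ne' by (simp add: hh_def Let_def M'_def)
   have e: "res F (US O' l) (UU O' J) (hh l (r, x)) = res F (B M') (UU O' J) (q M' (r, x))"
    unfolding hh by (rule res_res[OF oB oOO[OF fl] oW OO _ qs[OF r x]]) (use FB[OF fl] in \<open>simp add: M'_def\<close>)
   have "q M (r, x) = res F (B M') (B M) (q M' (r, x))" using q2[OF MM _ x, of r] False r by simp
   hence "res F (B M) (UU O' J) (q M (r, x)) = res F (B M') (UU O' J) (q M' (r, x))"
    using res_res[OF oB oB oW WB(1) Bmono[OF MM] qs[OF r x]] by simp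
   moreover have "\<not> r \<le> tau M" using False tau_mono[OF MM] by simp
   ultimately show ?thesis using e unfolding M_def by simp
  qed
 qed
 have chh: "cpx UNIV O' (cyl k) hh"
  unfolding cpx_def
 proof (intro conjI ballI)
  fix J l z assume "J \<in> nfins" "l \<in> simp J" "z \<in> cyl k"
  thus "hh l z \<in> sections (US O' l)" using hh_in by auto
 next
  fix J assume J: "J \<in> nfins"
  let ?R = "simp J \<times> (cyl k)"
  show "cmap ?R (sec F (UU O' J)) (\<lambda>(l, z). res F (US O' l) (UU O' J) (hh l z))"
  proof (cases "UU O' J = {}")
   case True
   show ?thesis
    unfolding True
   proof (rule cmap_sections_empty)
    fix w assume "w \<in> topspace (top_of_set ?R)"
    then obtain l r x where w: "w = (l, r, x)" "l \<in> simp J" "r \<in> {0..1}" "x \<in> cube k" by auto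
    have "res F (US O' l) (UU O' J) (hh l (r, x)) \<in> sections (UU O' J)"
     by (rule res_in[OF oOO[OF fins_supp[OF J w(2)]] oOO[OF J] UU_antimono[OF supp_simp(1)[OF w(2)]] hh_in[OF J w(2-4)]])
    thus "(\<lambda>(l, z). res F (US O' l) {} (hh l z)) w \<in> sections {}" using True w(1) by simp
   qed
  next
   case False
   note KJ = K[OF J _ False]
   show ?thesis
   proof (rule cmap_paste_le[where a="\<lambda>w. fst (snd w)" and b="\<lambda>_. tau (mm J)"])
    show "continuous_on ?R (\<lambda>w. fst (snd w))" "continuous_on ?R (\<lambda>_. tau (mm J))" by (intro continuous_intros)+
    let ?R1 = "{w \<in> ?R. fst (snd w) \<le> tau (mm J)}"
    let ?R2 = "{w \<in> ?R. tau (mm J) \<le> fst (snd w)}"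
    have "cmap ?R1 (sec F (UU O' J)) (\<lambda>w. res F (UU (V (mm J)) (supp (fst w))) (UU O' J) (h (mm J) (fst w) (snd w)))"
     by (rule cpx_comp[OF hn J _ _ _ _ oOO[OF J] FV[OF J]]) (auto intro!: continuous_intros)
    thus "cmap ?R1 (sec F (UU O' J)) (\<lambda>(l, z). res F (US O' l) (UU O' J) (hh l z))"
    proof (rule continuous_map_eq)
     fix w assume "w \<in> topspace (top_of_set ?R1)"
     then obtain l r x where w: "w = (l, r, x)" "l \<in> simp J" "r \<in> {0..1}" "x \<in> cube k" "r \<le> tau (mm J)" by auto
     show "res F (UU (V (mm J)) (supp (fst w))) (UU O' J) (h (mm J) (fst w) (snd w)) = (\<lambda>(l, z). res F (US O' l) (UU O' J) (hh l z)) w"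
      using KJ[OF w(2-4)] w(5) by (simp add: w(1))
    qed
    have "cmap ?R2 (sec F (UU O' J)) (\<lambda>w. res F (B (mm J)) (UU O' J) (q (mm J) (snd w)))"
     by (rule cmap_res[OF cmap_compose[OF qc] oB oOO[OF J] FB[OF J]]) (auto intro!: continuous_intros)
    thus "cmap ?R2 (sec F (UU O' J)) (\<lambda>(l, z). res F (US O' l) (UU O' J) (hh l z))"
    proof (rule continuous_map_eq)
     fix w assume "w \<in> topspace (top_of_set ?R2)"
     then obtain l r x where w: "w = (l, r, x)" "l \<in> simp J" "r \<in> {0..1}" "x \<in> cube k" "tau (mm J) \<le> r" by auto
     show "res F (B (mm J)) (UU O' J) (q (mm J) (snd w)) = (\<lambda>(l, z). res F (US O' l) (UU O' J) (hh l z)) w"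
      using KJ[OF w(2-4)] w(5) by (simp add: w(1))
    qed
   qed
  qed
 qed (rule oO)
 have OU: "O' i \<subseteq> U i" for i by (simp add: O'_def VU)
 have hh_self: "(r \<le> tau (mm (supp l)) \<longrightarrow> hh l (r, x) = res F (UU (V (mm (supp l))) (supp l)) (US O' l) (h (mm (supp l)) l (r, x))) \<and>
   (tau (mm (supp l)) \<le> r \<longrightarrow> hh l (r, x) = res F (B (mm (supp l))) (US O' l) (q (mm (supp l)) (r, x)))"
  if J: "J \<in> fins UNIV" "l \<in> simp J" and ne: "US O' l \<noteq> {}" and r: "r \<in> {0..1}" and x: "x \<in> cube k" for J l r x
  using K[OF fins_supp[OF J] fins_supp_simp[OF J] ne r x]
  unfolding res_id[OF oOO[OF fins_supp[OF J]] hh_in[OF J r x]] .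
 have hp: "htpy UNIV U O' (cube k) (cube_bd k) f hh"
 proof (rule htpyI[OF OU chh])
  fix J l x assume J: "J \<in> nfins" and l: "l \<in> simp J"
  have fl: "supp l \<in> fins UNIV" by (rule fins_supp[OF J l])
  have UO: "US O' l \<subseteq> US U l" by (rule UU_mono[OF OU])
  show "hh l (0, x) = res F (US U l) (US O' l) (f l x)" if x: "x \<in> cube k"
  proof (cases "US O' l = {}")
   case True
   have "hh l (0, x) \<in> sections {}" using hh_in[OF J l _ x, of 0] True by simp
   moreover have "res F (US U l) (US O' l) (f l x) \<in> sections {}"
    using res_in[OF cpx_openUU[OF f fl] oOO[OF fl] UO cpx_in[OF f J l x]] True by simp
   ultimately show ?thesis by (rule sections_empty_unique)
  next
   case False
   have "hh l (0, x) = res F (UU (V (mm (supp l))) (supp l)) (US O' l) (h (mm (supp l)) l (0, x))"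
    using hh_self[OF J l False _ x, of 0] tau_nonneg by simp
   thus ?thesis using htpy_res[OF hV J l x f oOO[OF fl] FV[OF fl]] by simp
  qed
  fix t :: real assume xb: "x \<in> cube_bd k" and t: "t \<in> {0..1}"
  have x: "x \<in> cube k" using xb cube_bd_subset by blast
  show "hh l (t, x) = hh l (0, x)"
  proof (cases "US O' l = {}")
   case True
   have "hh l (t, x) \<in> sections {}" "hh l (0, x) \<in> sections {}" using hh_in[OF J l t x] hh_in[OF J l _ x, of 0] True by auto
   thus ?thesis by (rule sections_empty_unique)
  next
   case False
   define M where "M = mm (supp l)"
   have h0: "hh l (r, x) = res F (UU (V M) (supp l)) (US O' l) (h M l (0, x))" if "r \<in> {0..1}" "r \<le> tau M" for r
    using hh_self[OF J l False that(1) x] that(2) htpyD(4)[OF hV J l xb that(1)] by (simp add: M_def)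
   have t01: "tau M \<in> {0..1}" using tau_nonneg[of M] tau_less[of M] by simp
   show ?thesis
   proof (cases "t \<le> tau M")
    case True
    show ?thesis unfolding h0[OF t True] using h0[of 0] tau_nonneg by simp
   next
    case F2: False
    hence "hh l (t, x) = res F (B M) (US O' l) (q M (t, x))" using hh_self[OF J l False t x] by (simp add: M_def)
    also have "q M (t, x) = q M (tau M, x)" using qb[OF t xb] qb[OF t01 xb] by simp
    also have "res F (B M) (US O' l) (q M (tau M, x)) = hh l (tau M, x)"
     using hh_self[OF J l False t01 x, THEN conjunct2] unfolding M_def by simp
    also have "\<dots> = hh l (0, x)" using h0[OF t01 order_refl] h0[of 0] tau_nonneg by simp
    finally show ?thesis .
   qed
  qed
 qed
 show thesis
 proof (rule that[OF _ hp g(1)])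
  show "A i \<subseteq> O' i" for i by (simp add: O'_def AV)
  fix J l x assume J: "J \<in> nfins" and l: "l \<in> simp J" and x: "x \<in> cube k"
  have fl: "supp l \<in> fins UNIV" by (rule fins_supp[OF J l])
  have gs: "g x \<in> sections (topspace X)" by (rule cmap_in[OF g(1) x])
  have Ot: "US O' l \<subseteq> topspace X" by (rule openin_subset[OF oOO[OF fl]])
  show "hh l (1, x) = res F (topspace X) (US O' l) (g x)"
  proof (cases "US O' l = {}")
   case True
   have "hh l (1, x) \<in> sections {}" using hh_in[OF J l _ x, of 1] True by simp
   moreover have "res F (topspace X) (US O' l) (g x) \<in> sections {}"
    using res_in[OF openin_topspace oOO[OF fl] Ot gs] True by simp
   ultimately show ?thesis by (rule sections_empty_unique)
  next
   case False
   have "hh l (1, x) = res F (B (mm (supp l))) (US O' l) (q (mm (supp l)) (1, x))"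
    using hh_self[OF J l False _ x, of 1] tau_less[of "mm (supp l)"] by simp
   also have "q (mm (supp l)) (1, x) = res F (topspace X) (B (mm (supp l))) (g x)" using g(2)[OF UNIV_I x] by simp
   also have "res F (B (mm (supp l))) (US O' l) \<dots> = res F (topspace X) (US O' l) (g x)"
    by (rule res_res[OF openin_topspace oB oOO[OF fl] FB[OF fl] openin_subset[OF oB] gs])
   finally show ?thesis .
  qed
 qed
qed

end

text \<open>Finitely many sets \<open>Q y\<close>, on which \<open>b\<close> stays within
  \<open>e / 3\<close> of \<open>b y\<close>, cover the compact \<open>Y\<close>. The conditions
  that the compact \<open>C y\<close> be mapped into \<open>G y\<close>, the points that
  \<open>r\<close> sends into the ball of radius \<open>e / 2\<close> about \<open>b y\<close>, are
  open and hold for \<open>a\<close> itself; \<open>e / 3 + e / 2 < e\<close> gives the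
  estimate.\<close>

lemma compact_open_uniform_nbhd:
 assumes Y: "compact_space Y" and d: "Metric_space S d" and a: "continuous_map Y Z a"
  and r: "continuous_map Z (Metric_space.mtopology S d) r" and e: "0 < e"
 shows "\<exists>G. openin (compact_open_topology Y Z) G \<and> restrict a (topspace Y) \<in> G \<and>
  (\<forall>p\<in>G. \<forall>y\<in>topspace Y. d (r (a y)) (r (p y)) < e)"
proof -
 interpret Metric_space S d by (rule d)
 define b where "b = (\<lambda>y. r (a y))"
 have b: "continuous_map Y mtopology b" unfolding b_def using continuous_map_compose[OF a r] by (simp add: o_def)
 have bS: "b y \<in> S" if "y \<in> topspace Y" for y using b that unfolding continuous_map_def by auto
 have az: "a y \<in> topspace Z" if "y \<in> topspace Y" for y using a that unfolding continuous_map_def by auto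
 define C where "C y = {y' \<in> topspace Y. b y' \<in> mcball (b y) (e / 3)}" for y
 define Q where "Q y = {y' \<in> topspace Y. b y' \<in> mball (b y) (e / 3)}" for y
 define G where "G y = {z \<in> topspace Z. r z \<in> mball (b y) (e / 2)}" for y
 have oG: "openin Z (G y)" for y
  unfolding G_def by (rule openin_continuous_map_preimage[OF r]) simp
 have oQ: "openin Y (Q y)" for y
  unfolding Q_def by (rule openin_continuous_map_preimage[OF b]) simp
 have "closedin Y (C y)" for y
  unfolding C_def by (rule closedin_continuous_map_preimage[OF b]) simp
 hence cC: "compactin Y (C y)" for y using Y closedin_compact_space by blast
 have "\<exists>\<F>. finite \<F> \<and> \<F> \<subseteq> Q ` topspace Y \<and> topspace Y \<subseteq> \<Union>\<F>"
 proof -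
  have "topspace Y \<subseteq> \<Union>(Q ` topspace Y)" using bS e by (auto simp: Q_def)
  thus ?thesis using Y oQ unfolding compact_space_alt by (metis (no_types, lifting) imageE)
 qed
 then obtain Ys where Ys: "finite Ys" "Ys \<subseteq> topspace Y" "topspace Y \<subseteq> \<Union>(Q ` Ys)"
  by (metis finite_subset_image)
 define N where "N = \<Inter>(insert (continuous_maps Y Z) ((\<lambda>y. {f \<in> continuous_maps Y Z. f ` C y \<subseteq> G y}) ` Ys))"
 have "openin (compact_open_topology Y Z) N"
  unfolding N_def
 proof (rule openin_Inter)
  show "openin (compact_open_topology Y Z) V"
   if "V \<in> insert (continuous_maps Y Z) ((\<lambda>y. {f \<in> continuous_maps Y Z. f ` C y \<subseteq> G y}) ` Ys)" for V
   using that openin_compact_open[OF cC oG] openin_topspace[of "compact_open_topology Y Z"]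
   unfolding topspace_compact_open by auto
 qed (use Ys in auto)
 moreover have "restrict a (topspace Y) \<in> N"
 proof -
  have "restrict a (topspace Y) ` C y \<subseteq> G y" if "y \<in> Ys" for y
  proof
   fix z assume "z \<in> restrict a (topspace Y) ` C y"
   then obtain y' where y': "y' \<in> C y" "z = restrict a (topspace Y) y'" by blast
   have yt: "y' \<in> topspace Y" using y'(1) by (simp add: C_def)
   have "d (b y) (b y') \<le> e / 3" "b y \<in> S" "b y' \<in> S" using y'(1) by (auto simp: C_def)
   thus "z \<in> G y" using y'(2) yt az[OF yt] e by (simp add: G_def b_def)
  qed
  moreover have "restrict a (topspace Y) \<in> continuous_maps Y Z" by (rule continuous_maps_restrict[OF a])
  ultimately show ?thesis by (auto simp: N_def)
 qed
 moreover have "d (r (a y)) (r (p y)) < e" if p: "p \<in> N" and y: "y \<in> topspace Y" for p y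
 proof -
  obtain y0 where y0: "y0 \<in> Ys" "y \<in> Q y0" using Ys(3) y by blast
  have yC: "y \<in> C y0" using y0(2) by (auto simp: Q_def C_def)
  have "p ` C y0 \<subseteq> G y0" using p y0(1) by (auto simp: N_def)
  hence "p y \<in> G y0" using yC by blast
  hence 1: "d (b y0) (r (p y)) < e / 2" "r (p y) \<in> S" by (auto simp: G_def)
  have 2: "d (b y) (b y0) < e / 3" "b y0 \<in> S" "b y \<in> S" using y0(2) by (auto simp: Q_def commute)
  show ?thesis using triangle[OF 2(3,2) 1(2)] 1(1) 2(1) e by (simp add: b_def)
 qed
 ultimately show ?thesis by blast
qed

lemma compact_disk: "compact_space (disk n)"
proof -
 have "compact (disk_set n)" by (rule cell_pair_compact[OF cell_pair_disk])
 thus ?thesis by (simp add: disk_eq compact_space_subtopology)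
qed

text \<open>\<open>U i\<close> is placed inside some \<open>K (c i)\<close>, and every
  \<open>K j\<close> with \<open>j \<le> i\<close> that misses \<open>A i\<close> is removed from
  it. So \<open>U j\<close> meets \<open>K (c i)\<close> only if \<open>j < c i\<close> or
  \<open>A j\<close> meets \<open>K (c i)\<close>, and by local finiteness this leaves finitely many
  \<open>j\<close>.\<close>

lemma locally_finite_enlarge:
 fixes A W :: "nat \<Rightarrow> 'a set"
 assumes X: "Hausdorff_space X" and K: "exhaustion X K" "\<And>i. compactin X (K i)"
  and A: "\<And>i. compactin X (A i)" and W: "\<And>i. openin X (W i)" "\<And>i. A i \<subseteq> W i"
  and lf: "\<And>x. x \<in> topspace X \<Longrightarrow> \<exists>V. openin X V \<and> x \<in> V \<and> finite {i. A i \<inter> V \<noteq> {}}"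
 obtains U where "\<And>i. openin X (U i)" "\<And>i. A i \<subseteq> U i" "\<And>i. U i \<subseteq> W i" "\<And>i. finite {j. U i \<inter> U j \<noteq> {}}"
proof -
 have Kint: "K i \<subseteq> X interior_of K (Suc i)" and KSuc: "K i \<subseteq> K (Suc i)" and Ktop: "(\<Union>i. K i) = topspace X" for i
  using K(1) unfolding exhaustion_def by auto
 have Kmono: "K i \<subseteq> K j" if "i \<le> j" for i j using lift_Suc_mono_le[of K, OF KSuc that] .
 have "\<exists>m. A i \<subseteq> X interior_of K m" for i
 proof -
  have "A i \<subseteq> \<Union>(range (\<lambda>m. X interior_of K m))"
  proof
   fix x assume "x \<in> A i"
   hence "x \<in> topspace X" using A[of i] by (auto simp: compactin_def)
   then obtain m where "x \<in> K m" unfolding Ktop[symmetric] by blast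
   thus "x \<in> \<Union>(range (\<lambda>m. X interior_of K m))" using Kint[of m] by blast
  qed
  then obtain \<F> where \<F>: "finite \<F>" "\<F> \<subseteq> range (\<lambda>m. X interior_of K m)" "A i \<subseteq> \<Union>\<F>"
   using compactinD[OF A[of i], of "range (\<lambda>m. X interior_of K m)"] by (metis (no_types, lifting) imageE openin_interior_of)
  obtain S where S: "finite S" "\<F> = (\<lambda>m. X interior_of K m) ` S" using \<F>(1,2) by (metis finite_subset_image)
  have "\<Union>\<F> \<subseteq> X interior_of K (Max (insert 0 S))"
   unfolding S(2) by (intro UN_least interior_of_mono Kmono Max_ge) (use S(1) in auto)
  thus ?thesis using \<F>(3) by blast
 qed
 then obtain c where c: "\<And>i. A i \<subseteq> X interior_of K (c i)" by metis
 define U where "U i = W i \<inter> (X interior_of K (c i)) - \<Union>{K j | j. j \<le> i \<and> A i \<inter> K j = {}}" for i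
 have clK: "closedin X (K j)" for j by (rule compactin_imp_closedin[OF X K(2)])
 show thesis
 proof (rule that[of U])
  fix i
  have "closedin X (\<Union>{K j | j. j \<le> i \<and> A i \<inter> K j = {}})"
  proof (rule closedin_Union)
   have "{K j | j. j \<le> i \<and> A i \<inter> K j = {}} \<subseteq> K ` {..i}" by blast
   thus "finite {K j | j. j \<le> i \<and> A i \<inter> K j = {}}" by (rule finite_subset) simp
  qed (use clK in blast)
  thus "openin X (U i)" unfolding U_def using W(1)[of i] by (intro openin_diff openin_Int) auto
  show "U i \<subseteq> W i" by (auto simp: U_def)
  show "A i \<subseteq> U i" using W(2)[of i] c[of i] by (auto simp: U_def)
  have UK: "U i \<subseteq> K (c i)" using interior_of_subset[of X "K (c i)"] by (auto simp: U_def)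
  have "finite {j. A j \<inter> K (c i) \<noteq> {}}"
  proof -
   obtain V where V: "\<And>x. x \<in> topspace X \<Longrightarrow> openin X (V x) \<and> x \<in> V x \<and> finite {i. A i \<inter> V x \<noteq> {}}"
    using lf by metis
   have Kt: "K (c i) \<subseteq> topspace X" using K(2)[of "c i"] by (simp add: compactin_def)
   hence "K (c i) \<subseteq> \<Union>(V ` K (c i))" using V by blast
   then obtain \<F> where \<F>: "finite \<F>" "\<F> \<subseteq> V ` K (c i)" "K (c i) \<subseteq> \<Union>\<F>"
    using compactinD[OF K(2)[of "c i"], of "V ` K (c i)"] V Kt by blast
   have "{j. A j \<inter> K (c i) \<noteq> {}} \<subseteq> (\<Union>T\<in>\<F>. {j. A j \<inter> T \<noteq> {}})" using \<F>(3) by blast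
   moreover have "finite (\<Union>T\<in>\<F>. {j. A j \<inter> T \<noteq> {}})" using \<F>(1,2) V Kt by (intro finite_UN_I) auto
   ultimately show ?thesis by (rule finite_subset)
  qed
  hence "finite ({..<c i} \<union> {j. A j \<inter> K (c i) \<noteq> {}})" by simp
  moreover have "{j. U i \<inter> U j \<noteq> {}} \<subseteq> {..<c i} \<union> {j. A j \<inter> K (c i) \<noteq> {}}"
  proof
   fix j assume "j \<in> {j. U i \<inter> U j \<noteq> {}}"
   then obtain z where z: "z \<in> U j" "z \<in> K (c i)" using UK by blast
   hence "\<not> (c i \<le> j \<and> A j \<inter> K (c i) = {})" by (auto simp: U_def)
   thus "j \<in> {..<c i} \<union> {j. A j \<inter> K (c i) \<noteq> {}}" by auto
  qed
  ultimately show "finite {j. U i \<inter> U j \<noteq> {}}" using finite_subset by blast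
 qed
qed

context space_sheaf
begin

definition flexible_class where
 "flexible_class \<longleftrightarrow> ((\<exists>d. complete_metric_sheaf X F d) \<and> weakly_flexible X F) \<or> ordered_flexible X F"

text \<open>The compacts of the flexible cover are forgotten; later steps only use that the sets
  \<open>O'\<close> still cover \<open>X\<close>.\<close>

definition glues where
 "glues k U f \<longleftrightarrow> (\<exists>O' h g. (\<Union>i::nat. O' i) = topspace X \<and> htpy UNIV U O' (cube k) (cube_bd k) f h \<and>
  cmap (cube k) (sec F (topspace X)) g \<and>
  (\<forall>J\<in>fins UNIV. \<forall>l\<in>simp J. \<forall>x\<in>cube k. h l (1, x) = res F (topspace X) (US O' l) (g x)))"

lemma flexible_cover_facts:
 assumes X: "Hausdorff_space X" and PW: "\<And>A B. P A B \<Longrightarrow> weakly_flexible_pair X F A B"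
  and A: "flexible_cover X P A"
 shows "compactin X (A i)" "P (\<Union>i<Suc n. A i) (A (Suc n))" "glueable (Suc n) (\<lambda>i. A i \<inter> A (Suc n))"
proof -
 have s: "flexible_string X P (map A [0..<n])" if "2 \<le> n" for n
  using A that unfolding flexible_cover_def by blast
 show "compactin X (A i)"
  using flexible_string_glueable[OF X PW s[of "Suc (Suc i)"]] by auto
 have s2: "flexible_string X P (map A [0..<Suc n] @ [A (Suc n)])" using s[of "Suc (Suc n)"] by simp
 have "\<Union>(set (map A [0..<Suc n])) = (\<Union>i<Suc n. A i)" by (simp only: set_map set_upt lessThan_atLeast0)
 thus "P (\<Union>i<Suc n. A i) (A (Suc n))" using flexible_string_snocD(1)[OF s2] by (simp only:)
 \<comment> \<open>A single intersection does not form a string, since strings have at least two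
   members; for one set gluing is trivial.\<close>
 show "glueable (Suc n) (\<lambda>i. A i \<inter> A (Suc n))"
 proof (cases "n = 0")
  case True
  thus ?thesis using glueable_1 by simp
 next
  case False
  let ?L = "map (\<lambda>B. B \<inter> A (Suc n)) (map A [0..<Suc n])"
  have "flexible_string X P ?L" by (rule flexible_string_snocD(2)[OF s2]) (use False in simp)
  hence "glueable (length ?L) ((!) ?L)" using flexible_string_glueable[OF X PW] by blast
  hence "glueable (Suc n) ((!) ?L)" by simp
  thus ?thesis
  proof (rule glueable_cong[rotated])
   fix i assume "i < Suc n"
   thus "?L ! i = A i \<inter> A (Suc n)" by (simp only: nth_map length_map length_upt diff_zero nth_upt add_0)
  qed
 qed
qed

text \<open>The family \<open>w\<close> is fixed before any complex is considered and serves all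
  dimensions: the deformation complexes are built on it afterwards. Its members contain the compacts
  of a flexible cover that refines \<open>\<W>\<close>.\<close>

lemma flexible_class_glues:
 assumes X: "Hausdorff_space X" and K: "exhaustion X K" "\<And>i. compactin X (K i)"
  and fc: "flexible_class" and \<W>: "open_cover X \<W>"
 obtains w where "\<And>i. w i \<in> \<W>"
  "\<And>k f. cpx UNIV w (cube k) f \<Longrightarrow> (\<And>x. x \<in> cube_bd k \<Longrightarrow> cst UNIV w f x) \<Longrightarrow> glues k w f"
proof -
 \<comment> \<open>Shared by both classes: the complex is restricted to a locally finite family
   inside \<open>w\<close>. The infinite gluing for the cover at hand is passed as the elimination
   rule \<open>inf\<close>.\<close>
 have main: "glues k w f"
  if P: "\<And>A B. P A B \<Longrightarrow> weakly_flexible_pair X F A B" and A: "flexible_cover X P A"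
   and w: "\<And>i. openin X (w i)" "\<And>i. A i \<subseteq> w i"
   and f: "cpx UNIV w (cube k) f" and bd: "\<And>x. x \<in> cube_bd k \<Longrightarrow> cst UNIV w f x"
   and inf: "\<And>U f thesis. \<lbrakk>cpx UNIV U (cube k) f; (\<And>x. x \<in> cube_bd k \<Longrightarrow> cst UNIV U f x); (\<And>i. A i \<subseteq> U i);
    (\<And>i. finite {j. U i \<inter> U j \<noteq> {}}); (\<And>O' h g. (\<And>i. A i \<subseteq> O' i) \<Longrightarrow>
     htpy UNIV U O' (cube k) (cube_bd k) f h \<Longrightarrow> cmap (cube k) (sec F (topspace X)) g \<Longrightarrow>
     (\<And>J l x. J \<in> fins UNIV \<Longrightarrow> l \<in> simp J \<Longrightarrow> x \<in> cube k \<Longrightarrow> h l (1, x) = res F (topspace X) (US O' l) (g x)) \<Longrightarrow> thesis)\<rbrakk> \<Longrightarrow> thesis"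
  for P A k f w
 proof -
  have lf: "\<exists>V. openin X V \<and> x \<in> V \<and> finite {i. A i \<inter> V \<noteq> {}}" if "x \<in> topspace X" for x
   using A that unfolding flexible_cover_def by blast
  have cov: "(\<Union>i. A i) = topspace X" using A unfolding flexible_cover_def by blast
  obtain U where U: "\<And>i. openin X (U i)" "\<And>i. A i \<subseteq> U i" "\<And>i. U i \<subseteq> w i" "\<And>i. finite {j. U i \<inter> U j \<noteq> {}}"
   using locally_finite_enlarge[OF X K flexible_cover_facts(1)[OF X P A] w lf] by metis
  define f' where "f' = (\<lambda>l x. res F (US w l) (US U l) (f l x))"
  have f': "cpx UNIV U (cube k) f'" unfolding f'_def by (rule cpx_restrict[OF f _ U(1,3)]) simp
  have bd': "cst UNIV U f' x" if x: "x \<in> cube_bd k" for x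
   unfolding f'_def by (rule cst_restrict[OF f bd[OF x] _ _ U(1,3)]) (use x cube_bd_subset in auto)
  show ?thesis
  proof (rule inf[OF f' bd' U(2,4)])
   fix O' h g assume AO: "\<And>i. A i \<subseteq> O' i" and h: "htpy UNIV U O' (cube k) (cube_bd k) f' h"
    and g: "cmap (cube k) (sec F (topspace X)) g"
    and hg: "\<And>J l x. \<lbrakk>J \<in> fins UNIV; l \<in> simp J; x \<in> cube k\<rbrakk> \<Longrightarrow> h l (1, x) = res F (topspace X) (US O' l) (g x)"
   have oO: "openin X (O' i)" for i by (rule cpx_open[OF htpyD(2)[OF h] UNIV_I])
   have "(\<Union>i. O' i) = topspace X"
   proof
    show "(\<Union>i. O' i) \<subseteq> topspace X" using openin_subset[OF oO] by blast
    show "topspace X \<subseteq> (\<Union>i. O' i)" unfolding cov[symmetric] by (rule UN_mono[OF subset_refl AO])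
   qed
   moreover have "htpy UNIV w O' (cube k) (cube_bd k) f h"
   proof (rule htpyI[OF _ htpyD(2)[OF h] _ htpyD(4)[OF h]])
    show "O' i \<subseteq> w i" for i using htpyD(1)[OF h UNIV_I] U(3) by blast
    fix J l x assume a: "J \<in> nfins" "l \<in> simp J" "x \<in> cube k"
    have fl: "supp l \<in> fins UNIV" by (rule fins_supp[OF a(1,2)])
    show "h l (0, x) = res F (US w l) (US O' l) (f l x)"
     unfolding htpyD(3)[OF h a] f'_def
     by (rule res_res[OF cpx_openUU[OF f fl] cpx_openUU[OF f' fl] cpx_openUU[OF htpyD(2)[OF h] fl]
       UU_mono[OF htpyD(1)[OF h UNIV_I]] UU_mono[OF U(3)] cpx_in[OF f a]])
   qed
   ultimately show ?thesis unfolding glues_def using g hg by blast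
  qed
 qed
 have choose: "\<exists>w. (\<forall>i. w i \<in> \<W> \<and> A i \<subseteq> w i \<and> openin X (w i))" if AW: "\<forall>i. \<exists>W\<in>\<W>. A i \<subseteq> W" for A :: "nat \<Rightarrow> 'a set"
 proof -
  obtain w where "\<And>i. w i \<in> \<W> \<and> A i \<subseteq> w i" using AW by metis
  thus ?thesis using \<W> unfolding open_cover_def by blast
 qed
 consider (ordered) "ordered_flexible X F" | (metric) d where "complete_metric_sheaf X F d" "weakly_flexible X F"
  using fc unfolding flexible_class_def by blast
 thus thesis
 proof cases
  case ordered
  then obtain A where A: "flexible_cover X (ordered_flexible_pair X F) A" "\<forall>i. \<exists>W\<in>\<W>. A i \<subseteq> W"
   using \<W> unfolding ordered_flexible_def flexible_sheaf_def by blast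
  obtain w where w: "\<And>i. w i \<in> \<W> \<and> A i \<subseteq> w i \<and> openin X (w i)" using choose[OF A(2)] by blast
  note P = ordered_flexible_pair_imp_weakly
  note Af = flexible_cover_facts[OF X P A(1)]
  show thesis
  proof (rule that[of w])
   show "w i \<in> \<W>" for i using w by blast
   fix k f assume f: "cpx UNIV w (cube k) f" and bd: "\<And>x. x \<in> cube_bd k \<Longrightarrow> cst UNIV w f x"
   show "glues k w f"
   proof (rule main[OF P A(1) _ _ f bd])
    fix U f and thesis :: bool
    assume a: "cpx UNIV U (cube k) f" "\<And>x. x \<in> cube_bd k \<Longrightarrow> cst UNIV U f x" "\<And>i. A i \<subseteq> U i"
     "\<And>i. finite {j. U i \<inter> U j \<noteq> {}}"
     "\<And>O' h g. \<lbrakk>(\<And>i. A i \<subseteq> O' i);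
      htpy UNIV U O' (cube k) (cube_bd k) f h; cmap (cube k) (sec F (topspace X)) g;
      (\<And>J l x. J \<in> fins UNIV \<Longrightarrow> l \<in> simp J \<Longrightarrow> x \<in> cube k \<Longrightarrow> h l (1, x) = res F (topspace X) (US O' l) (g x))\<rbrakk> \<Longrightarrow> thesis"
    show thesis
    \<comment> \<open>Ordered case: consecutive approximations over a core are equal, so the limits
      are those of eventually constant sequences.\<close>
    proof (rule infinite_glue[where A=A and k=k and U=U and f=f and R="\<lambda>n a0 a. \<forall>x\<in>cube k. a x = a0 x"
       and E="\<lambda>n M z z'. z = z'" and lim="\<lambda>V s z. z \<in> sections V \<and> (\<exists>N. \<forall>n\<ge>N. s n = z)", OF X Af(1)])
     show "(\<Union>i. A i) = topspace X" using A(1) unfolding flexible_cover_def by blast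
     show "flexible_with (\<lambda>a0 a. \<forall>x\<in>cube k. a x = a0 x) k (\<Union>i<Suc n. A i) (A (Suc n))" for n
      by (rule ordered_flexible_with[OF Af(2)])
     show "glueable (Suc n) (\<lambda>i. A i \<inter> A (Suc n))" for n by (rule Af(3))
     show "z = z'" if l: "z \<in> sections V \<and> (\<exists>N. \<forall>n\<ge>N. s n = z)" "z' \<in> sections V \<and> (\<exists>N. \<forall>n\<ge>N. s n = z')" for V and s :: "nat \<Rightarrow> 'b" and z z'
     proof -
      obtain N N' where N: "\<forall>n\<ge>N. s n = z" "\<forall>n\<ge>N'. s n = z'" using l by blast
      have "s (max N N') = z" using N(1) by simp
      moreover have "s (max N N') = z'" using N(2) by simp
      ultimately show ?thesis by simp
     qed
     show "res F V W z \<in> sections W \<and> (\<exists>N. \<forall>n\<ge>N. res F V W (s n) = res F V W z)"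
      if "openin X V" "openin X W" "W \<subseteq> V" "z \<in> sections V \<and> (\<exists>N. \<forall>n\<ge>N. s n = z)" for V W and s :: "nat \<Rightarrow> 'b" and z
      using that res_in[of V W z] by metis
     show "z \<in> sections V \<and> (\<exists>N. \<forall>n\<ge>N. s' n = z)"
      if l: "z \<in> sections V \<and> (\<exists>N. \<forall>n\<ge>N. s n = z)" and e: "\<And>n. N \<le> n \<Longrightarrow> s n = s' n" for V and s s' :: "nat \<Rightarrow> 'b" and z and N :: nat
     proof -
      obtain N' where N': "\<forall>n\<ge>N'. s n = z" using l by blast
      have "s' n = z" if "max N N' \<le> n" for n using N' e[of n] that by simp
      thus ?thesis using l by blast
     qed
     show "\<exists>q. cmap (cyl k) (sec F (core A M)) q \<and>
       (\<forall>y\<in>cyl k. q y \<in> sections (core A M) \<and> (\<exists>N. \<forall>n\<ge>N. p n y = q y))"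
      if p: "\<And>n. cmap (cyl k) (sec F (core A M)) (p n)"
       "\<And>n y. M \<le> n \<Longrightarrow> y \<in> cyl k \<Longrightarrow> p n y = p (Suc n) y" for M p
     proof (intro exI[of _ "p M"] conjI ballI p(1))
      fix y assume y: "y \<in> cyl k"
      show "p M y \<in> sections (core A M)" by (rule cmap_in[OF p(1) y])
      have "p n y = p M y" if "M \<le> n" for n
       using that
      proof (induction n rule: dec_induct)
       case (step n)
       thus ?case using p(2)[OF step(1) y] by simp
      qed simp
      thus "\<exists>N. \<forall>n\<ge>N. p n y = p M y" by blast
     qed
     show "res F (core A n) (core A M) (a0 x) =
       res F (core A n) (core A M) (a x)"
      if "\<forall>x\<in>cube k. a x = a0 x" "x \<in> cube k" for n a0 a M x using that by simp
     show "z \<in> sections V \<and> (\<exists>N. \<forall>n\<ge>N. z = z)" if "z \<in> sections V" for V z using that by simp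
     show "cpx UNIV U (cube k) f" by (rule a(1))
     show "cst UNIV U f x" if "x \<in> cube_bd k" for x by (rule a(2)[OF that])
     show "A i \<subseteq> U i" for i by (rule a(3))
     show "finite {j. U i \<inter> U j \<noteq> {}}" for i by (rule a(4))
     show thesis if "\<And>i. A i \<subseteq> O' i" "htpy UNIV U O' (cube k) (cube_bd k) f h"
      "cmap (cube k) (sec F (topspace X)) g"
      "\<And>J l x. \<lbrakk>J \<in> fins UNIV; l \<in> simp J; x \<in> cube k\<rbrakk> \<Longrightarrow> h l (1, x) = res F (topspace X) (US O' l) (g x)"
      for O' h g by (rule a(5)[OF that])
    qed simp_all
   qed (use w in auto)
  qed
 next
  case metric
  then obtain A where A: "flexible_cover X (weakly_flexible_pair X F) A" "\<forall>i. \<exists>W\<in>\<W>. A i \<subseteq> W"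
   using \<W> unfolding weakly_flexible_def flexible_sheaf_def by blast
  obtain w where w: "\<And>i. w i \<in> \<W> \<and> A i \<subseteq> w i \<and> openin X (w i)" using choose[OF A(2)] by blast
  have P: "weakly_flexible_pair X F A B \<Longrightarrow> weakly_flexible_pair X F A B" for A B .
  note Af = flexible_cover_facts[OF X P A(1)]
  have m: "Metric_space (sections U) (d U)" "Metric_space.mtopology (sections U) (d U) = sec F U"
   "Metric_space.mcomplete (sections U) (d U)" if U: "openin X U" for U
  proof -
   have "Metric_space (sections U) (d U) \<and> Metric_space.mtopology (sections U) (d U) = sec F U \<and>
     Metric_space.mcomplete (sections U) (d U)"
    using metric(1) U unfolding complete_metric_sheaf_def by blast
   thus "Metric_space (sections U) (d U)" "Metric_space.mtopology (sections U) (d U) = sec F U"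
    "Metric_space.mcomplete (sections U) (d U)" by simp_all
  qed
  define I where "I = (\<lambda>M. core A M)"
  have oI: "openin X (I M)" for M by (simp add: I_def)
  have Imono: "I M \<subseteq> I n" if "M \<le> n" for M n unfolding I_def by (intro interior_of_mono UN_mono) (use that in auto)
  \<comment> \<open>Closeness is demanded over all smaller cores separately, because restriction is
    only continuous with respect to the metrics on different open sets. The bounds
    \<open>1 / 2 ^ n\<close> are summable.\<close>
  define e where "e = (\<lambda>n z z'. \<forall>M\<le>n. d (I M) (res F (I n) (I M) z) (res F (I n) (I M) z') < 1 / 2 ^ n)"
  have haus: "Hausdorff_space (sec F U)" if "openin X U" for U
   using Metric_space.Hausdorff_space_mtopology[OF m(1)[OF that]] m(2)[OF that] by simp
  show thesis
  proof (rule that[of w])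
   show "w i \<in> \<W>" for i using w by blast
   fix k f assume f: "cpx UNIV w (cube k) f" and bd: "\<And>x. x \<in> cube_bd k \<Longrightarrow> cst UNIV w f x"
   have fw: "flexible_with (\<lambda>a0 a. \<forall>x\<in>cube k. e n (a0 x) (a x)) k (\<Union>i<Suc n. A i) (A (Suc n))" for n
   proof (rule weakly_flexible_with[OF Af(2)])
    fix a0 assume "continuous_map (disk k) (sec F (X interior_of (\<Union>i<Suc n. A i))) a0"
    hence a0: "continuous_map (disk k) (sec F (I n)) a0" by (simp add: I_def lessThan_Suc_atMost)
    have "\<exists>G. openin (compact_open_topology (disk k) (sec F (I n))) G \<and> restrict a0 (topspace (disk k)) \<in> G \<and>
      (\<forall>p\<in>G. \<forall>y\<in>topspace (disk k). d (I M) (res F (I n) (I M) (a0 y)) (res F (I n) (I M) (p y)) < 1 / 2 ^ n)" if "M \<le> n" for M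
    proof (rule compact_open_uniform_nbhd[OF compact_disk m(1)[OF oI] a0])
     show "continuous_map (sec F (I n)) (Metric_space.mtopology (sections (I M)) (d (I M))) (res F (I n) (I M))"
      unfolding m(2)[OF oI] by (rule res_continuous[OF oI oI Imono[OF that]])
    qed simp
    then obtain G where G: "\<And>M. M \<le> n \<Longrightarrow> openin (compact_open_topology (disk k) (sec F (I n))) (G M) \<and> restrict a0 (topspace (disk k)) \<in> G M \<and>
      (\<forall>p\<in>G M. \<forall>y\<in>topspace (disk k). d (I M) (res F (I n) (I M) (a0 y)) (res F (I n) (I M) (p y)) < 1 / 2 ^ n)" by metis
    have oN: "openin (compact_open_topology (disk k) (sec F (I n))) (\<Inter>M\<in>{..n}. G M)"
     using G by (intro openin_INT2) auto
    show "\<exists>N. neighbourhood_of (compact_open_topology (disk k) (sec F (X interior_of (\<Union>i<Suc n. A i)))) (restrict a0 (disk_set k)) N \<and>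
      (\<forall>p\<in>N. \<forall>y\<in>disk_set k. e n (a0 y) (p y))"
    proof (intro exI[of _ "\<Inter>M\<in>{..n}. G M"] conjI ballI)
     have "restrict a0 (disk_set k) \<in> (\<Inter>M\<in>{..n}. G M)" using G by (simp add: disk_eq)
     thus "neighbourhood_of (compact_open_topology (disk k) (sec F (X interior_of (\<Union>i<Suc n. A i)))) (restrict a0 (disk_set k)) (\<Inter>M\<in>{..n}. G M)"
      unfolding neighbourhood_of_def using oN openin_subset[OF oN] by (auto simp: I_def lessThan_Suc_atMost)
     fix p y assume "p \<in> (\<Inter>M\<in>{..n}. G M)" "y \<in> disk_set k"
     thus "e n (a0 y) (p y)" using G unfolding e_def by (simp add: disk_eq)
    qed
   qed
   show "glues k w f"
   proof (rule main[OF P A(1) _ _ f bd])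
    fix U f and thesis :: bool
    assume a: "cpx UNIV U (cube k) f" "\<And>x. x \<in> cube_bd k \<Longrightarrow> cst UNIV U f x" "\<And>i. A i \<subseteq> U i"
     "\<And>i. finite {j. U i \<inter> U j \<noteq> {}}"
     "\<And>O' h g. \<lbrakk>(\<And>i. A i \<subseteq> O' i);
      htpy UNIV U O' (cube k) (cube_bd k) f h; cmap (cube k) (sec F (topspace X)) g;
      (\<And>J l x. J \<in> fins UNIV \<Longrightarrow> l \<in> simp J \<Longrightarrow> x \<in> cube k \<Longrightarrow> h l (1, x) = res F (topspace X) (US O' l) (g x))\<rbrakk> \<Longrightarrow> thesis"
    show thesis
    proof (rule infinite_glue[where A=A and k=k and U=U and f=f and R="\<lambda>n a0 a. \<forall>x\<in>cube k. e n (a0 x) (a x)"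
       and E="\<lambda>n M z z'. d (I M) z z' < 1 / 2 ^ n" and lim="\<lambda>V s z. limitin (sec F V) s z sequentially", OF X Af(1)])
     show "(\<Union>i. A i) = topspace X" using A(1) unfolding flexible_cover_def by blast
     show "flexible_with (\<lambda>a0 a. \<forall>x\<in>cube k. e n (a0 x) (a x)) k (\<Union>i<Suc n. A i) (A (Suc n))" for n by (rule fw)
     show "glueable (Suc n) (\<lambda>i. A i \<inter> A (Suc n))" for n by (rule Af(3))
     show "d (I M) (res F (core A n) (core A M) (a0 x))
       (res F (core A n) (core A M) (a x)) < 1 / 2 ^ n"
      if "\<forall>x\<in>cube k. e n (a0 x) (a x)" "M \<le> n" "x \<in> cube k" for n a0 a M x
      using that unfolding e_def I_def by blast
     show "d (I M) z z < 1 / 2 ^ n" if "z \<in> sections (core A M)" for n M z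
     proof -
      have "d (I M) z z = 0" using Metric_space.zero[OF m(1)[OF oI], of z M z] that by (simp add: I_def)
      thus ?thesis by simp
     qed
     show "z = z'" if "openin X V" "limitin (sec F V) s z sequentially" "limitin (sec F V) s z' sequentially" for V s z z'
      using limitin_Hausdorff_unique[OF that(2,3) _ haus[OF that(1)]] by simp
     show "limitin (sec F W) (\<lambda>n. res F V W (s n)) (res F V W z) sequentially"
      if "openin X V" "openin X W" "W \<subseteq> V" "limitin (sec F V) s z sequentially" for V W s z
      using continuous_map_limit[OF res_continuous[OF that(1-3)] that(4)] by (simp add: o_def)
     show "limitin (sec F V) (\<lambda>_. z) z sequentially" if "z \<in> sections V" for V z
      using that by simp
     show "limitin (sec F V) s' z sequentially"
      if "limitin (sec F V) s z sequentially" "\<And>n. N \<le> n \<Longrightarrow> s n = s' n" for V s s' z N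
      by (rule limitin_transform_eventually[OF _ that(1)]) (use that(2) in \<open>auto simp: eventually_sequentially\<close>)
     show "\<exists>q. cmap (cyl k) (sec F (core A M)) q \<and>
       (\<forall>y\<in>cyl k. limitin (sec F (core A M)) (\<lambda>n. p n y) (q y) sequentially)"
      if p: "\<And>n. cmap (cyl k) (sec F (core A M)) (p n)"
       "\<And>n y. M \<le> n \<Longrightarrow> y \<in> cyl k \<Longrightarrow> d (I M) (p n y) (p (Suc n) y) < 1 / 2 ^ n" for M p
     proof -
      interpret IM: Metric_space "sections (I M)" "d (I M)" by (rule m(1)[OF oI])
      have top: "IM.mtopology = sec F (I M)" by (rule m(2)[OF oI])
      have pc: "cmap (cyl k) IM.mtopology (p n)" for n
       unfolding top using p(1) by (simp add: I_def)
      have pin: "p n y \<in> sections (I M)" if "y \<in> cyl k" for n y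
       using cmap_in[OF p(1) that, of n] by (simp add: I_def)
      \<comment> \<open>The right-hand side is the sum of \<open>1 / 2 ^ i\<close> over
        \<open>i\<close> from \<open>n\<close> to \<open>n + j - 1\<close>.\<close>
      have tele: "d (I M) (p n y) (p (n + j) y) \<le> 2 / 2 ^ n - 2 / 2 ^ (n + j)"
       if n: "M \<le> n" and y: "y \<in> cyl k" for n j y
      proof (induction j)
       case 0
       show ?case using IM.zero[of "p n y" "p n y"] pin[OF y] by simp
      next
       case (Suc j)
       have "d (I M) (p n y) (p (n + Suc j) y) \<le> d (I M) (p n y) (p (n + j) y) + d (I M) (p (n + j) y) (p (n + Suc j) y)"
        by (rule IM.triangle) (use pin[OF y] in auto)
       moreover have "d (I M) (p (n + j) y) (p (n + Suc j) y) < 1 / 2 ^ (n + j)" using p(2)[of "n + j" y] n y by simp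
       moreover have "2 / 2 ^ (n + Suc j) = 1 / (2 ^ (n + j) :: real)" "2 / 2 ^ (n + j) = 2 * (1 / 2 ^ (n + j) :: real)" by simp_all
       ultimately show ?case using Suc by linarith
      qed
      have small: "d (I M) (p n y) (p (n + j) y) < 2 / 2 ^ n" if "M \<le> n" "y \<in> cyl k" for n j y
      proof -
       have "(0::real) < 2 / 2 ^ (n + j)" by simp
       thus ?thesis using tele[OF that, of j] by linarith
      qed
      obtain q where q: "cmap (cyl k) IM.mtopology q"
       "\<And>\<epsilon>. 0 < \<epsilon> \<Longrightarrow> \<forall>\<^sub>F n in sequentially. \<forall>x\<in>topspace (top_of_set (cyl k)). d (I M) (p n x) (q x) < \<epsilon>"
      proof (rule IM.continuous_map_uniformly_Cauchy_limit[of "top_of_set (cyl k)" p, OF m(3)[OF oI]])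
       show "\<forall>\<^sub>F n in sequentially. cmap (cyl k) IM.mtopology (p n)" using pc by simp
       fix \<epsilon> :: real assume "0 < \<epsilon>"
       \<comment> \<open>Two members of the sequence are compared through the \<open>L\<close>-th
         one, at a cost of \<open>2 / 2 ^ L\<close> each; hence the quarter.\<close>
       then obtain N where N: "(1 / 2) ^ N < \<epsilon> / 4" using real_arch_pow_inv[of "\<epsilon> / 4" "1 / 2"] by auto
       define L where "L = max N M"
       have "(1 / 2) ^ L \<le> (1 / 2 :: real) ^ N" unfolding L_def by (rule power_decreasing) auto
       hence L: "4 / 2 ^ L < \<epsilon>" using N by (simp add: power_divide)
       have near: "d (I M) (p L y) (p i y) < 2 / 2 ^ L" if "L \<le> i" "y \<in> cyl k" for i y
        using small[of L y "i - L"] that by (simp add: L_def)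
       show "\<exists>N. \<forall>m n x. N \<le> m \<longrightarrow> N \<le> n \<longrightarrow> x \<in> topspace (top_of_set (cyl k)) \<longrightarrow> d (I M) (p m x) (p n x) < \<epsilon>"
       proof (intro exI[of _ L] allI impI)
        fix i j y assume ij: "L \<le> i" "L \<le> j" "y \<in> topspace (top_of_set (cyl k))"
        hence y: "y \<in> cyl k" by simp
        have "d (I M) (p i y) (p j y) \<le> d (I M) (p i y) (p L y) + d (I M) (p L y) (p j y)"
         by (rule IM.triangle) (use pin[OF y] in auto)
        thus "d (I M) (p i y) (p j y) < \<epsilon>"
         using near[OF ij(1) y] near[OF ij(2) y] L IM.commute[of "p i y" "p L y"] by simp
       qed
      qed blast
      have "limitin IM.mtopology (\<lambda>n. p n y) (q y) sequentially" if y: "y \<in> cyl k" for y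
       unfolding IM.limitin_metric
      proof (intro conjI allI impI)
       show "q y \<in> sections (I M)" using cmap_in[OF q(1) y] by simp
       fix \<epsilon> :: real assume "0 < \<epsilon>"
       from q(2)[OF this] show "\<forall>\<^sub>F n in sequentially. p n y \<in> sections (I M) \<and> d (I M) (p n y) (q y) < \<epsilon>"
        by (rule eventually_mono) (use y pin in auto)
      qed
      thus ?thesis using q(1) unfolding top unfolding I_def by (intro exI[of _ q] conjI ballI) simp_all
     qed
     show "cpx UNIV U (cube k) f" by (rule a(1))
     show "cst UNIV U f x" if "x \<in> cube_bd k" for x by (rule a(2)[OF that])
     show "A i \<subseteq> U i" for i by (rule a(3))
     show "finite {j. U i \<inter> U j \<noteq> {}}" for i by (rule a(4))
     show thesis if "\<And>i. A i \<subseteq> O' i" "htpy UNIV U O' (cube k) (cube_bd k) f h"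
      "cmap (cube k) (sec F (topspace X)) g"
      "\<And>J l x. \<lbrakk>J \<in> fins UNIV; l \<in> simp J; x \<in> cube k\<rbrakk> \<Longrightarrow> h l (1, x) = res F (topspace X) (US O' l) (g x)"
      for O' h g by (rule a(5)[OF that])
    qed
   qed (use w in auto)
  qed
 qed
qed

end

section \<open>Deforming sections of the larger sheaf\<close>

text \<open>As the dimensions of the \<open>K i\<close> may grow, the bound \<open>k W\<close> on
  the multiplicity depends on the member. \<open>X\<close> is cut into open shells
  \<open>Q i\<close>, and each is covered by traces of a cover of \<open>K (Suc i)\<close> of
  bounded multiplicity. The bound for a shell depends only on the dimensions \<open>m\<close>, so it
  is known before the cover \<open>\<V> (k i)\<close> to be refined is selected.\<close>

lemma dimension_cover:
 fixes X :: "'a topology" and \<V> :: "nat \<Rightarrow> 'a set set"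
 assumes X: "Hausdorff_space X" and K: "exhaustion X K" "\<And>i. compactin X (K i)"
  and m: "\<And>i. covering_dim_le (subtopology X (K i)) (m i)" and \<V>: "\<And>d. open_cover X (\<V> d)"
 obtains \<W> k where "open_cover X \<W>" "\<And>W. W \<in> \<W> \<Longrightarrow> \<exists>V\<in>\<V> (k W). W \<subseteq> V"
  "\<And>x W. W \<in> \<W> \<Longrightarrow> x \<in> W \<Longrightarrow> finite {W' \<in> \<W>. x \<in> W'} \<and> card {W' \<in> \<W>. x \<in> W'} \<le> k W"
proof -
 \<comment> \<open>Points of the shell \<open>Q i\<close> lie only in shells of index at most
   \<open>i + 1\<close>, and the cover of shell \<open>j\<close> has at most
   \<open>m (Suc j) + 1\<close> members through a point.\<close>
 define k where "k = (\<lambda>i. \<Sum>j\<le>Suc i. m (Suc j) + 1)"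
 have Kt: "K i \<subseteq> topspace X" and KS: "K i \<subseteq> X interior_of K (Suc i)" for i
  using K(1) unfolding exhaustion_def by simp_all
 have Km: "K i \<subseteq> K j" if "i \<le> j" for i j
  using K(1) lift_Suc_mono_le[of K, OF _ that] unfolding exhaustion_def by blast
 define Q where "Q = (\<lambda>i. X interior_of K (Suc i) - (if i = 0 then {} else K (i - 1)))"
 have oQ: "openin X (Q i)" for i unfolding Q_def
  using compactin_imp_closedin[OF X K(2)] by (auto intro: openin_diff)
 have QK: "Q i \<subseteq> K (Suc i)" for i unfolding Q_def using interior_of_subset by fastforce
 have Qd: "i \<le> Suc j" if "x \<in> Q i" "x \<in> Q j" for i j x
 proof (rule ccontr)
  assume "\<not> i \<le> Suc j"
  hence "Suc j \<le> i - 1" "i \<noteq> 0" by auto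
  hence "x \<in> K (i - 1)" using Km[of "Suc j" "i - 1"] QK[of j] that(2) by blast
  thus False using that(1) \<open>i \<noteq> 0\<close> unfolding Q_def by simp
 qed
 have Qc: "\<exists>i. x \<in> Q i" if x: "x \<in> topspace X" for x
 proof -
  obtain j where "x \<in> K j" using x K(1) unfolding exhaustion_def by blast
  hence ex: "x \<in> X interior_of K (Suc j)" using KS by blast
  define i where "i = (LEAST i. x \<in> X interior_of K (Suc i))"
  have i: "x \<in> X interior_of K (Suc i)" unfolding i_def by (rule LeastI[of _ j]) (rule ex)
  have "x \<notin> K (i - 1)" if "i \<noteq> 0"
  proof
   assume "x \<in> K (i - 1)"
   hence "x \<in> X interior_of K (Suc (i - 1))" using KS[of "i - 1"] by blast
   hence "i \<le> i - 1" unfolding i_def by (rule Least_le)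
   thus False using that by simp
  qed
  hence "x \<in> Q i" using i unfolding Q_def by auto
  thus ?thesis by blast
 qed
 have "\<exists>C. open_cover (subtopology X (K (Suc i))) C \<and> (\<forall>W\<in>C. \<exists>V\<in>\<V> (k i). W \<subseteq> V) \<and>
   (\<forall>x\<in>K (Suc i). finite {W \<in> C. x \<in> W} \<and> card {W \<in> C. x \<in> W} \<le> m (Suc i) + 1)" for i
 proof -
  have "open_cover (subtopology X (K (Suc i))) ((\<lambda>V. K (Suc i) \<inter> V) ` \<V> (k i))"
   using \<V>[of "k i"] Kt[of "Suc i"] unfolding open_cover_def by (auto simp: openin_subtopology_Int2)
  from m[of "Suc i", unfolded covering_dim_le_def, rule_format, OF this]
  obtain C where C: "open_cover (subtopology X (K (Suc i))) C"
   "\<forall>V\<in>C. \<exists>U\<in>(\<lambda>V. K (Suc i) \<inter> V) ` \<V> (k i). V \<subseteq> U"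
   "\<forall>x\<in>topspace (subtopology X (K (Suc i))). finite {V\<in>C. x \<in> V} \<and> card {V\<in>C. x \<in> V} \<le> m (Suc i) + 1" by blast
  have "topspace (subtopology X (K (Suc i))) = K (Suc i)" using Kt[of "Suc i"] by auto
  hence C3: "\<forall>x\<in>K (Suc i). finite {W \<in> C. x \<in> W} \<and> card {W \<in> C. x \<in> W} \<le> m (Suc i) + 1" using C(3) by simp
  have C2: "\<forall>W\<in>C. \<exists>V\<in>\<V> (k i). W \<subseteq> V"
  proof
   fix W assume "W \<in> C"
   then obtain V where "V \<in> \<V> (k i)" "W \<subseteq> K (Suc i) \<inter> V" using C(2) by blast
   thus "\<exists>V\<in>\<V> (k i). W \<subseteq> V" by blast
  qed
  show ?thesis using C(1) C2 C3 by (intro exI[of _ C] conjI)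
 qed
 hence "\<forall>i. \<exists>C. open_cover (subtopology X (K (Suc i))) C \<and> (\<forall>W\<in>C. \<exists>V\<in>\<V> (k i). W \<subseteq> V) \<and>
   (\<forall>x\<in>K (Suc i). finite {W \<in> C. x \<in> W} \<and> card {W \<in> C. x \<in> W} \<le> m (Suc i) + 1)" ..
 from choice[OF this] obtain C where C0: "\<forall>i. open_cover (subtopology X (K (Suc i))) (C i) \<and> (\<forall>W\<in>C i. \<exists>V\<in>\<V> (k i). W \<subseteq> V) \<and>
   (\<forall>x\<in>K (Suc i). finite {W \<in> C i. x \<in> W} \<and> card {W \<in> C i. x \<in> W} \<le> m (Suc i) + 1)" ..
 hence C: "\<And>i. open_cover (subtopology X (K (Suc i))) (C i)" "\<And>i W. W \<in> C i \<Longrightarrow> \<exists>V\<in>\<V> (k i). W \<subseteq> V"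
   "\<And>i x. x \<in> K (Suc i) \<Longrightarrow> finite {W \<in> C i. x \<in> W} \<and> card {W \<in> C i. x \<in> W} \<le> m (Suc i) + 1" by simp_all
 define D where "D = (\<lambda>i. (\<lambda>W. W \<inter> Q i) ` C i)"
 have Dopen: "openin X W" if W: "W \<in> D i" for W i
 proof -
  obtain C' where C': "C' \<in> C i" "W = C' \<inter> Q i" using W unfolding D_def by blast
  obtain O' where O': "openin X O'" "C' = O' \<inter> K (Suc i)" using C(1)[of i] C'(1) unfolding open_cover_def openin_subtopology by blast
  have "W = O' \<inter> Q i" using C'(2) O'(2) QK[of i] by blast
  thus ?thesis using O'(1) oQ by auto
 qed
 have Dcard: "finite {W \<in> D i. x \<in> W}" "card {W \<in> D i. x \<in> W} \<le> m (Suc i) + 1" for i x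
 proof -
  have "finite {W \<in> D i. x \<in> W} \<and> card {W \<in> D i. x \<in> W} \<le> m (Suc i) + 1"
  proof (cases "x \<in> Q i")
   case True
   have "x \<in> K (Suc i)" using True QK by blast
   note c = C(3)[OF this]
   have e: "{W \<in> D i. x \<in> W} = (\<lambda>W. W \<inter> Q i) ` {W \<in> C i. x \<in> W}" using True unfolding D_def by auto
   show ?thesis unfolding e using c card_image_le[of "{W \<in> C i. x \<in> W}" "\<lambda>W. W \<inter> Q i"] by auto
  next
   case False
   hence "{W \<in> D i. x \<in> W} = {}" unfolding D_def by auto
   show ?thesis unfolding \<open>{W \<in> D i. x \<in> W} = {}\<close> by simp
  qed
  thus "finite {W \<in> D i. x \<in> W}" "card {W \<in> D i. x \<in> W} \<le> m (Suc i) + 1" by auto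
 qed
 define \<W> where "\<W> = (\<Union>i. D i)"
 define ii where "ii = (\<lambda>W. SOME i. W \<in> D i)"
 have ii: "W \<in> D (ii W)" if "W \<in> \<W>" for W
  unfolding ii_def by (rule someI_ex) (use that in \<open>auto simp: \<W>_def\<close>)
 show thesis
 proof (rule that[of \<W> "\<lambda>W. k (ii W)"])
  have "topspace X \<subseteq> \<Union>\<W>"
  proof
   fix x assume "x \<in> topspace X"
   then obtain i where i: "x \<in> Q i" using Qc by blast
   hence "x \<in> topspace (subtopology X (K (Suc i)))" using QK[of i] Kt[of "Suc i"] by auto
   then obtain W where "W \<in> C i" "x \<in> W" using C(1)[of i] unfolding open_cover_def by blast
   thus "x \<in> \<Union>\<W>" using i unfolding \<W>_def D_def by blast
  qed
  moreover have "openin X W" if "W \<in> \<W>" for W using that Dopen unfolding \<W>_def by blast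
  ultimately show "open_cover X \<W>" unfolding open_cover_def using openin_subset by blast
  show "\<exists>V\<in>\<V> (k (ii W)). W \<subseteq> V" if W: "W \<in> \<W>" for W
  proof -
   obtain C' where "C' \<in> C (ii W)" "W = C' \<inter> Q (ii W)" using ii[OF W] unfolding D_def by blast
   thus ?thesis using C(2)[of C' "ii W"] by blast
  qed
  show "finite {W' \<in> \<W>. x \<in> W'} \<and> card {W' \<in> \<W>. x \<in> W'} \<le> k (ii W)" if W: "W \<in> \<W>" "x \<in> W" for x W
  proof -
   have xQ: "x \<in> Q (ii W)" using ii[OF W(1)] W(2) unfolding D_def by auto
   have "i \<le> Suc (ii W)" if "W' \<in> D i" "x \<in> W'" for W' i
    using Qd[of x i "ii W"] xQ that unfolding D_def by auto
   hence sub: "{W' \<in> \<W>. x \<in> W'} \<subseteq> (\<Union>i\<le>Suc (ii W). {W' \<in> D i. x \<in> W'})" unfolding \<W>_def by blast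
   have fin: "finite (\<Union>i\<le>Suc (ii W). {W' \<in> D i. x \<in> W'})" using Dcard(1) by blast
   have "card {W' \<in> \<W>. x \<in> W'} \<le> card (\<Union>i\<le>Suc (ii W). {W' \<in> D i. x \<in> W'})" by (rule card_mono[OF fin sub])
   also have "\<dots> \<le> (\<Sum>i\<le>Suc (ii W). card {W' \<in> D i. x \<in> W'})" by (rule card_UN_le) simp
   also have "\<dots> \<le> k (ii W)" unfolding k_def by (rule sum_mono) (rule Dcard(2))
   finally show ?thesis using finite_subset[OF sub fin] by blast
  qed
 qed
qed

section \<open>Filling of cells by means of the local weak homotopy equivalence\<close>

locale sheaf_pair = space_sheaf X \<Psi> for X :: "'a topology" and \<Psi> :: "('a, 'b) top_presheaf" +
 fixes \<Phi> :: "('a, 'b) top_presheaf"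
 assumes incl: "sheaf_inclusion X \<Phi> \<Psi>" and lwhe: "local_weak_homotopy_equivalence X \<Phi> \<Psi>"
begin

abbreviation small :: "'a set \<Rightarrow> 'b set" where
 "small U \<equiv> topspace (sec \<Phi> U)"

sublocale sub: space_sheaf X \<Phi>
 using incl unfolding sheaf_inclusion_def by unfold_locales blast

lemma small_subset: "openin X U \<Longrightarrow> small U \<subseteq> sections U"
 using incl unfolding sheaf_inclusion_def by blast

lemma small_topology: "openin X U \<Longrightarrow> sec \<Phi> U = subtopology (sec \<Psi> U) (small U)"
 using incl unfolding sheaf_inclusion_def by blast

lemma small_res: "\<lbrakk>openin X U; openin X V; V \<subseteq> U; z \<in> small U\<rbrakk> \<Longrightarrow> res \<Phi> U V z = res \<Psi> U V z"
 using incl unfolding sheaf_inclusion_def by blast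

lemma res_small: "\<lbrakk>openin X U; openin X V; V \<subseteq> U; z \<in> small U\<rbrakk> \<Longrightarrow> res \<Psi> U V z \<in> small V"
 using small_res[of U V z] sub.res_in[of U V z] by simp

lemma cmap_small:
 "openin X U \<Longrightarrow> continuous_map Y (sec \<Phi> U) f \<longleftrightarrow> continuous_map Y (sec \<Psi> U) f \<and> (\<forall>y\<in>topspace Y. f y \<in> small U)"
 by (subst small_topology) (auto simp: continuous_map_in_subtopology)

text \<open>The map \<open>\<kappa>\<close> identifies the ball with the bottom and the sides of the cylinder over it. The
 homotopy supplied by the hypothesis is run on the part of the cylinder over the interior.\<close>

lemma fill_disk:
 assumes U: "openin X U" "p \<in> U"
  and g: "cmap ({0} \<times> disk_set n \<union> {0..1::real} \<times> disk_boundary n) (sec \<Psi> U) g"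
  and g1: "\<And>x. x \<in> disk_boundary n \<Longrightarrow> g (1, x) \<in> small U"
 obtains V G where "openin X V" "p \<in> V" "V \<subseteq> U" "cmap ({0..1} \<times> disk_set n) (sec \<Psi> V) G"
  "\<And>z. z \<in> {0} \<times> disk_set n \<union> {0..1} \<times> disk_boundary n \<Longrightarrow> G z = res \<Psi> U V (g z)"
  "\<And>x. x \<in> disk_set n \<Longrightarrow> G (1, x) \<in> small V"
proof -
 define N where "N = (\<lambda>x::nat\<Rightarrow>real. sqrt (\<Sum>i<n. (x i)\<^sup>2))"
 have N: "gauge_fun n N" unfolding N_def by (rule gauge_norm)
 have d: "x \<in> disk_set n \<longleftrightarrow> x \<in> coords n \<and> N x \<le> 1" for x by (simp add: disk_set_def N_def)
 have b: "x \<in> disk_boundary n \<longleftrightarrow> x \<in> coords n \<and> N x = 1" for x by (simp add: disk_boundary_eq N_def)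
 have sc: "(\<lambda>i. a * x i) \<in> coords n" "N (\<lambda>i. a * x i) = a * N x" if "x \<in> coords n" "0 \<le> a" for a x
  using gauge_scale[OF N that(2,1)] that(1) by (auto simp: coords_def)
 have Nc: "continuous_on S N" for S unfolding N_def by (intro continuous_intros)
 have N2: "continuous_on S (\<lambda>z. N (snd z))" for S :: "(real \<times> (nat \<Rightarrow> real)) set" unfolding N_def by (intro continuous_intros)
 \<comment> \<open>The ball of radius 1/2 is stretched onto the bottom, and the shell around it
   becomes the side, with height \<open>2 * N c - 1\<close>.\<close>
 define \<kappa> where "\<kappa> = (\<lambda>c. (max 0 (2 * N c - 1), \<lambda>i. (1 / max (N c) (1 / 2)) * c i))"
 let ?L = "{0} \<times> disk_set n \<union> {0..1::real} \<times> disk_boundary n"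
 have \<kappa>L: "\<kappa> c \<in> ?L" if c: "c \<in> disk_set n" for c
 proof (cases "N c \<le> 1 / 2")
  case True
  hence "\<kappa> c = (0, \<lambda>i. 2 * c i)" by (simp add: \<kappa>_def max_def mult.commute)
  thus ?thesis using True c sc[of c 2] by (simp add: d)
 next
  case False
  thus ?thesis using c sc[of c "1 / N c"] by (simp add: \<kappa>_def d b)
 qed
 have \<kappa>0: "\<kappa> (\<lambda>i. 1 / 2 * x i) = (0, x)" if "x \<in> disk_set n" for x
 proof -
  have "N (\<lambda>i. 1 / 2 * x i) = 1 / 2 * N x" using that sc[of x "1 / 2"] by (simp add: d)
  thus ?thesis using that by (simp add: \<kappa>_def d)
 qed
 have \<kappa>t: "\<kappa> (\<lambda>i. (1 + t) / 2 * x i) = (t, x)" if "x \<in> disk_boundary n" "t \<in> {0..1}" for x t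
 proof -
  have "N (\<lambda>i. (1 + t) / 2 * x i) = (1 + t) / 2" using that sc[of x "(1 + t) / 2"] by (simp add: b)
  moreover have "max ((1 + t) / 2) (1 / 2) = (1 + t) / 2" using that by simp
  ultimately show ?thesis unfolding \<kappa>_def using that by (auto simp: add_divide_distrib)
 qed
 have \<kappa>1: "\<kappa> c = (1, c)" if "c \<in> disk_boundary n" for c using \<kappa>t[OF that, of 1] by simp
 have \<kappa>c: "continuous_on (disk_set n) \<kappa>"
  unfolding \<kappa>_def by (intro continuous_on_Pair continuous_on_pi continuous_intros Nc) auto
 have "continuous_map (disk n) (sec \<Psi> U) (\<lambda>c. g (\<kappa> c))"
  unfolding disk_eq by (rule cmap_compose[OF g \<kappa>c]) (use \<kappa>L in blast)
 moreover have "(\<lambda>c. g (\<kappa> c)) ` disk_boundary n \<subseteq> small U" using g1 \<kappa>1 by auto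
 moreover have pX: "p \<in> topspace X" using U openin_subset by blast
 ultimately have "\<exists>V h. openin X V \<and> p \<in> V \<and> V \<subseteq> U \<and>
     continuous_map (prod_topology unit_interval (disk n)) (sec \<Psi> V) (\<lambda>(t, x). h t x) \<and>
     (\<forall>x\<in>topspace (disk n). h 0 x = res \<Psi> U V (g (\<kappa> x))) \<and>
     (\<forall>t\<in>{0..1}. \<forall>x\<in>disk_boundary n. h t x = h 0 x) \<and>
     h 1 ` topspace (disk n) \<subseteq> small V"
  by (intro lwhe[unfolded local_weak_homotopy_equivalence_def, THEN bspec, OF pX, THEN spec, THEN spec, THEN spec, THEN mp] conjI U)
 then obtain V h where Vh: "openin X V \<and> p \<in> V \<and> V \<subseteq> U \<and>
     continuous_map (prod_topology unit_interval (disk n)) (sec \<Psi> V) (\<lambda>(t, x). h t x) \<and>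
     (\<forall>x\<in>topspace (disk n). h 0 x = res \<Psi> U V (g (\<kappa> x))) \<and>
     (\<forall>t\<in>{0..1}. \<forall>x\<in>disk_boundary n. h t x = h 0 x) \<and>
     h 1 ` topspace (disk n) \<subseteq> small V"
  by (elim exE)
 hence V: "openin X V" "p \<in> V" "V \<subseteq> U" by blast+
 have td: "topspace (disk n) = disk_set n" by (simp add: disk_eq)
 from Vh have h: "continuous_map (prod_topology unit_interval (disk n)) (sec \<Psi> V) (\<lambda>(t, x). h t x)"
   "\<And>x. x \<in> disk_set n \<Longrightarrow> h 0 x = res \<Psi> U V (g (\<kappa> x))"
   "\<And>t x. t \<in> {0..1} \<Longrightarrow> x \<in> disk_boundary n \<Longrightarrow> h t x = h 0 x"
   "\<And>x. x \<in> disk_set n \<Longrightarrow> h 1 x \<in> small V"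
  unfolding td by blast+
 have hc: "cmap ({0..1} \<times> disk_set n) (sec \<Psi> V) (\<lambda>(t, x). h t x)"
  using h(1) unfolding disk_eq prod_topology_subtopology_eu .
 \<comment> \<open>The point \<open>x\<close> at height \<open>t\<close> is scaled by
   \<open>s\<close>, cut off at the unit sphere, and \<open>h\<close> is run up to time
   \<open>u\<close>. On the bottom and the sides \<open>u = 0\<close> and the scaling inverts
   \<open>\<kappa>\<close>. At the top, either \<open>N x \<le> 1 / 2\<close> and
   \<open>u = 1\<close>, or \<open>N x * (3 - 2 * N x) \<ge> 1\<close>, so that the scaled point
   lies on the sphere, where \<open>h\<close> rests. In both cases the value is one of
   \<open>h 1\<close>.\<close>
 define s where "s = (\<lambda>z. (1 + fst z) / 2 + 2 * fst z * (1 - N (snd z)))"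
 define u where "u = (\<lambda>z. min 1 (2 * fst z * (1 - N (snd z))))"
 define \<mu> where "\<mu> = (\<lambda>z. (\<lambda>i. 1 / max (N (snd z)) (1 / s z) * snd z i))"
 define G where "G = (\<lambda>z. case (u z, \<mu> z) of (t, x) \<Rightarrow> h t x)"
 have spos: "1 / 2 \<le> s z" if "z \<in> {0..1} \<times> disk_set n" for z
 proof -
  have "0 \<le> 2 * fst z * (1 - N (snd z))" using that by (intro mult_nonneg_nonneg) (auto simp: d)
  moreover have "1 / 2 \<le> (1 + fst z) / 2" using that by auto
  ultimately show ?thesis unfolding s_def by linarith
 qed
 have mpos: "0 < max (N (snd z)) (1 / s z)" if "z \<in> {0..1} \<times> disk_set n" for z
  using spos[OF that] by (simp add: less_max_iff_disj)
 have ur: "u z \<in> {0..1}" if "z \<in> {0..1} \<times> disk_set n" for z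
  using that unfolding u_def by (auto simp: d)
 have \<mu>r: "\<mu> z \<in> disk_set n" if z: "z \<in> {0..1} \<times> disk_set n" for z
 proof -
  have "\<mu> z \<in> coords n" "N (\<mu> z) = 1 / max (N (snd z)) (1 / s z) * N (snd z)"
   unfolding \<mu>_def using sc[of "snd z" "1 / max (N (snd z)) (1 / s z)"] mpos[OF z] z by (auto simp: d)
  thus ?thesis using mpos[OF z] by (simp add: d divide_le_eq)
 qed
 have Gc: "cmap ({0..1} \<times> disk_set n) (sec \<Psi> V) G"
  unfolding G_def
 proof (rule cmap_compose[OF hc])
  have sC: "continuous_on ({0..1} \<times> disk_set n) s" unfolding s_def by (intro continuous_intros N2) auto
  have sne: "\<forall>z\<in>{0..1} \<times> disk_set n. s z \<noteq> 0" using spos by fastforce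
  have mne: "\<forall>z\<in>{0..1} \<times> disk_set n. max (N (snd z)) (1 / s z) \<noteq> 0" using mpos by (intro ballI) (rule less_imp_neq[symmetric], blast)
  show "continuous_on ({0..1} \<times> disk_set n) (\<lambda>z. (u z, \<mu> z))"
   unfolding u_def \<mu>_def by (intro continuous_on_Pair continuous_on_pi continuous_intros N2 sC sne mne)
  show "(\<lambda>z. (u z, \<mu> z)) ` ({0..1} \<times> disk_set n) \<subseteq> {0..1} \<times> disk_set n" using ur \<mu>r by blast
 qed
 show thesis
 proof (rule that[OF V Gc])
  fix z assume z: "z \<in> ?L"
  obtain t x where tx: "z = (t, x)" by (cases z)
  show "G z = res \<Psi> U V (g z)"
  proof (cases "t = 0")
   case True
   hence x: "x \<in> disk_set n" using z disk_boundary_subset unfolding tx by auto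
   have "u z = 0" "\<mu> z = (\<lambda>i. 1 / 2 * x i)" using x True unfolding tx u_def \<mu>_def s_def by (auto simp: d)
   thus ?thesis using h(2)[of "\<lambda>i. 1 / 2 * x i"] \<kappa>0[OF x] x sc[of x "1 / 2"] by (simp add: G_def tx True d)
  next
   case False
   hence x: "x \<in> disk_boundary n" "t \<in> {0..1}" using z unfolding tx by auto
   have Nx: "N x = 1" using x b by simp
   have "max 1 (1 / ((1 + t) / 2)) = 1 / ((1 + t) / 2)" using x by (simp add: field_simps)
   hence "u z = 0" "\<mu> z = (\<lambda>i. (1 + t) / 2 * x i)" unfolding tx u_def \<mu>_def s_def by (simp_all add: Nx)
   moreover have "\<mu> z \<in> disk_set n" using \<mu>r[of z] x disk_boundary_subset unfolding tx by blast
   ultimately show ?thesis using h(2)[of "\<mu> z"] \<kappa>t[OF x] by (simp add: G_def tx)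
  qed
 next
  fix x assume x: "x \<in> disk_set n"
  show "G (1, x) \<in> small V"
  proof (cases "N x \<le> 1 / 2")
   case True
   hence "u (1, x) = 1" unfolding u_def by simp
   thus ?thesis using h(4)[OF \<mu>r[of "(1, x)"]] x by (simp add: G_def)
  next
   case False
   have "1 \<le> N x * s (1, x)"
   proof -
    have "0 \<le> (2 * N x - 1) * (1 - N x)" using False x by (intro mult_nonneg_nonneg) (auto simp: d)
    thus ?thesis unfolding s_def by (simp add: algebra_simps)
   qed
   hence "1 / s (1, x) \<le> N x" using spos[of "(1, x)"] x by (simp add: divide_le_eq)
   hence "\<mu> (1, x) = (\<lambda>i. 1 / N x * x i)" unfolding \<mu>_def by (simp add: max_def)
   hence mb: "\<mu> (1, x) \<in> disk_boundary n" using False x sc[of x "1 / N x"] by (simp add: b d)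
   have "G (1, x) = h 0 (\<mu> (1, x))" using h(3)[OF ur[of "(1, x)"] mb] x by (simp add: G_def)
   also have "\<dots> = h 1 (\<mu> (1, x))" using h(3)[of 1, OF _ mb] by simp
   finally show ?thesis using h(4)[OF \<mu>r[of "(1, x)"]] x by simp
  qed
 qed
qed

lemma fill_cell:
 assumes T: "cell_pair n T S" and U: "openin X U" "p \<in> U"
  and g: "cmap ({0} \<times> T \<union> {0..1::real} \<times> S) (sec \<Psi> U) g"
  and g1: "\<And>x. x \<in> S \<Longrightarrow> g (1, x) \<in> small U"
 obtains V G where "openin X V" "p \<in> V" "V \<subseteq> U" "cmap ({0..1} \<times> T) (sec \<Psi> V) G"
  "\<And>z. z \<in> {0} \<times> T \<union> {0..1} \<times> S \<Longrightarrow> G z = res \<Psi> U V (g z)"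
  "\<And>x. x \<in> T \<Longrightarrow> G (1, x) \<in> small V"
proof -
 obtain f f' where f: "homeomorphism (disk_set n) T f f'" "f ` disk_boundary n = S" using T unfolding cell_pair_def by blast
 note F = homeomorphism_cont1[OF f(1)] homeomorphism_cont2[OF f(1)] homeomorphism_image1[OF f(1)] homeomorphism_image2[OF f(1)]
 have f'S: "f' x \<in> disk_boundary n" if x: "x \<in> S" for x
 proof -
  obtain y where y: "y \<in> disk_boundary n" "x = f y" using x f(2) by blast
  thus ?thesis using homeomorphism_apply1[OF f(1), OF subsetD[OF disk_boundary_subset y(1)]] by simp
 qed
 have ff: "f (f' x) = x" if "x \<in> T" for x using homeomorphism_apply2[OF f(1) that] .
 have ST: "S \<subseteq> T" by (rule cell_pair_subset[OF T])
 let ?L = "{0} \<times> disk_set n \<union> {0..1::real} \<times> disk_boundary n"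
 have 1: "cmap ?L (sec \<Psi> U) (\<lambda>z. g (fst z, f (snd z)))"
 proof (rule cmap_compose[OF g])
  show "continuous_on ?L (\<lambda>z. (fst z, f (snd z)))"
   by (rule continuous_on_Pair[OF continuous_on_fst[OF continuous_on_id] continuous_on_compose2[OF F(1) continuous_on_snd[OF continuous_on_id]]])
    (use disk_boundary_subset[of n] in force)
  show "(\<lambda>z. (fst z, f (snd z))) ` ?L \<subseteq> {0} \<times> T \<union> {0..1} \<times> S" using F(3) f(2) by auto
 qed
 have 2: "g (fst (1, x), f (snd (1, x))) \<in> small U" if "x \<in> disk_boundary n" for x :: "nat \<Rightarrow> real"
  using g1[of "f x"] f(2) that by auto
 obtain V G where V: "openin X V" "p \<in> V" "V \<subseteq> U" and G: "cmap ({0..1} \<times> disk_set n) (sec \<Psi> V) G"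
  "\<And>z. z \<in> ?L \<Longrightarrow> G z = res \<Psi> U V (g (fst z, f (snd z)))" "\<And>x. x \<in> disk_set n \<Longrightarrow> G (1, x) \<in> small V"
  by (rule fill_disk[OF U 1], rule 2, assumption, blast)
 show thesis
 proof (rule that[OF V, of "\<lambda>z. G (fst z, f' (snd z))"])
  show "cmap ({0..1} \<times> T) (sec \<Psi> V) (\<lambda>z. G (fst z, f' (snd z)))"
  proof (rule cmap_compose[OF G(1)])
   show "continuous_on ({0..1} \<times> T) (\<lambda>z. (fst z, f' (snd z)))"
    by (rule continuous_on_Pair[OF continuous_on_fst[OF continuous_on_id] continuous_on_compose2[OF F(2) continuous_on_snd[OF continuous_on_id]]]) auto
  qed (use F(4) in auto)
  show "G (fst z, f' (snd z)) = res \<Psi> U V (g z)" if "z \<in> {0} \<times> T \<union> {0..1} \<times> S" for z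
  proof -
   have "(fst z, f' (snd z)) \<in> ?L" using that F(4) f'S by auto
   moreover have "f (f' (snd z)) = snd z" using that ff ST by auto
   ultimately show ?thesis using G(2) by simp
  qed
  show "G (fst (1, x), f' (snd (1, x))) \<in> small V" if "x \<in> T" for x using G(3)[of "f' x"] F(4) that by auto
 qed
qed

end

text \<open>The simplicial map with vertex map \<open>\<phi>\<close> in barycentric coordinates: the
  weights of vertices with the same image add up. It transports complexes between nerves of
  successive covers.\<close>

definition push :: "('i \<Rightarrow> 'v) \<Rightarrow> ('i \<Rightarrow> real) \<Rightarrow> 'v \<Rightarrow> real" where
 "push \<phi> l = (\<lambda>v. \<Sum>j\<in>{j \<in> supp l. \<phi> j = v}. l j)"

lemma push_eq:
 assumes "finite J" "l \<in> simp J"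
 shows "push \<phi> l v = (\<Sum>j\<in>{j \<in> J. \<phi> j = v}. l j)"
 unfolding push_def
proof (rule sum.mono_neutral_left)
 show "{j \<in> supp l. \<phi> j = v} \<subseteq> {j \<in> J. \<phi> j = v}" using supp_simp(1)[OF assms(2)] by blast
qed (use assms(1) in \<open>auto simp: supp_def\<close>)

lemma simp_nonneg: "l \<in> simp J \<Longrightarrow> 0 \<le> l i"
 unfolding simp_def by blast

lemma supp_push:
 assumes "finite J" "l \<in> simp J"
 shows "supp (push \<phi> l) = \<phi> ` supp l"
proof -
 have fin: "finite (supp l)" using supp_simp(1)[OF assms(2)] assms(1) finite_subset by blast
 have "push \<phi> l v = 0 \<longleftrightarrow> (\<forall>j\<in>{j \<in> supp l. \<phi> j = v}. l j = 0)" for v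
  unfolding push_def by (rule sum_nonneg_eq_0_iff) (use fin simp_nonneg[OF assms(2)] in auto)
 thus ?thesis by (auto simp: supp_def)
qed

lemma push_simp:
 assumes "finite J" "l \<in> simp J"
 shows "push \<phi> l \<in> simp (\<phi> ` J)"
proof -
 have "sum (push \<phi> l) (\<phi> ` J) = (\<Sum>v\<in>\<phi> ` J. \<Sum>j\<in>{j \<in> J. \<phi> j = v}. l j)"
  by (rule sum.cong) (simp_all add: push_eq[OF assms])
 also have "\<dots> = sum l J" by (rule sum.image_gen[symmetric]) (rule assms(1))
 finally have "sum (push \<phi> l) (\<phi> ` J) = 1" using assms(2) by (simp add: simp_def)
 moreover have "0 \<le> push \<phi> l v" for v unfolding push_def by (rule sum_nonneg) (rule simp_nonneg[OF assms(2)])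
 moreover have "supp (push \<phi> l) \<subseteq> \<phi> ` J" unfolding supp_push[OF assms] using supp_simp(1)[OF assms(2)] by (rule image_mono)
 ultimately show ?thesis by (simp add: simp_def)
qed

lemma continuous_on_push:
 assumes "finite J" shows "continuous_on (simp J) (push \<phi>)"
proof -
 have "continuous_on (simp J) (\<lambda>l v. \<Sum>j\<in>{j \<in> J. \<phi> j = v}. l j)"
  by (intro continuous_on_pi continuous_on_sum continuous_on_apply)
 thus ?thesis by (rule continuous_on_eq) (auto simp: push_eq[OF assms])
qed

lemma push_push:
 assumes "finite J" "l \<in> simp J"
 shows "push \<psi> (push \<phi> l) = push (\<lambda>j. \<psi> (\<phi> j)) l"
proof
 fix w
 let ?A = "{j \<in> J. \<psi> (\<phi> j) = w}"
 have e: "{v \<in> \<phi> ` J. \<psi> v = w} = \<phi> ` ?A" by auto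
 have "push \<psi> (push \<phi> l) w = (\<Sum>v\<in>\<phi> ` ?A. push \<phi> l v)"
  unfolding e[symmetric] using push_eq[OF finite_imageI[OF assms(1)] push_simp[OF assms]] .
 also have "\<dots> = (\<Sum>v\<in>\<phi> ` ?A. \<Sum>j\<in>{j \<in> ?A. \<phi> j = v}. l j)"
 proof (rule sum.cong[OF refl])
  fix v assume "v \<in> \<phi> ` ?A"
  hence "{j \<in> J. \<phi> j = v} = {j \<in> ?A. \<phi> j = v}" by auto
  thus "push \<phi> l v = (\<Sum>j\<in>{j \<in> ?A. \<phi> j = v}. l j)" by (simp only: push_eq[OF assms])
 qed
 also have "\<dots> = sum l ?A" by (rule sum.image_gen[symmetric]) (use assms(1) in simp)
 finally show "push \<psi> (push \<phi> l) w = push (\<lambda>j. \<psi> (\<phi> j)) l w" unfolding push_eq[OF assms] .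
qed

lemma cmap_paste_finite:
 assumes "finite I" "\<And>i. i \<in> I \<Longrightarrow> closedin (top_of_set R) (A i)" "R \<subseteq> (\<Union>i\<in>I. A i)"
  and c: "\<And>i. i \<in> I \<Longrightarrow> cmap (A i) Z h"
 shows "cmap R Z h"
proof (rule pasting_lemma_closed[OF assms(1,2)])
 fix i assume i: "i \<in> I"
 have "subtopology (top_of_set R) (A i) = top_of_set (A i)"
  using closedin_imp_subset[OF assms(2)[OF i]] by (simp add: subtopology_subtopology Int_absorb1)
 thus "continuous_map (subtopology (top_of_set R) (A i)) Z h" using c[OF i] by simp
qed (use assms(3) in auto)

lemma closed_simp: "closed (simp J)"
proof -
 have "simp J = (\<Inter>i. {l. 0 \<le> l i}) \<inter> (\<Inter>i\<in>-J. {l. l i = 0}) \<inter> {l. sum l J = 1}"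
  by (auto simp: simp_def supp_def)
 thus ?thesis
  by (simp only:) (intro closed_Int closed_INT ballI closed_Collect_le closed_Collect_eq continuous_intros)
qed

lemma compact_cube_bd: "compact (cube_bd k)"
proof -
 have "compact (cube k \<inter> {x. x i = c})" for i and c :: real
  by (intro compact_Int_closed compact_cube closed_Collect_eq continuous_intros)
 hence "compact (\<Union>i<k. (cube k \<inter> {x. x i = 0}) \<union> (cube k \<inter> {x. x i = 1}))"
  by (intro compact_UN compact_Un) auto
 moreover have "(\<Union>i<k. (cube k \<inter> {x. x i = 0}) \<union> (cube k \<inter> {x. x i = 1})) = cube_bd k"
  unfolding cube_bd_def by auto
 ultimately show ?thesis by simp
qed

lemma simp_proper_face: "\<lbrakk>finite J; l \<in> simp J; j \<notin> supp l\<rbrakk> \<Longrightarrow> l \<in> simp (J - {j})"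
 using simp_mono[of "J - {j}" "supp l"] simp_mono[of "supp l" "J - {j}"] simp_supp[of J l] supp_simp(1)[of l J]
 by (metis (no_types, lifting) Diff_empty finite_Diff subsetD subset_Diff_insert)

section \<open>The tower of covers and the deformation over its skeleta\<close>

locale deformation_problem = sheaf_pair X \<Psi> \<Phi>
 for X :: "'a topology" and \<Psi> \<Phi> :: "('a, 'b) top_presheaf" +
 fixes k :: nat and f0 :: "(nat \<Rightarrow> real) \<Rightarrow> 'b"
 assumes f0: "cmap (cube k) (sec \<Psi> (topspace X)) f0"
  and f0_small: "\<And>x. x \<in> cube_bd k \<Longrightarrow> f0 x \<in> small (topspace X)"
begin

definition bot :: "'a set \<Rightarrow> (nat \<Rightarrow> real) \<Rightarrow> 'b" where
 "bot U x = res \<Psi> (topspace X) U (f0 x)"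

lemma bot_in: "openin X U \<Longrightarrow> x \<in> cube k \<Longrightarrow> bot U x \<in> sections U"
 unfolding bot_def by (rule res_in[OF openin_topspace _ openin_subset cmap_in[OF f0]])

lemma bot_small: "openin X U \<Longrightarrow> x \<in> cube_bd k \<Longrightarrow> bot U x \<in> small U"
 unfolding bot_def by (rule res_small[OF openin_topspace _ openin_subset f0_small])

lemma bot_continuous: "openin X U \<Longrightarrow> cmap (cube k) (sec \<Psi> U) (bot U)"
 unfolding bot_def by (rule cmap_res[OF f0 openin_topspace _ openin_subset])

lemma bot_res: "\<lbrakk>openin X U; openin X V; V \<subseteq> U; x \<in> cube k\<rbrakk> \<Longrightarrow> res \<Psi> U V (bot U x) = bot V x"
 unfolding bot_def by (rule res_res[OF openin_topspace _ _ _ openin_subset cmap_in[OF f0]])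

text \<open>A homotopy of sections over \<open>U\<close>, relative to the boundary of the parameter
  cube, from the restriction of \<open>f0\<close> into the smaller sheaf. It belongs to a single
  point of a simplex; joint continuity is imposed by \<open>adm\<close>.\<close>

definition deforms :: "'a set \<Rightarrow> (real \<times> (nat \<Rightarrow> real) \<Rightarrow> 'b) \<Rightarrow> bool" where
 "deforms U g \<longleftrightarrow> (\<forall>z\<in>cyl k. g z \<in> sections U) \<and>
  (\<forall>x\<in>cube k. g (0, x) = bot U x \<and> g (1, x) \<in> small U) \<and>
  (\<forall>x\<in>cube_bd k. \<forall>t\<in>{0..1}. g (t, x) = bot U x)"

lemma deformsD:
 assumes "deforms U g"
 shows "z \<in> cyl k \<Longrightarrow> g z \<in> sections U" "x \<in> cube k \<Longrightarrow> g (0, x) = bot U x"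
  "x \<in> cube k \<Longrightarrow> g (1, x) \<in> small U" "x \<in> cube_bd k \<Longrightarrow> t \<in> {0..1} \<Longrightarrow> g (t, x) = bot U x"
 using assms unfolding deforms_def by blast+

lemma deformsI:
 assumes "\<And>z. z \<in> cyl k \<Longrightarrow> g z \<in> sections U" "\<And>x. x \<in> cube k \<Longrightarrow> g (0, x) = bot U x"
  "\<And>x. x \<in> cube k \<Longrightarrow> g (1, x) \<in> small U" "\<And>x t. x \<in> cube_bd k \<Longrightarrow> t \<in> {0..1} \<Longrightarrow> g (t, x) = bot U x"
 shows "deforms U g"
 using assms unfolding deforms_def by blast

lemma deforms_res:
 assumes "deforms U g" "openin X U" "openin X V" "V \<subseteq> U"
 shows "deforms V (\<lambda>z. res \<Psi> U V (g z))"
proof (rule deformsI)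
 note d = deformsD[OF assms(1)] and o = assms(2-4)
 show "res \<Psi> U V (g z) \<in> sections V" if "z \<in> cyl k" for z by (rule res_in[OF o d(1)[OF that]])
 show "res \<Psi> U V (g (0, x)) = bot V x" if "x \<in> cube k" for x unfolding d(2)[OF that] by (rule bot_res[OF o that])
 show "res \<Psi> U V (g (1, x)) \<in> small V" if "x \<in> cube k" for x by (rule res_small[OF o d(3)[OF that]])
 show "res \<Psi> U V (g (t, x)) = bot V x" if "x \<in> cube_bd k" "t \<in> {0..1}" for x t
  unfolding d(4)[OF that] by (rule bot_res[OF o]) (use that cube_bd_subset in blast)
qed

definition adm :: "('i \<Rightarrow> 'a set) \<Rightarrow> 'i set \<Rightarrow> (('i \<Rightarrow> real) \<Rightarrow> real \<times> (nat \<Rightarrow> real) \<Rightarrow> 'b) \<Rightarrow> bool" where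
 "adm U J f \<longleftrightarrow> cmap (simp J \<times> (cyl k)) (sec \<Psi> (UU U J))
   (\<lambda>(l, z). res \<Psi> (US U l) (UU U J) (f l z)) \<and> (\<forall>l\<in>simp J. deforms (US U l) (f l))"

text \<open>Pull-back along a simplicial map. The vertex map may identify vertices, since
  \<open>push\<close> then lands in the simplex spanned by the image, on which \<open>f\<close> is
  admissible.\<close>

lemma adm_push:
 fixes \<phi> :: "'i \<Rightarrow> 'v"
 assumes J: "finite J" "J \<noteq> {}" and f: "adm U (\<phi> ` J) f"
  and U: "\<And>j. j \<in> J \<Longrightarrow> openin X (U (\<phi> j))" "\<And>j. j \<in> J \<Longrightarrow> openin X (U' j)" "\<And>j. j \<in> J \<Longrightarrow> U' j \<subseteq> U (\<phi> j)"
 shows "adm U' J (\<lambda>l z. res \<Psi> (UU U (supp (push \<phi> l))) (US U' l) (f (push \<phi> l) z))"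
proof -
 have oU: "openin X (UU U (\<phi> ` L))" "openin X (UU U' L)" "UU U' L \<subseteq> UU U (\<phi> ` L)" if L: "L \<subseteq> J" "L \<noteq> {}" for L
 proof -
  have "finite L" using L J finite_subset by blast
  thus "openin X (UU U (\<phi> ` L))" by (intro openin_UU[of "\<phi> ` J"]) (use L U(1) in \<open>auto simp: fins_def\<close>)
  show "openin X (UU U' L)" by (rule openin_UU[of J]) (use L U(2) \<open>finite L\<close> in \<open>auto simp: fins_def\<close>)
  show "UU U' L \<subseteq> UU U (\<phi> ` L)" using L U(3) unfolding UU_def by blast
 qed
 note oJ = oU[OF order.refl J(2)]
 have sl: "supp l \<subseteq> J" "supp l \<noteq> {}" if "l \<in> simp J" for l using supp_simp[OF that] by blast+
 have sp: "supp (push \<phi> l) = \<phi> ` supp l" if "l \<in> simp J" for l by (rule supp_push[OF J(1) that])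
 have fd: "deforms (UU U (\<phi> ` supp l)) (f (push \<phi> l))" if "l \<in> simp J" for l
  using f push_simp[OF J(1) that, of \<phi>] sp[OF that] unfolding adm_def by (metis (no_types, lifting))
 show ?thesis
  unfolding adm_def
 proof (intro conjI ballI)
  fix l assume l: "l \<in> simp J"
  show "deforms (US U' l) (\<lambda>z. res \<Psi> (UU U (supp (push \<phi> l))) (US U' l) (f (push \<phi> l) z))"
   unfolding sp[OF l] by (rule deforms_res[OF fd[OF l]]) (rule oU[OF sl[OF l]])+
 next
  have "cmap (simp (\<phi> ` J) \<times> (cyl k)) (sec \<Psi> (UU U' J))
    (\<lambda>y. res \<Psi> (UU U (\<phi> ` J)) (UU U' J) ((\<lambda>(l, z). res \<Psi> (US U l) (UU U (\<phi> ` J)) (f l z)) y))"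
   by (rule cmap_res[OF _ oJ]) (use f in \<open>simp add: adm_def\<close>)
  hence "cmap (simp J \<times> (cyl k)) (sec \<Psi> (UU U' J))
    (\<lambda>y. res \<Psi> (UU U (\<phi> ` J)) (UU U' J) ((\<lambda>(l, z). res \<Psi> (US U l) (UU U (\<phi> ` J)) (f l z)) (push \<phi> (fst y), snd y)))"
  proof (rule cmap_compose)
   show "continuous_on (simp J \<times> (cyl k)) (\<lambda>y. (push \<phi> (fst y), snd y))"
    by (rule continuous_on_Pair[OF continuous_on_compose2[OF continuous_on_push[OF J(1)] continuous_on_fst[OF continuous_on_id]] continuous_on_snd[OF continuous_on_id]]) auto
  qed (use push_simp[OF J(1)] in auto)
  thus "cmap (simp J \<times> (cyl k)) (sec \<Psi> (UU U' J))
   (\<lambda>(l, z). res \<Psi> (US U' l) (UU U' J) (res \<Psi> (UU U (supp (push \<phi> l))) (US U' l) (f (push \<phi> l) z)))"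
  proof (rule continuous_map_eq)
   fix y assume "y \<in> topspace (top_of_set (simp J \<times> (cyl k)))"
   then obtain l z where y: "y = (l, z)" and l: "l \<in> simp J" and z: "z \<in> cyl k" by auto
   note fz = deformsD(1)[OF fd[OF l] z] and o = oU[OF sl[OF l]]
   have "res \<Psi> (UU U (\<phi> ` J)) (UU U' J) (res \<Psi> (UU U (\<phi> ` supp l)) (UU U (\<phi> ` J)) (f (push \<phi> l) z)) =
     res \<Psi> (UU U (\<phi> ` supp l)) (UU U' J) (f (push \<phi> l) z)"
    by (rule res_res[OF o(1) oJ(1,2,3) UU_antimono[OF image_mono[OF sl(1)[OF l]]] fz])
   moreover have "res \<Psi> (US U' l) (UU U' J) (res \<Psi> (UU U (\<phi> ` supp l)) (US U' l) (f (push \<phi> l) z)) =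
     res \<Psi> (UU U (\<phi> ` supp l)) (UU U' J) (f (push \<phi> l) z)"
    by (rule res_res[OF o(1) o(2) oJ(2) UU_antimono[OF sl(1)[OF l]] o(3) fz])
   ultimately show "res \<Psi> (UU U (\<phi> ` J)) (UU U' J) ((\<lambda>(l, z). res \<Psi> (US U l) (UU U (\<phi> ` J)) (f l z)) (push \<phi> (fst y), snd y)) =
     (\<lambda>(l, z). res \<Psi> (US U' l) (UU U' J) (res \<Psi> (UU U (supp (push \<phi> l))) (US U' l) (f (push \<phi> l) z))) y"
    unfolding y by (simp add: sp[OF l])
  qed
 qed
qed

text \<open>At most \<open>d\<close> vertices means the skeleton of dimension \<open>d - 1\<close>,
  so stage 0 carries no data. The sections live over the sets \<open>V P\<close>, while the smaller
  members \<open>P\<close> decide by their closures which simplices have to be filled at a point;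
  the gap between the two leaves neighbourhoods to work in.\<close>

definition tower_ok where
 "tower_ok d S V f \<longleftrightarrow> open_cover X S \<and> locally_finite_in X S \<and> (\<forall>P\<in>S. openin X (V P) \<and> X closure_of P \<subseteq> V P) \<and>
  (\<forall>J\<in>fins S. card J \<le> d \<longrightarrow> UU V J \<noteq> {} \<longrightarrow> adm V J f)"

definition fillp where
 "fillp V f W J g \<longleftrightarrow> cmap (simp J \<times> (cyl k)) (sec \<Psi> W) (\<lambda>(l, z). g l z) \<and>
  (\<forall>l\<in>simp J. deforms W (g l) \<and>
   (supp l \<noteq> J \<longrightarrow> (\<forall>z\<in>cyl k. g l z = res \<Psi> (US V l) W (f l z))))"

text \<open>A simplex times the parameter cube is a cell. Prescribed are the bottom, by
  \<open>f0\<close>, and the sides, by \<open>f\<close> over the boundary of the simplex and by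
  \<open>f0\<close> over the boundary of the cube. At time 1 the sides lie in the smaller sheaf, so
  the cell can be filled near \<open>p\<close>.\<close>

lemma fill_one:
 assumes ok: "tower_ok d S V f" and J: "J \<in> fins S" "card J = Suc d" and p: "\<And>P. P \<in> J \<Longrightarrow> p \<in> X closure_of P"
 shows "\<exists>W g. openin X W \<and> p \<in> W \<and> W \<subseteq> UU V J \<and> fillp V f W J g"
proof -
 have fJ: "finite J" "J \<noteq> {}" "J \<subseteq> S" using J(1) unfolding fins_def by auto
 have Vo: "openin X (V P)" if "P \<in> S" for P using ok that unfolding tower_ok_def by blast
 define U0 where "U0 = UU V J"
 have oU0: "openin X U0" unfolding U0_def by (rule openin_UU[OF Vo J(1)])
 have pU0: "p \<in> U0" using p ok fJ(3) unfolding U0_def UU_def tower_ok_def by blast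
 have oV: "openin X (UU V L)" "U0 \<subseteq> UU V L" if L: "L \<subseteq> J" "L \<noteq> {}" for L
 proof -
  have LF: "L \<in> fins S" using L fJ finite_subset unfolding fins_def by blast
  show "openin X (UU V L)" by (rule openin_UU[where I=S, OF _ LF]) (rule Vo)
  show "U0 \<subseteq> UU V L" unfolding U0_def by (rule UU_antimono[OF L(1)])
 qed
 have admL: "adm V L f" if L: "L \<subset> J" "L \<noteq> {}" for L
 proof -
  have "L \<in> fins S" using L fJ finite_subset unfolding fins_def by blast
  moreover have "card L \<le> d" using psubset_card_mono[OF fJ(1) L(1)] J(2) by simp
  moreover have "UU V L \<noteq> {}" using oV(2)[OF psubset_imp_subset[OF L(1)] L(2)] pU0 by blast
  ultimately show ?thesis using ok unfolding tower_ok_def by blast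
 qed
 have sl: "supp l \<subseteq> J" "supp l \<noteq> {}" if "l \<in> simp J" for l using supp_simp[OF that] by blast+
 have fd: "deforms (US V l) (f l)" if l: "l \<in> simp J" "supp l \<noteq> J" for l
 proof -
  have "supp l \<subset> J" using sl(1)[OF l(1)] l(2) by blast
  from admL[OF this sl(2)[OF l(1)]] show ?thesis unfolding adm_def using simp_supp[OF fJ(1) l(1)] by blast
 qed
 let ?Q = "\<lambda>l z. res \<Psi> (US V l) U0 (f l z)"
 have Qd: "deforms U0 (?Q l)" if l: "l \<in> simp J" "supp l \<noteq> J" for l
  using deforms_res[OF fd[OF l] oV(1)[OF sl[OF l(1)]] oU0 oV(2)[OF sl[OF l(1)]]] .
 define T where "T = simp J \<times> cube k"
 define E where "E = {l \<in> simp J. supp l \<noteq> J} \<times> cube k \<union> simp J \<times> cube_bd k"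
 have cell: "cell_pair (card J - 1 + k) T E"
  unfolding T_def E_def by (rule cell_pair_Times[OF cell_pair_simp[OF fJ(1,2)] cell_pair_cube])
 \<comment> \<open>At interior points of the simplex only the bottom and the boundary of the cube
   occur, where \<open>bot\<close> is prescribed; on proper faces the deformation itself equals
   \<open>bot\<close> at such points, so the formulas fit.\<close>
 define g where "g = (\<lambda>y. if supp (fst (snd y)) \<noteq> J then ?Q (fst (snd y)) (fst y, snd (snd y)) else bot U0 (snd (snd y)))"
 define A where "A = {0::real} \<times> (simp J \<times> cube k) \<union> {0..1} \<times> (simp J \<times> cube_bd k)"
 define B where "B = (\<lambda>j. {0..1::real} \<times> (simp (J - {j}) \<times> cube k))"
 have R: "{0} \<times> T \<union> {0..1} \<times> E = A \<union> (\<Union>j\<in>J. B j)"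
 proof -
  have face: "l \<in> simp J \<and> supp l \<noteq> J \<longleftrightarrow> (\<exists>j\<in>J. l \<in> simp (J - {j}))" for l
  proof
   assume l: "l \<in> simp J \<and> supp l \<noteq> J"
   then obtain j where "j \<in> J" "j \<notin> supp l" using sl(1)[of l] by blast
   thus "\<exists>j\<in>J. l \<in> simp (J - {j})" using simp_proper_face[OF fJ(1)] l by blast
  next
   assume "\<exists>j\<in>J. l \<in> simp (J - {j})"
   then obtain j where j: "j \<in> J" "l \<in> simp (J - {j})" by blast
   thus "l \<in> simp J \<and> supp l \<noteq> J" using simp_mono[OF fJ(1), of "J - {j}"] supp_simp(1)[OF j(2)] by blast
  qed
  have "{l \<in> simp J. supp l \<noteq> J} = (\<Union>j\<in>J. simp (J - {j}))" using face by blast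
  thus ?thesis unfolding T_def E_def A_def B_def by auto
 qed
 have gA: "g y = bot U0 (snd (snd y))" if y: "y \<in> A" for y
 proof -
  obtain t l x where e: "y = (t, l, x)" by (cases y) auto
  have l: "l \<in> simp J" and x: "x \<in> cube k" using y cube_bd_subset[of k] unfolding A_def e by auto
  have "t = 0 \<or> x \<in> cube_bd k \<and> t \<in> {0..1}" using y unfolding A_def e by auto
  hence "supp l \<noteq> J \<Longrightarrow> ?Q l (t, x) = bot U0 x" using deformsD(2,4)[OF Qd[OF l]] x by auto
  thus ?thesis by (simp add: g_def e)
 qed
 have gE: "g (1, y) \<in> small U0" if y: "y \<in> E" for y
 proof -
  obtain l x where e: "y = (l, x)" by (cases y)
  have l: "l \<in> simp J" and x: "x \<in> cube k" using y cube_bd_subset[of k] unfolding E_def e by auto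
  show ?thesis
  proof (cases "supp l = J")
   case True
   hence "x \<in> cube_bd k" using y unfolding E_def e by auto
   thus ?thesis using True bot_small[OF oU0] by (simp add: g_def e)
  next
   case False
   thus ?thesis using deformsD(3)[OF Qd[OF l False] x] by (simp add: g_def e)
  qed
 qed
 have gc: "cmap ({0} \<times> T \<union> {0..1} \<times> E) (sec \<Psi> U0) g"
 proof (rule cmap_paste)
  have cA: "closed A" unfolding A_def
   by (intro closed_Un closed_Times closed_simp compact_imp_closed[OF compact_cube] compact_imp_closed[OF compact_cube_bd]) auto
  have cB: "closed (B j)" for j unfolding B_def
   by (intro closed_Times closed_simp compact_imp_closed[OF compact_cube]) auto
  show "closedin (top_of_set ({0} \<times> T \<union> {0..1} \<times> E)) A" unfolding R by (rule closed_subset) (use cA in auto)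
  show "closedin (top_of_set ({0} \<times> T \<union> {0..1} \<times> E)) (\<Union>j\<in>J. B j)" unfolding R
   by (rule closed_subset) (use cB fJ(1) in auto)
  show "{0} \<times> T \<union> {0..1} \<times> E \<subseteq> A \<union> (\<Union>j\<in>J. B j)" unfolding R by simp
  have "cmap A (sec \<Psi> U0) (\<lambda>y. bot U0 (snd (snd y)))"
  proof (rule cmap_compose[OF bot_continuous[OF oU0]])
   show "continuous_on A (\<lambda>y. snd (snd y))" by (intro continuous_on_snd continuous_on_id)
  qed (use cube_bd_subset[of k] in \<open>auto simp: A_def\<close>)
  thus "cmap A (sec \<Psi> U0) g" by (rule continuous_map_eq) (simp add: gA)
  show "cmap (\<Union>j\<in>J. B j) (sec \<Psi> U0) g"
  proof (rule cmap_paste_finite[OF fJ(1)])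
   show "closedin (top_of_set (\<Union>j\<in>J. B j)) (B j)" if "j \<in> J" for j by (rule closed_subset) (use cB that in auto)
   fix j assume j: "j \<in> J"
   show "cmap (B j) (sec \<Psi> U0) g"
   proof (cases "J - {j} = {}")
    case True
    hence "simp (J - {j}) = {}" using supp_simp by fastforce
    hence "B j = {}" unfolding B_def by simp
    thus ?thesis by simp
   next
    case False
    have ps: "J - {j} \<subset> J" using j by blast
    note L = psubset_imp_subset[OF ps] False
    have "cmap (simp (J - {j}) \<times> (cyl k)) (sec \<Psi> U0)
      (\<lambda>y. res \<Psi> (UU V (J - {j})) U0 ((\<lambda>(l, z). res \<Psi> (US V l) (UU V (J - {j})) (f l z)) y))"
     by (rule cmap_res[OF _ oV(1)[OF L] oU0 oV(2)[OF L]]) (use admL[OF ps False] in \<open>simp add: adm_def\<close>)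
    hence "cmap (B j) (sec \<Psi> U0)
      (\<lambda>y. res \<Psi> (UU V (J - {j})) U0 ((\<lambda>(l, z). res \<Psi> (US V l) (UU V (J - {j})) (f l z)) (fst (snd y), fst y, snd (snd y))))"
     by (rule cmap_compose) (auto simp: B_def intro!: continuous_on_Pair continuous_on_fst continuous_on_snd continuous_on_id)
    thus ?thesis
    proof (rule continuous_map_eq)
     fix y assume "y \<in> topspace (top_of_set (B j))"
     then obtain t l x where y: "y = (t, l, x)" and t: "(t, x) \<in> cyl k" and l': "l \<in> simp (J - {j})" unfolding B_def by auto
     have sub: "supp l \<subseteq> J - {j}" using supp_simp(1)[OF l'] .
     have l: "l \<in> simp J" using simp_mono[OF fJ(1) L(1)] l' by blast
     have ne: "supp l \<noteq> J" using sub j by blast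
     have "res \<Psi> (UU V (J - {j})) U0 (res \<Psi> (US V l) (UU V (J - {j})) (f l (t, x))) = ?Q l (t, x)"
      by (rule res_res[OF oV(1)[OF sl[OF l]] oV(1)[OF L] oU0 oV(2)[OF L] UU_antimono[OF sub] deformsD(1)[OF fd[OF l ne] t]])
     thus "res \<Psi> (UU V (J - {j})) U0 ((\<lambda>(l, z). res \<Psi> (US V l) (UU V (J - {j})) (f l z)) (fst (snd y), fst y, snd (snd y))) = g y"
      using ne by (simp add: g_def y)
    qed
   qed
  qed simp
 qed
 obtain W G where W: "openin X W" "p \<in> W" "W \<subseteq> U0" and G: "cmap ({0..1} \<times> T) (sec \<Psi> W) G"
  "\<And>z. z \<in> {0} \<times> T \<union> {0..1} \<times> E \<Longrightarrow> G z = res \<Psi> U0 W (g z)" "\<And>x. x \<in> T \<Longrightarrow> G (1, x) \<in> small W"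
  by (rule fill_cell[OF cell oU0 pU0 gc], rule gE, assumption, blast)
 have GA: "G y = bot W (snd (snd y))" if y: "y \<in> A" for y
 proof -
  have "snd (snd y) \<in> cube k" using y cube_bd_subset[of k] unfolding A_def by auto
  thus ?thesis using G(2)[of y] gA[OF y] bot_res[OF oU0 W(1,3)] y R by auto
 qed
 have "fillp V f W J (\<lambda>l z. G (fst z, l, snd z))"
  unfolding fillp_def
 proof (intro conjI ballI impI)
  show "cmap (simp J \<times> (cyl k)) (sec \<Psi> W) (\<lambda>(l, z). G (fst z, l, snd z))"
   unfolding case_prod_beta
   by (rule cmap_compose[OF G(1)]) (auto simp: T_def intro!: continuous_on_Pair continuous_on_fst continuous_on_snd continuous_on_id)
  fix l assume l: "l \<in> simp J"
  show "deforms W (\<lambda>z. G (fst z, l, snd z))"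
  proof (rule deformsI)
   show "G (fst z, l, snd z) \<in> sections W" if "z \<in> cyl k" for z
    by (rule cmap_in[OF G(1)]) (use that l in \<open>auto simp: T_def\<close>)
   show "G (fst (0, x), l, snd (0, x)) = bot W x" if "x \<in> cube k" for x
    using GA[of "(0, l, x)"] that l by (simp add: A_def)
   show "G (fst (1, x), l, snd (1, x)) \<in> small W" if "x \<in> cube k" for x
    using G(3)[of "(l, x)"] that l by (simp add: T_def)
   show "G (fst (t, x), l, snd (t, x)) = bot W x" if "x \<in> cube_bd k" "t \<in> {0..1}" for x t
    using GA[of "(t, l, x)"] that l by (simp add: A_def)
  qed
  fix z assume ne: "supp l \<noteq> J" and z: "z \<in> cyl k"
  have "G (fst z, l, snd z) = res \<Psi> U0 W (g (fst z, l, snd z))" by (rule G(2)) (use z l ne in \<open>auto simp: E_def\<close>)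
  also have "\<dots> = res \<Psi> U0 W (?Q l z)" using ne by (simp add: g_def)
  also have "\<dots> = res \<Psi> (US V l) W (f l z)"
   by (rule res_res[OF oV(1)[OF sl[OF l]] oU0 W(1,3) oV(2)[OF sl[OF l]] deformsD(1)[OF fd[OF l ne] z]])
  finally show "G (fst z, l, snd z) = res \<Psi> (US V l) W (f l z)" .
 qed
 thus ?thesis using W unfolding U0_def by blast
qed

lemma fillp_res:
 assumes g: "fillp V f W J g" and W: "openin X W" "openin X W'" "W' \<subseteq> W"
  and fW: "\<And>l z. \<lbrakk>l \<in> simp J; supp l \<noteq> J; z \<in> cyl k\<rbrakk> \<Longrightarrow>
   openin X (US V l) \<and> W \<subseteq> US V l \<and> f l z \<in> sections (US V l)"
 shows "fillp V f W' J (\<lambda>l z. res \<Psi> W W' (g l z))"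
 unfolding fillp_def
proof (intro conjI ballI impI)
 show "cmap (simp J \<times> (cyl k)) (sec \<Psi> W') (\<lambda>(l, z). res \<Psi> W W' (g l z))"
  using cmap_res[OF _ W, of _ "\<lambda>(l, z). g l z"] g unfolding fillp_def case_prod_beta by blast
 fix l assume l: "l \<in> simp J"
 show "deforms W' (\<lambda>z. res \<Psi> W W' (g l z))" by (rule deforms_res[OF _ W]) (use g l in \<open>auto simp: fillp_def\<close>)
 fix z assume ne: "supp l \<noteq> J" and z: "z \<in> cyl k"
 note f = fW[OF l ne z]
 have "g l z = res \<Psi> (US V l) W (f l z)" using g l ne z unfolding fillp_def by blast
 thus "res \<Psi> W W' (g l z) = res \<Psi> (US V l) W' (f l z)" using res_res[OF _ W(1,2,3)] f by simp
qed

end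

context deformation_problem
begin

lemma adm_cong:
 assumes f: "adm U J f" and e: "\<And>l z. l \<in> simp J \<Longrightarrow> z \<in> cyl k \<Longrightarrow> f l z = g l z"
 shows "adm U J g"
proof -
 have "deforms (US U l) (g l)" if l: "l \<in> simp J" for l
 proof -
  have d: "deforms (US U l) (f l)" using f l unfolding adm_def by blast
  note d' = deformsD[OF d]
  show ?thesis using d' e[OF l] cube_bd_subset[of k] by (intro deformsI) (fastforce dest: subsetD)+
 qed
 moreover have "cmap (simp J \<times> (cyl k)) (sec \<Psi> (UU U J))
   (\<lambda>(l, z). res \<Psi> (US U l) (UU U J) (g l z))"
  by (rule continuous_map_eq[of _ _ "\<lambda>(l, z). res \<Psi> (US U l) (UU U J) (f l z)"]) (use f e in \<open>auto simp: adm_def\<close>)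
 ultimately show ?thesis unfolding adm_def by blast
qed

lemma tower_okD:
 assumes "tower_ok d S V f"
 shows "open_cover X S" "locally_finite_in X S" "P \<in> S \<Longrightarrow> openin X (V P)" "P \<in> S \<Longrightarrow> X closure_of P \<subseteq> V P"
  "\<lbrakk>J \<in> fins S; card J \<le> d; UU V J \<noteq> {}\<rbrakk> \<Longrightarrow> adm V J f"
 using assms unfolding tower_ok_def by blast+

lemma tower_face:
 assumes ok: "tower_ok d S V f" and J: "J \<in> fins S" "card J = Suc d" "p \<in> UU V J" and l: "l \<in> simp J" "supp l \<noteq> J"
 shows "openin X (US V l)" "UU V J \<subseteq> US V l" "deforms (US V l) (f l)"
proof -
 have fJ: "finite J" "J \<subseteq> S" using J(1) unfolding fins_def by auto
 have sl: "supp l \<subset> J" "supp l \<noteq> {}" using supp_simp[OF l(1)] l(2) by auto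
 have F: "supp l \<in> fins S" by (rule fins_supp[OF J(1) l(1)])
 show "openin X (US V l)" by (rule openin_UU[OF _ F]) (rule tower_okD(3)[OF ok])
 show sub: "UU V J \<subseteq> US V l" by (rule UU_antimono[OF psubset_imp_subset[OF sl(1)]])
 have "card (supp l) \<le> d" using psubset_card_mono[OF fJ(1) sl(1)] J(2) by simp
 moreover have "US V l \<noteq> {}" using sub J(3) by blast
 ultimately have "adm V (supp l) f" by (rule tower_okD(5)[OF ok F])
 thus "deforms (US V l) (f l)" using simp_supp[OF fJ(1) l(1)] unfolding adm_def by blast
qed

text \<open>By local finiteness only finitely many members have \<open>p\<close> in their closure,
  so finitely many simplices are to be filled at \<open>p\<close> and the neighbourhoods can be
  intersected. The closures that avoid \<open>p\<close> have a closed union, again by local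
  finiteness, and are removed.\<close>

lemma local_fill:
 assumes ok: "tower_ok d S V f" and p: "p \<in> topspace X"
 shows "\<exists>W g. openin X W \<and> p \<in> W \<and> (\<exists>P\<in>S. W \<subseteq> P \<and> p \<in> P) \<and> (\<forall>P\<in>S. p \<in> X closure_of P \<longrightarrow> W \<subseteq> V P) \<and>
  (\<forall>P\<in>S. p \<notin> X closure_of P \<longrightarrow> W \<inter> X closure_of P = {}) \<and>
  (\<forall>J\<in>fins S. card J = Suc d \<longrightarrow> (\<forall>P\<in>J. p \<in> X closure_of P) \<longrightarrow> fillp V f W J (g J))"
proof -
 define I where "I = {P \<in> S. p \<in> X closure_of P}"
 have finI: "finite I"
 proof -
  obtain N where N: "openin X N" "p \<in> N" "finite {P \<in> S. P \<inter> N \<noteq> {}}"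
   using tower_okD(2)[OF ok] p unfolding locally_finite_in_def by blast
  have "I \<subseteq> {P \<in> S. P \<inter> N \<noteq> {}}" using N(1,2) unfolding I_def by (auto simp: in_closure_of)
  thus ?thesis using N(3) finite_subset by blast
 qed
 define M where "M = {J \<in> fins S. card J = Suc d \<and> J \<subseteq> I}"
 have finM: "finite M" by (rule finite_subset[of _ "Pow I"]) (use finI in \<open>auto simp: M_def\<close>)
 have "\<forall>J\<in>M. \<exists>Wg. openin X (fst Wg) \<and> p \<in> fst Wg \<and> fst Wg \<subseteq> UU V J \<and> fillp V f (fst Wg) J (snd Wg)"
 proof
  fix J assume "J \<in> M"
  hence J: "J \<in> fins S" "card J = Suc d" "J \<subseteq> I" unfolding M_def by auto
  have "\<exists>W g. openin X W \<and> p \<in> W \<and> W \<subseteq> UU V J \<and> fillp V f W J g"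
   by (rule fill_one[OF ok J(1,2)]) (use J(3) in \<open>auto simp: I_def\<close>)
  thus "\<exists>Wg. openin X (fst Wg) \<and> p \<in> fst Wg \<and> fst Wg \<subseteq> UU V J \<and> fillp V f (fst Wg) J (snd Wg)" by auto
 qed
 from bchoice[OF this] obtain c where c: "\<And>J. J \<in> M \<Longrightarrow> openin X (fst (c J)) \<and> p \<in> fst (c J) \<and> fst (c J) \<subseteq> UU V J \<and> fillp V f (fst (c J)) J (snd (c J))"
  by blast
 obtain P0 where P0: "P0 \<in> S" "p \<in> P0" "openin X P0" using tower_okD(1)[OF ok] p unfolding open_cover_def by blast
 define C where "C = P0 - \<Union>((\<lambda>P. X closure_of P) ` (S - I))"
 have oC: "openin X C" unfolding C_def
  by (intro openin_diff P0(3) closedin_Union_locally_finite_closure) (rule locally_finite_in_subset[OF tower_okD(2)[OF ok]], blast)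
 define W where "W = C \<inter> ((\<Inter>P\<in>I. V P) \<inter> topspace X) \<inter> ((\<Inter>J\<in>M. fst (c J)) \<inter> topspace X)"
 have h1: "openin X ((\<Inter>P\<in>I. V P) \<inter> topspace X)" by (rule openin_INT[OF finI]) (use tower_okD(3)[OF ok] in \<open>simp add: I_def\<close>)
 have h2: "openin X ((\<Inter>J\<in>M. fst (c J)) \<inter> topspace X)" by (rule openin_INT[OF finM]) (use c in blast)
 have oW: "openin X W" unfolding W_def by (rule openin_Int[OF openin_Int[OF oC h1] h2])
 show ?thesis
 proof (intro exI conjI ballI impI)
  show "openin X W" by (rule oW)
  have "p \<in> C" using P0(2) p unfolding C_def I_def by blast
  moreover have "p \<in> (\<Inter>P\<in>I. V P)" using tower_okD(4)[OF ok] unfolding I_def by blast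
  moreover have "p \<in> (\<Inter>J\<in>M. fst (c J))" using c by blast
  ultimately show "p \<in> W" using p unfolding W_def by blast
  show "\<exists>P\<in>S. W \<subseteq> P \<and> p \<in> P" using P0 unfolding W_def C_def by blast
  show "W \<subseteq> V P" if "P \<in> S" "p \<in> X closure_of P" for P using that unfolding W_def I_def by auto
  show "W \<inter> X closure_of P = {}" if "P \<in> S" "p \<notin> X closure_of P" for P using that unfolding W_def C_def I_def by auto
  fix J assume J: "J \<in> fins S" "card J = Suc d" "\<forall>P\<in>J. p \<in> X closure_of P"
  hence JM: "J \<in> M" unfolding M_def I_def fins_def by auto
  have pJ: "p \<in> UU V J" using c[OF JM] by blast
  show "fillp V f W J ((\<lambda>J l z. res \<Psi> (fst (c J)) W (snd (c J) l z)) J)"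
  proof (rule fillp_res)
   show "fillp V f (fst (c J)) J (snd (c J))" "openin X (fst (c J))" using c[OF JM] by blast+
   show "W \<subseteq> fst (c J)" using JM unfolding W_def by blast
   fix l z assume l: "l \<in> simp J" "supp l \<noteq> J" and z: "z \<in> cyl k"
   note t = tower_face[OF ok J(1,2) pJ l]
   show "openin X (US V l) \<and> fst (c J) \<subseteq> US V l \<and> f l z \<in> sections (US V l)"
    using t(1,2) deformsD(1)[OF t(3) z] c[OF JM] by blast
  qed (rule oW)
 qed
qed

text \<open>On a simplex \<open>h\<close> is the filling at points of full support and the old
  \<open>f\<close> on proper faces; these fit because the filling extends \<open>f\<close>.
  Injectivity of \<open>\<phi>\<close> ensures that proper faces go to proper faces.\<close>

lemma adm_glue:
 fixes \<phi> :: "'i \<Rightarrow> 'v"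
 assumes J: "finite J" "J \<noteq> {}" and inj: "inj_on \<phi> J" and W: "openin X W" "UU U' J \<subseteq> W"
  and g: "fillp V f W (\<phi> ` J) g" and V: "\<And>j. j \<in> J \<Longrightarrow> openin X (V (\<phi> j)) \<and> W \<subseteq> V (\<phi> j)"
  and U': "\<And>j. j \<in> J \<Longrightarrow> openin X (U' j) \<and> U' j \<subseteq> V (\<phi> j)"
  and f: "\<And>l. l \<in> simp (\<phi> ` J) \<Longrightarrow> supp l \<noteq> \<phi> ` J \<Longrightarrow> deforms (US V l) (f l)"
  and h1: "\<And>l z. l \<in> simp J \<Longrightarrow> supp l = J \<Longrightarrow> h l z = res \<Psi> W (UU U' J) (g (push \<phi> l) z)"
  and h2: "\<And>l z. l \<in> simp J \<Longrightarrow> supp l \<noteq> J \<Longrightarrow>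
   h l z = res \<Psi> (UU V (\<phi> ` supp l)) (US U' l) (f (push \<phi> l) z)"
 shows "adm U' J h"
proof -
 have oU: "openin X (UU V (\<phi> ` L))" "openin X (UU U' L)" "UU U' L \<subseteq> UU V (\<phi> ` L)" "W \<subseteq> UU V (\<phi> ` L)" if L: "L \<subseteq> J" "L \<noteq> {}" for L
 proof -
  have "finite L" using L J finite_subset by blast
  thus "openin X (UU V (\<phi> ` L))" by (intro openin_UU[of "\<phi> ` J"]) (use L V in \<open>auto simp: fins_def\<close>)
  show "openin X (UU U' L)" by (rule openin_UU[of J]) (use L U' \<open>finite L\<close> in \<open>auto simp: fins_def\<close>)
  show "UU U' L \<subseteq> UU V (\<phi> ` L)" using L U' unfolding UU_def by blast
  show "W \<subseteq> UU V (\<phi> ` L)" using L V unfolding UU_def by blast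
 qed
 have sl: "supp l \<subseteq> J" "supp l \<noteq> {}" if "l \<in> simp J" for l using supp_simp[OF that] by blast+
 have sp: "supp (push \<phi> l) = \<phi> ` supp l" if "l \<in> simp J" for l by (rule supp_push[OF J(1) that])
 have ps: "push \<phi> l \<in> simp (\<phi> ` J)" if "l \<in> simp J" for l by (rule push_simp[OF J(1) that])
 have ne: "\<phi> ` supp l \<noteq> \<phi> ` J" if "l \<in> simp J" "supp l \<noteq> J" for l
  using inj_on_image_eq_iff[OF inj sl(1)[OF that(1)] order.refl] that(2) by simp
 have fd: "deforms (UU V (\<phi> ` supp l)) (f (push \<phi> l))" if "l \<in> simp J" "supp l \<noteq> J" for l
  using f[OF ps[OF that(1)]] ne[OF that] unfolding sp[OF that(1)] by simp
 have gd: "deforms W (g (push \<phi> l))" if "l \<in> simp J" for l using g ps[OF that] unfolding fillp_def by blast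
 note oJ = oU(2)[OF order.refl J(2)]
 have hd: "deforms (US U' l) (h l)" if l: "l \<in> simp J" for l
 proof (cases "supp l = J")
  case True
  have "h l = (\<lambda>z. res \<Psi> W (UU U' J) (g (push \<phi> l) z))" using h1[OF l True] by blast
  thus ?thesis using deforms_res[OF gd[OF l] W(1) oJ W(2)] True by simp
 next
  case False
  have "h l = (\<lambda>z. res \<Psi> (UU V (\<phi> ` supp l)) (US U' l) (f (push \<phi> l) z))" using h2[OF l False] by blast
  thus ?thesis using deforms_res[OF fd[OF l False] oU(1,2,3)[OF sl[OF l]]] by simp
 qed
 show ?thesis
  unfolding adm_def
 proof (intro conjI ballI hd)
  have "cmap (simp (\<phi> ` J) \<times> (cyl k)) (sec \<Psi> (UU U' J))
    (\<lambda>y. res \<Psi> W (UU U' J) ((\<lambda>(l, z). g l z) y))"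
   by (rule cmap_res[OF _ W(1) oJ W(2)]) (use g in \<open>simp add: fillp_def\<close>)
  hence "cmap (simp J \<times> (cyl k)) (sec \<Psi> (UU U' J))
    (\<lambda>y. res \<Psi> W (UU U' J) ((\<lambda>(l, z). g l z) (push \<phi> (fst y), snd y)))"
  proof (rule cmap_compose)
   show "continuous_on (simp J \<times> (cyl k)) (\<lambda>y. (push \<phi> (fst y), snd y))"
    by (rule continuous_on_Pair[OF continuous_on_compose2[OF continuous_on_push[OF J(1)] continuous_on_fst[OF continuous_on_id]] continuous_on_snd[OF continuous_on_id]]) auto
  qed (use ps in auto)
  thus "cmap (simp J \<times> (cyl k)) (sec \<Psi> (UU U' J))
   (\<lambda>(l, z). res \<Psi> (US U' l) (UU U' J) (h l z))"
  proof (rule continuous_map_eq)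
   fix y assume "y \<in> topspace (top_of_set (simp J \<times> (cyl k)))"
   then obtain l z where y: "y = (l, z)" and l: "l \<in> simp J" and z: "z \<in> cyl k" by auto
   have "res \<Psi> W (UU U' J) (g (push \<phi> l) z) = res \<Psi> (US U' l) (UU U' J) (h l z)"
   proof (cases "supp l = J")
    case True
    thus ?thesis using res_id[OF oJ] deformsD(1)[OF hd[OF l] z] h1[OF l True] by simp
   next
    case False
    have "g (push \<phi> l) z = res \<Psi> (UU V (\<phi> ` supp l)) W (f (push \<phi> l) z)"
     using g ps[OF l] ne[OF l False] z unfolding fillp_def sp[OF l, symmetric] by blast
    thus ?thesis unfolding h2[OF l False]
     using res_res[OF oU(1)[OF sl[OF l]] W(1) oJ W(2) oU(4)[OF sl[OF l]] deformsD(1)[OF fd[OF l False] z]]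
      res_res[OF oU(1,2)[OF sl[OF l]] oJ UU_antimono[OF sl(1)[OF l]] oU(3)[OF sl[OF l]] deformsD(1)[OF fd[OF l False] z]] by simp
   qed
   thus "res \<Psi> W (UU U' J) ((\<lambda>(l, z). g l z) (push \<phi> (fst y), snd y)) = (\<lambda>(l, z). res \<Psi> (US U' l) (UU U' J) (h l z)) y"
    by (simp add: y)
  qed
 qed
qed

text \<open>Every point \<open>p\<close> has a neighbourhood \<open>W p\<close> with fillings of all
  simplices of \<open>d + 1\<close> vertices whose closures contain \<open>p\<close>. The members of
  \<open>S'\<close> have closures in such neighbourhoods, and each is sent to a member of
  \<open>S\<close> around the point used. A simplex of at most \<open>d + 1\<close> vertices then
  has an image with at most \<open>d\<close> vertices, where \<open>f\<close> is pulled back, or is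
  mapped injectively, where a filling is available.\<close>

lemma tower_step:
 assumes ok: "tower_ok d S V f" and par: "paracompact_space X" and reg: "regular_space X"
 obtains S' V' f' \<phi> where "tower_ok (Suc d) S' V' f'" "\<And>P. P \<in> S' \<Longrightarrow> \<phi> P \<in> S \<and> V' P \<subseteq> V (\<phi> P)"
  "\<And>l z. card (supp (push \<phi> l)) \<le> d \<Longrightarrow> f' l z = res \<Psi> (UU V (supp (push \<phi> l))) (US V' l) (f (push \<phi> l) z)"
proof -
 have "\<forall>p\<in>topspace X. \<exists>Wg. openin X (fst Wg) \<and> p \<in> fst Wg \<and> (\<exists>P\<in>S. fst Wg \<subseteq> P \<and> p \<in> P) \<and> (\<forall>P\<in>S. p \<in> X closure_of P \<longrightarrow> fst Wg \<subseteq> V P) \<and>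
  (\<forall>P\<in>S. p \<notin> X closure_of P \<longrightarrow> fst Wg \<inter> X closure_of P = {}) \<and>
  (\<forall>J\<in>fins S. card J = Suc d \<longrightarrow> (\<forall>P\<in>J. p \<in> X closure_of P) \<longrightarrow> fillp V f (fst Wg) J (snd Wg J))"
 proof
  fix p assume "p \<in> topspace X"
  from local_fill[OF ok this] obtain W g where "openin X W \<and> p \<in> W \<and> (\<exists>P\<in>S. W \<subseteq> P \<and> p \<in> P) \<and> (\<forall>P\<in>S. p \<in> X closure_of P \<longrightarrow> W \<subseteq> V P) \<and>
   (\<forall>P\<in>S. p \<notin> X closure_of P \<longrightarrow> W \<inter> X closure_of P = {}) \<and>
   (\<forall>J\<in>fins S. card J = Suc d \<longrightarrow> (\<forall>P\<in>J. p \<in> X closure_of P) \<longrightarrow> fillp V f W J (g J))" by (elim exE)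
  thus "\<exists>Wg. openin X (fst Wg) \<and> p \<in> fst Wg \<and> (\<exists>P\<in>S. fst Wg \<subseteq> P \<and> p \<in> P) \<and> (\<forall>P\<in>S. p \<in> X closure_of P \<longrightarrow> fst Wg \<subseteq> V P) \<and>
   (\<forall>P\<in>S. p \<notin> X closure_of P \<longrightarrow> fst Wg \<inter> X closure_of P = {}) \<and>
   (\<forall>J\<in>fins S. card J = Suc d \<longrightarrow> (\<forall>P\<in>J. p \<in> X closure_of P) \<longrightarrow> fillp V f (fst Wg) J (snd Wg J))"
   by - (rule exI[of _ "(W, g)"], unfold fst_conv snd_conv, assumption)
 qed
 from bchoice[OF this] obtain C where C: "\<forall>p\<in>topspace X. openin X (fst (C p)) \<and> p \<in> fst (C p) \<and> (\<exists>P\<in>S. fst (C p) \<subseteq> P \<and> p \<in> P) \<and> (\<forall>P\<in>S. p \<in> X closure_of P \<longrightarrow> fst (C p) \<subseteq> V P) \<and>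
  (\<forall>P\<in>S. p \<notin> X closure_of P \<longrightarrow> fst (C p) \<inter> X closure_of P = {}) \<and>
  (\<forall>J\<in>fins S. card J = Suc d \<longrightarrow> (\<forall>P\<in>J. p \<in> X closure_of P) \<longrightarrow> fillp V f (fst (C p)) J (snd (C p) J))" ..
 define W where "W = (\<lambda>p. fst (C p))"
 define g where "g = (\<lambda>p. snd (C p))"
 have W: "openin X (W p)" "p \<in> W p" "\<And>P. P \<in> S \<Longrightarrow> p \<in> X closure_of P \<Longrightarrow> W p \<subseteq> V P"
  "\<And>P. P \<in> S \<Longrightarrow> p \<notin> X closure_of P \<Longrightarrow> W p \<inter> X closure_of P = {}"
  "\<And>J. \<lbrakk>J \<in> fins S; card J = Suc d; (\<forall>P\<in>J. p \<in> X closure_of P)\<rbrakk> \<Longrightarrow> fillp V f (W p) J (g p J)"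
  "\<exists>P\<in>S. W p \<subseteq> P \<and> p \<in> P"
  if "p \<in> topspace X" for p
  using C[rule_format, OF that] unfolding W_def g_def by blast+
 define \<W> where "\<W> = {Q. openin X Q \<and> (\<exists>p\<in>topspace X. X closure_of Q \<subseteq> W p)}"
 have "open_cover X \<W>"
  unfolding open_cover_def
 proof (intro conjI ballI equalityI subsetI)
  show "openin X Q" if "Q \<in> \<W>" for Q using that unfolding \<W>_def by blast
  show "x \<in> topspace X" if "x \<in> \<Union>\<W>" for x using that openin_subset unfolding \<W>_def by fastforce
  fix p assume p: "p \<in> topspace X"
  then obtain Q where Q: "openin X Q" "p \<in> Q" "disjnt (topspace X - W p) (X closure_of Q)"
   using reg[unfolded regular_space, rule_format, of "topspace X - W p" p] W(1,2)[OF p] by blast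
  hence "X closure_of Q \<subseteq> W p" using closure_of_subset_topspace[of X Q] unfolding disjnt_def by blast
  thus "p \<in> \<Union>\<W>" using p Q unfolding \<W>_def by blast
 qed
 from par[unfolded paracompact_space_def, rule_format, OF this] obtain S' where S': "open_cover X S'" "\<forall>P\<in>S'. \<exists>Q\<in>\<W>. P \<subseteq> Q" "locally_finite_in X S'"
  by blast
 have "\<forall>P\<in>S'. \<exists>p. p \<in> topspace X \<and> X closure_of P \<subseteq> W p"
 proof
  fix P assume "P \<in> S'"
  then obtain Q p where "P \<subseteq> Q" "p \<in> topspace X" "X closure_of Q \<subseteq> W p" using S'(2) unfolding \<W>_def by blast
  thus "\<exists>p. p \<in> topspace X \<and> X closure_of P \<subseteq> W p" using closure_of_mono by blast
 qed
 from bchoice[OF this] obtain \<pi> where \<pi>: "\<And>P. P \<in> S' \<Longrightarrow> \<pi> P \<in> topspace X \<and> X closure_of P \<subseteq> W (\<pi> P)" by blast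
 have "\<forall>p\<in>topspace X. \<exists>P. P \<in> S \<and> p \<in> P \<and> W p \<subseteq> P" using W(6) by blast
 from bchoice[OF this] obtain c where c: "\<And>p. p \<in> topspace X \<Longrightarrow> c p \<in> S \<and> p \<in> c p \<and> W p \<subseteq> c p" by blast
 have ccl: "p \<in> X closure_of (c p)" if "p \<in> topspace X" for p
  using c[OF that] closure_of_subset[of "c p" X] tower_okD(1)[OF ok] openin_subset unfolding open_cover_def by blast
 define \<phi> where "\<phi> = (\<lambda>P. c (\<pi> P))"
 define V' where "V' = (\<lambda>P. W (\<pi> P))"
 \<comment> \<open>Any vertex may supply the filling, but the choice has to be the same at all
   interior points of a simplex; so it depends on the support alone.\<close>
 define pick where "pick = (\<lambda>J :: 'a set set. SOME P. P \<in> J)"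
 define f' where "f' = (\<lambda>l z. if card (supp (push \<phi> l)) \<le> d then res \<Psi> (UU V (supp (push \<phi> l))) (US V' l) (f (push \<phi> l) z)
  else res \<Psi> (W (\<pi> (pick (supp l)))) (US V' l) (g (\<pi> (pick (supp l))) (\<phi> ` supp l) (push \<phi> l) z))"
 have \<phi>S: "\<phi> P \<in> S" "V' P \<subseteq> V (\<phi> P)" "openin X (V' P)" "openin X (V (\<phi> P))" if P: "P \<in> S'" for P
 proof -
  show "\<phi> P \<in> S" unfolding \<phi>_def using c \<pi>[OF P] by blast
  thus "openin X (V (\<phi> P))" by (rule tower_okD(3)[OF ok])
  show "V' P \<subseteq> V (\<phi> P)" unfolding \<phi>_def V'_def using W(3) ccl c \<pi>[OF P] by blast
  show "openin X (V' P)" unfolding V'_def using W(1) \<pi>[OF P] by blast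
 qed
 show thesis
 proof (rule that[of S' V' f' \<phi>])
  show "\<phi> P \<in> S \<and> V' P \<subseteq> V (\<phi> P)" if "P \<in> S'" for P using \<phi>S[OF that] by blast
  show "f' l z = res \<Psi> (UU V (supp (push \<phi> l))) (US V' l) (f (push \<phi> l) z)" if "card (supp (push \<phi> l)) \<le> d" for l z
   using that by (simp add: f'_def)
  have "adm V' J f'" if J: "J \<in> fins S'" "card J \<le> Suc d" "UU V' J \<noteq> {}" for J
  proof -
   have fJ: "finite J" "J \<noteq> {}" "J \<subseteq> S'" using J(1) unfolding fins_def by auto
   have \<phi>J: "\<phi> ` J \<in> fins S" using fJ \<phi>S(1) unfolding fins_def by blast
   have sub: "UU V' J \<subseteq> UU V (\<phi> ` J)" using \<phi>S(2) fJ(3) unfolding UU_def by blast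
   show ?thesis
   proof (cases "card (\<phi> ` J) \<le> d")
    case True
    have "UU V (\<phi> ` J) \<noteq> {}" using sub J(3) by blast
    from tower_okD(5)[OF ok \<phi>J True this]
    have "adm V' J (\<lambda>l z. res \<Psi> (UU V (supp (push \<phi> l))) (US V' l) (f (push \<phi> l) z))"
     by (rule adm_push[OF fJ(1,2)]) (use \<phi>S fJ(3) in blast)+
    thus ?thesis
    proof (rule adm_cong)
     fix l z assume l: "l \<in> simp J"
     have "card (\<phi> ` supp l) \<le> card (\<phi> ` J)" by (rule card_mono) (use fJ(1) supp_simp(1)[OF l] in auto)
     thus "res \<Psi> (UU V (supp (push \<phi> l))) (US V' l) (f (push \<phi> l) z) = f' l z"
       using True supp_push[OF fJ(1) l, of \<phi>] by (simp add: f'_def)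
    qed
   next
    case False
    have cJ: "card (\<phi> ` J) = Suc d" "card J = Suc d" using False J(2) card_image_le[OF fJ(1), of \<phi>] by linarith+
    hence inj: "inj_on \<phi> J" using eq_card_imp_inj_on[OF fJ(1)] by simp
    obtain q where q: "q \<in> UU V' J" using J(3) by blast
    \<comment> \<open>If \<open>\<pi> P\<close> were outside the closure of \<open>\<phi> Q\<close>,
      then \<open>W (\<pi> P)\<close> would miss this closure. But \<open>q\<close> lies in
      \<open>W (\<pi> P)\<close> and in \<open>W (\<pi> Q)\<close>, which is contained in
      \<open>\<phi> Q\<close>.\<close>
    have cl: "\<pi> P \<in> X closure_of (\<phi> Q)" if PQ: "P \<in> J" "Q \<in> J" for P Q
    proof (rule ccontr)
     assume n: "\<pi> P \<notin> X closure_of (\<phi> Q)"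
     have P: "\<pi> P \<in> topspace X" and Q: "\<pi> Q \<in> topspace X" using \<pi> PQ fJ(3) by blast+
     have "q \<in> W (\<pi> P)" "q \<in> W (\<pi> Q)" using q PQ unfolding UU_def V'_def by auto
     moreover have "W (\<pi> Q) \<subseteq> X closure_of (\<phi> Q)"
      using c[OF Q] closure_of_subset[of "\<phi> Q" X] tower_okD(1)[OF ok] openin_subset unfolding open_cover_def \<phi>_def by blast
     moreover have "\<phi> Q \<in> S" using \<phi>S(1) PQ(2) fJ(3) by blast
     ultimately show False using W(4)[OF P _ n] by blast
    qed
    define p0 where "p0 = \<pi> (pick J)"
    have pk: "pick J \<in> J" unfolding pick_def using fJ(2) some_in_eq by blast
    hence p0: "p0 \<in> topspace X" unfolding p0_def using \<pi> fJ(3) by blast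
    show ?thesis
    proof (rule adm_glue[OF fJ(1,2) inj, where W="W p0" and g="g p0 (\<phi> ` J)" and V=V and f=f])
     show "openin X (W p0)" by (rule W(1)[OF p0])
     show "UU V' J \<subseteq> W p0" using UU_le[OF pk, of V'] by (simp add: V'_def p0_def)
     show "fillp V f (W p0) (\<phi> ` J) (g p0 (\<phi> ` J))" by (rule W(5)[OF p0 \<phi>J cJ(1)]) (use cl[OF pk] in \<open>simp add: p0_def\<close>)
     show "openin X (V (\<phi> j)) \<and> W p0 \<subseteq> V (\<phi> j)" if j: "j \<in> J" for j
      using \<phi>S(1,4)[of j] W(3)[OF p0, of "\<phi> j"] cl[OF pk j] j fJ(3) unfolding p0_def by blast
     show "openin X (V' j) \<and> V' j \<subseteq> V (\<phi> j)" if j: "j \<in> J" for j using \<phi>S(2,3)[of j] j fJ(3) by blast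
     show "deforms (US V l) (f l)" if l: "l \<in> simp (\<phi> ` J)" "supp l \<noteq> \<phi> ` J" for l
      by (rule tower_face(3)[OF ok \<phi>J cJ(1) subsetD[OF sub q] l])
     show "f' l z = res \<Psi> (W p0) (UU V' J) (g p0 (\<phi> ` J) (push \<phi> l) z)" if l: "l \<in> simp J" "supp l = J" for l z
      using supp_push[OF fJ(1) l(1), of \<phi>] l(2) cJ(1) by (simp add: f'_def p0_def)
     show "f' l z = res \<Psi> (UU V (\<phi> ` supp l)) (US V' l) (f (push \<phi> l) z)" if l: "l \<in> simp J" "supp l \<noteq> J" for l z
     proof -
      have "supp l \<subset> J" using supp_simp(1)[OF l(1)] l(2) by blast
      hence "card (supp l) < Suc d" using psubset_card_mono[OF fJ(1)] cJ(2) by metis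
      moreover have "card (\<phi> ` supp l) \<le> card (supp l)" by (rule card_image_le) (use supp_simp(1)[OF l(1)] fJ(1) finite_subset in blast)
      ultimately have "card (supp (push \<phi> l)) \<le> d" unfolding supp_push[OF fJ(1) l(1)] by linarith
      thus ?thesis using supp_push[OF fJ(1) l(1), of \<phi>] by (simp add: f'_def)
     qed
    qed
   qed
  qed
  thus "tower_ok (Suc d) S' V' f'"
   unfolding tower_ok_def using S'(1,3) \<phi>S(3) \<pi> unfolding V'_def by blast
 qed
qed

end

context deformation_problem
begin

text \<open>On simplices whose image has at most \<open>d\<close> vertices the step to the next
  stage changes only the domain. Stages are interchangeable there, which makes it possible to
  combine simplices of different stages.\<close>

definition link where
 "link d \<phi> S V f S' V' f' \<longleftrightarrow> (\<forall>P\<in>S'. \<phi> P \<in> S \<and> V' P \<subseteq> V (\<phi> P)) \<and>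
  (\<forall>l z. card (supp (push \<phi> l)) \<le> d \<longrightarrow> f' l z = res \<Psi> (UU V (supp (push \<phi> l))) (US V' l) (f (push \<phi> l) z))"

lemma tower_exists:
 assumes par: "paracompact_space X" and reg: "regular_space X"
 obtains S V f \<phi> where "\<And>d. tower_ok d (S d) (V d) (f d)" "\<And>d. link d (\<phi> d) (S d) (V d) (f d) (S (Suc d)) (V (Suc d)) (f (Suc d))"
proof -
 have "\<exists>s. \<forall>d. (case s d of (S, V, f) \<Rightarrow> tower_ok d S V f) \<and>
   (case s d of (S, V, f) \<Rightarrow> case s (Suc d) of (S', V', f') \<Rightarrow> \<exists>\<phi>. link d \<phi> S V f S' V' f')"
 proof (rule dependent_nat_choice)
  \<comment> \<open>Simplices are nonempty, so stage 0 prescribes no values and the trivial cover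
    can start the tower.\<close>
  have "tower_ok 0 {topspace X} (\<lambda>_. topspace X) (\<lambda>_ _. undefined)"
   unfolding tower_ok_def open_cover_def
   by (auto simp: fins_def closure_of_subset_topspace intro!: finite_imp_locally_finite_in dest: in_closure_of[THEN iffD1])
  thus "\<exists>s. case s of (S, V, f) \<Rightarrow> tower_ok 0 S V f"
   by (intro exI[of _ "({topspace X}, \<lambda>_. topspace X, \<lambda>_ _. undefined)"]) simp
  fix s d assume s: "case s of (S, V, f) \<Rightarrow> tower_ok d S V f"
  obtain S V f where e: "s = (S, V, f)" by (cases s)
  have ok: "tower_ok d S V f" using s unfolding e by simp
  obtain S' V' f' \<phi> where "tower_ok (Suc d) S' V' f'" "\<And>P. P \<in> S' \<Longrightarrow> \<phi> P \<in> S \<and> V' P \<subseteq> V (\<phi> P)"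
   "\<And>l z. card (supp (push \<phi> l)) \<le> d \<Longrightarrow> f' l z = res \<Psi> (UU V (supp (push \<phi> l))) (US V' l) (f (push \<phi> l) z)"
   by (rule tower_step[OF ok par reg], blast)
  hence "tower_ok (Suc d) S' V' f'" "link d \<phi> S V f S' V' f'" unfolding link_def by simp_all
  thus "\<exists>t. (case t of (S, V, f) \<Rightarrow> tower_ok (Suc d) S V f) \<and>
    (case s of (S, V, f) \<Rightarrow> case t of (S', V', f') \<Rightarrow> \<exists>\<phi>. link d \<phi> S V f S' V' f')"
   unfolding e by (intro exI[of _ "(S', V', f')"]) auto
 qed
 then obtain s where s0: "\<forall>d. (case s d of (S, V, f) \<Rightarrow> tower_ok d S V f) \<and>
   (case s d of (S, V, f) \<Rightarrow> case s (Suc d) of (S', V', f') \<Rightarrow> \<exists>\<phi>. link d \<phi> S V f S' V' f')" ..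
 note s = s0[THEN spec, THEN conjunct1] s0[THEN spec, THEN conjunct2]
 have 1: "tower_ok d (fst (s d)) (fst (snd (s d))) (snd (snd (s d)))" for d using s(1)[of d] by (simp add: case_prod_beta)
 have "\<forall>d. \<exists>\<phi>. link d \<phi> (fst (s d)) (fst (snd (s d))) (snd (snd (s d))) (fst (s (Suc d))) (fst (snd (s (Suc d)))) (snd (snd (s (Suc d))))"
  using s(2) by (simp add: case_prod_beta)
 from choice[OF this] obtain \<phi> where "\<forall>d. link d (\<phi> d) (fst (s d)) (fst (snd (s d))) (snd (snd (s d))) (fst (s (Suc d))) (fst (snd (s (Suc d)))) (snd (snd (s (Suc d))))" ..
 with 1 show thesis using that[of "\<lambda>d. fst (s d)" "\<lambda>d. fst (snd (s d))" "\<lambda>d. snd (snd (s d))" \<phi>] by blast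
qed

lemma deforms_empty:
 assumes e: "e \<in> small {}" shows "deforms {} (\<lambda>_. e)"
proof -
 have u: "e \<in> sections {}" using small_subset[OF openin_empty] e by blast
 have "bot {} x = e" if "x \<in> cube k" for x by (rule sections_empty_unique[OF bot_in[OF openin_empty that] u])
 thus ?thesis using e u cube_bd_subset[of k] by (intro deformsI) auto
qed

lemma push_cong: "(\<And>j. j \<in> supp l \<Longrightarrow> \<phi> j = \<psi> j) \<Longrightarrow> push \<phi> l = push \<psi> l"
 unfolding push_def by (intro ext sum.cong) auto

text \<open>A simplex whose vertices lie in \<open>w i\<close> and carry the dimensions \<open>kk i\<close> is mapped to the stage of
 the tower given by the smallest of these dimensions. Faces may use a higher stage, but since the
 simplex has few distinct vertices its image in all stages in between is the same.\<close>

lemma tower_complex: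
 fixes w :: "nat \<Rightarrow> 'a set"
 assumes ok: "\<And>d. tower_ok d (S d) (V d) (f d)"
  and lk: "\<And>d. link d (\<phi> d) (S d) (V d) (f d) (S (Suc d)) (V (Suc d)) (f (Suc d))"
  and w: "\<And>i. openin X (w i)" "\<And>i. v i \<in> S (kk i)" "\<And>i. w i \<subseteq> V (kk i) (v i)"
  and card: "\<And>J i. \<lbrakk>finite J; i \<in> J; UU w J \<noteq> {}\<rbrakk> \<Longrightarrow> card ((\<lambda>i. (kk i, v i)) ` J) \<le> kk i"
 shows "\<exists>h. \<forall>J\<in>fins UNIV. adm w J h"
proof -
 \<comment> \<open>\<open>dn i n\<close> sends the vertex \<open>v i\<close> from stage
   \<open>kk i\<close> down by \<open>n\<close> stages, so that \<open>vd D i\<close> is its image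
   at stage \<open>D\<close> whenever \<open>D \<le> kk i\<close>.\<close>
 define dn where "dn = (\<lambda>i. rec_nat (v i) (\<lambda>m. \<phi> (kk i - Suc m)))"
 define vd where "vd = (\<lambda>D i. dn i (kk i - D))"
 have vd0: "vd (kk i) i = v i" for i by (simp add: vd_def dn_def)
 have vdS: "vd D i = \<phi> D (vd (Suc D) i)" if "Suc D \<le> kk i" for D i
 proof -
  have "kk i - D = Suc (kk i - Suc D)" using that by simp
  thus ?thesis using that by (simp add: vd_def dn_def)
 qed
 have vdw: "vd D i \<in> S D \<and> w i \<subseteq> V D (vd D i)" if "D \<le> kk i" for D i
  using that
 proof (induction rule: inc_induct)
  case base
  thus ?case using w(2,3) by (simp add: vd0)
 next
  case (step n)
  hence "vd n i = \<phi> n (vd (Suc n) i)" by (intro vdS) simp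
  thus ?case using step.IH lk[of n] unfolding link_def by auto
 qed
 have oV: "openin X (V D (vd D i))" if "D \<le> kk i" for D i using tower_okD(3)[OF ok] vdw[OF that] by blast
 have vf: "vd D i = vd D j" if "kk i = kk j" "v i = v j" for D i j using that by (simp add: vd_def dn_def)
 \<comment> \<open>Different indices may carry the same member of the cover. The image vertices
   depend on the pairs \<open>(kk i, v i)\<close> only, and it is these that the multiplicity bound
   counts.\<close>
 have vcard: "card (vd D ` J) \<le> card ((\<lambda>i. (kk i, v i)) ` J)" if J: "finite J" for D J
 proof -
  have "vd D ` J = (\<lambda>c. vd D (SOME i. i \<in> J \<and> (kk i, v i) = c)) ` ((\<lambda>i. (kk i, v i)) ` J)"
   unfolding image_image
  proof (rule image_cong[OF refl])
   fix i assume "i \<in> J"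
   hence "(SOME j. j \<in> J \<and> (kk j, v j) = (kk i, v i)) \<in> J \<and>
     (kk (SOME j. j \<in> J \<and> (kk j, v j) = (kk i, v i)), v (SOME j. j \<in> J \<and> (kk j, v j) = (kk i, v i))) = (kk i, v i)"
    by (intro someI[where P="\<lambda>j. j \<in> J \<and> (kk j, v j) = (kk i, v i)" and x=i]) simp
   thus "vd D i = vd D (SOME j. j \<in> J \<and> (kk j, v j) = (kk i, v i))" by (intro vf) auto
  qed
  from arg_cong[OF this, of card] show ?thesis by (rule ord_eq_le_trans) (rule card_image_le[OF finite_imageI[OF J]])
 qed
 define H where "H = (\<lambda>D l z. res \<Psi> (UU (V D) (supp (push (vd D) l))) (US w l) (f D (push (vd D) l) z))"
 obtain e where e: "e \<in> small {}" using sub.sections_empty_ex by blast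
 define h where "h = (\<lambda>l z. if US w l = {} then e else H (Min (kk ` supp l)) l z)"
 have fS: "vd D ` J \<in> fins (S D)" if "finite J" "J \<noteq> {}" "\<And>j. j \<in> J \<Longrightarrow> D \<le> kk j" for D J
  using that vdw unfolding fins_def by blast
 have sub: "UU w J \<subseteq> UU (V D) (vd D ` J)" if "\<And>j. j \<in> J \<Longrightarrow> D \<le> kk j" for D J
  using that vdw unfolding UU_def by blast
 have ad: "adm (V D) (vd D ` J) (f D)"
  if J: "finite J" "J \<noteq> {}" "\<And>j. j \<in> J \<Longrightarrow> D \<le> kk j" and c: "card (vd D ` J) \<le> D" and ne: "UU w J \<noteq> {}" for D J
 proof -
  have "vd D ` J \<in> fins (S D)" by (rule fS[OF J])
  moreover have "UU (V D) (vd D ` J) \<noteq> {}" using sub[OF J(3)] ne by blast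
  ultimately show ?thesis using tower_okD(5)[OF ok _ c] by blast
 qed
 \<comment> \<open>Going down one stage changes nothing: the image at the lower stage
   \<open>D\<close> has at most \<open>E \<le> D\<close> vertices, the range in which
   \<open>link\<close> identifies consecutive stages.\<close>
 have shift: "H D l z = H E l z"
  if l: "l \<in> simp J" "finite J" and ED: "E \<le> D" "\<And>j. j \<in> supp l \<Longrightarrow> D \<le> kk j"
   and c: "card ((\<lambda>i. (kk i, v i)) ` supp l) \<le> E" and ne: "US w l \<noteq> {}" and z: "z \<in> cyl k" for D E J l z
  using ED
 proof (induction D rule: dec_induct)
  case base
  show ?case by (rule refl)
 next
  case (step D)
  have fs: "finite (supp l)" "supp l \<noteq> {}" using supp_simp[OF l(1)] l(2) finite_subset by blast+
  have ls: "l \<in> simp (supp l)" by (rule simp_supp[OF l(2,1)])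
  have k1: "\<And>j. j \<in> supp l \<Longrightarrow> Suc D \<le> kk j" and k0: "\<And>j. j \<in> supp l \<Longrightarrow> D \<le> kk j" using step.prems by (blast, force)
  have pp: "push (\<phi> D) (push (vd (Suc D)) l) = push (vd D) l"
   unfolding push_push[OF l(2,1)] by (rule push_cong) (use vdS k1 in simp)
  have sD: "supp (push (vd E') l) = vd E' ` supp l" for E' by (rule supp_push[OF l(2,1)])
  have cD: "card (vd D ` supp l) \<le> D" using vcard[OF fs(1), of D] c step.hyps by linarith
  have fd: "f D (push (vd D) l) z \<in> sections (UU (V D) (vd D ` supp l))"
   using ad[OF fs k0 cD ne] push_simp[OF fs(1) ls, of "vd D"] deformsD(1)[OF _ z] unfolding adm_def sD[symmetric] by blast
  have o1: "openin X (UU (V D) (vd D ` supp l))" by (rule openin_UU[OF tower_okD(3)[OF ok] fS[OF fs k0]])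
  have o2: "openin X (UU (V (Suc D)) (vd (Suc D) ` supp l))" by (rule openin_UU[OF tower_okD(3)[OF ok] fS[OF fs k1]])
  have o3: "openin X (US w l)" by (rule openin_UU[of UNIV]) (use w(1) fs in \<open>auto simp: fins_def\<close>)
  have sub2: "UU (V (Suc D)) (vd (Suc D) ` supp l) \<subseteq> UU (V D) (vd D ` supp l)"
  proof
   fix x assume x: "x \<in> UU (V (Suc D)) (vd (Suc D) ` supp l)"
   have "x \<in> V D (vd D j)" if j: "j \<in> supp l" for j
   proof -
    have "V (Suc D) (vd (Suc D) j) \<subseteq> V D (\<phi> D (vd (Suc D) j))" using lk[of D] vdw[OF k1[OF j]] unfolding link_def by blast
    thus ?thesis using x j vdS[OF k1[OF j]] unfolding UU_def by auto
   qed
   thus "x \<in> UU (V D) (vd D ` supp l)" unfolding UU_def by blast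
  qed
  have "card (supp (push (\<phi> D) (push (vd (Suc D)) l))) \<le> D" unfolding pp sD by (rule cD)
  hence "f (Suc D) (push (vd (Suc D)) l) z = res \<Psi> (UU (V D) (vd D ` supp l)) (UU (V (Suc D)) (vd (Suc D) ` supp l)) (f D (push (vd D) l) z)"
   using lk[of D, unfolded link_def, THEN conjunct2, THEN spec, THEN spec, THEN mp, of "push (vd (Suc D)) l" z] unfolding pp sD by blast
  hence "H (Suc D) l z = H D l z"
   unfolding H_def sD using res_res[OF o1 o2 o3 sub[OF k1] sub2 fd] by simp
  thus ?case using step.IH k0 by simp
 qed
 have main: "adm w J h" if J: "J \<in> fins UNIV" and ne: "UU w J \<noteq> {}" for J
 proof -
  have fJ: "finite J" "J \<noteq> {}" using J unfolding fins_def by auto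
  define E where "E = Min (kk ` J)"
  have E: "E \<le> kk j" if "j \<in> J" for j unfolding E_def using fJ that by (intro Min_le) auto
  have "E \<in> kk ` J" unfolding E_def using fJ by (intro Min_in) auto
  then obtain i where i: "i \<in> J" "E = kk i" by blast
  have cJ: "card ((\<lambda>i. (kk i, v i)) ` J) \<le> E" using card[OF fJ(1) i(1) ne] i(2) by simp
  have "card (vd E ` J) \<le> E" using vcard[OF fJ(1), of E] cJ by linarith
  from ad[OF fJ E this ne] have "adm w J (H E)"
   unfolding H_def by (rule adm_push[OF fJ]) (use oV E w(1) vdw in blast)+
  moreover have "H E l z = h l z" if l: "l \<in> simp J" and z: "z \<in> cyl k" for l z
  proof -
   have sl: "supp l \<subseteq> J" "supp l \<noteq> {}" using supp_simp[OF l] by auto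
   have fs: "finite (supp l)" using sl(1) fJ(1) finite_subset by blast
   have ne': "US w l \<noteq> {}" using UU_antimono[OF sl(1), of w] ne by blast
   have "H (Min (kk ` supp l)) l z = H E l z"
   proof (rule shift[OF l fJ(1)])
    show "E \<le> Min (kk ` supp l)" using E sl fs by (subst Min_ge_iff) auto
    show "Min (kk ` supp l) \<le> kk j" if "j \<in> supp l" for j using fs that by (intro Min_le) auto
    have "card ((\<lambda>i. (kk i, v i)) ` supp l) \<le> card ((\<lambda>i. (kk i, v i)) ` J)" by (rule card_mono) (use fJ(1) sl(1) in auto)
    thus "card ((\<lambda>i. (kk i, v i)) ` supp l) \<le> E" using cJ by linarith
   qed (use ne' z in auto)
   thus ?thesis using ne' by (simp add: h_def)
  qed
  ultimately show ?thesis by (rule adm_cong)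
 qed
 have hd: "deforms (US w l) (h l)" if J: "J \<in> fins UNIV" and l: "l \<in> simp J" for J l
 proof (cases "US w l = {}")
  case True
  have "h l = (\<lambda>_. e)" using True by (simp add: h_def)
  thus ?thesis using deforms_empty[OF e] True by simp
 next
  case False
  show ?thesis using main[OF fins_supp[OF J l] False] fins_supp_simp[OF J l] unfolding adm_def by blast
 qed
 have "adm w J h" if J: "J \<in> fins UNIV" for J
 proof (cases "UU w J = {}")
  case True
  have ow: "openin X (UU w L)" if "L \<in> fins UNIV" for L by (rule openin_UU[OF w(1) that])
  show ?thesis unfolding adm_def
  proof (intro conjI ballI)
   show "deforms (US w l) (h l)" if "l \<in> simp J" for l by (rule hd[OF J that])
   show "cmap (simp J \<times> (cyl k)) (sec \<Psi> (UU w J))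
     (\<lambda>(l, z). res \<Psi> (US w l) (UU w J) (h l z))"
    unfolding True
   proof (rule cmap_sections_empty)
    fix y assume "y \<in> topspace (top_of_set (simp J \<times> (cyl k)))"
    then obtain l z where y: "y = (l, z)" "l \<in> simp J" "z \<in> cyl k" by auto
    have "res \<Psi> (US w l) {} (h l z) \<in> sections {}"
     by (rule res_in[OF ow[OF fins_supp[OF J y(2)]] openin_empty empty_subsetI deformsD(1)[OF hd[OF J y(2)] y(3)]])
    thus "(case y of (l, z) \<Rightarrow> res \<Psi> (US w l) {} (h l z)) \<in> sections {}" by (simp add: y(1))
   qed
  qed
 next
  case False
  thus ?thesis by (rule main[OF J])
 qed
 thus ?thesis by blast
qed

text \<open>A member \<open>W\<close> of the cover lies in a set of stage \<open>k' W\<close>, at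
  which simplices with up to \<open>k' W\<close> vertices are filled. A simplex with nonempty
  intersection involves at most \<open>k' W\<close> distinct members for each of its members
  \<open>W\<close>, so the multiplicities match the stages.\<close>

lemma deformation_complex:
 assumes par: "paracompact_space X" and X: "Hausdorff_space X" and K: "exhaustion X K" "\<And>i. compactin X (K i)"
  and dim: "\<And>i. finite_dimensional (subtopology X (K i))"
 obtains \<W> where "open_cover X \<W>"
  "\<And>w :: nat \<Rightarrow> 'a set. (\<And>i. w i \<in> \<W>) \<Longrightarrow> \<exists>h. \<forall>J\<in>fins UNIV. adm w J h"
proof -
 have "locally_compact_space X"
  unfolding locally_compact_space_def
 proof
  fix x assume "x \<in> topspace X"
  then obtain i where "x \<in> K i" using K(1) unfolding exhaustion_def by blast
  hence "x \<in> X interior_of K (Suc i)" using K(1) unfolding exhaustion_def by blast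
  thus "\<exists>U K. openin X U \<and> compactin X K \<and> x \<in> U \<and> U \<subseteq> K"
   by - (rule exI[of _ "X interior_of K (Suc i)"], rule exI[of _ "K (Suc i)"], simp add: K(2) interior_of_subset)
 qed
 hence reg: "regular_space X" using X by (intro locally_compact_Hausdorff_imp_regular_space) auto
 obtain m where m: "\<And>i. covering_dim_le (subtopology X (K i)) (m i)" using dim unfolding finite_dimensional_def by metis
 obtain S V f \<phi> where ok: "\<And>d. tower_ok d (S d) (V d) (f d)" and lk: "\<And>d. link d (\<phi> d) (S d) (V d) (f d) (S (Suc d)) (V (Suc d)) (f (Suc d))"
  using tower_exists[OF par reg] by blast
 have oc: "open_cover X (V d ` S d)" for d
  unfolding open_cover_def
 proof (intro conjI ballI equalityI subsetI)
  show "openin X U" if "U \<in> V d ` S d" for U using that tower_okD(3)[OF ok] by blast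
  show "x \<in> topspace X" if x: "x \<in> \<Union>(V d ` S d)" for x
  proof -
   obtain P where "P \<in> S d" "x \<in> V d P" using x by blast
   thus ?thesis using openin_subset[OF tower_okD(3)[OF ok[of d]]] by blast
  qed
  fix x assume "x \<in> topspace X"
  then obtain P where P: "P \<in> S d" "x \<in> P" "openin X P" using tower_okD(1)[OF ok[of d]] unfolding open_cover_def by blast
  thus "x \<in> \<Union>(V d ` S d)" using tower_okD(4)[OF ok[of d] P(1)] closure_of_subset[of P X] openin_subset[OF P(3)] by blast
 qed
 obtain \<W> k' where \<W>: "open_cover X \<W>" "\<And>W. W \<in> \<W> \<Longrightarrow> \<exists>U\<in>V (k' W) ` S (k' W). W \<subseteq> U"
  "\<And>x W. W \<in> \<W> \<Longrightarrow> x \<in> W \<Longrightarrow> finite {W' \<in> \<W>. x \<in> W'} \<and> card {W' \<in> \<W>. x \<in> W'} \<le> k' W"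
  by (rule dimension_cover[OF X K(1), of m "\<lambda>d. V d ` S d"], rule K(2), rule m, rule oc, blast)
 have "\<forall>W\<in>\<W>. \<exists>P. P \<in> S (k' W) \<and> W \<subseteq> V (k' W) P" using \<W>(2) by blast
 from bchoice[OF this] obtain v where v: "\<And>W. W \<in> \<W> \<Longrightarrow> v W \<in> S (k' W) \<and> W \<subseteq> V (k' W) (v W)" by blast
 show thesis
 proof (rule that[OF \<W>(1)])
  fix w :: "nat \<Rightarrow> 'a set" assume w: "\<And>i. w i \<in> \<W>"
  show "\<exists>h. \<forall>J\<in>fins UNIV. adm w J h"
  proof (rule tower_complex[OF ok lk, where w=w and v="\<lambda>i. v (w i)" and kk="\<lambda>i. k' (w i)"])
   show "openin X (w i)" for i using w \<W>(1) unfolding open_cover_def by blast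
   show "v (w i) \<in> S (k' (w i))" "w i \<subseteq> V (k' (w i)) (v (w i))" for i using v[OF w] by blast+
   fix J i assume J: "finite J" "i \<in> J" "UU w J \<noteq> {}"
   then obtain x where x: "x \<in> UU w J" by blast
   have "x \<in> w i" using x J(2) unfolding UU_def by blast
   note c = \<W>(3)[OF w this]
   have "card ((\<lambda>i. (k' (w i), v (w i))) ` J) = card ((\<lambda>W. (k' W, v W)) ` w ` J)" by (simp add: image_image)
   also have "\<dots> \<le> card (w ` J)" by (rule card_image_le) (use J(1) in simp)
   also have "\<dots> \<le> card {W' \<in> \<W>. x \<in> W'}" by (rule card_mono) (use c x w in \<open>auto simp: UU_def\<close>)
   also have "\<dots> \<le> k' (w i)" using c by blast
   finally show "card ((\<lambda>i. (k' (w i), v (w i))) ` J) \<le> k' (w i)" .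
  qed
 qed
qed

end

section \<open>Compression of families of sections into the smaller sheaf\<close>

context space_sheaf
begin

lemma gluesE:
 assumes "glues k U f"
 obtains O' :: "nat \<Rightarrow> 'a set" and h g where "(\<Union>i. O' i) = topspace X" "htpy UNIV U O' (cube k) (cube_bd k) f h"
  "cmap (cube k) (sec F (topspace X)) g"
  "\<And>J l x. \<lbrakk>J \<in> fins UNIV; l \<in> simp J; x \<in> cube k\<rbrakk> \<Longrightarrow> h l (1, x) = res F (topspace X) (US O' l) (g x)"
proof -
 obtain O' :: "nat \<Rightarrow> 'a set" and h g where "(\<Union>i. O' i) = topspace X \<and> htpy UNIV U O' (cube k) (cube_bd k) f h \<and>
  cmap (cube k) (sec F (topspace X)) g \<and>
  (\<forall>J\<in>fins UNIV. \<forall>l\<in>simp J. \<forall>x\<in>cube k. h l (1, x) = res F (topspace X) (US O' l) (g x))"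
  using assms unfolding glues_def by (elim exE)
 thus thesis by (elim conjE) (rule that[of O' h g], simp_all)
qed

end

context sheaf_pair
begin

lemma cpx_sub:
 assumes f: "sub.cpx I U T f" shows "cpx I U T f"
 unfolding cpx_def
proof (intro conjI ballI)
 show "openin X (U i)" if "i \<in> I" for i using f that by (rule sub.cpx_open)
 have o: "openin X (UU U J)" if "J \<in> fins I" for J using f that by (rule sub.cpx_openUU)
 show "f l x \<in> sections (US U l)" if "J \<in> fins I" "l \<in> simp J" "x \<in> T" for J l x
  using sub.cpx_in[OF f that] small_subset[OF o[OF fins_supp[OF that(1,2)]]] by blast
 fix J assume J: "J \<in> fins I"
 have "cmap (simp J \<times> T) (sec \<Psi> (UU U J)) (\<lambda>(l, x). res \<Phi> (US U l) (UU U J) (f l x))"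
  using sub.cpx_continuous[OF f J] cmap_small[OF o[OF J]] by blast
 thus "cmap (simp J \<times> T) (sec \<Psi> (UU U J)) (\<lambda>(l, x). res \<Psi> (US U l) (UU U J) (f l x))"
 proof (rule continuous_map_eq)
  fix y assume "y \<in> topspace (top_of_set (simp J \<times> T))"
  then obtain l x where y: "y = (l, x)" "l \<in> simp J" "x \<in> T" by auto
  have "res \<Phi> (US U l) (UU U J) (f l x) = res \<Psi> (US U l) (UU U J) (f l x)"
   by (rule small_res[OF o[OF fins_supp[OF J y(2)]] o[OF J] UU_antimono[OF supp_simp(1)[OF y(2)]] sub.cpx_in[OF f J y(2,3)]])
  thus "(case y of (l, x) \<Rightarrow> res \<Phi> (US U l) (UU U J) (f l x)) = (case y of (l, x) \<Rightarrow> res \<Psi> (US U l) (UU U J) (f l x))"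
   by (simp add: y(1))
 qed
qed

end

context deformation_problem
begin

text \<open>At time 1 the deformation is a complex of the smaller sheaf, and over the boundary of
  the cube it is constant because it consists of restrictions of \<open>f0\<close>. Gluing it in the
  smaller sheaf produces \<open>g\<close>, and the deformation followed by the gluing is the complex
  \<open>H\<close> that joins \<open>f0\<close> to \<open>g\<close>.\<close>

lemma deform_into_small:
 assumes par: "paracompact_space X" and X: "Hausdorff_space X" and K: "exhaustion X K" "\<And>i. compactin X (K i)"
  and dim: "\<And>i. finite_dimensional (subtopology X (K i))" and fc: "sub.flexible_class"
 obtains O' :: "nat \<Rightarrow> 'a set" and H g where "(\<Union>i. O' i) = topspace X" "cpx UNIV O' (cyl k) H"
  "cmap (cube k) (sec \<Phi> (topspace X)) g"
  "\<And>J l x. \<lbrakk>J \<in> nfins; l \<in> simp J; x \<in> cube k\<rbrakk> \<Longrightarrow> H l (0, x) = bot (US O' l) x"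
  "\<And>J l x. \<lbrakk>J \<in> nfins; l \<in> simp J; x \<in> cube k\<rbrakk> \<Longrightarrow> H l (1, x) = res \<Psi> (topspace X) (US O' l) (g x)"
  "\<And>J l x t. \<lbrakk>J \<in> nfins; l \<in> simp J; x \<in> cube_bd k; t \<in> {0..1::real}\<rbrakk> \<Longrightarrow> H l (t, x) = bot (US O' l) x"
proof -
 obtain \<W> where \<W>: "open_cover X \<W>" "\<And>w :: nat \<Rightarrow> 'a set. (\<And>i. w i \<in> \<W>) \<Longrightarrow> \<exists>h. \<forall>J\<in>nfins. adm w J h"
  by (rule deformation_complex[OF par X K(1)], rule K(2), rule dim, blast)
 obtain w :: "nat \<Rightarrow> 'a set" where w: "\<And>i. w i \<in> \<W>"
  and gl: "\<And>k f. sub.cpx UNIV w (cube k) f \<Longrightarrow> (\<And>x. x \<in> cube_bd k \<Longrightarrow> sub.cst UNIV w f x) \<Longrightarrow> sub.glues k w f"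
  by (rule sub.flexible_class_glues[OF X K(1) _ fc \<W>(1)], rule K(2), blast)
 obtain h where h: "\<And>J. J \<in> nfins \<Longrightarrow> adm w J h" using \<W>(2)[of w, OF w] by blast
 have ow: "openin X (w i)" for i using w \<W>(1) unfolding open_cover_def by blast
 have oJ: "openin X (UU w J)" if "J \<in> nfins" for J by (rule openin_UU[OF ow that])
 have hd: "deforms (US w l) (h l)" if "J \<in> nfins" "l \<in> simp J" for J l
  using h[OF that(1)] that(2) unfolding adm_def by blast
 have hc: "cpx UNIV w (cyl k) h"
  unfolding cpx_def using ow hd deformsD(1) h unfolding adm_def by blast
 define \<phi> where "\<phi> = (\<lambda>l x. h l (1, x))"
 define \<beta> where "\<beta> = (\<lambda>l. bot (US w l))"
 have ps: "cpx UNIV w (cube k) (\<lambda>l x. h l (t, x))" if t: "t \<in> {0..1::real}" for t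
  by (rule cpx_param[OF hc order.refl, where g="\<lambda>x. (t, x)"]) (use t in \<open>auto intro!: continuous_intros\<close>)
 have \<phi>c: "cpx UNIV w (cube k) \<phi>" unfolding \<phi>_def by (rule ps) simp
 have \<phi>small: "\<phi> l x \<in> small (US w l)" if "J \<in> nfins" "l \<in> simp J" "x \<in> cube k" for J l x
  unfolding \<phi>_def by (rule deformsD(3)[OF hd[OF that(1,2)] that(3)])
 have \<phi>s: "sub.cpx UNIV w (cube k) \<phi>"
  unfolding sub.cpx_def
 proof (intro conjI ballI ow)
  show "\<phi> l x \<in> small (US w l)" if "J \<in> nfins" "l \<in> simp J" "x \<in> cube k" for J l x by (rule \<phi>small[OF that])
  fix J :: "nat set" assume J: "J \<in> nfins"
  have e: "res \<Psi> (US w l) (UU w J) (\<phi> l x) = res \<Phi> (US w l) (UU w J) (\<phi> l x)"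
   "res \<Phi> (US w l) (UU w J) (\<phi> l x) \<in> small (UU w J)" if l: "l \<in> simp J" "x \<in> cube k" for l x
  proof -
   note a = oJ[OF fins_supp[OF J l(1)]] oJ[OF J] UU_antimono[OF supp_simp(1)[OF l(1)]] \<phi>small[OF J l]
   show "res \<Psi> (US w l) (UU w J) (\<phi> l x) = res \<Phi> (US w l) (UU w J) (\<phi> l x)" by (rule small_res[OF a, symmetric])
   show "res \<Phi> (US w l) (UU w J) (\<phi> l x) \<in> small (UU w J)" by (rule sub.res_in[OF a])
  qed
  have "cmap (simp J \<times> cube k) (sec \<Psi> (UU w J)) (\<lambda>(l, x). res \<Phi> (US w l) (UU w J) (\<phi> l x))"
   by (rule continuous_map_eq[OF cpx_continuous[OF \<phi>c J]]) (use e(1) in auto)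
  thus "cmap (simp J \<times> cube k) (sec \<Phi> (UU w J)) (\<lambda>(l, x). res \<Phi> (US w l) (UU w J) (\<phi> l x))"
   unfolding cmap_small[OF oJ[OF J]] using e(2) by auto
 qed
 have "sub.glues k w \<phi>"
 proof (rule gl[OF \<phi>s])
  fix x assume x: "x \<in> cube_bd k"
  show "sub.cst UNIV w \<phi> x"
  proof (rule sub.cstI[OF openin_topspace f0_small[OF x] ow openin_subset[OF ow]])
   fix J l assume l: "J \<in> nfins" "l \<in> simp J"
   have "\<phi> l x = bot (US w l) x" unfolding \<phi>_def using deformsD(4)[OF hd[OF l] x, of 1] by simp
   also have "\<dots> = res \<Phi> (topspace X) (US w l) (f0 x)"
    unfolding bot_def by (rule small_res[OF openin_topspace oJ[OF fins_supp[OF l]] openin_subset[OF oJ[OF fins_supp[OF l]]] f0_small[OF x], symmetric])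
   finally show "\<phi> l x = res \<Phi> (topspace X) (US w l) (f0 x)" .
  qed
 qed
 then obtain O' h' g where cov: "(\<Union>i. O' i) = topspace X" and h': "sub.htpy UNIV w O' (cube k) (cube_bd k) \<phi> h'"
  and g: "cmap (cube k) (sec \<Phi> (topspace X)) g"
  and hg: "\<And>J l x. \<lbrakk>J \<in> nfins; l \<in> simp J; x \<in> cube k\<rbrakk> \<Longrightarrow> h' l (1, x) = res \<Phi> (topspace X) (US O' l) (g x)"
  by (rule sub.gluesE, blast)
 note h'D = sub.htpyD[OF h']
 have oO: "openin X (O' i)" for i using sub.cpx_open[OF h'D(2)] by blast
 have oOJ: "openin X (UU O' J)" if "J \<in> nfins" for J by (rule openin_UU[OF oO that])
 have OwJ: "UU O' J \<subseteq> UU w J" for J using h'D(1) by (intro UU_mono) blast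
 have h2: "htpy UNIV w O' (cube k) (cube_bd k) (\<lambda>l x. h l (1, x)) h'"
 proof (rule htpyI)
  show "O' i \<subseteq> w i" for i using h'D(1) by blast
  show "cpx UNIV O' (cyl k) h'" by (rule cpx_sub[OF h'D(2)])
  show "h' l (0, x) = res \<Psi> (US w l) (US O' l) (h l (1, x))" if l: "J \<in> nfins" "l \<in> simp J" "x \<in> cube k" for J l x
   using h'D(3)[OF l] small_res[OF oJ oOJ OwJ \<phi>small[OF l], OF fins_supp[OF l(1,2)] fins_supp[OF l(1,2)]] by (simp add: \<phi>_def)
  show "h' l (t, x) = h' l (0, x)" if "J \<in> nfins" "l \<in> simp J" "x \<in> cube_bd k" "t \<in> {0..1::real}" for J l x t
   by (rule h'D(4)[OF that])
 qed
 have \<beta>: "cpx UNIV w (cube k) \<beta>"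
  by (rule cpx_cong[OF ps[of 0]]) (use deformsD(2)[OF hd] in \<open>auto simp: \<beta>_def\<close>)
 have h1: "htpy UNIV w w (cube k) (cube_bd k) \<beta> h"
 proof (rule htpyI)
  show "h l (0, x) = res \<Psi> (US w l) (US w l) (\<beta> l x)" if l: "J \<in> nfins" "l \<in> simp J" "x \<in> cube k" for J l x
   using deformsD(2)[OF hd[OF l(1,2)] l(3)] res_id[OF oJ[OF fins_supp[OF l(1,2)]] bot_in[OF oJ[OF fins_supp[OF l(1,2)]] l(3)]] by (simp add: \<beta>_def)
  show "h l (t, x) = h l (0, x)" if l: "J \<in> nfins" "l \<in> simp J" "x \<in> cube_bd k" "t \<in> {0..1::real}" for J l x t
   using deformsD(4)[OF hd[OF l(1,2)] l(3)] l(4) by simp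
 qed (use hc in auto)
 define H where "H = (\<lambda>l (t::real, x). if t \<le> 1 / 2 then res \<Psi> (US w l) (US O' l) (h l (2 * t, x)) else h' l (2 * t - 1, x))"
 have HH: "htpy UNIV w O' (cube k) (cube_bd k) \<beta> H"
  unfolding H_def by (rule htpy_trans[OF h1 h2 \<beta> cube_bd_subset])
 note HD = htpyD[OF HH]
 have H0: "H l (0, x) = bot (US O' l) x" if l: "J \<in> nfins" "l \<in> simp J" "x \<in> cube k" for J l x
  using HD(3)[OF l] bot_res[OF oJ oOJ OwJ l(3), OF fins_supp[OF l(1,2)] fins_supp[OF l(1,2)]] by (simp add: \<beta>_def)
 show thesis
 proof (rule that[OF cov HD(2) g H0])
  have gin: "g x \<in> small (topspace X)" if "x \<in> cube k" for x by (rule cmap_in[OF g that])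
  show "H l (1, x) = res \<Psi> (topspace X) (US O' l) (g x)" if l: "J \<in> nfins" "l \<in> simp J" "x \<in> cube k" for J l x
   using hg[OF l] small_res[OF openin_topspace oOJ[OF fins_supp[OF l(1,2)]] openin_subset[OF oOJ[OF fins_supp[OF l(1,2)]]] gin[OF l(3)]]
   by (simp add: H_def)
  show "H l (t, x) = bot (US O' l) x" if l: "J \<in> nfins" "l \<in> simp J" "x \<in> cube_bd k" "t \<in> {0..1::real}" for J l x t
   using HD(4)[OF l] H0[OF l(1,2) subsetD[OF cube_bd_subset l(3)]] by simp
 qed
qed

text \<open>\<open>H\<close> joins \<open>f0\<close> to \<open>g\<close> merely as a complex. With
  the time as last coordinate it is a complex over the cube of dimension \<open>k + 1\<close> that
  is constant on the whole boundary, since its ends and its sides come from global sections. Gluing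
  it relative to the boundary in the larger sheaf yields a genuine homotopy with the same ends and
  sides.\<close>

lemma compress_cube:
 assumes par: "paracompact_space X" and X: "Hausdorff_space X" and K: "exhaustion X K" "\<And>i. compactin X (K i)"
  and dim: "\<And>i. finite_dimensional (subtopology X (K i))" and fc: "sub.flexible_class" and fc': "flexible_class"
 obtains G where "cmap (cyl k) (sec \<Psi> (topspace X)) G"
  "\<And>x. x \<in> cube k \<Longrightarrow> G (0, x) = f0 x" "\<And>x. x \<in> cube k \<Longrightarrow> G (1, x) \<in> small (topspace X)"
  "\<And>x t. x \<in> cube_bd k \<Longrightarrow> t \<in> {0..1::real} \<Longrightarrow> G (t, x) = f0 x"
proof -
 obtain O' :: "nat \<Rightarrow> 'a set" and H g where cov: "(\<Union>i. O' i) = topspace X" and H: "cpx UNIV O' (cyl k) H"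
  and g: "cmap (cube k) (sec \<Phi> (topspace X)) g"
  and H0: "\<And>J l x. \<lbrakk>J \<in> nfins; l \<in> simp J; x \<in> cube k\<rbrakk> \<Longrightarrow> H l (0, x) = bot (US O' l) x"
  and H1: "\<And>J l x. \<lbrakk>J \<in> nfins; l \<in> simp J; x \<in> cube k\<rbrakk> \<Longrightarrow> H l (1, x) = res \<Psi> (topspace X) (US O' l) (g x)"
  and Hb: "\<And>J l x t. \<lbrakk>J \<in> nfins; l \<in> simp J; x \<in> cube_bd k; t \<in> {0..1::real}\<rbrakk> \<Longrightarrow> H l (t, x) = bot (US O' l) x"
  by (rule deform_into_small[OF par X K(1) _ _ fc], rule K(2), rule dim, blast)
 have oO: "openin X (O' i)" for i using cpx_open[OF H] by blast
 have oc: "open_cover X (range O')" unfolding open_cover_def using oO cov by blast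
 obtain w :: "nat \<Rightarrow> 'a set" where w: "\<And>i. w i \<in> range O'"
  and gl: "\<And>k f. cpx UNIV w (cube k) f \<Longrightarrow> (\<And>x. x \<in> cube_bd k \<Longrightarrow> cst UNIV w f x) \<Longrightarrow> glues k w f"
  by (rule flexible_class_glues[OF X K(1) _ fc' oc], rule K(2), blast)
 \<comment> \<open>The sets \<open>w i\<close> obtained for the larger sheaf are members of the
   family \<open>O'\<close> in another order and with repetitions, so the complex is pulled back
   along this change of index.\<close>
 define \<sigma> where "\<sigma> = (\<lambda>i. SOME j. w i = O' j)"
 have \<sigma>: "w i = O' (\<sigma> i)" for i unfolding \<sigma>_def by (rule someI_ex) (use w[of i] in auto)
 have ow: "openin X (w i)" for i using \<sigma> oO by simp
 have UUw: "UU w J = UU O' (\<sigma> ` J)" for J using \<sigma> by (simp add: UU_def)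
 have oJ: "openin X (UU w J)" if "J \<in> nfins" for J by (rule openin_UU[OF ow that])
 have \<sigma>J: "\<sigma> ` J \<in> nfins" if "J \<in> nfins" for J using that unfolding fins_def by auto
 have fin: "finite J" if "J \<in> nfins" for J using that unfolding fins_def by blast
 define q where "q = (\<lambda>y::nat \<Rightarrow> real. (y k, y(k := 0)))"
 have q: "q y \<in> cyl k" if "y \<in> cube (Suc k)" for y using cube_last[OF that] cube_upd_0[OF that] by (simp add: q_def)
 have qc: "continuous_on S q" for S unfolding q_def
  by (intro continuous_on_Pair continuous_on_upd continuous_on_id continuous_on_const continuous_on_apply)
 define f where "f = (\<lambda>l y. res \<Psi> (UU O' (supp (push \<sigma> l))) (US w l) (H (push \<sigma> l) (q y)))"
 have fc: "cpx UNIV w (cube (Suc k)) f"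
  unfolding f_def
 proof (rule cpx_subst[OF H ow, where p="\<lambda>J. \<sigma> ` J" and s="\<lambda>l y. push \<sigma> l" and g="\<lambda>l y. q y"])
  show "continuous_on (simp J \<times> cube (Suc k)) (\<lambda>z. push \<sigma> (fst z))" if "J \<in> nfins" for J
   by (rule continuous_on_compose2[OF continuous_on_push[OF fin[OF that]] continuous_on_fst[OF continuous_on_id]]) auto
  show "continuous_on (simp J \<times> cube (Suc k)) (\<lambda>z. q (snd z))" for J :: "nat set"
   by (rule continuous_on_compose2[OF qc[of UNIV] continuous_on_snd[OF continuous_on_id]]) auto
  show "push \<sigma> l \<in> simp (\<sigma> ` J)" if "J \<in> nfins" "l \<in> simp J" for J l by (rule push_simp[OF fin[OF that(1)] that(2)])
 qed (use \<sigma>J UUw q in auto)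
 \<comment> \<open>The global sections whose restrictions make up the complex on the boundary:
   \<open>g\<close> at the top, \<open>f0\<close> on the bottom and the sides.\<close>
 define b where "b = (\<lambda>y. if y k = 1 then g (y(k := 0)) else f0 (y(k := 0)))"
 have b: "b y \<in> sections (topspace X)" if y: "y \<in> cube (Suc k)" for y
  unfolding b_def using cmap_in[OF f0 cube_upd_0[OF y]] cmap_in[OF g cube_upd_0[OF y]] small_subset[OF openin_topspace] by auto
 have fb: "f l y = res \<Psi> (topspace X) (US w l) (b y)" if l: "J \<in> nfins" "l \<in> simp J" and y: "y \<in> cube_bd (Suc k)" for J l y
 proof -
  have y': "y \<in> cube (Suc k)" using cube_bd_subset y by blast
  note P = \<sigma>J[OF l(1)] push_simp[OF fin[OF l(1)] l(2), of \<sigma>]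
  have sp: "UU O' (supp (push \<sigma> l)) = US w l" unfolding UUw supp_push[OF fin[OF l(1)] l(2)] by (rule refl)
  have t: "y k \<in> {0..1}" "y(k := 0) \<in> cube k" using q[OF y'] by (simp_all add: q_def)
  have "H (push \<sigma> l) (q y) = res \<Psi> (topspace X) (US w l) (b y)"
  proof (cases "y k = 1")
   case True
   thus ?thesis using H1[OF P t(2)] unfolding sp q_def b_def by simp
  next
   case False
   hence "y k = 0 \<or> y(k := 0) \<in> cube_bd k" using cube_bd_Suc[OF y] by blast
   thus ?thesis using False H0[OF P t(2)] Hb[OF P _ t(1)] unfolding sp q_def b_def bot_def by auto
  qed
  moreover have "res \<Psi> (topspace X) (US w l) (b y) \<in> sections (US w l)"
   by (rule res_in[OF openin_topspace oJ[OF fins_supp[OF l]] openin_subset[OF oJ[OF fins_supp[OF l]]] b[OF y']])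
  ultimately show ?thesis unfolding f_def sp using res_id[OF oJ[OF fins_supp[OF l]]] by simp
 qed
 have "glues (Suc k) w f"
 proof (rule gl[OF fc])
  fix y assume y: "y \<in> cube_bd (Suc k)"
  show "cst UNIV w f y"
   by (rule cstI[OF openin_topspace b[OF subsetD[OF cube_bd_subset y]] ow openin_subset[OF ow]]) (rule fb[OF _ _ y])
 qed
 then obtain O'' h'' gg where cov'': "(\<Union>i::nat. O'' i) = topspace X" and h'': "htpy UNIV w O'' (cube (Suc k)) (cube_bd (Suc k)) f h''"
  and gg: "cmap (cube (Suc k)) (sec \<Psi> (topspace X)) gg"
  and hg: "\<And>J l x. \<lbrakk>J \<in> nfins; l \<in> simp J; x \<in> cube (Suc k)\<rbrakk> \<Longrightarrow> h'' l (1, x) = res \<Psi> (topspace X) (US O'' l) (gg x)"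
  by (rule gluesE, blast)
 note hD = htpyD[OF h'']
 have ggb: "gg y = b y" if y: "y \<in> cube_bd (Suc k)" for y
 proof -
  have y': "y \<in> cube (Suc k)" using cube_bd_subset y by blast
  have oO: "openin X (O'' i)" for i using cpx_open[OF hD(2)] by blast
  show ?thesis
  proof (rule sections_eqI[where I="UNIV :: nat set" and U=O'' and W="topspace X"])
   show "gg y \<in> sections (topspace X)" by (rule cmap_in[OF gg y'])
   fix i :: nat
   have J: "{i} \<in> nfins" "dl i \<in> simp {i}" by (simp_all add: fins_def dl_in_simp)
   have "res \<Psi> (topspace X) (O'' i) (gg y) = h'' (dl i) (1, y)" using hg[OF J y'] by simp
   also have "\<dots> = h'' (dl i) (0, y)" by (rule hD(4)[OF J y]) simp
   also have "\<dots> = res \<Psi> (w i) (O'' i) (res \<Psi> (topspace X) (w i) (b y))" using hD(3)[OF J y'] fb[OF J y] by simp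
   also have "\<dots> = res \<Psi> (topspace X) (O'' i) (b y)"
    by (rule res_res[OF openin_topspace ow oO _ openin_subset[OF ow] b[OF y']]) (use hD(1) in blast)
   finally show "res \<Psi> (topspace X) (O'' i) (gg y) = res \<Psi> (topspace X) (O'' i) (b y)" .
  qed (use oO cov'' b[OF y'] in auto)
 qed
 have upd: "b (x(k := t)) = (if t = 1 then g x else f0 x)" if "x \<in> cube k" for x t
  using cube_upd_id[OF that] by (simp add: b_def)
 show thesis
 proof (rule that[of "\<lambda>z. gg ((snd z)(k := fst z))"])
  show "cmap (cyl k) (sec \<Psi> (topspace X)) (\<lambda>z. gg ((snd z)(k := fst z)))"
  proof (rule cmap_compose[OF gg])
   show "continuous_on (cyl k) (\<lambda>z. (snd z)(k := fst z))"
    by (intro continuous_on_upd continuous_on_fst continuous_on_snd continuous_on_id)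
  qed (use cube_upd in auto)
  have B: "x(k := t) \<in> cube_bd (Suc k)" if "x \<in> cube k" "t = 0 \<or> t = 1 \<or> x \<in> cube_bd k" "t \<in> {0..1::real}" for x t
   using cube_bd_upd[of x k t] that by auto
  show "gg ((snd (0, x))(k := fst (0, x))) = f0 x" if "x \<in> cube k" for x
   using ggb[OF B[OF that]] upd[OF that] by simp
  show "gg ((snd (1, x))(k := fst (1, x))) \<in> small (topspace X)" if "x \<in> cube k" for x
   using ggb[OF B[OF that, of 1]] upd[OF that, of 1] cmap_in[OF g that] by simp
  show "gg ((snd (t, x))(k := fst (t, x))) = f0 x" if x: "x \<in> cube_bd k" "t \<in> {0..1::real}" for x t
  proof -
   have xc: "x \<in> cube k" using cube_bd_subset x(1) by blast
   \<comment> \<open>At the top edge of the sides \<open>b\<close> has the value \<open>g x\<close>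
     instead of \<open>f0 x\<close>; they coincide because \<open>H\<close> rests over the boundary
     of the cube.\<close>
   have "g x = f0 x"
   proof (rule sections_eqI[where I="UNIV :: nat set" and U=O' and W="topspace X"])
    show "g x \<in> sections (topspace X)" using cmap_in[OF g xc] small_subset[OF openin_topspace] by blast
    show "f0 x \<in> sections (topspace X)" by (rule cmap_in[OF f0 xc])
    fix i :: nat
    have J: "{i} \<in> nfins" "dl i \<in> simp {i}" by (simp_all add: fins_def dl_in_simp)
    show "res \<Psi> (topspace X) (O' i) (g x) = res \<Psi> (topspace X) (O' i) (f0 x)"
     using H1[OF J xc] Hb[OF J x(1), of 1] by (simp add: bot_def)
   qed (use oO cov in auto)
   thus ?thesis using ggb[OF B[OF xc _ x(2)]] upd[OF xc, of t] x(1) by simp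
  qed
 qed
qed

end

context sheaf_pair
begin

lemma compress_cell:
 assumes par: "paracompact_space X" and X: "Hausdorff_space X" and K: "exhaustion X K" "\<And>i. compactin X (K i)"
  and dim: "\<And>i. finite_dimensional (subtopology X (K i))" and fc: "sub.flexible_class" "flexible_class"
  and T: "cell_pair n T S" and f: "cmap T (sec \<Psi> (topspace X)) f" "f ` S \<subseteq> small (topspace X)"
 shows "\<exists>H. cmap ({0..1::real} \<times> T) (sec \<Psi> (topspace X)) H \<and>
  (\<forall>x\<in>T. H (0, x) = f x \<and> H (1, x) \<in> small (topspace X)) \<and> (\<forall>x\<in>S. \<forall>t\<in>{0..1::real}. H (t, x) = f x)"
proof -
 obtain a a' where a: "homeomorphism (disk_set n) T a a'" "a ` disk_boundary n = S" using T unfolding cell_pair_def by blast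
 obtain b b' where b: "homeomorphism (disk_set n) (cube n) b b'" "b ` disk_boundary n = cube_bd n"
  using cell_pair_cube unfolding cell_pair_def by blast
 define c where "c = a \<circ> b'"
 define c' where "c' = b \<circ> a'"
 have c: "homeomorphism (cube n) T c c'" unfolding c_def c'_def
  by (rule homeomorphism_compose[OF _ a(1)]) (rule homeomorphism_symD[OF b(1)])
 have "b' ` cube_bd n = disk_boundary n"
 proof -
  have "b' (b x) = x" if "x \<in> disk_boundary n" for x
   by (rule homeomorphism_apply1[OF b(1)]) (use that disk_boundary_subset in blast)
  hence "(\<lambda>x. b' (b x)) ` disk_boundary n = disk_boundary n" by force
  thus ?thesis unfolding b(2)[symmetric] image_image .
 qed
 hence cb: "c ` cube_bd n = S" unfolding c_def image_comp[symmetric] by (simp add: a(2))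
 note C = homeomorphism_cont1[OF c] homeomorphism_cont2[OF c] homeomorphism_image1[OF c] homeomorphism_image2[OF c]
 interpret deformation_problem X \<Psi> \<Phi> n "\<lambda>x. f (c x)"
 proof unfold_locales
  show "cmap (cube n) (sec \<Psi> (topspace X)) (\<lambda>x. f (c x))"
   by (rule cmap_compose[OF f(1) C(1)]) (simp add: C(3))
  show "f (c x) \<in> small (topspace X)" if "x \<in> cube_bd n" for x using f(2) cb that by blast
 qed
 obtain G where G: "cmap (cyl n) (sec \<Psi> (topspace X)) G"
  "\<And>x. x \<in> cube n \<Longrightarrow> G (0, x) = f (c x)" "\<And>x. x \<in> cube n \<Longrightarrow> G (1, x) \<in> small (topspace X)"
  "\<And>x t. x \<in> cube_bd n \<Longrightarrow> t \<in> {0..1::real} \<Longrightarrow> G (t, x) = f (c x)"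
  by (rule compress_cube[OF par X K(1) _ _ fc], rule K(2), rule dim, blast)
 have c'T: "c' x \<in> cube n" "c (c' x) = x" if "x \<in> T" for x using C(4) homeomorphism_apply2[OF c] that by blast+
 have c'S: "c' x \<in> cube_bd n" if x: "x \<in> S" for x
 proof -
  obtain y where y: "y \<in> cube_bd n" "x = c y" using cb x by blast
  thus ?thesis using homeomorphism_apply1[OF c subsetD[OF cube_bd_subset y(1)]] by simp
 qed
 show ?thesis
 proof (intro exI[of _ "\<lambda>z. G (fst z, c' (snd z))"] conjI ballI)
  show "cmap ({0..1::real} \<times> T) (sec \<Psi> (topspace X)) (\<lambda>z. G (fst z, c' (snd z)))"
  proof (rule cmap_compose[OF G(1)])
   show "continuous_on ({0..1::real} \<times> T) (\<lambda>z. (fst z, c' (snd z)))"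
    by (rule continuous_on_Pair[OF continuous_on_fst[OF continuous_on_id] continuous_on_compose2[OF C(2) continuous_on_snd[OF continuous_on_id]]]) auto
  qed (use C(4) in auto)
  show "G (fst (0, x), c' (snd (0, x))) = f x" if "x \<in> T" for x using G(2)[OF c'T(1)[OF that]] c'T(2)[OF that] by simp
  show "G (fst (1, x), c' (snd (1, x))) \<in> small (topspace X)" if "x \<in> T" for x using G(3)[OF c'T(1)[OF that]] by simp
  show "G (fst (t, x), c' (snd (t, x))) = f x" if "x \<in> S" "t \<in> {0..1}" for x t
   using G(4)[OF c'S[OF that(1)] that(2)] c'T(2)[of x] that(1) cell_pair_subset[OF T] by auto
 qed
qed

end

section \<open>Weak homotopy equivalences of subspaces\<close>

lemma pathin_eq: "pathin Z g \<longleftrightarrow> cmap {0..1} Z g"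
 by (simp add: pathin_def)

lemma homotopic_with_disk:
 "homotopic_with (\<lambda>h. h ` disk_boundary n \<subseteq> {y}) (disk n) Z p q \<longleftrightarrow>
  (\<exists>h. cmap ({0..1::real} \<times> disk_set n) Z h \<and> (\<forall>x\<in>disk_set n. h (0, x) = p x) \<and>
   (\<forall>x\<in>disk_set n. h (1, x) = q x) \<and> (\<forall>t\<in>{0..1::real}. \<forall>x\<in>disk_boundary n. h (t, x) = y))"
proof -
 have "homotopic_with (\<lambda>h. h ` disk_boundary n \<subseteq> {y}) (disk n) Z p q \<longleftrightarrow>
  (\<exists>h. continuous_map (prod_topology unit_interval (disk n)) Z h \<and> (\<forall>x\<in>topspace (disk n). h (0, x) = p x) \<and>
   (\<forall>x\<in>topspace (disk n). h (1, x) = q x) \<and> (\<forall>t\<in>{0..1::real}. (\<lambda>x. h (t, x)) ` disk_boundary n \<subseteq> {y}))"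
 proof (rule homotopic_with)
  fix h k :: "(nat \<Rightarrow> real) \<Rightarrow> 'a"
  assume e: "\<And>x. x \<in> topspace (disk n) \<Longrightarrow> h x = k x"
  have "h x = k x" if "x \<in> disk_boundary n" for x
   by (rule e) (use that disk_boundary_subset[of n] in \<open>auto simp: disk_eq\<close>)
  thus "(h ` disk_boundary n \<subseteq> {y}) = (k ` disk_boundary n \<subseteq> {y})" by (simp add: image_subset_iff)
 qed
 thus ?thesis unfolding disk_eq prod_topology_subtopology_eu by (simp add: image_subset_iff)
qed

lemma homotopy_class_eq:
 assumes "homotopic_with (\<lambda>h. h ` disk_boundary n \<subseteq> {y}) (disk n) Z p q"
 shows "homotopy_class n Z y p = homotopy_class n Z y q"
 unfolding homotopy_class_def using assms homotopic_with_trans homotopic_with_symD by blast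

text \<open>Compressing a representative relative to its boundary gives surjectivity. A homotopy
  between maps into the subspace is a map of a cylinder with its boundary in the subspace, and
  replacing it by one into the subspace gives injectivity. Dimension 0 accounts for the path
  components.\<close>

lemma weak_homotopy_equivalence_subspace:
 fixes Y Z :: "'b topology"
 assumes Y: "Y = subtopology Z (topspace Y)"
  and cD: "\<And>n f. cmap (disk_set n) Z f \<Longrightarrow> f ` disk_boundary n \<subseteq> topspace Y \<Longrightarrow>
   \<exists>H. cmap ({0..1::real} \<times> disk_set n) Z H \<and>
    (\<forall>x\<in>disk_set n. H (0, x) = f x \<and> H (1, x) \<in> topspace Y) \<and> (\<forall>x\<in>disk_boundary n. \<forall>t\<in>{0..1::real}. H (t, x) = f x)"
  and cC: "\<And>n f. cmap ({0..1::real} \<times> disk_set n) Z f \<Longrightarrow>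
   f ` ({0, 1 :: real} \<times> disk_set n \<union> {0..1::real} \<times> disk_boundary n) \<subseteq> topspace Y \<Longrightarrow>
   \<exists>g. cmap ({0..1::real} \<times> disk_set n) Y g \<and>
    (\<forall>z\<in>{0, 1 :: real} \<times> disk_set n \<union> {0..1::real} \<times> disk_boundary n. g z = f z)"
 shows "weak_homotopy_equivalence Y Z id"
proof -
 have YZ: "topspace Y \<subseteq> topspace Z" using Y by (metis topspace_subtopology inf_le1)
 have cY: "continuous_map W Y f \<longleftrightarrow> continuous_map W Z f \<and> (\<forall>x\<in>topspace W. f x \<in> topspace Y)" for W and f :: "'w \<Rightarrow> 'b"
  by (subst Y) (auto simp: continuous_map_in_subtopology)
 have id: "continuous_map Y Z id" by (subst Y) (simp add: continuous_map_from_subtopology)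
 have d0: "disk_set 0 = {\<lambda>_. 0}" "disk_boundary 0 = {}" by (auto simp: disk_set_def coords_def disk_boundary_def)
 have pcmap: "path_components_map Z id (path_component_of_set Y y) = path_component_of_set Z y" if y: "y \<in> topspace Y" for y
 proof -
  have e: "path_component_of_set Z y' = path_component_of_set Z y" if y': "path_component_of Y y y'" for y'
  proof -
   have "path_component_of Z y y'"
    using y' continuous_map_compose[OF _ id] unfolding path_component_of_def pathin_eq by fastforce
   thus ?thesis using path_component_of_equiv[of Z y y'] by simp
  qed
  have ne: "y \<in> path_component_of_set Y y" using y by (simp add: path_component_of_refl)
  have "path_components_map Z id (path_component_of_set Y y) = (\<Union>y'\<in>path_component_of_set Y y. path_component_of_set Z y)"
   unfolding path_components_map_def by (rule SUP_cong[OF refl]) (use e in \<open>simp only: id_apply mem_Collect_eq\<close>)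
  also have "\<dots> = path_component_of_set Z y" using ne by blast
  finally show ?thesis .
 qed
 have inj0: "path_component_of Y y y'" if yy: "y \<in> topspace Y" "y' \<in> topspace Y" "path_component_of Z y y'" for y y'
 proof -
  obtain p where p: "cmap {0..1::real} Z p" "p 0 = y" "p 1 = y'"
   using yy(3) unfolding path_component_of_def pathin_eq by blast
  have "cmap ({0..1::real} \<times> disk_set 0) Z (\<lambda>z. p (fst z))"
   by (rule cmap_compose[OF p(1) continuous_on_fst[OF continuous_on_id]]) auto
  moreover have "(\<lambda>z. p (fst z)) ` ({0, 1 :: real} \<times> disk_set 0 \<union> {0..1::real} \<times> disk_boundary 0) \<subseteq> topspace Y" using p yy by (auto simp: d0)
  ultimately obtain g where g: "cmap ({0..1::real} \<times> disk_set 0) Y g"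
   "\<forall>z\<in>{0, 1 :: real} \<times> disk_set 0 \<union> {0..1::real} \<times> disk_boundary 0. g z = p (fst z)" using cC[of 0 "\<lambda>z. p (fst z)"] by blast
  have "cmap {0..1} Y (\<lambda>t. g (t, \<lambda>_. 0))"
   by (rule cmap_compose[OF g(1)]) (auto simp: d0 intro!: continuous_intros)
  thus ?thesis unfolding path_component_of_def pathin_eq
   using g(2) p by (intro exI[of _ "\<lambda>t. g (t, \<lambda>_. 0)"]) (simp add: d0)
 qed
 have surj0: "\<exists>y\<in>topspace Y. path_component_of Z z y" if z: "z \<in> topspace Z" for z
 proof -
  obtain H where H: "cmap ({0..1::real} \<times> disk_set 0) Z H"
   "\<forall>x\<in>disk_set 0. H (0, x) = z \<and> H (1, x) \<in> topspace Y" using cD[of 0 "\<lambda>_. z"] z by (auto simp: d0)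
  have "cmap {0..1} Z (\<lambda>t. H (t, \<lambda>_. 0))"
   by (rule cmap_compose[OF H(1)]) (auto simp: d0 intro!: continuous_intros)
  moreover have "H (0, \<lambda>_. 0) = z" "H (1, \<lambda>_. 0) \<in> topspace Y" using H(2) by (auto simp: d0)
  ultimately show ?thesis unfolding path_component_of_def pathin_eq by blast
 qed
 have pi0: "bij_betw (path_components_map Z id) (path_components_of Y) (path_components_of Z)"
  unfolding bij_betw_def path_components_of_def
 proof
  show "inj_on (path_components_map Z id) (path_component_of_set Y ` topspace Y)"
  proof (rule inj_onI)
   fix C C' assume "C \<in> path_component_of_set Y ` topspace Y" "C' \<in> path_component_of_set Y ` topspace Y"
    and e: "path_components_map Z id C = path_components_map Z id C'"
   then obtain y y' where y: "y \<in> topspace Y" "C = path_component_of_set Y y" "y' \<in> topspace Y" "C' = path_component_of_set Y y'" by blast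
   have "path_component_of_set Z y = path_component_of_set Z y'" using e pcmap y by simp
   moreover have "y' \<in> path_component_of_set Z y'" using y(3) YZ by (auto simp: path_component_of_refl)
   ultimately have "path_component_of Z y y'" by blast
   hence "path_component_of Y y y'" by (rule inj0[OF y(1,3)])
   thus "C = C'" using y path_component_of_equiv[of Y y y'] by simp
  qed
  have "path_components_map Z id ` path_component_of_set Y ` topspace Y = path_component_of_set Z ` topspace Y"
   unfolding image_image using pcmap by (intro image_cong) auto
  also have "\<dots> = path_component_of_set Z ` topspace Z"
  proof
   show "path_component_of_set Z ` topspace Z \<subseteq> path_component_of_set Z ` topspace Y"
   proof
    fix C assume "C \<in> path_component_of_set Z ` topspace Z"
    then obtain z where z: "z \<in> topspace Z" "C = path_component_of_set Z z" by blast
    obtain y where "y \<in> topspace Y" "path_component_of Z z y" using surj0[OF z(1)] by blast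
    thus "C \<in> path_component_of_set Z ` topspace Y" using z(2) path_component_of_equiv[of Z z y] by auto
   qed
  qed (use YZ in blast)
  finally show "path_components_map Z id ` path_component_of_set Y ` topspace Y = path_component_of_set Z ` topspace Z" .
 qed
 let ?R = "\<lambda>n y. homotopic_with (\<lambda>h. h ` disk_boundary n \<subseteq> {y}) (disk n)"
 have RYZ: "?R n y Z p q" if "?R n y Y p q" for n y p q
  using that unfolding homotopic_with_disk using cY by blast
 have pin: "bij_betw (homotopy_group_map n Z id y) (homotopy_group n Y y) (homotopy_group n Z (id y))" if y: "y \<in> topspace Y" for n y
 proof -
  have map: "homotopy_group_map n Z id y (homotopy_class n Y y p) = homotopy_class n Z y p"
   if p: "continuous_map (disk n) Y p" "p ` disk_boundary n \<subseteq> {y}" for p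
  proof -
   have e: "homotopy_class n Z y q = homotopy_class n Z y p" if q: "q \<in> homotopy_class n Y y p" for q
    using homotopy_class_eq[OF RYZ[of n y p q]] q unfolding homotopy_class_def by blast
   have ne: "p \<in> homotopy_class n Y y p" unfolding homotopy_class_def using p by simp
   have "homotopy_group_map n Z id y (homotopy_class n Y y p) = (\<Union>q\<in>homotopy_class n Y y p. homotopy_class n Z y p)"
    unfolding homotopy_group_map_def by (rule SUP_cong[OF refl]) (use e in \<open>simp only: id_apply id_comp\<close>)
   also have "\<dots> = homotopy_class n Z y p" using ne by blast
   finally show ?thesis .
  qed
  show ?thesis
   unfolding bij_betw_def homotopy_group_def
  proof
   show "inj_on (homotopy_group_map n Z id y) (homotopy_class n Y y ` {p. continuous_map (disk n) Y p \<and> p ` disk_boundary n \<subseteq> {y}})"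
   proof (rule inj_onI)
    fix C C' assume "C \<in> homotopy_class n Y y ` {p. continuous_map (disk n) Y p \<and> p ` disk_boundary n \<subseteq> {y}}"
     "C' \<in> homotopy_class n Y y ` {p. continuous_map (disk n) Y p \<and> p ` disk_boundary n \<subseteq> {y}}"
     and e: "homotopy_group_map n Z id y C = homotopy_group_map n Z id y C'"
    then obtain p p' where p: "continuous_map (disk n) Y p" "p ` disk_boundary n \<subseteq> {y}" "C = homotopy_class n Y y p"
     and p': "continuous_map (disk n) Y p'" "p' ` disk_boundary n \<subseteq> {y}" "C' = homotopy_class n Y y p'" by blast
    have "homotopy_class n Z y p = homotopy_class n Z y p'" using e map p p' by simp
    moreover have "continuous_map (disk n) Z p'" using p'(1) cY by blast
    hence "p' \<in> homotopy_class n Z y p'" unfolding homotopy_class_def using p'(2) by simp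
    ultimately have "?R n y Z p p'" unfolding homotopy_class_def by blast
    then obtain h where h: "cmap ({0..1::real} \<times> disk_set n) Z h" "\<forall>x\<in>disk_set n. h (0, x) = p x"
     "\<forall>x\<in>disk_set n. h (1, x) = p' x" "\<forall>t\<in>{0..1::real}. \<forall>x\<in>disk_boundary n. h (t, x) = y" unfolding homotopic_with_disk by blast
    have "p x \<in> topspace Y" "p' x \<in> topspace Y" if "x \<in> disk_set n" for x
     using p(1) p'(1) that unfolding disk_eq continuous_map_def by auto
    hence "h ` ({0, 1 :: real} \<times> disk_set n \<union> {0..1::real} \<times> disk_boundary n) \<subseteq> topspace Y" using h(2-4) y by auto
    then obtain g where g: "cmap ({0..1::real} \<times> disk_set n) Y g"
     "\<forall>z\<in>{0, 1 :: real} \<times> disk_set n \<union> {0..1::real} \<times> disk_boundary n. g z = h z" using cC[OF h(1)] by blast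
    have "?R n y Y p p'" unfolding homotopic_with_disk using g h(2-4) by (intro exI[of _ g]) auto
    thus "C = C'" unfolding p(3) p'(3) by (rule homotopy_class_eq)
   qed
   show "homotopy_group_map n Z id y ` homotopy_class n Y y ` {p. continuous_map (disk n) Y p \<and> p ` disk_boundary n \<subseteq> {y}} =
     homotopy_class n Z (id y) ` {p. continuous_map (disk n) Z p \<and> p ` disk_boundary n \<subseteq> {id y}}"
   proof (intro equalityI subsetI)
    fix C assume "C \<in> homotopy_group_map n Z id y ` homotopy_class n Y y ` {p. continuous_map (disk n) Y p \<and> p ` disk_boundary n \<subseteq> {y}}"
    then obtain p where p: "continuous_map (disk n) Y p" "p ` disk_boundary n \<subseteq> {y}" "C = homotopy_class n Z y p" using map by auto
    have "continuous_map (disk n) Z p" using p(1) cY by blast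
    with p(2,3) show "C \<in> homotopy_class n Z (id y) ` {p. continuous_map (disk n) Z p \<and> p ` disk_boundary n \<subseteq> {id y}}" by auto
   next
    fix C assume "C \<in> homotopy_class n Z (id y) ` {p. continuous_map (disk n) Z p \<and> p ` disk_boundary n \<subseteq> {id y}}"
    then obtain q where q: "continuous_map (disk n) Z q" "q ` disk_boundary n \<subseteq> {y}" "C = homotopy_class n Z y q" by auto
    have "q ` disk_boundary n \<subseteq> topspace Y" using q(2) y by blast
    then obtain H where H: "cmap ({0..1::real} \<times> disk_set n) Z H"
     "\<forall>x\<in>disk_set n. H (0, x) = q x \<and> H (1, x) \<in> topspace Y" "\<forall>x\<in>disk_boundary n. \<forall>t\<in>{0..1::real}. H (t, x) = q x"
     using cD[OF q(1)[unfolded disk_eq]] by blast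
    define p where "p = (\<lambda>x. H (1, x))"
    have "cmap (disk_set n) Z p" unfolding p_def
     by (rule cmap_compose[OF H(1)]) (auto intro!: continuous_intros)
    hence p: "continuous_map (disk n) Y p" "p ` disk_boundary n \<subseteq> {y}" unfolding disk_eq cY using H(2,3) q(2) by (auto simp: p_def)
    have "?R n y Z q p" unfolding homotopic_with_disk using H q(2) by (intro exI[of _ H]) (auto simp: p_def)
    hence "C = homotopy_group_map n Z id y (homotopy_class n Y y p)" unfolding map[OF p] q(3) by (rule homotopy_class_eq)
    thus "C \<in> homotopy_group_map n Z id y ` homotopy_class n Y y ` {p. continuous_map (disk n) Y p \<and> p ` disk_boundary n \<subseteq> {y}}"
     using p by blast
   qed
  qed
 qed
 show ?thesis unfolding weak_homotopy_equivalence_def using id pi0 pin by blast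
qed

theorem theorem2:
 fixes X :: "'a topology" and \<Phi> \<Psi> :: "('a, 'b) top_presheaf"
 assumes "paracompact_space X" and "Hausdorff_space X"
  and "\<exists>K. exhaustion X K \<and>
     (\<forall>i. compactin X (K i) \<and> finite_dimensional (subtopology X (K i)))"
  and "sheaf_inclusion X \<Phi> \<Psi>"
  and "local_weak_homotopy_equivalence X \<Phi> \<Psi>"
  and "((\<exists>d. complete_metric_sheaf X \<Phi> d) \<and> weakly_flexible X \<Phi>) \<or> ordered_flexible X \<Phi>"
 shows "(topspace (sec \<Phi> (topspace X)) \<noteq> {} \<longleftrightarrow> topspace (sec \<Psi> (topspace X)) \<noteq> {}) \<and>
  (((\<exists>d. complete_metric_sheaf X \<Psi> d) \<and> weakly_flexible X \<Psi>) \<or> ordered_flexible X \<Psi> \<longrightarrow>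
   weak_homotopy_equivalence (sec \<Phi> (topspace X)) (sec \<Psi> (topspace X)) id)"
proof -
 obtain K where K: "exhaustion X K" "\<And>i. compactin X (K i)" "\<And>i. finite_dimensional (subtopology X (K i))"
  using assms(3) by blast
 have "sheaf_of_spaces X \<Psi>" using assms(4) unfolding sheaf_inclusion_def by blast
 then interpret sheaf_pair X \<Psi> \<Phi> using assms(4,5) by unfold_locales
 have fc: "sub.flexible_class" unfolding sub.flexible_class_def by (rule assms(6))
 have "small (topspace X) \<noteq> {}" if ne: "sections (topspace X) \<noteq> {}"
 proof -
  obtain s where s: "s \<in> sections (topspace X)" using ne by blast
  have c0: "cube_bd 0 = {}" "(\<lambda>_. 0) \<in> cube 0" by (auto simp: cube_bd_def cube_def)
  \<comment> \<open>A single section is a family over the cube of dimension 0, whose boundary is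
    empty.\<close>
  interpret deformation_problem X \<Psi> \<Phi> 0 "\<lambda>_. s" by unfold_locales (use s c0 in auto)
  obtain g where g: "cmap (cube 0) (sec \<Phi> (topspace X)) g"
   by (rule deform_into_small[OF assms(1,2) K(1) _ _ fc], rule K(2), rule K(3), blast)
  from cmap_in[OF g c0(2)] show ?thesis by blast
 qed
 moreover have "weak_homotopy_equivalence (sec \<Phi> (topspace X)) (sec \<Psi> (topspace X)) id" if fc': "flexible_class"
 proof (rule weak_homotopy_equivalence_subspace)
  show "sec \<Phi> (topspace X) = subtopology (sec \<Psi> (topspace X)) (small (topspace X))" by (rule small_topology[OF openin_topspace])
  fix n
  show "\<exists>H. cmap ({0..1::real} \<times> disk_set n) (sec \<Psi> (topspace X)) H \<and>
    (\<forall>x\<in>disk_set n. H (0, x) = f x \<and> H (1, x) \<in> small (topspace X)) \<and> (\<forall>x\<in>disk_boundary n. \<forall>t\<in>{0..1::real}. H (t, x) = f x)"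
   if f: "cmap (disk_set n) (sec \<Psi> (topspace X)) f" "f ` disk_boundary n \<subseteq> small (topspace X)" for f
   by (rule compress_cell[OF assms(1,2) K fc fc' cell_pair_disk f])
  \<comment> \<open>The cylinder over a ball is a cell whose boundary consists of the two ends and
    the sides, so it can be compressed too; the end of the compression is the required map into the
    smaller space.\<close>
  let ?C = "{0..1::real} \<times> disk_set n" and ?B = "{0, 1 :: real} \<times> disk_set n \<union> {0..1::real} \<times> disk_boundary n"
  have cp: "cell_pair (1 + n) ?C ?B" by (rule cell_pair_Times[OF cell_pair_interval cell_pair_disk])
  fix f assume f: "cmap ?C (sec \<Psi> (topspace X)) f" "f ` ?B \<subseteq> small (topspace X)"
  obtain H where H: "cmap ({0..1::real} \<times> ?C) (sec \<Psi> (topspace X)) H"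
   "\<forall>x\<in>?C. H (0, x) = f x \<and> H (1, x) \<in> small (topspace X)" "\<forall>x\<in>?B. \<forall>t\<in>{0..1::real}. H (t, x) = f x"
   using compress_cell[OF assms(1,2) K fc fc' cp f] by blast
  have "cmap ?C (sec \<Psi> (topspace X)) (\<lambda>z. H (1, z))"
   by (rule cmap_compose[OF H(1)]) (auto intro!: continuous_intros)
  hence "cmap ?C (sec \<Phi> (topspace X)) (\<lambda>z. H (1, z))"
   unfolding cmap_small[OF openin_topspace] using H(2) by auto
  thus "\<exists>g. cmap ?C (sec \<Phi> (topspace X)) g \<and> (\<forall>z\<in>?B. g z = f z)"
   using H(3) by (intro exI[of _ "\<lambda>z. H (1, z)"]) auto
 qed
 ultimately show ?thesis using small_subset[OF openin_topspace] unfolding flexible_class_def by blast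
qed

end
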